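(* Let $d \in \mathbb{N}^\ast$. There is a constant $K_0 = K_0(d)$, depending only on $d$, such that for all $\delta \in (0,1/2)$, all $E \in \mathbb{R}$, all measurable and bounded $V \colon \mathbb{R}^d \to \mathbb{R}$, all $L \in \mathbb{N}^\ast$, all sequences $(z_j)_{j \in \mathbb{Z}^d} \subset \mathbb{R}^d$ such that $B(z_j,\delta) \subset \Lambda_1 + j$ for all $j \in \mathbb{Z}^d$, and each of the choices of Dirichlet, Neumann or periodic boundary conditions for $H_L$, we have \[ \chi_{(-\infty,E]}(H_L)\, W_{L,\delta}\, \chi_{(-\infty,E]}(H_L) \ \ge\ \delta^{K_0\left(1 + \|V\|_\infty^{2/3} + |E|^{1/2}\right)}\, \chi_{(-\infty,E]}(H_L) \] in the sense of quadratic forms on $L^2(\Lambda_L)$. Moreover, $K_0$ can be taken to be the constant in the scale-free unique continuation principle recalled in the context.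
   Context: $\mathbb{N}^\ast = \{1,2,3,\ldots\}$. For $L>0$, $\Lambda_L = (-L/2, L/2)^d \subset \mathbb{R}^d$. $B(z,\delta)$ is the ball in $\mathbb{R}^d$ with center $z$ and radius $\delta$. For $L \in \mathbb{N}^\ast$, $\delta > 0$ and a sequence $(z_j)_{j\in\mathbb{Z}^d}$ in $\mathbb{R}^d$, \[ S_{L,\delta} = \Lambda_L \cap \Big( \bigcup_{j \in \mathbb{Z}^d} B(z_j,\delta) \Big), \] and $W_{L,\delta}$ is the characteristic function of $S_{L,\delta}$, regarded as a multiplication operator on $L^2(\Lambda_L)$. For $V \colon \mathbb{R}^d \to \mathbb{R}$ measurable and bounded, $H_L$ denotes the self-adjoint restriction of the Schrödinger operator $-\Delta + V$ to $L^2(\Lambda_L)$ with either Dirichlet, Neumann, or periodic boundary conditions. $\chi_I(H_L)$ denotes the spectral projector of $H_L$ onto the interval $I$. Scale-free unique continuation principle: there is a constant $K_0 = K_0(d)$, depending only on $d$, such that for all $\delta$, $E$, $V$, $L$, $(z_j)_{j\in\mathbb{Z}^d}$ and boundary conditions as in the claim, and all $\psi = \sum_{n\in\mathbb{N}^\ast\colon E_n \le E}\alpha_n\psi_n$ with $\alpha_n\in\mathbb{C}$, where $(\psi_n)_{n\in\mathbb{N}^\ast}\subset W^{2,2}(\Lambda_L;\mathbb{R})$ is an orthonormal basis with $H_L\psi_n = E_n\psi_n$, one has $\int_{S_{L,\delta}}|\psi|^2 \ge \delta^{K_0(1+\|V\|_\infty^{2/3}+|E|^{1/2})}\int_{\Lambda_L}|\psi|^2$.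 *)

theory Defs
  imports "HOL-Analysis.Analysis" "HOL-Probability.Essential_Supremum"
begin

section \<open>The Hilbert space $L^2$ and operators on it\<close>

text \<open>
  Elements of $L^2(M;\mathbb{C})$ are represented by functions, and equality in $L^2$ is
  equality almost everywhere. A bounded operator is a map on representatives; an unbounded
  operator is given by its graph, a set of pairs \<open>(f, g)\<close> closed under almost everywhere
  equality in both components. The inner product is conjugate-linear in the first argument.
\<close>

definition L2 :: "'a measure \<Rightarrow> ('a \<Rightarrow> complex) set" where
  "L2 M = {f \<in> borel_measurable M. integrable M (\<lambda>x. (norm (f x))\<^sup>2)}"

definition l2_inner :: "'a measure \<Rightarrow> ('a \<Rightarrow> complex) \<Rightarrow> ('a \<Rightarrow> complex) \<Rightarrow> complex" where
  "l2_inner M f g = (LINT x|M. cnj (f x) * g x)"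

definition l2_norm :: "'a measure \<Rightarrow> ('a \<Rightarrow> complex) \<Rightarrow> real" where
  "l2_norm M f = sqrt (LINT x|M. (norm (f x))\<^sup>2)"

definition orthonormal_basis_L2 :: "'a measure \<Rightarrow> (nat \<Rightarrow> 'a \<Rightarrow> complex) \<Rightarrow> bool" where
  "orthonormal_basis_L2 M \<psi> \<longleftrightarrow>
     (\<forall>n. \<psi> n \<in> L2 M) \<and>
     (\<forall>m n. l2_inner M (\<psi> m) (\<psi> n) = (if m = n then 1 else 0)) \<and>
     (\<forall>f \<in> L2 M. (\<lambda>N. l2_norm M (\<lambda>x. f x - (\<Sum>n<N. l2_inner M (\<psi> n) f * \<psi> n x))) \<longlonglongrightarrow> 0)"

definition mult_op :: "('a \<Rightarrow> real) \<Rightarrow> ('a \<Rightarrow> complex) \<Rightarrow> 'a \<Rightarrow> complex" where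
  "mult_op w f = (\<lambda>x. of_real (w x) * f x)"

definition form_ge ::
    "'a measure \<Rightarrow> (('a \<Rightarrow> complex) \<Rightarrow> 'a \<Rightarrow> complex) \<Rightarrow> (('a \<Rightarrow> complex) \<Rightarrow> 'a \<Rightarrow> complex) \<Rightarrow> bool" where
  "form_ge M A B \<longleftrightarrow> (\<forall>f \<in> L2 M. Re (l2_inner M f (B f)) \<le> Re (l2_inner M f (A f)))"

section \<open>Spectral projectors\<close>

text \<open>Symmetry on all of $L^2$ already entails linearity (almost everywhere) and
  compatibility with almost everywhere equality.\<close>

definition orth_projection :: "'a measure \<Rightarrow> (('a \<Rightarrow> complex) \<Rightarrow> 'a \<Rightarrow> complex) \<Rightarrow> bool" where
  "orth_projection M Q \<longleftrightarrow>
     (\<forall>f \<in> L2 M. Q f \<in> L2 M) \<and>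
     (\<forall>f \<in> L2 M. \<forall>g \<in> L2 M. l2_inner M (Q f) g = l2_inner M f (Q g)) \<and>
     (\<forall>f \<in> L2 M. AE x in M. Q (Q f) x = Q f x)"

definition projection_valued_measure ::
    "'a measure \<Rightarrow> (real set \<Rightarrow> ('a \<Rightarrow> complex) \<Rightarrow> 'a \<Rightarrow> complex) \<Rightarrow> bool" where
  "projection_valued_measure M P \<longleftrightarrow>
     (\<forall>A \<in> sets borel. orth_projection M (P A)) \<and>
     (\<forall>f \<in> L2 M. AE x in M. P {} f x = 0) \<and>
     (\<forall>f \<in> L2 M. AE x in M. P UNIV f x = f x) \<and>
     (\<forall>A \<in> sets borel. \<forall>B \<in> sets borel. \<forall>f \<in> L2 M. AE x in M. P (A \<inter> B) f x = P A (P B f) x) \<and>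
     (\<forall>A. range A \<subseteq> sets borel \<longrightarrow> disjoint_family A \<longrightarrow>
        (\<forall>f \<in> L2 M. (\<lambda>N. l2_norm M (\<lambda>x. P (\<Union>n. A n) f x - (\<Sum>n<N. P (A n) f x))) \<longlonglongrightarrow> 0))"

definition spectral_distribution ::
    "'a measure \<Rightarrow> (real set \<Rightarrow> ('a \<Rightarrow> complex) \<Rightarrow> 'a \<Rightarrow> complex) \<Rightarrow> ('a \<Rightarrow> complex) \<Rightarrow> real measure" where
  "spectral_distribution M P f = measure_of UNIV (sets borel) (\<lambda>A. ennreal (Re (l2_inner M f (P A f))))"

text \<open>\<open>P\<close> is the projection-valued measure of the operator with graph \<open>H\<close>: the domain of \<open>H\<close>
  is $\{f : \int \lambda^2 \, d\langle f, P_\lambda f\rangle < \infty\}$, and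
  $\langle f, H f\rangle = \int \lambda \, d\langle f, P_\lambda f\rangle$ on it.\<close>

definition spectral_measure_of ::
    "'a measure \<Rightarrow> (('a \<Rightarrow> complex) \<times> ('a \<Rightarrow> complex)) set \<Rightarrow>
       (real set \<Rightarrow> ('a \<Rightarrow> complex) \<Rightarrow> 'a \<Rightarrow> complex) \<Rightarrow> bool" where
  "spectral_measure_of M H P \<longleftrightarrow>
     projection_valued_measure M P \<and>
     (\<forall>f \<in> L2 M. (\<exists>g. (f, g) \<in> H) \<longleftrightarrow> integrable (spectral_distribution M P f) (\<lambda>t. t\<^sup>2)) \<and>
     (\<forall>(f, g) \<in> H. l2_inner M f g = of_real (LINT t|spectral_distribution M P f. t))"

text \<open>The projection-valued measure of a self-adjoint operator exists and is unique up to
  the choice of representatives, hence \<open>SOME\<close> rather than \<open>THE\<close>.\<close>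

definition spectral_projector ::
    "'a measure \<Rightarrow> (('a \<Rightarrow> complex) \<times> ('a \<Rightarrow> complex)) set \<Rightarrow> real set \<Rightarrow>
       ('a \<Rightarrow> complex) \<Rightarrow> 'a \<Rightarrow> complex" where
  "spectral_projector M H I = (SOME P. spectral_measure_of M H P) I"

section \<open>Smooth functions and Sobolev spaces\<close>

definition partial :: "'n::finite \<Rightarrow> (real^'n \<Rightarrow> complex) \<Rightarrow> real^'n \<Rightarrow> complex" where
  "partial i f = (\<lambda>x. frechet_derivative f (at x) (axis i 1))"

primrec C_k :: "nat \<Rightarrow> (real^'n::finite \<Rightarrow> complex) \<Rightarrow> bool" where
  "C_k 0 f \<longleftrightarrow> continuous_on UNIV f"
| "C_k (Suc k) f \<longleftrightarrow> (\<forall>x. f differentiable at x) \<and> (\<forall>i. C_k k (partial i f))"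

definition smooth :: "(real^'n::finite \<Rightarrow> complex) \<Rightarrow> bool" where
  "smooth f \<longleftrightarrow> (\<forall>k. C_k k f)"

definition test_functions :: "(real^'n::finite) set \<Rightarrow> (real^'n \<Rightarrow> complex) set" where
  "test_functions \<Omega> = {\<phi>. smooth \<phi> \<and> (\<exists>K. compact K \<and> K \<subseteq> \<Omega> \<and> (\<forall>x. x \<notin> K \<longrightarrow> \<phi> x = 0))}"

definition smooth_periodic :: "real \<Rightarrow> (real^'n::finite \<Rightarrow> complex) set" where
  "smooth_periodic L = {\<phi>. smooth \<phi> \<and> (\<forall>x i. \<phi> (x + axis i L) = \<phi> x)}"

definition weak_partial ::
    "(real^'n::finite) set \<Rightarrow> 'n \<Rightarrow> (real^'n \<Rightarrow> complex) \<Rightarrow> (real^'n \<Rightarrow> complex) \<Rightarrow> bool" where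
  "weak_partial \<Omega> i u g \<longleftrightarrow>
     (\<forall>\<phi> \<in> test_functions \<Omega>.
        (LINT x|lebesgue_on \<Omega>. u x * partial i \<phi> x) = - (LINT x|lebesgue_on \<Omega>. g x * \<phi> x))"

primrec sobolev :: "nat \<Rightarrow> (real^'n::finite) set \<Rightarrow> (real^'n \<Rightarrow> complex) set" where
  "sobolev 0 \<Omega> = L2 (lebesgue_on \<Omega>)"
| "sobolev (Suc k) \<Omega> =
     {u \<in> L2 (lebesgue_on \<Omega>). \<forall>i. \<exists>g \<in> sobolev k \<Omega>. weak_partial \<Omega> i u g}"

definition weak_deriv ::
    "(real^'n::finite) set \<Rightarrow> 'n \<Rightarrow> (real^'n \<Rightarrow> complex) \<Rightarrow> real^'n \<Rightarrow> complex" where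
  "weak_deriv \<Omega> i u = (SOME g. g \<in> L2 (lebesgue_on \<Omega>) \<and> weak_partial \<Omega> i u g)"

definition W12_norm :: "(real^'n::finite) set \<Rightarrow> (real^'n \<Rightarrow> complex) \<Rightarrow> real" where
  "W12_norm \<Omega> u =
     sqrt ((l2_norm (lebesgue_on \<Omega>) u)\<^sup>2 + (\<Sum>i\<in>UNIV. (l2_norm (lebesgue_on \<Omega>) (weak_deriv \<Omega> i u))\<^sup>2))"

definition W12_closure ::
    "(real^'n::finite) set \<Rightarrow> (real^'n \<Rightarrow> complex) set \<Rightarrow> (real^'n \<Rightarrow> complex) set" where
  "W12_closure \<Omega> D = {u \<in> sobolev 1 \<Omega>. \<forall>\<epsilon>>0. \<exists>\<phi> \<in> D. W12_norm \<Omega> (\<lambda>x. u x - \<phi> x) < \<epsilon>}"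

section \<open>The Schroedinger operator on a cube\<close>

definition cube :: "real \<Rightarrow> (real^'n::finite) set" where
  "cube L = {x. \<forall>i. - L / 2 < x $ i \<and> x $ i < L / 2}"

datatype boundary_condition = Dirichlet | Neumann | Periodic

primrec form_domain :: "boundary_condition \<Rightarrow> real \<Rightarrow> (real^'n::finite \<Rightarrow> complex) set" where
  "form_domain Dirichlet L = W12_closure (cube L) (test_functions (cube L))"
| "form_domain Neumann L = sobolev 1 (cube L)"
| "form_domain Periodic L = W12_closure (cube L) (smooth_periodic L)"

definition schroedinger_form ::
    "(real^'n::finite \<Rightarrow> real) \<Rightarrow> (real^'n) set \<Rightarrow> (real^'n \<Rightarrow> complex) \<Rightarrow> (real^'n \<Rightarrow> complex) \<Rightarrow> complex" where
  "schroedinger_form V \<Omega> v u =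
     (\<Sum>i\<in>UNIV. l2_inner (lebesgue_on \<Omega>) (weak_deriv \<Omega> i v) (weak_deriv \<Omega> i u))
     + l2_inner (lebesgue_on \<Omega>) v (mult_op V u)"

text \<open>The graph of $H_L$, the self-adjoint operator associated with the closed form
  $\int \overline{\nabla v}\cdot\nabla u + \int V \overline{v} u$ on the form domain of the
  boundary condition.\<close>

definition schroedinger_op ::
    "boundary_condition \<Rightarrow> (real^'n::finite \<Rightarrow> real) \<Rightarrow> real \<Rightarrow>
       ((real^'n \<Rightarrow> complex) \<times> (real^'n \<Rightarrow> complex)) set" where
  "schroedinger_op bc V L =
     {(u, f). u \<in> form_domain bc L \<and> f \<in> L2 (lebesgue_on (cube L)) \<and>
        (\<forall>v \<in> form_domain bc L.
           schroedinger_form V (cube L) v u = l2_inner (lebesgue_on (cube L)) v f)}"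

section \<open>Unique continuation\<close>

definition bounded_potential :: "(real^'n::finite \<Rightarrow> real) \<Rightarrow> bool" where
  "bounded_potential V \<longleftrightarrow> V \<in> borel_measurable lebesgue \<and> bounded (range V)"

definition Linf_norm :: "(real^'n::finite \<Rightarrow> real) \<Rightarrow> real" where
  "Linf_norm V = real_of_ereal (esssup lebesgue (\<lambda>x. ereal \<bar>V x\<bar>))"

definition lattice_point :: "int^'n::finite \<Rightarrow> real^'n" where
  "lattice_point j = (\<chi> i. of_int (j $ i))"

definition equidistributed :: "real \<Rightarrow> (int^'n::finite \<Rightarrow> real^'n) \<Rightarrow> bool" where
  "equidistributed \<delta> z \<longleftrightarrow> (\<forall>j. ball (z j) \<delta> \<subseteq> (\<lambda>x. x + lattice_point j) ` cube 1)"

definition obs_set :: "real \<Rightarrow> real \<Rightarrow> (int^'n::finite \<Rightarrow> real^'n) \<Rightarrow> (real^'n) set" where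
  "obs_set L \<delta> z = cube L \<inter> (\<Union>j. ball (z j) \<delta>)"

definition ucp_factor :: "real \<Rightarrow> real \<Rightarrow> (real^'n::finite \<Rightarrow> real) \<Rightarrow> real \<Rightarrow> real" where
  "ucp_factor K\<^sub>0 \<delta> V E = \<delta> powr (K\<^sub>0 * (1 + Linf_norm V powr (2/3) + \<bar>E\<bar> powr (1/2)))"

text \<open>The scale-free unique continuation principle with constant \<open>K\<^sub>0\<close>, in dimension
  \<open>CARD('n)\<close>. The set of indices \<open>n\<close> with \<open>En n \<le> E\<close> is finite, since $H_L$ is bounded below
  with compact resolvent, so the sum is a genuine finite sum.\<close>

definition scale_free_ucp :: "'n::finite itself \<Rightarrow> real \<Rightarrow> bool" where
  "scale_free_ucp _ K\<^sub>0 \<longleftrightarrow>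
     (\<forall>(\<delta>::real) (E::real) (V :: real^'n \<Rightarrow> real) (L::nat) (z :: int^'n \<Rightarrow> real^'n)
        (bc :: boundary_condition)
        (\<psi> :: nat \<Rightarrow> real^'n \<Rightarrow> real) (En :: nat \<Rightarrow> real) (\<alpha> :: nat \<Rightarrow> complex).
        0 < \<delta> \<and> \<delta> < 1/2 \<and> bounded_potential V \<and> 1 \<le> L \<and> equidistributed \<delta> z \<and>
        orthonormal_basis_L2 (lebesgue_on (cube L)) (\<lambda>n x. of_real (\<psi> n x)) \<and>
        (\<forall>n. (\<lambda>x. of_real (\<psi> n x)) \<in> sobolev 2 (cube L)) \<and>
        (\<forall>n. ((\<lambda>x. of_real (\<psi> n x)), (\<lambda>x. of_real (En n * \<psi> n x))) \<in> schroedinger_op bc V L)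
        \<longrightarrow> (LINT x|lebesgue_on (obs_set L \<delta> z). (norm (\<Sum>n | En n \<le> E. \<alpha> n * of_real (\<psi> n x)))\<^sup>2)
            \<ge> ucp_factor K\<^sub>0 \<delta> V E *
              (LINT x|lebesgue_on (cube L). (norm (\<Sum>n | En n \<le> E. \<alpha> n * of_real (\<psi> n x)))\<^sup>2))"

definition projector_ucp :: "'n::finite itself \<Rightarrow> real \<Rightarrow> bool" where
  "projector_ucp _ K\<^sub>0 \<longleftrightarrow>
     (\<forall>(\<delta>::real) (E::real) (V :: real^'n \<Rightarrow> real) (L::nat) (z :: int^'n \<Rightarrow> real^'n)
        (bc :: boundary_condition).
        0 < \<delta> \<and> \<delta> < 1/2 \<and> bounded_potential V \<and> 1 \<le> L \<and> equidistributed \<delta> z \<longrightarrow>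
        (let M = lebesgue_on (cube L);
             Q = spectral_projector M (schroedinger_op bc V L) {..E};
             W = mult_op (indicator (obs_set L \<delta> z))
         in form_ge M (\<lambda>f. Q (W (Q f))) (\<lambda>f x. of_real (ucp_factor K\<^sub>0 \<delta> V E) * Q f x)))"

end

theory Submission
  imports Defs "HOL-Library.Function_Algebras" "HOL-Complex_Analysis.Great_Picard"
begin

text \<open>
  The form of $H_L$ is closed, bounded below and has a form domain that embeds compactly into
  $L^2(\Lambda_L)$, so $H_L$ has an orthonormal basis of eigenfunctions with eigenvalues tending to
  infinity; since the form is real, the eigenfunctions can be taken real, and they lie in
  $W^{2,2}$. Compactness, density and regularity are all read off the explicit Laplace
  eigenfunctions of the cube (products of sines, cosines or exponentials): Bessel's inequality
  bounds the Fourier tails of $u$ by its gradient, and $\Delta u \in L^2$ is a weighted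
  $\ell^2$-condition on the Fourier coefficients. The projector $\chi_{(-\infty,E]}(H_L)$ is then
  the finite sum $Q f = \sum_{E_n \le E} \langle\psi_n, f\rangle \psi_n$. As $Q$ is an orthogonal
  projection, $\langle f, Q W Q f\rangle$ is the integral of $|Q f|^2$ over the observation set and
  $\langle f, Q f\rangle$ its integral over the cube, so the unique continuation principle for the
  coefficients $\alpha_n = \langle\psi_n, f\rangle$ is the claimed form inequality.

  The spectral projector is a choice among all projection-valued measures representing $H_L$, so
  one has to show both that one exists and that each of them is given by this sum.
\<close>

section \<open>Hilbert space structure of $L^2$\<close>

text \<open>A spectral measure of H is constrained only through the domain of H and the diagonal
  values <f, H f>. How it acts on an eigenvector is not given and has to be recovered from the
  diagonal by polarization; since operators act on representatives, identities hold almost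
  everywhere. The principle is stated for real eigenfunctions, so the variational argument runs in
  the real-valued part of the form domain, with a form shifted by B + 1, where B bounds |V|, so that
  it dominates the W^{1,2} norm. Since the cube has corners, boundary conditions are expressed by
  Green's formula instead of traces: <D_i u, d_i E_k> = \<mu>(k_i) <u, E_k> for every u in the form
  domain and every mode E_k. This formula, the modes lying in the form domain and their totality
  distinguish the three cases; compactness and regularity are then proved once for all three.
  Totality is shown in all coordinates at once: multiplying a mode by the components of a
  point-separating map stays in the span of the modes, so orthogonality to the modes becomes
  orthogonality to polynomials in that map.\<close>

lemma borel_measurable_cnj [measurable (raw)]:
  "f \<in> borel_measurable M \<Longrightarrow> (\<lambda>x. cnj (f x)) \<in> borel_measurable M"
  by (rule borel_measurable_continuous_on[of cnj]) (auto intro: continuous_intros)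

lemma L2_measurable [measurable_dest]: "f \<in> L2 M \<Longrightarrow> f \<in> borel_measurable M"
  and L2_integrable: "f \<in> L2 M \<Longrightarrow> integrable M (\<lambda>x. (norm (f x))\<^sup>2)"
  by (auto simp: L2_def)

lemma L2_dominated:
  assumes "integrable M g" "f \<in> borel_measurable M" "\<And>x. x \<in> space M \<Longrightarrow> (norm (f x))\<^sup>2 \<le> g x"
  shows "f \<in> L2 M"
  using assms unfolding L2_def
  by (auto intro!: Bochner_Integration.integrable_bound[OF assms(1)] AE_I2 order_trans[OF _ abs_ge_self])

lemma norm_add_sq_le: "(norm (a + b))\<^sup>2 \<le> 2 * (norm a)\<^sup>2 + 2 * (norm (b :: complex))\<^sup>2"
proof -
  have "(norm (a + b))\<^sup>2 \<le> (norm a + norm b)\<^sup>2" by (intro power_mono norm_triangle_ineq) auto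
  also have "\<dots> \<le> 2 * (norm a)\<^sup>2 + 2 * (norm b)\<^sup>2"
    using sum_squares_bound[of "norm a" "norm b"] by (simp add: power2_sum)
  finally show ?thesis .
qed

lemma L2_add: "f \<in> L2 M \<Longrightarrow> g \<in> L2 M \<Longrightarrow> (\<lambda>x. f x + g x) \<in> L2 M"
  by (rule L2_dominated[of _ "\<lambda>x. 2 * (norm (f x))\<^sup>2 + 2 * (norm (g x))\<^sup>2"])
    (auto simp: L2_integrable L2_measurable norm_add_sq_le)

lemma L2_bounded_mult:
  assumes "f \<in> L2 M" "h \<in> borel_measurable M" "\<And>x. x \<in> space M \<Longrightarrow> norm (h x) \<le> C"
  shows "(\<lambda>x. h x * f x) \<in> L2 M"
proof (rule L2_dominated)
  show "integrable M (\<lambda>x. C\<^sup>2 * (norm (f x))\<^sup>2)" using assms by (simp add: L2_integrable)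
  show "(norm (h x * f x))\<^sup>2 \<le> C\<^sup>2 * (norm (f x))\<^sup>2" if "x \<in> space M" for x
    using assms(3)[OF that] by (auto simp: norm_mult power_mult_distrib intro!: mult_right_mono power_mono)
qed (use assms in auto)

lemma L2_cmult: "f \<in> L2 M \<Longrightarrow> (\<lambda>x. c * f x) \<in> L2 M"
  by (rule L2_bounded_mult[of _ _ _ "norm c"]) auto

lemma L2_uminus: "f \<in> L2 M \<Longrightarrow> (\<lambda>x. - f x) \<in> L2 M"
  using L2_cmult[of f M "-1"] by simp

lemma L2_diff: "f \<in> L2 M \<Longrightarrow> g \<in> L2 M \<Longrightarrow> (\<lambda>x. f x - g x) \<in> L2 M"
  using L2_add[of f M "\<lambda>x. - g x"] L2_uminus[of g M] by simp

lemma L2_zero: "(\<lambda>x. 0) \<in> L2 M"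
  by (simp add: L2_def)

lemma L2_sum: "(\<And>i. i \<in> I \<Longrightarrow> f i \<in> L2 M) \<Longrightarrow> (\<lambda>x. \<Sum>i\<in>I. f i x) \<in> L2 M"
  by (induction I rule: infinite_finite_induct) (auto simp: L2_zero L2_add)

lemma L2_cnj: "f \<in> L2 M \<Longrightarrow> (\<lambda>x. cnj (f x)) \<in> L2 M"
  by (auto simp: L2_def)

lemmas L2_intros = L2_add L2_diff L2_uminus L2_cmult L2_zero L2_sum L2_cnj

lemma L2_integrable_mult:
  assumes "f \<in> L2 M" "g \<in> L2 M"
  shows "integrable M (\<lambda>x. f x * g x)"
proof (rule Bochner_Integration.integrable_bound)
  show "integrable M (\<lambda>x. (norm (f x))\<^sup>2 + (norm (g x))\<^sup>2)" using assms by (simp add: L2_integrable)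
  show "AE x in M. norm (f x * g x) \<le> norm ((norm (f x))\<^sup>2 + (norm (g x))\<^sup>2)"
  proof (rule AE_I2)
    fix x
    have "2 * (norm (f x) * norm (g x)) \<le> (norm (f x))\<^sup>2 + (norm (g x))\<^sup>2"
      using sum_squares_bound[of "norm (f x)" "norm (g x)"] by simp
    moreover have "0 \<le> norm (f x) * norm (g x)" by simp
    ultimately show "norm (f x * g x) \<le> norm ((norm (f x))\<^sup>2 + (norm (g x))\<^sup>2)"
      unfolding norm_mult real_norm_def by linarith
  qed
qed (use assms in auto)

lemma l2_integrable: "f \<in> L2 M \<Longrightarrow> g \<in> L2 M \<Longrightarrow> integrable M (\<lambda>x. cnj (f x) * g x)"
  by (rule L2_integrable_mult[OF L2_cnj])

lemma l2_inner_commute: "l2_inner M f g = cnj (l2_inner M g f)"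
  unfolding l2_inner_def by (simp add: mult.commute flip: Bochner_Integration.integral_cnj)

lemma l2_inner_cnj: "l2_inner M (\<lambda>x. cnj (f x)) (\<lambda>x. cnj (g x)) = cnj (l2_inner M f g)"
  unfolding l2_inner_def by (simp flip: Bochner_Integration.integral_cnj)

lemma l2_inner_add_right: "f \<in> L2 M \<Longrightarrow> g \<in> L2 M \<Longrightarrow> h \<in> L2 M \<Longrightarrow>
    l2_inner M h (\<lambda>x. f x + g x) = l2_inner M h f + l2_inner M h g"
  unfolding l2_inner_def by (simp add: distrib_left l2_integrable)

lemma l2_inner_diff_right: "f \<in> L2 M \<Longrightarrow> g \<in> L2 M \<Longrightarrow> h \<in> L2 M \<Longrightarrow>
    l2_inner M h (\<lambda>x. f x - g x) = l2_inner M h f - l2_inner M h g"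
  unfolding l2_inner_def by (simp add: right_diff_distrib l2_integrable)

lemma l2_inner_cmult_right: "l2_inner M h (\<lambda>x. c * f x) = c * l2_inner M h f"
  unfolding l2_inner_def by (simp add: mult.left_commute)

lemma l2_inner_cmult_left: "l2_inner M (\<lambda>x. c * f x) h = cnj c * l2_inner M f h"
  unfolding l2_inner_def by (simp add: mult.assoc)

lemma l2_inner_add_left: "f \<in> L2 M \<Longrightarrow> g \<in> L2 M \<Longrightarrow> h \<in> L2 M \<Longrightarrow>
    l2_inner M (\<lambda>x. f x + g x) h = l2_inner M f h + l2_inner M g h"
  unfolding l2_inner_def by (simp add: distrib_right l2_integrable)

lemma l2_inner_zero [simp]: "l2_inner M h (\<lambda>x. 0) = 0" "l2_inner M (\<lambda>x. 0) h = 0"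
  unfolding l2_inner_def by auto

lemma l2_inner_sum_right: "(\<And>i. i \<in> I \<Longrightarrow> f i \<in> L2 M) \<Longrightarrow> h \<in> L2 M \<Longrightarrow>
    l2_inner M h (\<lambda>x. \<Sum>i\<in>I. f i x) = (\<Sum>i\<in>I. l2_inner M h (f i))"
  by (induction I rule: infinite_finite_induct) (auto simp: l2_inner_add_right L2_sum)

lemma l2_inner_sum_left: "(\<And>i. i \<in> I \<Longrightarrow> f i \<in> L2 M) \<Longrightarrow> h \<in> L2 M \<Longrightarrow>
    l2_inner M (\<lambda>x. \<Sum>i\<in>I. f i x) h = (\<Sum>i\<in>I. l2_inner M (f i) h)"
  by (induction I rule: infinite_finite_induct) (auto simp: l2_inner_add_left L2_sum)

lemma l2_inner_cong_AE:
  assumes "AE x in M. f x = f' x" "AE x in M. g x = g' x" 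
    "f \<in> borel_measurable M" "f' \<in> borel_measurable M" "g \<in> borel_measurable M" "g' \<in> borel_measurable M"
  shows "l2_inner M f g = l2_inner M f' g'"
  unfolding l2_inner_def using assms by (intro integral_cong_AE) auto

lemma l2_norm_nonneg [simp]: "0 \<le> l2_norm M f"
  unfolding l2_norm_def by simp

lemma l2_norm_sq: "(l2_norm M f)\<^sup>2 = (LINT x|M. (norm (f x))\<^sup>2)"
  unfolding l2_norm_def by simp

lemma l2_inner_self: "l2_inner M f f = of_real ((l2_norm M f)\<^sup>2)"
proof -
  have "l2_inner M f f = (LINT x|M. of_real ((norm (f x))\<^sup>2))"
    unfolding l2_inner_def by (intro Bochner_Integration.integral_cong refl)
      (simp add: complex_norm_square mult.commute del: of_real_power)
  then show ?thesis by (simp add: l2_norm_sq del: of_real_power)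
qed

lemma l2_norm_cong_AE:
  "AE x in M. f x = g x \<Longrightarrow> f \<in> borel_measurable M \<Longrightarrow> g \<in> borel_measurable M \<Longrightarrow> l2_norm M f = l2_norm M g"
  unfolding l2_norm_def by (intro arg_cong[of _ _ sqrt] integral_cong_AE) auto

lemma l2_norm_zero [simp]: "l2_norm M (\<lambda>x. 0) = 0"
  unfolding l2_norm_def by simp

lemma l2_norm_cmult: "l2_norm M (\<lambda>x. c * f x) = norm c * l2_norm M f"
  unfolding l2_norm_def by (simp add: norm_mult power_mult_distrib real_sqrt_mult)

lemma l2_norm_cnj: "l2_norm M (\<lambda>x. cnj (f x)) = l2_norm M f"
  unfolding l2_norm_def by simp

lemma l2_norm_minus_commute: "l2_norm M (\<lambda>x. f x - g x) = l2_norm M (\<lambda>x. g x - f x)"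
  unfolding l2_norm_def by (simp add: norm_minus_commute)

lemma l2_norm_eq_0_iff:
  assumes "f \<in> L2 M"
  shows "l2_norm M f = 0 \<longleftrightarrow> (AE x in M. f x = 0)"
  unfolding l2_norm_def
  using integral_nonneg_eq_0_iff_AE[OF L2_integrable[OF assms]] by simp

lemma AE_eq_of_l2_norm_diff:
  assumes "f \<in> L2 M" "g \<in> L2 M" "l2_norm M (\<lambda>x. f x - g x) = 0"
  shows "AE x in M. f x = g x"
  using assms(3) l2_norm_eq_0_iff[OF L2_diff[OF assms(1,2)]] by simp

lemma l2_norm_sq_add:
  assumes "f \<in> L2 M" "g \<in> L2 M"
  shows "(l2_norm M (\<lambda>x. f x + g x))\<^sup>2 = (l2_norm M f)\<^sup>2 + 2 * Re (l2_inner M f g) + (l2_norm M g)\<^sup>2"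
proof -
  have "complex_of_real ((l2_norm M (\<lambda>x. f x + g x))\<^sup>2) = 
     of_real ((l2_norm M f)\<^sup>2) + (l2_inner M f g + cnj (l2_inner M f g)) + of_real ((l2_norm M g)\<^sup>2)"
    unfolding l2_inner_self[symmetric] l2_inner_commute[of M g f, symmetric]
    using assms by (simp add: l2_inner_add_left l2_inner_add_right L2_intros)
  also have "\<dots> = of_real ((l2_norm M f)\<^sup>2 + 2 * Re (l2_inner M f g) + (l2_norm M g)\<^sup>2)"
    by (simp add: complex_add_cnj)
  finally show ?thesis using of_real_eq_iff by blast
qed

lemma l2_norm_sq_diff:
  assumes "f \<in> L2 M" "g \<in> L2 M"
  shows "(l2_norm M (\<lambda>x. f x - g x))\<^sup>2 = (l2_norm M f)\<^sup>2 - 2 * Re (l2_inner M f g) + (l2_norm M g)\<^sup>2"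
  using l2_norm_sq_add[OF assms(1) L2_cmult[OF assms(2), of "-1"]] l2_norm_cmult[of M "-1" g]
    l2_inner_cmult_right[of M f "-1" g] by simp

text \<open>On representatives the inner product is only semidefinite, so a \<open>g\<close> of norm
  zero needs its own argument: there the expansion of the squared norm of f - c g is affine in c and
  nonnegative, which forces z = 0.\<close>

lemma l2_cauchy_schwarz:
  assumes f: "f \<in> L2 M" and g: "g \<in> L2 M"
  shows "norm (l2_inner M f g) \<le> l2_norm M f * l2_norm M g"
proof -
  define z where "z = l2_inner M f g"
  have *: "0 \<le> (l2_norm M f)\<^sup>2 - 2 * Re (c * z) + (norm c)\<^sup>2 * (l2_norm M g)\<^sup>2" for c
  proof -
    have "0 \<le> (l2_norm M (\<lambda>x. f x - c * g x))\<^sup>2" by simp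
    then show ?thesis unfolding l2_norm_sq_diff[OF f L2_cmult[OF g]] z_def
      by (simp add: l2_inner_cmult_right l2_norm_cmult power_mult_distrib)
  qed
  have re: "Re (of_real r * cnj z * z) = r * (norm z)\<^sup>2" for r
    by (simp add: mult.assoc mult.commute[of "cnj z"] complex_norm_square[symmetric] del: of_real_power)
  have "(norm z)\<^sup>2 \<le> (l2_norm M f)\<^sup>2 * (l2_norm M g)\<^sup>2"
  proof (cases "l2_norm M g = 0")
    case True
    have "2 * (r * (norm z)\<^sup>2) \<le> (l2_norm M f)\<^sup>2" for r
      using *[of "of_real r * cnj z"] True unfolding re by simp
    \<comment> \<open>A multiple so large that the affine bound fails unless z = 0. The argument is
      by contraposition, so the division takes place with z nonzero.\<close>
    from this[of "((l2_norm M f)\<^sup>2 + 1) / (norm z)\<^sup>2"] have "z = 0"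
    proof (rule contrapos_pp)
      assume "z \<noteq> 0"
      then have "2 * (((l2_norm M f)\<^sup>2 + 1) / (norm z)\<^sup>2 * (norm z)\<^sup>2) = 2 * ((l2_norm M f)\<^sup>2 + 1)" by simp
      moreover have "\<not> 2 * ((l2_norm M f)\<^sup>2 + 1) \<le> (l2_norm M f)\<^sup>2"
        using zero_le_power2[of "l2_norm M f"] by (simp add: not_le add_nonneg_pos)
      ultimately show "\<not> 2 * (((l2_norm M f)\<^sup>2 + 1) / (norm z)\<^sup>2 * (norm z)\<^sup>2) \<le> (l2_norm M f)\<^sup>2"
        by metis
    qed
    then show ?thesis using True by simp
  next
    case False
    define G where "G = (l2_norm M g)\<^sup>2"
    have G: "G > 0" using False by (simp add: G_def)
    \<comment> \<open>The multiplier cnj z / G minimizes the quadratic expression in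
      \<open>*\<close>.\<close>
    have "0 \<le> (l2_norm M f)\<^sup>2 - 2 * Re (of_real (1 / G) * cnj z * z) + (norm (of_real (1 / G) * cnj z))\<^sup>2 * G"
      unfolding G_def by (rule *)
    also have "\<dots> = (l2_norm M f)\<^sup>2 - (norm z)\<^sup>2 / G"
      unfolding re norm_mult using G by (simp add: power_mult_distrib power2_eq_square norm_divide)
    finally show ?thesis using G by (simp add: G_def[symmetric] field_simps)
  qed
  then show ?thesis unfolding z_def[symmetric]
    by (intro power2_le_imp_le[of "norm z"]) (auto simp: power_mult_distrib)
qed

lemma l2_norm_triangle:
  assumes f: "f \<in> L2 M" and g: "g \<in> L2 M"
  shows "l2_norm M (\<lambda>x. f x + g x) \<le> l2_norm M f + l2_norm M g"
proof (rule power2_le_imp_le)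
  have "Re (l2_inner M f g) \<le> l2_norm M f * l2_norm M g"
    using l2_cauchy_schwarz[OF f g] complex_Re_le_cmod order_trans by blast
  then show "(l2_norm M (\<lambda>x. f x + g x))\<^sup>2 \<le> (l2_norm M f + l2_norm M g)\<^sup>2"
    unfolding l2_norm_sq_add[OF f g] by (simp add: power2_sum)
qed simp

lemma l2_norm_triangle_diff:
  assumes "f \<in> L2 M" "g \<in> L2 M" "h \<in> L2 M"
  shows "l2_norm M (\<lambda>x. f x - h x) \<le> l2_norm M (\<lambda>x. f x - g x) + l2_norm M (\<lambda>x. g x - h x)"
  using l2_norm_triangle[OF L2_diff[OF assms(1,2)] L2_diff[OF assms(2,3)]] by simp

lemma l2_norm_le_of_norm_le:
  assumes "f \<in> L2 M" "g \<in> L2 M" "AE x in M. norm (f x) \<le> norm (g x)"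
  shows "l2_norm M f \<le> l2_norm M g"
  unfolding l2_norm_def
  by (intro real_sqrt_le_mono integral_mono_AE L2_integrable assms) (use assms(3) in \<open>auto elim!: eventually_mono intro: power_mono\<close>)

subsection \<open>Convergence and completeness\<close>

definition l2_lim :: "'a measure \<Rightarrow> (nat \<Rightarrow> 'a \<Rightarrow> complex) \<Rightarrow> ('a \<Rightarrow> complex) \<Rightarrow> bool" where
  "l2_lim M s f \<longleftrightarrow> (\<lambda>n. l2_norm M (\<lambda>x. s n x - f x)) \<longlonglongrightarrow> 0"

lemma l2_lim_bound:
  assumes "\<And>n. l2_norm M (\<lambda>x. s n x - f x) \<le> b n" "b \<longlonglongrightarrow> 0"
  shows "l2_lim M s f"
  unfolding l2_lim_def
  by (rule tendsto_sandwich[OF _ _ tendsto_const assms(2)]) (auto simp: assms(1))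

lemma l2_lim_inner_right:
  assumes "\<And>n. s n \<in> L2 M" "f \<in> L2 M" "g \<in> L2 M" "l2_lim M s f"
  shows "(\<lambda>n. l2_inner M g (s n)) \<longlonglongrightarrow> l2_inner M g f"
proof -
  have "(\<lambda>n. l2_inner M g (\<lambda>x. s n x - f x)) \<longlonglongrightarrow> 0"
  proof (rule tendsto_norm_zero_cancel, rule tendsto_sandwich[OF _ _ tendsto_const])
    show "\<forall>\<^sub>F n in sequentially. norm (l2_inner M g (\<lambda>x. s n x - f x)) \<le> l2_norm M g * l2_norm M (\<lambda>x. s n x - f x)"
      using assms by (auto intro!: always_eventually l2_cauchy_schwarz L2_intros)
    show "(\<lambda>n. l2_norm M g * l2_norm M (\<lambda>x. s n x - f x)) \<longlonglongrightarrow> 0"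
      using tendsto_mult_left[OF assms(4)[unfolded l2_lim_def], of "l2_norm M g"] by simp
  qed auto
  then have "(\<lambda>n. l2_inner M g (\<lambda>x. s n x - f x) + l2_inner M g f) \<longlonglongrightarrow> 0 + l2_inner M g f"
    by (intro tendsto_intros)
  then show ?thesis using assms by (simp add: l2_inner_diff_right)
qed

lemma l2_lim_inner_left:
  assumes "\<And>n. s n \<in> L2 M" "f \<in> L2 M" "g \<in> L2 M" "l2_lim M s f"
  shows "(\<lambda>n. l2_inner M (s n) g) \<longlonglongrightarrow> l2_inner M f g"
  using tendsto_cnj[OF l2_lim_inner_right[OF assms]] unfolding l2_inner_commute[symmetric] .

lemma l2_lim_add:
  assumes "\<And>n. s n \<in> L2 M" "\<And>n. t n \<in> L2 M" "f \<in> L2 M" "g \<in> L2 M" "l2_lim M s f" "l2_lim M t g"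
  shows "l2_lim M (\<lambda>n x. s n x + t n x) (\<lambda>x. f x + g x)"
proof (rule l2_lim_bound)
  show "l2_norm M (\<lambda>x. s n x + t n x - (f x + g x)) \<le> l2_norm M (\<lambda>x. s n x - f x) + l2_norm M (\<lambda>x. t n x - g x)" for n
    using l2_norm_triangle[OF L2_diff[OF assms(1,3)] L2_diff[OF assms(2,4)], of n n] by (simp add: algebra_simps)
qed (use tendsto_add[OF assms(5,6)[unfolded l2_lim_def]] in simp)

lemma l2_lim_cmult: "l2_lim M s f \<Longrightarrow> l2_lim M (\<lambda>n x. c * s n x) (\<lambda>x. c * f x)"
  unfolding l2_lim_def right_diff_distrib[symmetric] l2_norm_cmult by (rule tendsto_mult_right_zero)

lemma l2_lim_bounded_mult:
  assumes "\<And>n. s n \<in> L2 M" "f \<in> L2 M" "l2_lim M s f"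
    "h \<in> borel_measurable M" "\<And>x. x \<in> space M \<Longrightarrow> norm (h x) \<le> C"
  shows "l2_lim M (\<lambda>n x. h x * s n x) (\<lambda>x. h x * f x)"
proof (rule l2_lim_bound)
  show "l2_norm M (\<lambda>x. h x * s n x - h x * f x) \<le> norm C * l2_norm M (\<lambda>x. s n x - f x)" for n
  proof -
    have "l2_norm M (\<lambda>x. h x * (s n x - f x)) \<le> l2_norm M (\<lambda>x. of_real C * (s n x - f x))"
    proof (intro l2_norm_le_of_norm_le AE_I2)
      show "(\<lambda>x. h x * (s n x - f x)) \<in> L2 M"
        by (rule L2_bounded_mult[of _ _ _ C]) (use assms in \<open>auto intro!: L2_intros\<close>)
      show "norm (h x * (s n x - f x)) \<le> norm (of_real C * (s n x - f x))" if "x \<in> space M" for x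
        using assms(5)[OF that] by (auto simp: norm_mult intro!: mult_right_mono)
    qed (use assms in \<open>auto intro!: L2_intros\<close>)
    then show ?thesis by (simp add: l2_norm_cmult right_diff_distrib[symmetric])
  qed
qed (use tendsto_mult_right_zero[OF assms(3)[unfolded l2_lim_def]] in simp)

text \<open>A subsequence with increments of norm below 2^-k converges almost everywhere, and
  Fatou's lemma along it turns the Cauchy bound into a bound for the distance from the pointwise
  limit.\<close>

theorem L2_complete:
  assumes s: "\<And>n. s n \<in> L2 M"
    and cau: "\<And>e. e > 0 \<Longrightarrow> \<exists>N. \<forall>m\<ge>N. \<forall>n\<ge>N. l2_norm M (\<lambda>x. s m x - s n x) < e"
  shows "\<exists>f\<in>L2 M. l2_lim M s f"
proof -
  have [measurable]: "s n \<in> borel_measurable M" for n using s by auto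
  have "\<exists>r. \<forall>k. (\<forall>m\<ge>r k. \<forall>n\<ge>r k. l2_norm M (\<lambda>x. s m x - s n x) < (1/2) ^ k) \<and> r k < r (Suc k)"
  proof (rule dependent_nat_choice)
    show "\<exists>x. \<forall>m\<ge>x. \<forall>n\<ge>x. l2_norm M (\<lambda>y. s m y - s n y) < (1/2) ^ 0" using cau[of 1] by simp
    fix x k
    obtain N where "\<forall>m\<ge>N. \<forall>n\<ge>N. l2_norm M (\<lambda>x. s m x - s n x) < (1/2) ^ Suc k"
      using cau[of "(1/2) ^ Suc k"] by auto
    then show "\<exists>y. (\<forall>m\<ge>y. \<forall>n\<ge>y. l2_norm M (\<lambda>x. s m x - s n x) < (1/2) ^ Suc k) \<and> x < y"
      by (intro exI[of _ "max N (Suc x)"]) auto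
  qed
  then obtain r where r: "\<And>k m n. m \<ge> r k \<Longrightarrow> n \<ge> r k \<Longrightarrow> l2_norm M (\<lambda>x. s m x - s n x) < (1/2) ^ k"
    and rS: "\<And>k. r k < r (Suc k)" by metis
  have smr: "strict_mono r" using rS by (simp add: strict_mono_Suc_iff)
  define d where "d k x = s (r (Suc k)) x - s (r k) x" for k x
  have [measurable]: "d k \<in> borel_measurable M" for k unfolding d_def by measurable
  have dL2: "d k \<in> L2 M" for k unfolding d_def by (intro L2_intros s)
  \<comment> \<open>The squared increments have integral at most 4^-k, so the weight 2^k still
    leaves a summable series; this weight is what makes the increments themselves summable
    pointwise, not merely their squares.\<close>
  have nn: "(\<integral>\<^sup>+x. ennreal (2 ^ k * (norm (d k x))\<^sup>2) \<partial>M) \<le> ennreal ((1/2) ^ k)" for k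
  proof -
    have "(\<integral>\<^sup>+x. ennreal (2 ^ k * (norm (d k x))\<^sup>2) \<partial>M) = ennreal (LINT x|M. 2 ^ k * (norm (d k x))\<^sup>2)"
      by (rule nn_integral_eq_integral) (use dL2 L2_integrable in auto)
    also have "(LINT x|M. 2 ^ k * (norm (d k x))\<^sup>2) = 2 ^ k * (l2_norm M (d k))\<^sup>2"
      by (simp add: l2_norm_sq)
    also have "\<dots> \<le> 2 ^ k * ((1/2) ^ k)\<^sup>2"
      using r[of k "r (Suc k)" "r k"] rS[of k] unfolding d_def
      by (intro mult_left_mono power_mono) auto
    also have "\<dots> = (1/2) ^ k" by (simp add: power2_eq_square power_one_over)
    finally show ?thesis by (simp add: ennreal_leI)
  qed
  have "(\<integral>\<^sup>+x. (\<Sum>k. ennreal (2 ^ k * (norm (d k x))\<^sup>2)) \<partial>M) = (\<Sum>k. \<integral>\<^sup>+x. ennreal (2 ^ k * (norm (d k x))\<^sup>2) \<partial>M)"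
    by (rule nn_integral_suminf) measurable
  also have "\<dots> \<le> (\<Sum>k. ennreal ((1/2) ^ k))" by (intro suminf_le nn) auto
  also have "\<dots> = ennreal (\<Sum>k. (1/2) ^ k)" by (intro suminf_ennreal2) auto
  finally have "(\<integral>\<^sup>+x. (\<Sum>k. ennreal (2 ^ k * (norm (d k x))\<^sup>2)) \<partial>M) \<noteq> \<infinity>"
    by (auto simp: top_unique)
  then have "AE x in M. (\<Sum>k. ennreal (2 ^ k * (norm (d k x))\<^sup>2)) \<noteq> \<infinity>"
    by (rule nn_integral_PInf_AE[rotated]) measurable
  then have conv: "AE x in M. convergent (\<lambda>k. s (r k) x)"
  proof eventually_elim
    fix x assume "(\<Sum>k. ennreal (2 ^ k * (norm (d k x))\<^sup>2)) \<noteq> \<infinity>"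
    then have S: "summable (\<lambda>k. 2 ^ k * (norm (d k x))\<^sup>2)"
      by (intro summable_suminf_not_top) auto
    have "summable (\<lambda>k. d k x)"
    proof (rule summable_comparison_test)
      show "summable (\<lambda>k. 2 ^ k * (norm (d k x))\<^sup>2 + (1/2) ^ k)"
        by (intro summable_add S) auto
      have "norm (d k x) \<le> 2 ^ k * (norm (d k x))\<^sup>2 + (1/2) ^ k" for k
      proof -
        define p :: real where "p = 2 ^ k"
        have p: "p > 0" "(1/2) ^ k = 1 / p" by (auto simp: p_def power_one_over)
        \<comment> \<open>The inequality between arithmetic and geometric mean, 2 a \<le> p a^2 +
          1/p with p = 2^k.\<close>
        have "0 \<le> (p * norm (d k x) - 1)\<^sup>2 / p" using p by simp
        also have "\<dots> = p * (norm (d k x))\<^sup>2 + 1 / p - 2 * norm (d k x)"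
          using p by (simp add: power2_eq_square field_simps)
        finally have "2 * norm (d k x) \<le> p * (norm (d k x))\<^sup>2 + 1 / p" by simp
        then show ?thesis unfolding p p_def[symmetric] using norm_ge_zero[of "d k x"] by linarith
      qed
      then show "\<exists>N. \<forall>n\<ge>N. norm (d n x) \<le> 2 ^ n * (norm (d n x))\<^sup>2 + (1/2) ^ n" by blast
    qed
    then have "convergent (\<lambda>n. \<Sum>k<n. d k x)" by (simp add: summable_iff_convergent)
    moreover have "(\<Sum>k<n. d k x) = s (r n) x - s (r 0) x" for n
      unfolding d_def by (rule sum_lessThan_telescope)
    ultimately have "convergent (\<lambda>n. s (r n) x - s (r 0) x + s (r 0) x)" 
      by (intro convergent_add convergent_const) simp
    then show "convergent (\<lambda>k. s (r k) x)" by simp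
  qed
  \<comment> \<open>On the null set where the subsequence diverges, \<open>lim\<close> has an
    arbitrary value; measurability is not affected.\<close>
  define f where "f x = lim (\<lambda>k. s (r k) x)" for x
  have [measurable]: "f \<in> borel_measurable M"
    unfolding f_def by (rule borel_measurable_lim_metric) measurable
  have AEf: "AE x in M. (\<lambda>k. s (r k) x) \<longlonglongrightarrow> f x"
    using conv by eventually_elim (simp add: f_def convergent_LIMSEQ_iff)
  have fatou: "(\<integral>\<^sup>+x. ennreal ((norm (s n x - f x))\<^sup>2) \<partial>M) \<le> ennreal (e\<^sup>2)"
    if N: "\<And>m. m \<ge> N \<Longrightarrow> l2_norm M (\<lambda>x. s n x - s m x) < e" for n N e
  proof -
    have "(\<integral>\<^sup>+x. ennreal ((norm (s n x - f x))\<^sup>2) \<partial>M) 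
        = (\<integral>\<^sup>+x. liminf (\<lambda>k. ennreal ((norm (s n x - s (r k) x))\<^sup>2)) \<partial>M)"
    proof (rule nn_integral_cong_AE, use AEf in eventually_elim)
      fix x assume *: "(\<lambda>k. s (r k) x) \<longlonglongrightarrow> f x"
      have "(\<lambda>k. ennreal ((norm (s n x - s (r k) x))\<^sup>2)) \<longlonglongrightarrow> ennreal ((norm (s n x - f x))\<^sup>2)"
        by (intro tendsto_ennrealI tendsto_intros *)
      then show "ennreal ((norm (s n x - f x))\<^sup>2) = liminf (\<lambda>k. ennreal ((norm (s n x - s (r k) x))\<^sup>2))"
        by (intro lim_imp_Liminf[symmetric]) auto
    qed
    also have "\<dots> \<le> liminf (\<lambda>k. \<integral>\<^sup>+x. ennreal ((norm (s n x - s (r k) x))\<^sup>2) \<partial>M)"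
      by (rule nn_integral_liminf) measurable
    also have "\<dots> \<le> ennreal (e\<^sup>2)"
    proof (rule Liminf_le)
      have "(\<integral>\<^sup>+x. ennreal ((norm (s n x - s (r k) x))\<^sup>2) \<partial>M) \<le> ennreal (e\<^sup>2)" if "k \<ge> N" for k
      proof -
        have "r k \<ge> N" using that seq_suble[OF smr, of k] by linarith
        have "(\<integral>\<^sup>+x. ennreal ((norm (s n x - s (r k) x))\<^sup>2) \<partial>M) = ennreal ((l2_norm M (\<lambda>x. s n x - s (r k) x))\<^sup>2)"
          unfolding l2_norm_sq by (rule nn_integral_eq_integral) (auto intro!: L2_integrable L2_intros s)
        also have "\<dots> \<le> ennreal (e\<^sup>2)"
          using N[OF \<open>r k \<ge> N\<close>] by (intro ennreal_leI power_mono) auto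
        finally show ?thesis .
      qed
      then show "\<forall>\<^sub>F k in sequentially. (\<integral>\<^sup>+x. ennreal ((norm (s n x - s (r k) x))\<^sup>2) \<partial>M) \<le> ennreal (e\<^sup>2)"
        by (auto simp: eventually_sequentially)
    qed simp
    finally show ?thesis .
  qed
  have diffL2: "(\<lambda>x. s n x - f x) \<in> L2 M" and dn: "l2_norm M (\<lambda>x. s n x - f x) \<le> e"
    if N: "\<And>m. m \<ge> N \<Longrightarrow> l2_norm M (\<lambda>x. s n x - s m x) < e" and e: "e > 0" for n N e
  proof -
    from fatou[of N n e, OF N] have *: "(\<integral>\<^sup>+x. ennreal ((norm (s n x - f x))\<^sup>2) \<partial>M) \<le> ennreal (e\<^sup>2)" .
    have int: "integrable M (\<lambda>x. (norm (s n x - f x))\<^sup>2)"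
      using le_less_trans[OF * ennreal_less_top] by (intro integrableI_bounded) auto
    then show "(\<lambda>x. s n x - f x) \<in> L2 M" by (simp add: L2_def)
    have "ennreal ((l2_norm M (\<lambda>x. s n x - f x))\<^sup>2) \<le> ennreal (e\<^sup>2)"
      unfolding l2_norm_sq using * nn_integral_eq_integral[OF int] by simp
    then have "(l2_norm M (\<lambda>x. s n x - f x))\<^sup>2 \<le> e\<^sup>2" by (simp add: ennreal_le_iff)
    then show "l2_norm M (\<lambda>x. s n x - f x) \<le> e" by (rule power2_le_imp_le) (use e in auto)
  qed
  obtain N1 where "\<forall>m\<ge>N1. \<forall>n\<ge>N1. l2_norm M (\<lambda>x. s m x - s n x) < 1" using cau[of 1] by auto
  then have "(\<lambda>x. s N1 x - f x) \<in> L2 M" using diffL2[of N1 N1 1] by auto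
  \<comment> \<open>Fatou only yields that a difference s - f is in L^2; subtracting it from s
    recovers f.\<close>
  from L2_diff[OF s[of N1] this] have f: "f \<in> L2 M" by simp
  moreover have "l2_lim M s f"
    unfolding l2_lim_def
  proof (rule LIMSEQ_I)
    fix e :: real assume e: "0 < e"
    then obtain N where N: "\<forall>m\<ge>N. \<forall>n\<ge>N. l2_norm M (\<lambda>x. s m x - s n x) < e / 2" using cau[of "e/2"] by auto
    have "l2_norm M (\<lambda>x. s n x - f x) < e" if "n \<ge> N" for n
      using dn[of N n "e/2"] N that e by auto
    then show "\<exists>no. \<forall>n\<ge>no. norm (l2_norm M (\<lambda>x. s n x - f x) - 0) < e" by auto
  qed
  ultimately show ?thesis by blast
qed

subsection \<open>Orthogonal series\<close>

text \<open>Pythagoras for unnormalised and possibly vanishing \<open>d n\<close>: besides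
  orthonormal systems it serves the first and second derivatives of the Fourier modes, whose norms
  are products of eigenvalue roots.\<close>

lemma l2_norm_sq_orthogonal_sum:
  assumes d: "\<And>n. d n \<in> L2 M" and orth: "\<And>m n. m \<noteq> n \<Longrightarrow> l2_inner M (d m) (d n) = 0" and F: "finite F"
  shows "(l2_norm M (\<lambda>x. \<Sum>n\<in>F. c n * d n x))\<^sup>2 = (\<Sum>n\<in>F. (norm (c n))\<^sup>2 * (l2_norm M (d n))\<^sup>2)"
  using F
proof (induction F rule: finite_induct)
  case (insert a F)
  have "l2_inner M (\<lambda>x. c a * d a x) (\<lambda>x. \<Sum>n\<in>F. c n * d n x) = (\<Sum>n\<in>F. l2_inner M (\<lambda>x. c a * d a x) (\<lambda>x. c n * d n x))"
    by (intro l2_inner_sum_right L2_intros d)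
  also have "\<dots> = 0" using insert(2)
    by (intro sum.neutral ballI) (metis l2_inner_cmult_right l2_inner_cmult_left orth mult_zero_right)
  finally have "(l2_norm M (\<lambda>x. c a * d a x + (\<Sum>n\<in>F. c n * d n x)))\<^sup>2 
      = (l2_norm M (\<lambda>x. c a * d a x))\<^sup>2 + (l2_norm M (\<lambda>x. \<Sum>n\<in>F. c n * d n x))\<^sup>2"
    by (subst l2_norm_sq_add) (auto intro!: L2_intros d)
  then show ?case using insert by (simp add: l2_norm_cmult power_mult_distrib)
qed simp

lemma orthogonal_series_converges:
  assumes d: "\<And>n. d n \<in> L2 M" and orth: "\<And>m n. m \<noteq> n \<Longrightarrow> l2_inner M (d m) (d n) = 0"
    and S: "summable (\<lambda>n. (norm (c n))\<^sup>2 * (l2_norm M (d n))\<^sup>2)"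
  shows "\<exists>f\<in>L2 M. l2_lim M (\<lambda>N x. \<Sum>n<N. c n * d n x) f"
proof (rule L2_complete)
  show "(\<lambda>x. \<Sum>n<N. c n * d n x) \<in> L2 M" for N by (intro L2_intros d)
  fix e :: real assume e: "e > 0"
  then have e2: "e\<^sup>2 > 0" by simp
  from S[unfolded summable_Cauchy] e2 obtain N where
    N: "\<And>m n. m \<ge> N \<Longrightarrow> norm (\<Sum>k=m..<n. (norm (c k))\<^sup>2 * (l2_norm M (d k))\<^sup>2) < e\<^sup>2" by blast
  have *: "l2_norm M (\<lambda>x. (\<Sum>k<n. c k * d k x) - (\<Sum>k<m. c k * d k x)) < e" if "m \<ge> N" "m \<le> n" for m n
  proof -
    have "(\<Sum>k<n. c k * d k x) - (\<Sum>k<m. c k * d k x) = (\<Sum>k=m..<n. c k * d k x)" for x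
      using that by (simp add: sum_diff_nat_ivl lessThan_atLeast0)
    then have "(l2_norm M (\<lambda>x. (\<Sum>k<n. c k * d k x) - (\<Sum>k<m. c k * d k x)))\<^sup>2 
       = (\<Sum>k=m..<n. (norm (c k))\<^sup>2 * (l2_norm M (d k))\<^sup>2)"
      by (simp add: l2_norm_sq_orthogonal_sum[OF d orth])
    also have "\<dots> < e\<^sup>2" using N[OF that(1), of n] by (auto simp: abs_if split: if_splits)
    finally show ?thesis by (rule power2_less_imp_less) (use e in auto)
  qed
  have "l2_norm M (\<lambda>x. (\<Sum>k<m. c k * d k x) - (\<Sum>k<n. c k * d k x)) < e" if "m \<ge> N" "n \<ge> N" for m n
    using *[of m n] *[of n m] that l2_norm_minus_commute[of M "\<lambda>x. \<Sum>k<m. c k * d k x"] 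
    by (cases "m \<le> n") auto
  then show "\<exists>N. \<forall>m\<ge>N. \<forall>n\<ge>N. l2_norm M (\<lambda>x. (\<Sum>k<m. c k * d k x) - (\<Sum>k<n. c k * d k x)) < e" by blast
qed

section \<open>Orthonormal sequences, bases and Parseval's identity\<close>

locale orthonormal_seq =
  fixes M :: "'a measure" and e :: "nat \<Rightarrow> 'a \<Rightarrow> complex"
  assumes e_L2: "\<And>n. e n \<in> L2 M"
    and orthonormal: "\<And>m n. l2_inner M (e m) (e n) = (if m = n then 1 else 0)"
begin

lemma norm_e: "l2_norm M (e n) = 1"
proof -
  have "complex_of_real ((l2_norm M (e n))\<^sup>2) = of_real 1" unfolding l2_inner_self[symmetric] by (simp add: orthonormal)
  then have "(l2_norm M (e n))\<^sup>2 = 1" using of_real_eq_iff by blast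
  then show ?thesis using power2_eq_1_iff[of "l2_norm M (e n)"] l2_norm_nonneg[of M "e n"] by auto
qed

lemma inner_sum: "finite F \<Longrightarrow> l2_inner M (e m) (\<lambda>x. \<Sum>n\<in>F. c n * e n x) = (if m \<in> F then c m else 0)"
  by (subst l2_inner_sum_right) 
    (auto simp: l2_inner_cmult_right orthonormal mult_delta_right intro!: L2_intros e_L2)

lemma norm_sum: "finite F \<Longrightarrow> (l2_norm M (\<lambda>x. \<Sum>n\<in>F. c n * e n x))\<^sup>2 = (\<Sum>n\<in>F. (norm (c n))\<^sup>2)"
  by (subst l2_norm_sq_orthogonal_sum) (auto simp: e_L2 orthonormal norm_e)

lemma bessel_identity:
  assumes f: "f \<in> L2 M" and F: "finite F"
  shows "(l2_norm M (\<lambda>x. f x - (\<Sum>n\<in>F. l2_inner M (e n) f * e n x)))\<^sup>2 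
    = (l2_norm M f)\<^sup>2 - (\<Sum>n\<in>F. (norm (l2_inner M (e n) f))\<^sup>2)"
proof -
  have "l2_inner M f (\<lambda>x. \<Sum>n\<in>F. l2_inner M (e n) f * e n x) = (\<Sum>n\<in>F. l2_inner M (e n) f * l2_inner M f (e n))"
    using f by (subst l2_inner_sum_right) (auto simp: l2_inner_cmult_right intro!: L2_intros e_L2)
  also have "\<dots> = (\<Sum>n\<in>F. of_real ((norm (l2_inner M (e n) f))\<^sup>2))"
    by (intro sum.cong refl) (simp add: l2_inner_commute[of M f] complex_norm_square[symmetric] del: of_real_power)
  finally have "Re (l2_inner M f (\<lambda>x. \<Sum>n\<in>F. l2_inner M (e n) f * e n x)) = (\<Sum>n\<in>F. (norm (l2_inner M (e n) f))\<^sup>2)"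
    by (simp add: Re_sum del: of_real_power)
  then show ?thesis using f F
    by (subst l2_norm_sq_diff) (auto simp: norm_sum intro!: L2_intros e_L2)
qed

lemma bessel: "f \<in> L2 M \<Longrightarrow> finite F \<Longrightarrow> (\<Sum>n\<in>F. (norm (l2_inner M (e n) f))\<^sup>2) \<le> (l2_norm M f)\<^sup>2"
  using bessel_identity[of f F] zero_le_power2[of "l2_norm M (\<lambda>x. f x - (\<Sum>n\<in>F. l2_inner M (e n) f * e n x))"] by simp

lemma summable_coeffs: "f \<in> L2 M \<Longrightarrow> summable (\<lambda>n. (norm (l2_inner M (e n) f))\<^sup>2)"
  by (rule bounded_imp_summable[of _ "(l2_norm M f)\<^sup>2"]) (auto intro: bessel)

lemma riesz_fischer:
  assumes "summable (\<lambda>n. (norm (c n))\<^sup>2)"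
  obtains f where "f \<in> L2 M" "l2_lim M (\<lambda>N x. \<Sum>n<N. c n * e n x) f" "\<And>n. l2_inner M (e n) f = c n"
proof -
  obtain f where f: "f \<in> L2 M" "l2_lim M (\<lambda>N x. \<Sum>n<N. c n * e n x) f"
    using orthogonal_series_converges[of e M c] assms by (auto simp: e_L2 orthonormal norm_e)
  moreover have "l2_inner M (e n) f = c n" for n
  proof -
    have "(\<lambda>N. l2_inner M (e n) (\<lambda>x. \<Sum>n<N. c n * e n x)) \<longlonglongrightarrow> l2_inner M (e n) f"
      by (rule l2_lim_inner_right) (auto intro!: L2_intros e_L2 f)
    moreover have "(\<lambda>N. l2_inner M (e n) (\<lambda>x. \<Sum>n<N. c n * e n x)) \<longlonglongrightarrow> c n"
      by (rule tendsto_eventually, rule eventually_sequentiallyI[of "Suc n"]) (auto simp: inner_sum)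
    ultimately show ?thesis using LIMSEQ_unique by blast
  qed
  ultimately show ?thesis using that by blast
qed

text \<open>The Fourier series of \<open>f\<close> converges by Riesz-Fischer to some
  \<open>g\<close> with the same coefficients, and totality applied to f - g identifies the two
  almost everywhere.\<close>

lemma orthonormal_basis_of_total:
  assumes total: "\<And>f. f \<in> L2 M \<Longrightarrow> (\<And>n. l2_inner M (e n) f = 0) \<Longrightarrow> l2_norm M f = 0"
  shows "orthonormal_basis_L2 M e"
  unfolding orthonormal_basis_L2_def
proof (intro conjI allI ballI)
  fix f assume f: "f \<in> L2 M"
  define c where "c n = l2_inner M (e n) f" for n
  obtain g where g: "g \<in> L2 M" "l2_lim M (\<lambda>N x. \<Sum>n<N. c n * e n x) g" "\<And>n. l2_inner M (e n) g = c n"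
    using riesz_fischer[of c] summable_coeffs[OF f] unfolding c_def by blast
  have 0: "l2_norm M (\<lambda>x. f x - g x) = 0"
    using f g by (intro total L2_intros) (auto simp: l2_inner_diff_right e_L2 c_def)
  have "l2_norm M (\<lambda>x. f x - (\<Sum>n<N. c n * e n x)) = l2_norm M (\<lambda>x. (\<Sum>n<N. c n * e n x) - g x)" for N
  proof -
    have "l2_norm M (\<lambda>x. f x - (\<Sum>n<N. c n * e n x)) = l2_norm M (\<lambda>x. g x - (\<Sum>n<N. c n * e n x))"
      using AE_eq_of_l2_norm_diff[OF f g(1) 0] f g(1)
      by (intro l2_norm_cong_AE) (auto intro!: L2_measurable L2_intros e_L2)
    then show ?thesis by (simp add: l2_norm_minus_commute)
  qed
  then show "(\<lambda>N. l2_norm M (\<lambda>x. f x - (\<Sum>n<N. l2_inner M (e n) f * e n x))) \<longlonglongrightarrow> 0"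
    using g(2) unfolding l2_lim_def c_def by simp
qed (auto simp: e_L2 orthonormal)

end

locale l2_basis = orthonormal_seq +
  assumes expansion: "\<And>f. f \<in> L2 M \<Longrightarrow> l2_lim M (\<lambda>N x. \<Sum>n<N. l2_inner M (e n) f * e n x) f"
begin

lemma parseval: 
  assumes f: "f \<in> L2 M" and g: "g \<in> L2 M"
  shows "(\<lambda>n. cnj (l2_inner M (e n) f) * l2_inner M (e n) g) sums l2_inner M f g"
  unfolding sums_def
proof -
  have "(\<lambda>N. l2_inner M f (\<lambda>x. \<Sum>n<N. l2_inner M (e n) g * e n x)) \<longlonglongrightarrow> l2_inner M f g"
    by (rule l2_lim_inner_right) (auto intro!: L2_intros e_L2 f g expansion)
  moreover have "l2_inner M f (\<lambda>x. \<Sum>n<N. l2_inner M (e n) g * e n x) 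
      = (\<Sum>n<N. cnj (l2_inner M (e n) f) * l2_inner M (e n) g)" for N
    using f by (subst l2_inner_sum_right)
      (auto simp: l2_inner_cmult_right l2_inner_commute[of M f] intro!: L2_intros e_L2 sum.cong)
  ultimately show "(\<lambda>N. \<Sum>n<N. cnj (l2_inner M (e n) f) * l2_inner M (e n) g) \<longlonglongrightarrow> l2_inner M f g" by simp
qed

lemma parseval_norm:
  assumes f: "f \<in> L2 M"
  shows "(\<lambda>n. (norm (l2_inner M (e n) f))\<^sup>2) sums (l2_norm M f)\<^sup>2"
  using parseval[OF f f] unfolding l2_inner_self mult.commute[of "cnj _"] complex_norm_square[symmetric]
  by (simp add: sums_of_real_iff del: of_real_power)

text \<open>Reduces identities between operators that are diagonal in the basis to a comparison of
  coefficients, up to null sets.\<close>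

lemma AE_eq_of_coeffs:
  assumes f: "f \<in> L2 M" and g: "g \<in> L2 M" and eq: "\<And>n. l2_inner M (e n) f = l2_inner M (e n) g"
  shows "AE x in M. f x = g x"
proof (rule AE_eq_of_l2_norm_diff[OF f g])
  have "(\<lambda>n. 0::real) sums (l2_norm M (\<lambda>x. f x - g x))\<^sup>2"
    using parseval_norm[OF L2_diff[OF f g]] eq f g by (simp add: l2_inner_diff_right e_L2)
  then show "l2_norm M (\<lambda>x. f x - g x) = 0" using sums_unique2[OF _ sums_zero] by fastforce
qed

end

lemma l2_basis_iff: "l2_basis M e \<longleftrightarrow> orthonormal_basis_L2 M e"
  unfolding l2_basis_def l2_basis_axioms_def orthonormal_seq_def orthonormal_basis_L2_def l2_lim_def
  by (simp add: l2_norm_minus_commute) (auto simp: l2_norm_minus_commute)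

section \<open>Eigenbases of compact form pairs\<close>

text \<open>The form is only semidefinite because functions that differ on a null set are different
  vectors. The scalars are real, since the eigenfunctions have to be real-valued.\<close>

locale psd_form =
  fixes X :: "'v::real_vector set" and b :: "'v \<Rightarrow> 'v \<Rightarrow> real"
  assumes sub: "subspace X"
    and add_left: "\<And>u v w. u \<in> X \<Longrightarrow> v \<in> X \<Longrightarrow> w \<in> X \<Longrightarrow> b (u + v) w = b u w + b v w"
    and scale_left: "\<And>r u w. u \<in> X \<Longrightarrow> w \<in> X \<Longrightarrow> b (r *\<^sub>R u) w = r * b u w"
    and sym: "\<And>u v. u \<in> X \<Longrightarrow> v \<in> X \<Longrightarrow> b u v = b v u"
    and nonneg: "\<And>u. u \<in> X \<Longrightarrow> 0 \<le> b u u"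
begin

lemmas X_intros = subspace_add[OF sub] subspace_diff[OF sub] subspace_scale[OF sub]
  subspace_0[OF sub] subspace_sum[OF sub]

lemma add_right: "u \<in> X \<Longrightarrow> v \<in> X \<Longrightarrow> w \<in> X \<Longrightarrow> b w (u + v) = b w u + b w v"
  by (metis add_left sym X_intros(1))

lemma scale_right: "u \<in> X \<Longrightarrow> w \<in> X \<Longrightarrow> b w (r *\<^sub>R u) = r * b w u"
  by (metis scale_left sym X_intros(3))

lemma diff_left: "u \<in> X \<Longrightarrow> v \<in> X \<Longrightarrow> w \<in> X \<Longrightarrow> b (u - v) w = b u w - b v w"
  using add_left[of u "(-1) *\<^sub>R v" w] scale_left[of v w "-1"] X_intros(3)[of v "-1"] by simp

lemma diff_right: "u \<in> X \<Longrightarrow> v \<in> X \<Longrightarrow> w \<in> X \<Longrightarrow> b w (u - v) = b w u - b w v"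
  by (metis diff_left sym X_intros(2))

lemma zero_left: "w \<in> X \<Longrightarrow> b 0 w = 0"
  using scale_left[of 0 w 0] X_intros(4) by simp

lemma zero_right: "w \<in> X \<Longrightarrow> b w 0 = 0"
  using scale_right[of 0 w 0] X_intros(4) by simp

lemma sum_left: "(\<And>i. i \<in> I \<Longrightarrow> f i \<in> X) \<Longrightarrow> w \<in> X \<Longrightarrow> b (\<Sum>i\<in>I. f i) w = (\<Sum>i\<in>I. b (f i) w)"
  by (induction I rule: infinite_finite_induct) (auto simp: zero_left add_left X_intros)

lemma sum_right: "(\<And>i. i \<in> I \<Longrightarrow> f i \<in> X) \<Longrightarrow> w \<in> X \<Longrightarrow> b w (\<Sum>i\<in>I. f i) = (\<Sum>i\<in>I. b w (f i))"
  by (induction I rule: infinite_finite_induct) (auto simp: zero_right add_right X_intros)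

lemma expand_add: "u \<in> X \<Longrightarrow> v \<in> X \<Longrightarrow> b (u + v) (u + v) = b u u + 2 * b u v + b v v"
  by (simp add: add_left add_right X_intros sym[of v u])

lemma expand_diff: "u \<in> X \<Longrightarrow> v \<in> X \<Longrightarrow> b (u - v) (u - v) = b u u - 2 * b u v + b v v"
  by (simp add: diff_left diff_right X_intros sym[of v u])

lemma cauchy_schwarz:
  assumes u: "u \<in> X" and v: "v \<in> X"
  shows "(b u v)\<^sup>2 \<le> b u u * b v v"
proof -
  have *: "0 \<le> b u u - 2 * t * b u v + t\<^sup>2 * b v v" for t
    using nonneg[of "u - t *\<^sub>R v"] u v
    by (simp add: expand_diff X_intros scale_left scale_right power2_eq_square algebra_simps)
  show ?thesis
  proof (cases "b v v = 0")
    case True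
    have "b u v = 0"
    proof (rule ccontr)
      assume n: "b u v \<noteq> 0"
      \<comment> \<open>With b v v = 0 the bound \<open>*\<close> is affine in t, and this t makes
        it negative.\<close>
      have "0 \<le> b u u - 2 * ((b u u + 1) / b u v) * b u v" 
        using *[of "(b u u + 1) / b u v"] True by simp
      then have "0 \<le> b u u - 2 * (b u u + 1)" using n by simp
      with nonneg[OF u] show False by simp
    qed
    then show ?thesis using True by simp
  next
    case False
    then have p: "b v v > 0" using nonneg[OF v] by simp
    have "0 \<le> b u u - 2 * (b u v / b v v) * b u v + (b u v / b v v)\<^sup>2 * b v v" by (rule *)
    also have "\<dots> = b u u - (b u v)\<^sup>2 / b v v" using p by (simp add: power2_eq_square field_simps)
    finally show ?thesis using p by (simp add: field_simps)
  qed
qed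

lemma tendsto_form:
  assumes s: "\<And>n. s n \<in> X" and u: "u \<in> X" and v: "v \<in> X"
    and lim: "(\<lambda>n. b (s n - u) (s n - u)) \<longlonglongrightarrow> 0"
  shows "(\<lambda>n. b (s n) v) \<longlonglongrightarrow> b u v"
proof -
  have "(\<lambda>n. (b (s n - u) v)\<^sup>2) \<longlonglongrightarrow> 0"
  proof (rule tendsto_sandwich)
    show "\<forall>\<^sub>F n in sequentially. 0 \<le> (b (s n - u) v)\<^sup>2" by simp
    show "\<forall>\<^sub>F n in sequentially. (b (s n - u) v)\<^sup>2 \<le> b (s n - u) (s n - u) * b v v"
      using s u v by (auto intro!: always_eventually cauchy_schwarz X_intros)
    show "(\<lambda>n. b (s n - u) (s n - u) * b v v) \<longlonglongrightarrow> 0"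
      using tendsto_mult_right[OF lim, of "b v v"] by simp
  qed simp
  then have "(\<lambda>n. b (s n - u) v) \<longlonglongrightarrow> 0" by simp
  then have "(\<lambda>n. b (s n - u) v + b u v) \<longlonglongrightarrow> 0 + b u v" by (intro tendsto_intros)
  then show ?thesis using s u v by (simp add: diff_left)
qed

lemma tendsto_form_diag:
  assumes s: "\<And>n. s n \<in> X" and u: "u \<in> X"
    and lim: "(\<lambda>n. b (s n - u) (s n - u)) \<longlonglongrightarrow> 0"
  shows "(\<lambda>n. b (s n) (s n)) \<longlonglongrightarrow> b u u"
proof -
  have "(\<lambda>n. b (s n - u) (s n - u) + 2 * b (s n) u - b u u) \<longlonglongrightarrow> 0 + 2 * b u u - b u u"
    by (intro tendsto_intros lim tendsto_form s u)
  then show ?thesis using s u by (simp add: expand_diff)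
qed

end

text \<open>The setting of the min-max method: b will be the L^2 inner product and q a complete
  energy form whose bounded sets are b-precompact. \<open>infinite_dim\<close> is phrased as the
  supply of one more b-orthogonal vector of positive length, which is what the recursion in
  \<open>eigenbasis\<close> consumes.\<close>

locale compact_form_pair = B: psd_form X b + Q: psd_form X q
  for X :: "'v::real_vector set" and b q +
  assumes le: "\<And>u. u \<in> X \<Longrightarrow> b u u \<le> q u u"
    and complete: "\<And>s. (\<And>n::nat. s n \<in> X) \<Longrightarrow>
      (\<And>e. e > 0 \<Longrightarrow> \<exists>N. \<forall>m\<ge>N. \<forall>n\<ge>N. q (s m - s n) (s m - s n) < e) \<Longrightarrow>
      \<exists>u\<in>X. (\<lambda>n. q (s n - u) (s n - u)) \<longlonglongrightarrow> 0"
    and compact: "\<And>s C. (\<And>n::nat. s n \<in> X) \<Longrightarrow> (\<And>n. q (s n) (s n) \<le> C) \<Longrightarrow>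
      \<exists>r. strict_mono r \<and> (\<forall>e>0. \<exists>N::nat. \<forall>m\<ge>N. \<forall>n\<ge>N. b (s (r m) - s (r n)) (s (r m) - s (r n)) < e)"
    and infinite_dim: "\<And>(n::nat) \<psi>. (\<And>j. j < n \<Longrightarrow> \<psi> j \<in> X) \<Longrightarrow>
      (\<And>i j. i < n \<Longrightarrow> j < n \<Longrightarrow> b (\<psi> i) (\<psi> j) = (if i = j then 1 else 0)) \<Longrightarrow>
      \<exists>f\<in>X. (\<forall>j<n. b (\<psi> j) f = 0) \<and> b f f > 0"
begin

lemmas X_intros = B.X_intros

lemma b_tendsto_of_q_tendsto:
  assumes s: "\<And>n. s n \<in> X" and u: "u \<in> X" and lim: "(\<lambda>n. q (s n - u) (s n - u)) \<longlonglongrightarrow> 0"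
  shows "(\<lambda>n. b (s n - u) (s n - u)) \<longlonglongrightarrow> 0"
proof (rule tendsto_sandwich[OF _ _ _ lim])
  show "\<forall>\<^sub>F n in sequentially. 0 \<le> b (s n - u) (s n - u)"
    using s u by (auto intro!: always_eventually B.nonneg X_intros)
  show "\<forall>\<^sub>F n in sequentially. b (s n - u) (s n - u) \<le> q (s n - u) (s n - u)"
    using s u by (auto intro!: always_eventually le X_intros)
qed simp

text \<open>The direct method: compactness makes a minimizing sequence b-Cauchy along a subsequence,
  and the parallelogram law upgrades this to q-Cauchy, because sums of minimizing vectors still obey
  the lower bound \<mu>.\<close>

lemma rayleigh_minimizer:
  assumes F: "F \<subseteq> X" and ne: "\<exists>f\<in>X. (\<forall>v\<in>F. b v f = 0) \<and> b f f > 0"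
  shows "\<exists>u\<in>X. (\<forall>v\<in>F. b v u = 0) \<and> b u u = 1 \<and>
           (\<forall>w\<in>X. (\<forall>v\<in>F. b v w = 0) \<longrightarrow> q u u * b w w \<le> q w w)"
proof -
  define Y where "Y = {u \<in> X. \<forall>v\<in>F. b v u = 0}"
  have YX: "Y \<subseteq> X" by (auto simp: Y_def)
  have Yscale: "r *\<^sub>R u \<in> Y" if "u \<in> Y" for r u
    using that F by (auto simp: Y_def X_intros B.scale_right subset_iff)
  have Yadd: "u + v \<in> Y" if "u \<in> Y" "v \<in> Y" for u v
    using that F by (auto simp: Y_def X_intros B.add_right subset_iff)
  define S where "S = (\<lambda>u. q u u) ` {u \<in> Y. b u u = 1}"
  define \<mu> where "\<mu> = Inf S"
  have bdd: "bdd_below S"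
    unfolding S_def bdd_below_def using YX Q.nonneg by auto
  have normalise: "\<exists>r. r *\<^sub>R w \<in> Y \<and> b (r *\<^sub>R w) (r *\<^sub>R w) = 1 \<and> q (r *\<^sub>R w) (r *\<^sub>R w) = q w w / b w w"
    if "w \<in> Y" "b w w > 0" for w
    using that YX Yscale[of w "1 / sqrt (b w w)"]
    by (intro exI[of _ "1 / sqrt (b w w)"])
      (auto simp: B.scale_left B.scale_right Q.scale_left Q.scale_right X_intros subset_iff field_simps)
  from ne obtain f where "f \<in> Y" "b f f > 0" by (auto simp: Y_def)
  with normalise have Sne: "S \<noteq> {}" unfolding S_def by blast
  have \<mu>le: "\<mu> * b w w \<le> q w w" if w: "w \<in> Y" for w
  proof (cases "b w w > 0")
    case True
    from normalise[OF w True] have "q w w / b w w \<in> S" unfolding S_def by (metis (mono_tags, lifting) image_iff mem_Collect_eq)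
    then have "\<mu> \<le> q w w / b w w" unfolding \<mu>_def using bdd by (rule cInf_lower)
    then show ?thesis using True by (simp add: field_simps)
  next
    case False
    then have "b w w = 0" using B.nonneg[of w] w YX by force
    then show ?thesis using Q.nonneg[of w] w YX by auto
  qed
  have \<mu>0: "0 \<le> \<mu>" unfolding \<mu>_def by (rule cInf_greatest[OF Sne]) (use YX Q.nonneg in \<open>auto simp: S_def\<close>)
  have "\<exists>u. u \<in> Y \<and> b u u = 1 \<and> q u u < \<mu> + 1 / real (Suc n)" for n
  proof -
    have "Inf S < \<mu> + 1 / real (Suc n)" unfolding \<mu>_def by simp
    then obtain x where "x \<in> S" "x < \<mu> + 1 / real (Suc n)"
      using Sne bdd by (auto simp: cInf_less_iff)
    then show ?thesis by (auto simp: S_def)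
  qed
  then obtain t where t: "\<And>n. t n \<in> Y" "\<And>n. b (t n) (t n) = 1" "\<And>n. q (t n) (t n) < \<mu> + 1 / real (Suc n)"
    by metis
  have tX: "t n \<in> X" for n using t YX by auto
  have "q (t n) (t n) \<le> \<mu> + 1" for n
    by (rule order_trans[OF less_imp_le[OF t(3)]]) auto
  from compact[of t, OF tX this] obtain r where r: "strict_mono r"
    and cau: "\<And>e. e > 0 \<Longrightarrow> \<exists>N::nat. \<forall>m\<ge>N. \<forall>n\<ge>N. b (t (r m) - t (r n)) (t (r m) - t (r n)) < e"
    by blast
  define s where "s n = t (r n)" for n
  have sX: "s n \<in> X" for n by (simp add: s_def tX)
  have sY: "s n \<in> Y" for n by (simp add: s_def t)
  have s1: "b (s n) (s n) = 1" for n by (simp add: s_def t)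
  have sq: "q (s n) (s n) \<le> \<mu> + 1 / real (Suc n)" for n
  proof -
    have "1 / real (Suc (r n)) \<le> 1 / real (Suc n)"
      using seq_suble[OF r, of n] by (simp add: frac_le)
    then show ?thesis using t(3)[of "r n"] by (simp add: s_def)
  qed
  \<comment> \<open>Parallelogram law for q and for b: s m + s n has Rayleigh quotient at least
    \<mu>, and its b-square is 4 minus that of the difference.\<close>
  have qdiff: "q (s m - s n) (s m - s n) \<le> 2 / real (Suc m) + 2 / real (Suc n) + \<mu> * b (s m - s n) (s m - s n)" for m n
  proof -
    have "q (s m - s n) (s m - s n) = 2 * q (s m) (s m) + 2 * q (s n) (s n) - q (s m + s n) (s m + s n)"
      using sX by (simp add: Q.expand_diff Q.expand_add)
    also have "\<dots> \<le> 2 * (\<mu> + 1 / real (Suc m)) + 2 * (\<mu> + 1 / real (Suc n)) - \<mu> * b (s m + s n) (s m + s n)"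
      using sq[of m] sq[of n] \<mu>le[OF Yadd[OF sY sY], of m n] by argo
    also have "b (s m + s n) (s m + s n) = 4 - b (s m - s n) (s m - s n)"
      using sX by (simp add: B.expand_diff B.expand_add s1)
    finally show ?thesis by (simp add: algebra_simps)
  qed
  have "\<exists>N. \<forall>m\<ge>N. \<forall>n\<ge>N. q (s m - s n) (s m - s n) < e" if e: "e > 0" for e
  proof -
    \<comment> \<open>The two error terms contribute less than 2 e' each and the b-term at most
      \<mu> e', so 4 + \<mu> multiples of e' are consumed and one is to spare.\<close>
    define e' where "e' = e / (5 + \<mu>)"
    have e': "e' > 0" "e = (5 + \<mu>) * e'" using e \<mu>0 by (auto simp: e'_def)
    from cau[OF e'(1)] obtain N where N: "\<And>m n. m \<ge> N \<Longrightarrow> n \<ge> N \<Longrightarrow> b (s m - s n) (s m - s n) < e'"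
      unfolding s_def by blast
    obtain M where M: "1 / real (Suc M) < e'" using nat_approx_posE[OF e'(1)] by auto
    have "q (s m - s n) (s m - s n) < e" if mn: "m \<ge> max M N" "n \<ge> max M N" for m n
    proof -
      have "1 / real (Suc m) \<le> 1 / real (Suc M)" "1 / real (Suc n) \<le> 1 / real (Suc M)"
        using mn by (auto intro!: frac_le)
      moreover have "\<mu> * b (s m - s n) (s m - s n) \<le> \<mu> * e'"
        using N[of m n] mn \<mu>0 by (intro mult_left_mono) auto
      ultimately show ?thesis using qdiff[of m n] M e' unfolding distrib_right by argo
    qed
    then show ?thesis by blast
  qed
  from complete[of s, OF sX this] obtain u where u: "u \<in> X" and limq: "(\<lambda>n. q (s n - u) (s n - u)) \<longlonglongrightarrow> 0"
    by blast
  have limb: "(\<lambda>n. b (s n - u) (s n - u)) \<longlonglongrightarrow> 0"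
    by (rule b_tendsto_of_q_tendsto[OF sX u limq])
  have orth: "b v u = 0" if "v \<in> F" for v
  proof -
    have v: "v \<in> X" using that F by auto
    have "(\<lambda>n. b (s n) v) \<longlonglongrightarrow> b u v" by (rule B.tendsto_form[OF sX u v limb])
    moreover have "b (s n) v = 0" for n using sY[of n] that B.sym[OF v sX[of n]] by (auto simp: Y_def)
    ultimately have "b u v = 0" by (simp add: LIMSEQ_const_iff)
    then show ?thesis using B.sym u v by simp
  qed
  have bu: "b u u = 1"
    using B.tendsto_form_diag[OF sX u limb] by (simp add: s1 LIMSEQ_const_iff)
  have "q u u \<le> \<mu>"
  proof (rule LIMSEQ_le[OF Q.tendsto_form_diag[OF sX u limq]])
    show "(\<lambda>n. \<mu> + 1 / real (Suc n)) \<longlonglongrightarrow> \<mu>"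
      using tendsto_add[OF tendsto_const LIMSEQ_inverse_real_of_nat, of \<mu>] by (simp add: inverse_eq_divide)
  qed (use sq in auto)
  have "q u u * b w w \<le> q w w" if "w \<in> X" "\<forall>v\<in>F. b v w = 0" for w
  proof -
    have "q u u * b w w \<le> \<mu> * b w w"
      using \<open>q u u \<le> \<mu>\<close> B.nonneg[OF that(1)] by (rule mult_right_mono)
    also have "\<dots> \<le> q w w" using \<mu>le that by (simp add: Y_def)
    finally show ?thesis .
  qed
  with u orth bu show ?thesis by blast
qed

text \<open>The Euler-Lagrange equation: along u + t w the difference between q and its minimal
  multiple of b is a nonnegative polynomial in t of degree two without constant term, so its linear
  coefficient vanishes.\<close>

lemma rayleigh_stationary:
  assumes u: "u \<in> X" "b u u = 1" and F: "F \<subseteq> X" "\<forall>v\<in>F. b v u = 0"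
    and min: "\<forall>w\<in>X. (\<forall>v\<in>F. b v w = 0) \<longrightarrow> q u u * b w w \<le> q w w"
    and w: "w \<in> X" "\<forall>v\<in>F. b v w = 0"
  shows "q w u = q u u * b w u"
proof -
  define A where "A = q w u - q u u * b w u"
  define C where "C = q w w - q u u * b w w"
  have *: "0 \<le> 2 * t * A + t\<^sup>2 * C" for t
  proof -
    have "\<forall>v\<in>F. b v (u + t *\<^sub>R w) = 0"
      using F u w by (auto simp: B.add_right B.scale_right X_intros subset_iff)
    then have "q u u * b (u + t *\<^sub>R w) (u + t *\<^sub>R w) \<le> q (u + t *\<^sub>R w) (u + t *\<^sub>R w)"
      using min u w X_intros by auto
    then show ?thesis using u w
      by (simp add: A_def C_def B.expand_add Q.expand_add X_intros B.scale_left B.scale_right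
          Q.scale_left Q.scale_right power2_eq_square algebra_simps B.sym[of u w] Q.sym[of u w])
  qed
  have "A = 0"
  proof (rule ccontr)
    assume A: "A \<noteq> 0"
    \<comment> \<open>The minimizer of 2 t A + t^2 (|C| + 1); the summand 1 keeps the denominator
      positive.\<close>
    define t where "t = - A / (\<bar>C\<bar> + 1)"
    have "2 * t * A + t\<^sup>2 * C \<le> 2 * t * A + t\<^sup>2 * (\<bar>C\<bar> + 1)"
      by (intro add_left_mono mult_left_mono) auto
    also have "\<dots> = - (A\<^sup>2 / (\<bar>C\<bar> + 1))"
    proof -
      have p: "\<bar>C\<bar> + 1 \<noteq> 0" by linarith
      then have "t\<^sup>2 * (\<bar>C\<bar> + 1) = A\<^sup>2 / (\<bar>C\<bar> + 1)" unfolding t_def power2_eq_square 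
        by (simp add: divide_simps)
      moreover have "2 * t * A = - 2 * (A\<^sup>2 / (\<bar>C\<bar> + 1))" by (simp add: t_def power2_eq_square)
      ultimately show ?thesis by simp
    qed
    also have "\<dots> < 0" using A by (simp add: add_nonneg_pos)
    finally show False using *[of t] by simp
  qed
  then show ?thesis by (simp add: A_def)
qed

text \<open>Successive minimization on the complement of the earlier vectors. A minimizer satisfies
  the eigenvalue equation on all of X because, by symmetry, q pairs it to zero with every earlier
  eigenvector. Only finitely many eigenvalues lie below a bound, since orthonormal vectors of
  bounded energy would contradict precompactness. The remainder of an expansion tends to zero
  because its energy stays below q f f while its Rayleigh quotient is at least the next
  eigenvalue.\<close>

theorem eigenbasis:
  obtains \<psi> E where
    "\<And>n::nat. \<psi> n \<in> X"
    "\<And>m n. b (\<psi> m) (\<psi> n) = (if m = n then 1 else 0)"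
    "\<And>n v. v \<in> X \<Longrightarrow> q v (\<psi> n) = E n * b v (\<psi> n)"
    "\<And>C. finite {n. E n \<le> C}"
    "\<And>f. f \<in> X \<Longrightarrow> (\<lambda>N. b (f - (\<Sum>n<N. b (\<psi> n) f *\<^sub>R \<psi> n)) (f - (\<Sum>n<N. b (\<psi> n) f *\<^sub>R \<psi> n))) \<longlonglongrightarrow> 0"
proof -
  define P where "P \<psi> n u \<longleftrightarrow> u \<in> X \<and> (\<forall>v\<in>\<psi> ` {..<n}. b v u = 0) \<and> b u u = 1 \<and>
      (\<forall>w\<in>X. (\<forall>v\<in>\<psi> ` {..<n}. b v w = 0) \<longrightarrow> q u u * b w w \<le> q w w)" for \<psi> and n::nat and u
  have "\<exists>\<psi>. \<forall>n. P \<psi> n (\<psi> n)"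
  proof (rule dependent_wellorder_choice)
    \<comment> \<open>The recursion principle asks that the condition on the n-th choice depend only
      on the earlier values.\<close>
    show "P f n r = P g n r" if "\<And>y. y < n \<Longrightarrow> f y = g y" for r f g and n :: nat
    proof -
      have "f ` {..<n} = g ` {..<n}" using that by (auto intro!: image_cong)
      then show ?thesis unfolding P_def by simp
    qed
    show "\<exists>r. P \<psi> n r" if h: "\<And>y. y < n \<Longrightarrow> P \<psi> y (\<psi> y)" for n \<psi>
    proof -
      have X: "\<psi> j \<in> X" if "j < n" for j using h[OF that] by (simp add: P_def)
      have O: "b (\<psi> i) (\<psi> j) = (if i = j then 1 else 0)" if "i < n" "j < n" for i j
      proof (rule linorder_cases[of i j])
        assume "i < j" then show ?thesis using h[OF that(2)] by (auto simp: P_def)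
      next
        assume "i = j" then show ?thesis using h[OF that(2)] by (auto simp: P_def)
      next
        assume "j < i" then show ?thesis using h[OF that(1)] B.sym[OF X[OF that(1)] X[OF that(2)]] that by (auto simp: P_def)
      qed
      have "\<psi> ` {..<n} \<subseteq> X" using X by auto
      moreover have "\<exists>f\<in>X. (\<forall>v\<in>\<psi> ` {..<n}. b v f = 0) \<and> b f f > 0"
        using infinite_dim[of n \<psi>] X O by auto
      ultimately show ?thesis
        using rayleigh_minimizer[of "\<psi> ` {..<n}"] unfolding P_def by blast
    qed
  qed
  then obtain \<psi> where P: "\<And>n. P \<psi> n (\<psi> n)" by blast
  define E where "E n = q (\<psi> n) (\<psi> n)" for n
  have X: "\<psi> n \<in> X" for n using P[of n] by (simp add: P_def)
  have O: "b (\<psi> m) (\<psi> n) = (if m = n then 1 else 0)" for m n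
  proof (rule linorder_cases[of m n])
    assume "m < n" then show ?thesis using P[of n] by (auto simp: P_def)
  next
    assume "m = n" then show ?thesis using P[of n] by (auto simp: P_def)
  next
    assume "n < m" then show ?thesis using P[of m] B.sym[OF X[of m] X[of n]] by (auto simp: P_def)
  qed
  have min: "E n * b w w \<le> q w w" if "w \<in> X" "\<And>j. j < n \<Longrightarrow> b (\<psi> j) w = 0" for n w
    using P[of n] that unfolding P_def E_def by auto
  define pr where "pr n v = v - (\<Sum>j<n. b (\<psi> j) v *\<^sub>R \<psi> j)" for n v
  have prX: "pr n v \<in> X" if "v \<in> X" for n v
    unfolding pr_def using that X by (intro X_intros) auto
  have pr_orth: "b (\<psi> j) (pr n v) = 0" if "v \<in> X" "j < n" for j n v
  proof -
    have "b (\<psi> j) (pr n v) = b (\<psi> j) v - (\<Sum>i<n. b (\<psi> j) (b (\<psi> i) v *\<^sub>R \<psi> i))"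
      unfolding pr_def using that X by (simp add: B.diff_right B.sum_right X_intros)
    also have "\<dots> = 0" using that X by (simp add: B.scale_right O mult_delta_right)
    finally show ?thesis .
  qed
  have eig: "q v (\<psi> n) = E n * b v (\<psi> n)" if "v \<in> X" for v n
    using that
  proof (induction n arbitrary: v rule: less_induct)
    case (less n)
    have "q (pr n v) (\<psi> n) = E n * b (pr n v) (\<psi> n)"
      unfolding E_def
    proof (rule rayleigh_stationary[of "\<psi> n" "\<psi> ` {..<n}" "pr n v"])
      show "\<forall>w\<in>X. (\<forall>v\<in>\<psi> ` {..<n}. b v w = 0) \<longrightarrow> q (\<psi> n) (\<psi> n) * b w w \<le> q w w"
        using P[of n] unfolding P_def by blast
    qed (use X O prX pr_orth less.prems in auto)
    moreover have "b (pr n v) (\<psi> n) = b v (\<psi> n)"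
    proof -
      have "b (pr n v) (\<psi> n) = b v (\<psi> n) - (\<Sum>i<n. b (\<psi> i) v * b (\<psi> i) (\<psi> n))"
        unfolding pr_def using less.prems X
        by (simp add: B.diff_left B.sum_left X_intros B.scale_left)
      then show ?thesis by (simp add: O)
    qed
    moreover have "q (pr n v) (\<psi> n) = q v (\<psi> n)"
    proof -
      have "q (pr n v) (\<psi> n) = q v (\<psi> n) - (\<Sum>i<n. b (\<psi> i) v * q (\<psi> i) (\<psi> n))"
        unfolding pr_def using less.prems X
        by (simp add: Q.diff_left Q.sum_left X_intros Q.scale_left)
      also have "(\<Sum>i<n. b (\<psi> i) v * q (\<psi> i) (\<psi> n)) = 0"
      proof (rule sum.neutral, rule ballI)
        fix i assume "i \<in> {..<n}"
        then have "q (\<psi> n) (\<psi> i) = E i * b (\<psi> n) (\<psi> i)" using less.IH[of i "\<psi> n"] X by auto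
        then show "b (\<psi> i) v * q (\<psi> i) (\<psi> n) = 0"
          using Q.sym[of "\<psi> i" "\<psi> n"] X O \<open>i \<in> {..<n}\<close> by auto
      qed
      finally show ?thesis by simp
    qed
    ultimately show ?case by simp
  qed
  have fin: "finite {n. E n \<le> C}" for C
  proof (rule ccontr)
    assume inf: "infinite {n. E n \<le> C}"
    define e where "e = enumerate {n. E n \<le> C}"
    have e: "strict_mono e" "\<And>n. E (e n) \<le> C"
      using enumerate_in_set[OF inf] strict_mono_enumerate[OF inf] by (auto simp: e_def)
    have "\<exists>r. strict_mono r \<and> (\<forall>d>0. \<exists>N::nat. \<forall>m\<ge>N. \<forall>n\<ge>N. b (\<psi> (e (r m)) - \<psi> (e (r n))) (\<psi> (e (r m)) - \<psi> (e (r n))) < d)"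
      using compact[of "\<lambda>n. \<psi> (e n)" C] X e by (auto simp: E_def)
    then obtain r where r: "strict_mono r" and
      c: "\<And>d. d > 0 \<Longrightarrow> \<exists>N::nat. \<forall>m\<ge>N. \<forall>n\<ge>N. b (\<psi> (e (r m)) - \<psi> (e (r n))) (\<psi> (e (r m)) - \<psi> (e (r n))) < d"
      by blast
    from c[of 1] obtain N where
      "\<And>m n. m \<ge> N \<Longrightarrow> n \<ge> N \<Longrightarrow> b (\<psi> (e (r m)) - \<psi> (e (r n))) (\<psi> (e (r m)) - \<psi> (e (r n))) < 1" by auto
    from this[of N "Suc N"] have "b (\<psi> (e (r N)) - \<psi> (e (r (Suc N)))) (\<psi> (e (r N)) - \<psi> (e (r (Suc N)))) < 1" by simp
    moreover have "e (r N) \<noteq> e (r (Suc N))"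
      using e(1) r by (metis lessI nat_neq_iff strict_mono_less)
    ultimately show False using X by (simp add: B.expand_diff O)
  qed
  have Epos: "0 \<le> E n" for n using X Q.nonneg by (simp add: E_def)
  have conv: "(\<lambda>N. b (pr N f) (pr N f)) \<longlonglongrightarrow> 0" if f: "f \<in> X" for f
  proof -
    \<comment> \<open>Both q f S and q S S, for the partial sum S, equal the same sum of nonnegative
      terms, so subtracting S lowers the energy.\<close>
    have qle: "q (pr N f) (pr N f) \<le> q f f" for N
    proof -
      have S: "(\<Sum>j<N. b (\<psi> j) f *\<^sub>R \<psi> j) \<in> X" using X by (intro X_intros) auto
      have "q f (\<Sum>j<N. b (\<psi> j) f *\<^sub>R \<psi> j) = (\<Sum>j<N. E j * (b (\<psi> j) f)\<^sup>2)"
        using X f by (subst Q.sum_right)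
          (auto simp: X_intros Q.scale_right eig power2_eq_square B.sym[of f] intro!: sum.cong)
      moreover have "q (\<Sum>j<N. b (\<psi> j) f *\<^sub>R \<psi> j) (\<Sum>j<N. b (\<psi> j) f *\<^sub>R \<psi> j) = (\<Sum>j<N. E j * (b (\<psi> j) f)\<^sup>2)"
      proof -
        have "q (\<Sum>j<N. b (\<psi> j) f *\<^sub>R \<psi> j) (\<Sum>j<N. b (\<psi> j) f *\<^sub>R \<psi> j)
            = (\<Sum>j<N. b (\<psi> j) f * (E j * b (\<Sum>j<N. b (\<psi> j) f *\<^sub>R \<psi> j) (\<psi> j)))"
          using X S by (subst Q.sum_right) (auto simp: X_intros Q.scale_right eig)
        also have "\<dots> = (\<Sum>j<N. E j * (b (\<psi> j) f)\<^sup>2)"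
        proof (rule sum.cong[OF refl])
          fix j assume j: "j \<in> {..<N}"
          have "b (\<Sum>i<N. b (\<psi> i) f *\<^sub>R \<psi> i) (\<psi> j) = b (\<psi> j) f"
            using X j by (simp add: B.sum_left X_intros B.scale_left O mult_delta_right)
          then show "b (\<psi> j) f * (E j * b (\<Sum>i<N. b (\<psi> i) f *\<^sub>R \<psi> i) (\<psi> j)) = E j * (b (\<psi> j) f)\<^sup>2"
            by (simp add: power2_eq_square)
        qed
        finally show ?thesis .
      qed
      moreover have "0 \<le> (\<Sum>j<N. E j * (b (\<psi> j) f)\<^sup>2)" using Epos by (intro sum_nonneg) auto
      ultimately show ?thesis unfolding pr_def using f S by (simp add: Q.expand_diff)
    qed
    show ?thesis
    proof (rule LIMSEQ_I)
      fix r :: real assume r: "0 < r"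
      \<comment> \<open>Chosen so that q f f < C r; an eigenvalue above C then forces the b-square
        of the remainder below r.\<close>
      define C where "C = (q f f + 1) / r"
      have Cp: "C > 0" using r Q.nonneg[OF f] by (simp add: C_def)
      obtain N0 where N0: "\<And>n. E n \<le> C \<Longrightarrow> n < N0"
        using fin[of C] by (metis (mono_tags, lifting) finite_nat_set_iff_bounded mem_Collect_eq)
      have "norm (b (pr n f) (pr n f) - 0) < r" if "n \<ge> N0" for n
      proof -
        have "C < E n" using N0[of n] that by (meson not_le)
        have "C * b (pr n f) (pr n f) \<le> E n * b (pr n f) (pr n f)"
          using \<open>C < E n\<close> B.nonneg[OF prX[OF f]] by (intro mult_right_mono) auto
        also have "\<dots> \<le> q (pr n f) (pr n f)" by (rule min) (use prX pr_orth f in auto)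
        also have "\<dots> \<le> q f f" by (rule qle)
        also have "\<dots> < C * r" using r by (simp add: C_def)
        finally have "b (pr n f) (pr n f) < r" using Cp by simp
        then show ?thesis using B.nonneg[OF prX[OF f]] by simp
      qed
      then show "\<exists>no. \<forall>n\<ge>no. norm (b (pr n f) (pr n f) - 0) < r" by blast
    qed
  qed
  show ?thesis
    by (rule that[of \<psi> E]) (use X O eig fin conv in \<open>auto simp: pr_def\<close>)
qed

end

section \<open>Spectral projectors of operators with an eigenbasis\<close>

locale pvm =
  fixes M :: "'a measure" and P
  assumes pvm: "projection_valued_measure M P"
begin

lemma orth: "A \<in> sets borel \<Longrightarrow> orth_projection M (P A)"
  using pvm unfolding projection_valued_measure_def by blast

lemma P_L2: "A \<in> sets borel \<Longrightarrow> f \<in> L2 M \<Longrightarrow> P A f \<in> L2 M"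
  using orth unfolding orth_projection_def by blast

lemma P_sym: "A \<in> sets borel \<Longrightarrow> f \<in> L2 M \<Longrightarrow> g \<in> L2 M \<Longrightarrow> l2_inner M (P A f) g = l2_inner M f (P A g)"
  using orth unfolding orth_projection_def by blast

lemma P_Int_AE: "A \<in> sets borel \<Longrightarrow> B \<in> sets borel \<Longrightarrow> f \<in> L2 M \<Longrightarrow> AE x in M. P A (P B f) x = P (A \<inter> B) f x"
proof -
  assume "A \<in> sets borel" "B \<in> sets borel" "f \<in> L2 M"
  then have "AE x in M. P (A \<inter> B) f x = P A (P B f) x"
    using pvm unfolding projection_valued_measure_def by blast
  then show ?thesis by eventually_elim simp
qed

lemma inner_P_P:
  assumes "A \<in> sets borel" "B \<in> sets borel" "f \<in> L2 M" "g \<in> L2 M"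
  shows "l2_inner M (P A f) (P B g) = l2_inner M f (P (A \<inter> B) g)"
  using assms P_Int_AE[of A B g]
  by (subst P_sym) (auto intro!: P_L2 L2_measurable l2_inner_cong_AE)

lemma inner_P_self: "A \<in> sets borel \<Longrightarrow> f \<in> L2 M \<Longrightarrow> l2_inner M f (P A f) = of_real ((l2_norm M (P A f))\<^sup>2)"
  using inner_P_P[of A A f f] l2_inner_self[of M "P A f"] by simp

lemma P_empty: "f \<in> L2 M \<Longrightarrow> g \<in> L2 M \<Longrightarrow> l2_inner M g (P {} f) = 0"
proof -
  assume f: "f \<in> L2 M" and g: "g \<in> L2 M"
  have "AE x in M. P {} f x = 0" using pvm f unfolding projection_valued_measure_def by blast
  then have "l2_inner M g (P {} f) = l2_inner M g (\<lambda>x. 0)"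
    using f g by (intro l2_inner_cong_AE) (auto intro!: L2_measurable P_L2)
  then show ?thesis by simp
qed

lemma P_sums:
  assumes A: "range A \<subseteq> sets borel" "disjoint_family A" and f: "f \<in> L2 M" and g: "g \<in> L2 M"
  shows "(\<lambda>n. l2_inner M g (P (A n) f)) sums l2_inner M g (P (\<Union>n. A n) f)"
  unfolding sums_def
proof -
  have A': "A n \<in> sets borel" "(\<Union>n. A n) \<in> sets borel" for n using A by auto
  have "(\<lambda>N. l2_norm M (\<lambda>x. P (\<Union>n. A n) f x - (\<Sum>n<N. P (A n) f x))) \<longlonglongrightarrow> 0"
    using pvm A f unfolding projection_valued_measure_def by blast
  then have "l2_lim M (\<lambda>N x. \<Sum>n<N. P (A n) f x) (P (\<Union>n. A n) f)"
    unfolding l2_lim_def by (subst l2_norm_minus_commute)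
  then have "(\<lambda>N. l2_inner M g (\<lambda>x. \<Sum>n<N. P (A n) f x)) \<longlonglongrightarrow> l2_inner M g (P (\<Union>n. A n) f)"
    using f g A' by (intro l2_lim_inner_right) (auto intro!: L2_intros P_L2)
  then show "(\<lambda>N. \<Sum>n<N. l2_inner M g (P (A n) f)) \<longlonglongrightarrow> l2_inner M g (P (\<Union>n. A n) f)"
    using f g A' by (simp add: l2_inner_sum_right P_L2)
qed

text \<open>Finite additivity extracted from countable additivity for the family A, -A, {}, {}, ....
  The equality is first obtained weakly, against every test vector, and then tested with the
  difference itself.\<close>

lemma P_split:
  assumes A: "A \<in> sets borel" and f: "f \<in> L2 M"
  shows "AE x in M. f x = P A f x + P (- A) f x"
proof (rule AE_eq_of_l2_norm_diff)
  have A': "- A \<in> sets borel" using A by auto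
  show sum: "(\<lambda>x. P A f x + P (- A) f x) \<in> L2 M" using A A' f by (intro L2_intros P_L2)
  have inner: "l2_inner M g f = l2_inner M g (\<lambda>x. P A f x + P (- A) f x)" if g: "g \<in> L2 M" for g
  proof -
    have *: "(\<lambda>n. l2_inner M g (P (binaryset A (- A) n) f)) sums l2_inner M g (P (\<Union>n. binaryset A (- A) n) f)"
    proof (rule P_sums)
      show "range (binaryset A (- A)) \<subseteq> sets borel" using A A' by (simp add: range_binaryset_eq)
      show "disjoint_family (binaryset A (- A))" by (auto simp: disjoint_family_on_def binaryset_def)
    qed (use f g in auto)
    have "(\<lambda>n. l2_inner M g (P (binaryset A (- A) n) f)) sums (\<Sum>n<2. l2_inner M g (P (binaryset A (- A) n) f))"
      by (rule sums_finite) (use f g in \<open>auto simp: binaryset_def P_empty\<close>)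
    from sums_unique2[OF * this] have "l2_inner M g (P UNIV f) = l2_inner M g (P A f) + l2_inner M g (P (- A) f)"
      by (simp add: binaryset_def numeral_2_eq_2 UN_binaryset_eq)
    moreover have "AE x in M. P UNIV f x = f x" using pvm f unfolding projection_valued_measure_def by blast
    then have "l2_inner M g (P UNIV f) = l2_inner M g f"
      using f g by (intro l2_inner_cong_AE) (auto intro!: L2_measurable P_L2)
    ultimately show ?thesis using A A' f g by (simp add: l2_inner_add_right P_L2)
  qed
  define h where "h = (\<lambda>x. f x - (P A f x + P (- A) f x))"
  have h: "h \<in> L2 M" unfolding h_def by (intro L2_diff f sum)
  have "l2_inner M h h = l2_inner M h f - l2_inner M h (\<lambda>x. P A f x + P (- A) f x)"
    unfolding h_def[symmetric] by (subst (2) h_def) (rule l2_inner_diff_right[OF f sum h])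
  then have "complex_of_real ((l2_norm M h)\<^sup>2) = 0" unfolding l2_inner_self using inner[OF h] by simp
  then show "l2_norm M (\<lambda>x. f x - (P A f x + P (- A) f x)) = 0" 
    unfolding h_def[symmetric] by simp
qed fact

abbreviation \<mu> where "\<mu> f \<equiv> spectral_distribution M P f"

lemma sets_\<mu> [simp, measurable_cong]: "sets (\<mu> f) = sets borel"
  and space_\<mu> [simp]: "space (\<mu> f) = UNIV"
  unfolding spectral_distribution_def
  using sets.sigma_sets_eq[of "borel :: real measure"] by (simp_all add: sets_measure_of_conv space_measure_of_conv)

text \<open>\<open>measure_of\<close> returns the given set function only once it is known to be
  positive and countably additive; nonnegativity holds since <f, P A f> is the squared norm of P A
  f.\<close>

lemma emeasure_\<mu>:
  assumes f: "f \<in> L2 M" and A: "A \<in> sets borel"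
  shows "emeasure (\<mu> f) A = ennreal (Re (l2_inner M f (P A f)))"
proof (rule emeasure_measure_of[OF spectral_distribution_def])
  show "positive (sets (\<mu> f)) (\<lambda>A. ennreal (Re (l2_inner M f (P A f))))"
    unfolding positive_def using P_empty[OF f f] by simp
  show "countably_additive (sets (\<mu> f)) (\<lambda>A. ennreal (Re (l2_inner M f (P A f))))"
    unfolding countably_additive_def
  proof (intro allI impI)
    fix A :: "nat \<Rightarrow> real set"
    assume A: "range A \<subseteq> sets (\<mu> f)" "disjoint_family A" "\<Union> (range A) \<in> sets (\<mu> f)"
    have "0 \<le> Re (l2_inner M f (P (A n) f))" for n
      using inner_P_self[OF _ f, of "A n"] A by auto
    moreover have "(\<lambda>n. Re (l2_inner M f (P (A n) f))) sums Re (l2_inner M f (P (\<Union>n. A n) f))"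
      using P_sums[of A f f] A f by (intro sums_Re) auto
    ultimately show "(\<Sum>i. ennreal (Re (l2_inner M f (P (A i) f)))) = ennreal (Re (l2_inner M f (P (\<Union> (range A)) f)))"
      by (rule suminf_ennreal_eq)
  qed
qed (use A in auto)

lemma measure_\<mu>: "f \<in> L2 M \<Longrightarrow> A \<in> sets borel \<Longrightarrow> measure (\<mu> f) A = (l2_norm M (P A f))\<^sup>2"
  unfolding measure_def by (simp add: emeasure_\<mu> inner_P_self del: of_real_power)

lemma finite_\<mu>: "f \<in> L2 M \<Longrightarrow> finite_measure (\<mu> f)"
  by (rule finite_measureI) (simp add: emeasure_\<mu>)

lemma \<mu>_eqI:
  assumes f: "f \<in> L2 M" and g: "g \<in> L2 M"
    and eq: "\<And>B. B \<in> sets borel \<Longrightarrow> l2_inner M f (P B f) = l2_inner M g (P B g)"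
  shows "\<mu> f = \<mu> g"
  by (rule measure_eqI) (auto simp: emeasure_\<mu> f g eq)

text \<open>Keeps P A f in the domain of the operator whenever f is: restricting a measure to A
  preserves the integrability of t^2.\<close>

lemma \<mu>_restrict:
  assumes f: "f \<in> L2 M" and A: "A \<in> sets borel"
  shows "\<mu> (P A f) = density (\<mu> f) (indicator A)"
proof (rule measure_eqI)
  fix B assume "B \<in> sets (\<mu> (P A f))"
  then have B: "B \<in> sets borel" by simp
  have "l2_inner M (P A f) (P B (P A f)) = l2_inner M (P A f) (P (B \<inter> A) f)"
    using f A B P_Int_AE[of B A f] by (intro l2_inner_cong_AE) (auto intro!: L2_measurable P_L2)
  also have "\<dots> = l2_inner M f (P (A \<inter> B) f)"
    using f A B by (subst inner_P_P) (auto simp: Int_ac)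
  finally have "emeasure (\<mu> (P A f)) B = emeasure (\<mu> f) (A \<inter> B)"
    using f A B by (simp add: emeasure_\<mu> P_L2)
  also have "\<dots> = emeasure (density (\<mu> f) (indicator A)) B"
    using A B by (simp add: emeasure_density indicator_inter_arith[symmetric])
  finally show "emeasure (\<mu> (P A f)) B = emeasure (density (\<mu> f) (indicator A)) B" .
qed simp

end

text \<open>Changing the phase of the component of \<open>f\<close> in the range of \<open>P (- A)\<close> does not change its
  spectral distribution; polarization then shows that the operator is reduced by \<open>P A\<close>, and the
  spectral distribution of an eigenvector is a point mass.\<close>

lemma (in pvm) \<mu>_phase:
  assumes f: "f \<in> L2 M" and A: "A \<in> sets borel" and s: "norm s = 1"
  shows "\<mu> (\<lambda>x. P A f x + s * P (- A) f x) = \<mu> (\<lambda>x. P A f x + 1 * P (- A) f x)"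
proof -
  define a where "a = P A f"
  define b where "b = P (- A) f"
  have A': "- A \<in> sets borel" using A by auto
  have a: "a \<in> L2 M" and b: "b \<in> L2 M" unfolding a_def b_def using f A A' by (auto intro: P_L2)
  \<comment> \<open>P B leaves the ranges of P A and P (- A) invariant, and these are
    orthogonal.\<close>
  have cross: "l2_inner M b (P B a) = 0" "l2_inner M a (P B b) = 0" if B: "B \<in> sets borel" for B
  proof -
    have "l2_inner M b (P B a) = l2_inner M b (P (B \<inter> A) f)"
      unfolding a_def using f A B P_Int_AE[of B A f] b by (intro l2_inner_cong_AE) (auto intro!: L2_measurable P_L2)
    also have "\<dots> = l2_inner M f (P (- A \<inter> (B \<inter> A)) f)"
      unfolding b_def using A A' B f by (intro inner_P_P) auto
    also have "- A \<inter> (B \<inter> A) = {}" by auto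
    finally show *: "l2_inner M b (P B a) = 0" using P_empty f by simp
    have "l2_inner M a (P B b) = cnj (l2_inner M b (P B a))"
      using P_sym[OF B a b] l2_inner_commute[of M "P B a" b] by simp
    then show "l2_inner M a (P B b) = 0" using * by simp
  qed
  have "l2_inner M (\<lambda>x. a x + s * b x) (P B (\<lambda>x. a x + s * b x)) = l2_inner M a (P B a) + l2_inner M b (P B b)"
    if s: "norm s = 1" and B: "B \<in> sets borel" for s B
  proof -
    define u where "u = (\<lambda>x. a x + s * b x)"
    have u: "u \<in> L2 M" unfolding u_def by (intro L2_intros a b)
    \<comment> \<open>With P B u moved to the left, u is split by linearity of the inner product;
      linearity of P B itself is nowhere given as an axiom.\<close>
    have "l2_inner M u (P B u) = l2_inner M (P B u) u" using P_sym[OF B u u] by simp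
    also have "\<dots> = l2_inner M (P B u) a + s * l2_inner M (P B u) b"
      using B u a b by (subst (2) u_def) (simp add: l2_inner_add_right l2_inner_cmult_right L2_intros P_L2)
    also have "\<dots> = l2_inner M u (P B a) + s * l2_inner M u (P B b)"
      using P_sym B u a b by simp
    also have "l2_inner M u (P B a) = l2_inner M a (P B a)"
      unfolding u_def using B a b cross by (simp add: l2_inner_add_left l2_inner_cmult_left L2_intros P_L2)
    also have "l2_inner M u (P B b) = cnj s * l2_inner M b (P B b)"
      unfolding u_def using B a b cross by (simp add: l2_inner_add_left l2_inner_cmult_left L2_intros P_L2)
    also have "s * (cnj s * l2_inner M b (P B b)) = l2_inner M b (P B b)"
      using s complex_norm_square[of s] by (simp add: mult.assoc[symmetric])
    finally show ?thesis unfolding u_def .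
  qed
  from this[OF s] this[of 1] show ?thesis
    unfolding a_def[symmetric] b_def[symmetric]
    by (intro \<mu>_eqI) (auto intro!: L2_intros a b)
qed

locale symmetric_graph =
  fixes M :: "'a measure" and H :: "(('a \<Rightarrow> complex) \<times> ('a \<Rightarrow> complex)) set"
  assumes H_L2: "\<And>u f. (u, f) \<in> H \<Longrightarrow> u \<in> L2 M" "\<And>u f. (u, f) \<in> H \<Longrightarrow> f \<in> L2 M"
    and H_add: "\<And>u f v g c. (u, f) \<in> H \<Longrightarrow> (v, g) \<in> H \<Longrightarrow> (\<lambda>x. u x + c * v x, \<lambda>x. f x + c * g x) \<in> H"
    and H_sym: "\<And>u f v g. (u, f) \<in> H \<Longrightarrow> (v, g) \<in> H \<Longrightarrow> l2_inner M v f = l2_inner M g u"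
begin

text \<open>A spectral measure reveals only the diagonal of H, whereas <P A \<psi>, H \<psi>> is
  wanted. The cross terms between the ranges of P A and P (- A) vanish because they enter the
  diagonal with a phase on which it does not depend; symmetry of H then equates two evaluations of
  <H P A \<psi>, \<psi>>.\<close>

lemma spectral_distribution_eigenvector:
  assumes P: "spectral_measure_of M H P" and eig: "(\<psi>, \<lambda>x. of_real e * \<psi> x) \<in> H" and A: "A \<in> sets borel"
  shows "integrable (spectral_distribution M P \<psi>) (\<lambda>t. t)"
    "(LINT t|spectral_distribution M P \<psi>. indicator A t * t) = e * measure (spectral_distribution M P \<psi>) A"
proof -
  interpret pvm M P by standard (use P in \<open>simp add: spectral_measure_of_def\<close>)
  have dom: "f \<in> L2 M \<Longrightarrow> (\<exists>g. (f, g) \<in> H) \<longleftrightarrow> integrable (\<mu> f) (\<lambda>t. t\<^sup>2)" for f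
    using P unfolding spectral_measure_of_def by blast
  have val: "(f, g) \<in> H \<Longrightarrow> l2_inner M f g = of_real (LINT t|\<mu> f. t)" for f g
    using P unfolding spectral_measure_of_def by blast
  have \<psi>: "\<psi> \<in> L2 M" using H_L2(1)[OF eig] .
  interpret \<mu>: finite_measure "\<mu> \<psi>" by (rule finite_\<mu>[OF \<psi>])
  have int2: "integrable (\<mu> \<psi>) (\<lambda>t. t\<^sup>2)" using dom[OF \<psi>] eig by blast
  show int1: "integrable (\<mu> \<psi>) (\<lambda>t. t)"
  proof (rule Bochner_Integration.integrable_bound)
    show "integrable (\<mu> \<psi>) (\<lambda>t. 1 + t\<^sup>2)" using int2 by simp
    show "AE t in \<mu> \<psi>. norm t \<le> norm (1 + t\<^sup>2)"
    proof (rule AE_I2)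
      fix t :: real
      have "0 \<le> (\<bar>t\<bar> - 1)\<^sup>2" by simp
      then have "2 * \<bar>t\<bar> \<le> 1 + t\<^sup>2" by (simp add: power2_diff)
      then show "norm t \<le> norm (1 + t\<^sup>2)" by (simp add: abs_if split: if_splits)
    qed
  qed simp
  have A': "- A \<in> sets borel" using A by auto
  define a where "a = P A \<psi>"
  define b where "b = P (- A) \<psi>"
  have a: "a \<in> L2 M" and b: "b \<in> L2 M" unfolding a_def b_def using \<psi> A A' by (auto intro: P_L2)
  \<comment> \<open>Both components of \<psi> stay in the domain, so that H can be applied to each
    of them.\<close>
  have "integrable (\<mu> (P B \<psi>)) (\<lambda>t. t\<^sup>2)" if B: "B \<in> sets borel" for B
  proof -
    have "integrable (density (\<mu> \<psi>) (\<lambda>t. ennreal (indicator B t))) (\<lambda>t. t\<^sup>2)"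
      by (subst integrable_density) (use B integrable_mult_indicator[OF _ int2, of B] in auto)
    then show ?thesis using \<mu>_restrict[OF \<psi> B] by (simp add: ennreal_indicator)
  qed
  from this[OF A] this[OF A'] obtain Ha Hb where Ha: "(a, Ha) \<in> H" and Hb: "(b, Hb) \<in> H"
    using dom[OF a] dom[OF b] unfolding a_def b_def by blast
  have HaL: "Ha \<in> L2 M" and HbL: "Hb \<in> L2 M" using H_L2 Ha Hb by blast+
  define X where "X = l2_inner M a Hb"
  define Y where "Y = l2_inner M b Ha"
  define \<kappa> where "\<kappa> = complex_of_real (LINT t|\<mu> (\<lambda>x. a x + 1 * b x). t) - l2_inner M a Ha - l2_inner M b Hb"
  have s: "s * X + cnj s * Y = \<kappa>" if "norm s = 1" for s
  proof -
    have "l2_inner M (\<lambda>x. a x + s * b x) (\<lambda>x. Ha x + s * Hb x) = of_real (LINT t|\<mu> (\<lambda>x. a x + s * b x). t)"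
      by (rule val[OF H_add[OF Ha Hb]])
    also have "\<mu> (\<lambda>x. a x + s * b x) = \<mu> (\<lambda>x. a x + 1 * b x)"
      unfolding a_def b_def by (rule \<mu>_phase[OF \<psi> A that])
    also have "l2_inner M (\<lambda>x. a x + s * b x) (\<lambda>x. Ha x + s * Hb x)
       = l2_inner M a Ha + s * X + (cnj s * Y + s * (cnj s * l2_inner M b Hb))"
      unfolding X_def Y_def using a b HaL HbL
      by (simp add: l2_inner_add_left l2_inner_add_right l2_inner_cmult_left l2_inner_cmult_right L2_intros algebra_simps)
    also have "s * (cnj s * l2_inner M b Hb) = l2_inner M b Hb"
      using that complex_norm_square[of s] by (simp add: mult.assoc[symmetric])
    finally show ?thesis unfolding \<kappa>_def by (simp add: algebra_simps)
  qed
  \<comment> \<open>The phases 1 and -1 give \<kappa> = 0 and X = -Y; the phase i gives X =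
    Y.\<close>
  have XY: "X + Y = \<kappa>" and "- X - Y = \<kappa>" "\<i> * X - \<i> * Y = \<kappa>"
    using s[of 1] s[of "-1"] s[of \<i>] by auto
  moreover have "- X - Y = - (X + Y)" by simp
  ultimately have "\<kappa> = - \<kappa>" "\<i> * (X - Y) = \<kappa>" using XY by (metis, simp only: right_diff_distrib)
  then have "\<kappa> = 0" by (simp add: complex_eq_iff)
  with \<open>\<i> * (X - Y) = \<kappa>\<close> have "X = Y" by simp
  then have Y: "Y = 0" using XY \<open>\<kappa> = 0\<close> by simp
  have "l2_inner M Ha \<psi> = l2_inner M Ha (\<lambda>x. a x + b x)"
    using P_split[OF A \<psi>] HaL \<psi> a b unfolding a_def b_def
    by (intro l2_inner_cong_AE) (auto intro!: L2_measurable)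
  also have "\<dots> = l2_inner M Ha a + cnj Y"
    unfolding Y_def using HaL a b by (simp add: l2_inner_add_right l2_inner_commute[symmetric])
  also have "\<dots> = cnj (l2_inner M a Ha)" using Y l2_inner_commute[of M Ha a] by simp
  also have "\<dots> = of_real (LINT t|\<mu> a. t)" using val[OF Ha] by simp
  also have "(LINT t|\<mu> a. t) = (LINT t|\<mu> \<psi>. indicator A t * t)"
  proof -
    have "(LINT t|density (\<mu> \<psi>) (\<lambda>t. ennreal (indicator A t)). t) = (LINT t|\<mu> \<psi>. indicator A t * t)"
      by (subst integral_density) (use A in auto)
    then show ?thesis unfolding a_def \<mu>_restrict[OF \<psi> A] by (simp add: ennreal_indicator)
  qed
  finally have 1: "l2_inner M Ha \<psi> = of_real (LINT t|\<mu> \<psi>. indicator A t * t)" .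
  have "l2_inner M Ha \<psi> = l2_inner M a (\<lambda>x. of_real e * \<psi> x)" using H_sym[OF eig Ha] by simp
  also have "\<dots> = of_real e * l2_inner M a \<psi>" by (simp add: l2_inner_cmult_right)
  also have "l2_inner M a \<psi> = of_real (measure (\<mu> \<psi>) A)"
    unfolding a_def P_sym[OF A \<psi> \<psi>] inner_P_self[OF A \<psi>] measure_\<mu>[OF \<psi> A] ..
  finally show "(LINT t|\<mu> \<psi>. indicator A t * t) = e * measure (\<mu> \<psi>) A"
    using 1 by (metis of_real_eq_iff of_real_mult)
qed

text \<open>On A the function t - e has one strict sign, yet its integral over A vanishes by the
  moment identity, so A carries no mass.\<close>

lemma spectral_measure_eigenvector_null:
  assumes P: "spectral_measure_of M H P" and eig: "(\<psi>, \<lambda>x. of_real e * \<psi> x) \<in> H" and A: "A \<in> sets borel"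
    and sgn: "(\<forall>t\<in>A. e < t) \<or> (\<forall>t\<in>A. t < e)"
  shows "AE x in M. P A \<psi> x = 0"
proof -
  interpret pvm M P by standard (use P in \<open>simp add: spectral_measure_of_def\<close>)
  have \<psi>: "\<psi> \<in> L2 M" using H_L2(1)[OF eig] .
  interpret \<mu>: finite_measure "\<mu> \<psi>" by (rule finite_\<mu>[OF \<psi>])
  note int = spectral_distribution_eigenvector[OF P eig A]
  have i1: "integrable (\<mu> \<psi>) (\<lambda>t. indicator A t * t)"
    using integrable_mult_indicator[of A "\<mu> \<psi>" "\<lambda>t. t"] int(1) A by simp
  have i2: "integrable (\<mu> \<psi>) (\<lambda>t. indicator A t * e)"
    using A by (intro integrable_mult_left) (auto simp: integrable_indicator_iff less_top[symmetric])
  have i: "integrable (\<mu> \<psi>) (\<lambda>t. indicator A t * (t - e))"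
    using Bochner_Integration.integrable_diff[OF i1 i2] by (simp add: right_diff_distrib)
  have 0: "(LINT t|\<mu> \<psi>. indicator A t * (t - e)) = 0"
    unfolding right_diff_distrib Bochner_Integration.integral_diff[OF i1 i2] int(2) using A by simp
  define \<sigma> :: real where "\<sigma> = (if \<forall>t\<in>A. e < t then 1 else -1)"
  have "AE t in \<mu> \<psi>. \<sigma> * (indicator A t * (t - e)) = 0"
  proof (subst integral_nonneg_eq_0_iff_AE[symmetric])
    show "AE t in \<mu> \<psi>. 0 \<le> \<sigma> * (indicator A t * (t - e))"
      using sgn by (intro AE_I2) (auto simp: \<sigma>_def indicator_def intro: less_imp_le)
  qed (use i 0 in auto)
  then have "AE t in \<mu> \<psi>. t \<notin> A"
    by eventually_elim (use sgn in \<open>auto simp: \<sigma>_def indicator_def split: if_splits\<close>)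
  then have "emeasure (\<mu> \<psi>) A = 0" using A by (subst AE_iff_measurable[symmetric]) auto
  then have "l2_norm M (P A \<psi>) = 0" using measure_\<mu>[OF \<psi> A] by (simp add: measure_def)
  then show ?thesis using l2_norm_eq_0_iff P_L2[OF A \<psi>] by blast
qed

lemma spectral_projector_eigenvector:
  assumes P: "spectral_measure_of M H P" and eig: "(\<psi>, \<lambda>x. of_real e * \<psi> x) \<in> H"
  shows "AE x in M. P {..E} \<psi> x = (if e \<le> E then \<psi> x else 0)"
proof (cases "e \<le> E")
  case True
  interpret pvm M P by standard (use P in \<open>simp add: spectral_measure_of_def\<close>)
  have "AE x in M. P {E<..} \<psi> x = 0"
    by (rule spectral_measure_eigenvector_null[OF P eig]) (use True in auto)
  moreover have "AE x in M. \<psi> x = P {..E} \<psi> x + P (- {..E}) \<psi> x"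
    by (rule P_split) (use H_L2(1)[OF eig] in auto)
  moreover have "- {..E} = {E<..}" by auto
  ultimately show ?thesis using True by auto
next
  case False
  then show ?thesis using spectral_measure_eigenvector_null[OF P eig, of "{..E}"] by auto
qed

end

section \<open>Existence and uniqueness of the spectral measure in the presence of an
  eigenbasis\<close>

locale eigenbasis_graph = symmetric_graph M H + l2_basis M \<psi>
  for M :: "'a measure" and H and \<psi> :: "nat \<Rightarrow> 'a \<Rightarrow> complex" +
  fixes En :: "nat \<Rightarrow> real"
  assumes H_eig: "\<And>n. (\<psi> n, \<lambda>x. of_real (En n) * \<psi> n x) \<in> H"
    and H_closed: "\<And>s t u f. (\<And>N::nat. (s N, t N) \<in> H) \<Longrightarrow> u \<in> L2 M \<Longrightarrow> f \<in> L2 M \<Longrightarrow>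
       l2_lim M s u \<Longrightarrow> l2_lim M t f \<Longrightarrow> (u, f) \<in> H"
begin

text \<open>Every spectral measure, whichever one is chosen, acts on the eigenvectors in the same
  way; symmetry of P transfers this to the coefficients of P f.\<close>

lemma spectral_projector_expansion:
  assumes P: "spectral_measure_of M H P" and fin: "finite {n. En n \<le> E}" and f: "f \<in> L2 M"
  shows "AE x in M. P {..E} f x = (\<Sum>n | En n \<le> E. l2_inner M (\<psi> n) f * \<psi> n x)"
proof (rule AE_eq_of_coeffs)
  interpret pvm M P by standard (use P in \<open>simp add: spectral_measure_of_def\<close>)
  show "P {..E} f \<in> L2 M" using f by (intro P_L2) auto
  show "(\<lambda>x. \<Sum>n | En n \<le> E. l2_inner M (\<psi> n) f * \<psi> n x) \<in> L2 M" by (intro L2_intros e_L2)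
  fix n
  have "l2_inner M (\<psi> n) (P {..E} f) = l2_inner M (P {..E} (\<psi> n)) f"
    using f e_L2 by (subst P_sym) auto
  also have "\<dots> = l2_inner M (\<lambda>x. if En n \<le> E then \<psi> n x else 0) f"
    using spectral_projector_eigenvector[OF P H_eig[of n], of E] f e_L2[of n]
    by (intro l2_inner_cong_AE) (auto intro!: L2_measurable P_L2)
  also have "\<dots> = (if En n \<le> E then l2_inner M (\<psi> n) f else 0)" by simp
  also have "\<dots> = l2_inner M (\<psi> n) (\<lambda>x. \<Sum>n | En n \<le> E. l2_inner M (\<psi> n) f * \<psi> n x)"
    using fin by (subst inner_sum) auto
  finally show "l2_inner M (\<psi> n) (P {..E} f) = l2_inner M (\<psi> n) (\<lambda>x. \<Sum>n | En n \<le> E. l2_inner M (\<psi> n) f * \<psi> n x)" .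
qed

text \<open>Specified by its coefficients instead of as a limit of a series, so that each axiom of a
  projection-valued measure becomes a statement about coefficients. The choice of a representative
  is arbitrary.\<close>

definition proj :: "real set \<Rightarrow> ('a \<Rightarrow> complex) \<Rightarrow> 'a \<Rightarrow> complex" where
  "proj A f = (SOME g. g \<in> L2 M \<and> (\<forall>n. l2_inner M (\<psi> n) g = (if En n \<in> A then l2_inner M (\<psi> n) f else 0)))"

lemma proj:
  assumes f: "f \<in> L2 M"
  shows "proj A f \<in> L2 M" "l2_inner M (\<psi> n) (proj A f) = (if En n \<in> A then l2_inner M (\<psi> n) f else 0)"
proof -
  have "summable (\<lambda>n. (norm (if En n \<in> A then l2_inner M (\<psi> n) f else 0))\<^sup>2)"
    by (rule summable_comparison_test[OF _ summable_coeffs[OF f]]) auto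
  from riesz_fischer[OF this] obtain g where
    "g \<in> L2 M" "\<And>n. l2_inner M (\<psi> n) g = (if En n \<in> A then l2_inner M (\<psi> n) f else 0)" by blast
  then have "\<exists>g. g \<in> L2 M \<and> (\<forall>n. l2_inner M (\<psi> n) g = (if En n \<in> A then l2_inner M (\<psi> n) f else 0))" by blast
  from someI_ex[OF this] show "proj A f \<in> L2 M" 
    "l2_inner M (\<psi> n) (proj A f) = (if En n \<in> A then l2_inner M (\<psi> n) f else 0)"
    unfolding proj_def by blast+
qed

text \<open>Only countable additivity involves a limit: the remainder is the projection onto the
  part not yet covered, and its squared norm tends to zero by Tannery's theorem, dominated by the
  coefficients of f.\<close>

lemma pvm_proj: "projection_valued_measure M proj"
  unfolding projection_valued_measure_def orth_projection_def
proof (intro conjI ballI allI impI)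
  fix A :: "real set" and f g assume f: "f \<in> L2 M" and g: "g \<in> L2 M"
  show "l2_inner M (proj A f) g = l2_inner M f (proj A g)"
  proof (rule sums_unique2)
    show "(\<lambda>n. cnj (l2_inner M (\<psi> n) (proj A f)) * l2_inner M (\<psi> n) g) sums l2_inner M (proj A f) g"
      by (rule parseval) (auto simp: f g proj)
    have "(\<lambda>n. cnj (l2_inner M (\<psi> n) f) * l2_inner M (\<psi> n) (proj A g)) sums l2_inner M f (proj A g)"
      by (rule parseval) (auto simp: f g proj)
    then show "(\<lambda>n. cnj (l2_inner M (\<psi> n) (proj A f)) * l2_inner M (\<psi> n) g) sums l2_inner M f (proj A g)"
      by (rule sums_cong[THEN iffD1, rotated]) (auto simp: f g proj)
  qed
next
  fix A :: "nat \<Rightarrow> real set" and f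
  assume A: "range A \<subseteq> sets borel" "disjoint_family A" and f: "f \<in> L2 M"
  \<comment> \<open>What the first N sets leave uncovered; every fixed eigenvalue eventually drops
    out of it.\<close>
  define B where "B N = (\<Union>n. A n) - (\<Union>n<N. A n)" for N
  have "l2_norm M (\<lambda>x. proj (\<Union>n. A n) f x - (\<Sum>n<N. proj (A n) f x)) = l2_norm M (proj (B N) f)" for N
  proof (rule l2_norm_cong_AE[OF AE_eq_of_coeffs])
    show L: "(\<lambda>x. proj (\<Union>n. A n) f x - (\<Sum>n<N. proj (A n) f x)) \<in> L2 M" by (intro L2_intros proj f)
    show L': "proj (B N) f \<in> L2 M" by (intro proj f)
    show "(\<lambda>x. proj (\<Union>n. A n) f x - (\<Sum>n<N. proj (A n) f x)) \<in> borel_measurable M" using L by auto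
    show "proj (B N) f \<in> borel_measurable M" using L' by auto
    fix k
    have "(\<Sum>n<N. if En k \<in> A n then l2_inner M (\<psi> k) f else 0) = (if En k \<in> (\<Union>n<N. A n) then l2_inner M (\<psi> k) f else 0)"
    proof (cases "En k \<in> (\<Union>n<N. A n)")
      case True
      then obtain m where m: "m < N" "En k \<in> A m" by auto
      have "En k \<in> A n \<longleftrightarrow> n = m" for n
        using A(2) m(2) unfolding disjoint_family_on_def by blast
      then show ?thesis using m True by simp
    next
      case False
      then show ?thesis by (auto intro!: sum.neutral)
    qed
    then show "l2_inner M (\<psi> k) (\<lambda>x. proj (\<Union>n. A n) f x - (\<Sum>n<N. proj (A n) f x)) = l2_inner M (\<psi> k) (proj (B N) f)"
      by (simp add: l2_inner_diff_right l2_inner_sum_right L2_intros proj f e_L2) (auto simp: B_def)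
  qed
  moreover have "(\<lambda>N. l2_norm M (proj (B N) f)) \<longlonglongrightarrow> 0"
  proof -
    have "(\<lambda>N. \<Sum>k. if En k \<in> B N then (norm (l2_inner M (\<psi> k) f))\<^sup>2 else 0) \<longlonglongrightarrow> (\<Sum>k::nat. 0::real)"
    proof (rule tannerys_theorem[THEN conjunct2, THEN conjunct2])
      show "summable (\<lambda>k. (norm (l2_inner M (\<psi> k) f))\<^sup>2)" by (rule summable_coeffs[OF f])
      show "\<forall>\<^sub>F (k, n) in sequentially \<times>\<^sub>F sequentially.
         norm (if En k \<in> B n then (norm (l2_inner M (\<psi> k) f))\<^sup>2 else 0) \<le> (norm (l2_inner M (\<psi> k) f))\<^sup>2"
        by (auto intro!: always_eventually)
      show "(\<lambda>n. if En k \<in> B n then (norm (l2_inner M (\<psi> k) f))\<^sup>2 else 0) \<longlonglongrightarrow> 0" for k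
      proof (cases "En k \<in> (\<Union>n. A n)")
        case True
        then obtain m where "En k \<in> A m" by auto
        then show ?thesis
          by (intro tendsto_eventually eventually_sequentiallyI[of "Suc m"]) (auto simp: B_def)
      qed (auto simp: B_def)
    qed auto
    moreover have "(\<Sum>k. if En k \<in> B N then (norm (l2_inner M (\<psi> k) f))\<^sup>2 else 0) = (l2_norm M (proj (B N) f))\<^sup>2" for N
    proof (rule sums_unique[symmetric])
      show "(\<lambda>k. if En k \<in> B N then (norm (l2_inner M (\<psi> k) f))\<^sup>2 else 0) sums (l2_norm M (proj (B N) f))\<^sup>2"
        using parseval_norm[OF proj(1)[OF f], of "B N"]
        by (rule sums_cong[THEN iffD1, rotated]) (auto simp: proj f)
    qed
    ultimately show ?thesis by simp
  qed
  ultimately show "(\<lambda>N. l2_norm M (\<lambda>x. proj (\<Union>n. A n) f x - (\<Sum>n<N. proj (A n) f x))) \<longlonglongrightarrow> 0" by simp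
next
  fix f assume f: "f \<in> L2 M"
  show "proj A f \<in> L2 M" for A by (rule proj[OF f])
  show "AE x in M. proj {} f x = 0" by (rule AE_eq_of_coeffs) (simp_all add: proj f L2_zero)
  show "AE x in M. proj UNIV f x = f x" by (rule AE_eq_of_coeffs) (simp_all add: proj f)
  show "AE x in M. proj A (proj A f) x = proj A f x" for A by (rule AE_eq_of_coeffs) (simp_all add: proj f)
  show "AE x in M. proj (A \<inter> B) f x = proj A (proj B f) x" for A B by (rule AE_eq_of_coeffs) (simp_all add: proj f)
qed

text \<open>The discrete measure with the squared coefficients as masses at the eigenvalues. Writing
  it as an image of a weighted counting measure lets repeated eigenvalues accumulate their
  masses.\<close>

lemma spectral_distribution_proj:
  assumes f: "f \<in> L2 M"
  shows "spectral_distribution M proj f =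
    distr (density (count_space UNIV) (\<lambda>n. ennreal ((norm (l2_inner M (\<psi> n) f))\<^sup>2))) borel En"
proof (rule measure_eqI)
  interpret pvm M proj by standard (rule pvm_proj)
  show "sets (\<mu> f) = sets (distr (density (count_space UNIV) (\<lambda>n. ennreal ((norm (l2_inner M (\<psi> n) f))\<^sup>2))) borel En)" by simp
  fix A assume "A \<in> sets (\<mu> f)"
  then have A: "A \<in> sets borel" by simp
  have "emeasure (\<mu> f) A = ennreal ((l2_norm M (proj A f))\<^sup>2)"
    using f A by (simp add: emeasure_\<mu> inner_P_self del: of_real_power)
  also have "\<dots> = (\<Sum>n. ennreal ((norm (l2_inner M (\<psi> n) (proj A f)))\<^sup>2))"
    by (rule suminf_ennreal_eq[symmetric]) (auto intro!: parseval_norm proj f)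
  also have "\<dots> = (\<Sum>n. ennreal ((norm (l2_inner M (\<psi> n) f))\<^sup>2) * indicator (En -` A) n)"
    by (intro suminf_cong) (auto simp: proj f indicator_def)
  also have "\<dots> = emeasure (distr (density (count_space UNIV) (\<lambda>n. ennreal ((norm (l2_inner M (\<psi> n) f))\<^sup>2))) borel En) A"
    using A by (simp add: emeasure_distr emeasure_density nn_integral_count_space_nat)
  finally show "emeasure (\<mu> f) A = emeasure (distr (density (count_space UNIV) (\<lambda>n. ennreal ((norm (l2_inner M (\<psi> n) f))\<^sup>2))) borel En) A" .
qed

lemma integrable_spectral_distribution_proj:
  fixes h :: "real \<Rightarrow> real"
  assumes f: "f \<in> L2 M" and [measurable]: "h \<in> borel_measurable borel"
  shows "integrable (spectral_distribution M proj f) h \<longleftrightarrow> summable (\<lambda>n. (norm (l2_inner M (\<psi> n) f))\<^sup>2 * \<bar>h (En n)\<bar>)"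
    "(LINT t|spectral_distribution M proj f. h t) = (LINT n|count_space UNIV. (norm (l2_inner M (\<psi> n) f))\<^sup>2 * h (En n))"
   apply (simp_all add: spectral_distribution_proj[OF f] integrable_distr_eq integral_distr integrable_density
      integral_density integrable_count_space_nat_iff abs_mult)
  done

lemma coeff_H:
  assumes "(f, g) \<in> H"
  shows "l2_inner M (\<psi> n) g = of_real (En n) * l2_inner M (\<psi> n) f"
  using H_sym[OF assms H_eig, of n] by (simp add: l2_inner_cmult_left)

text \<open>Square integrability of t means that the coefficients of f multiplied by the eigenvalues
  are square summable. Symmetry identifies them with the coefficients of H f; conversely, the
  partial sums lie in the graph and closedness passes to their limit.\<close>

lemma spectral_measure_of_proj: "spectral_measure_of M H proj"
  unfolding spectral_measure_of_def
proof (intro conjI ballI pvm_proj)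
  fix f assume f: "f \<in> L2 M"
  have int: "integrable (spectral_distribution M proj f) (\<lambda>t. t\<^sup>2) 
     \<longleftrightarrow> summable (\<lambda>n. (norm (of_real (En n) * l2_inner M (\<psi> n) f))\<^sup>2)"
    using integrable_spectral_distribution_proj(1)[OF f, of "\<lambda>t. t\<^sup>2"] by (simp add: norm_mult power_mult_distrib mult.commute)
  show "(\<exists>g. (f, g) \<in> H) \<longleftrightarrow> integrable (spectral_distribution M proj f) (\<lambda>t. t\<^sup>2)"
  proof
    assume "\<exists>g. (f, g) \<in> H"
    then obtain g where g: "(f, g) \<in> H" by blast
    show "integrable (spectral_distribution M proj f) (\<lambda>t. t\<^sup>2)"
      unfolding int using summable_coeffs[OF H_L2(2)[OF g]] by (simp add: coeff_H[OF g])
  next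
    assume "integrable (spectral_distribution M proj f) (\<lambda>t. t\<^sup>2)"
    from riesz_fischer[OF this[unfolded int]] obtain g where g: "g \<in> L2 M"
      "l2_lim M (\<lambda>N x. \<Sum>n<N. of_real (En n) * l2_inner M (\<psi> n) f * \<psi> n x) g" by blast
    have "(\<lambda>x. \<Sum>n<N. l2_inner M (\<psi> n) f * \<psi> n x, \<lambda>x. \<Sum>n<N. of_real (En n) * l2_inner M (\<psi> n) f * \<psi> n x) \<in> H" for N
    proof (induction N)
      case 0
      \<comment> \<open>The zero pair, as an eigenpair minus itself.\<close>
      then show ?case using H_add[OF H_eig H_eig, of 0 "-1" 0] by simp
    next
      case (Suc N)
      from H_add[OF this H_eig, of "l2_inner M (\<psi> N) f" N] show ?case by (simp add: algebra_simps)
    qed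
    from H_closed[OF this f g(1) expansion[OF f] g(2)] show "\<exists>g. (f, g) \<in> H" by blast
  qed
next
  fix p assume "p \<in> H"
  then obtain f g where p: "p = (f, g)" and fg: "(f, g) \<in> H" by (cases p) auto
  have f: "f \<in> L2 M" and g: "g \<in> L2 M" using H_L2 fg by blast+
  have *: "cnj (l2_inner M (\<psi> n) f) * l2_inner M (\<psi> n) g = of_real ((norm (l2_inner M (\<psi> n) f))\<^sup>2 * En n)" for n
    by (simp add: coeff_H[OF fg] complex_norm_square mult.commute mult.left_commute del: of_real_power)
  have sums: "(\<lambda>n. of_real ((norm (l2_inner M (\<psi> n) f))\<^sup>2 * En n)) sums l2_inner M f g"
    using parseval[OF f g] unfolding * .
  have abs: "summable (\<lambda>n. (norm (l2_inner M (\<psi> n) f))\<^sup>2 * \<bar>En n\<bar>)"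
  proof (rule summable_comparison_test)
    show "summable (\<lambda>n. (norm (l2_inner M (\<psi> n) f))\<^sup>2 + (norm (l2_inner M (\<psi> n) g))\<^sup>2)"
      by (intro summable_add summable_coeffs f g)
    \<comment> \<open>Bounds the first moment by the zeroth and second, whose series are Parseval
      series of f and g.\<close>
    have "c * \<bar>e\<bar> \<le> c + e\<^sup>2 * c" if "0 \<le> c" for c e :: real
    proof -
      have "0 \<le> (\<bar>e\<bar> - 1)\<^sup>2" by simp
      then have "\<bar>e\<bar> \<le> 1 + e\<^sup>2" by (simp add: power2_diff abs_if split: if_splits)
      from mult_left_mono[OF this that] show ?thesis by (simp add: algebra_simps)
    qed
    then show "\<exists>N. \<forall>n\<ge>N. norm ((norm (l2_inner M (\<psi> n) f))\<^sup>2 * \<bar>En n\<bar>) \<le> (norm (l2_inner M (\<psi> n) f))\<^sup>2 + (norm (l2_inner M (\<psi> n) g))\<^sup>2"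
      by (auto simp: coeff_H[OF fg] norm_mult power_mult_distrib)
  qed
  have "(LINT t|spectral_distribution M proj f. t) = (LINT n|count_space UNIV. (norm (l2_inner M (\<psi> n) f))\<^sup>2 * En n)"
    by (rule integrable_spectral_distribution_proj(2)[OF f]) simp
  also have "\<dots> = (\<Sum>n. (norm (l2_inner M (\<psi> n) f))\<^sup>2 * En n)"
    using abs by (intro integral_count_space_nat) (simp add: integrable_count_space_nat_iff abs_mult)
  moreover have "summable (\<lambda>n. (norm (l2_inner M (\<psi> n) f))\<^sup>2 * En n)"
    by (rule summable_rabs_cancel) (use abs in \<open>simp add: abs_mult\<close>)
  ultimately have "complex_of_real (LINT t|spectral_distribution M proj f. t) = (\<Sum>n. of_real ((norm (l2_inner M (\<psi> n) f))\<^sup>2 * En n))"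
    by (simp only: suminf_of_real)
  then show "case p of (f, g) \<Rightarrow> l2_inner M f g = of_real (LINT t|spectral_distribution M proj f. t)"
    using sums_unique[OF sums] p by simp
qed

theorem spectral_projector_eq:
  assumes "finite {n. En n \<le> E}" "f \<in> L2 M"
  shows "AE x in M. spectral_projector M H {..E} f x = (\<Sum>n | En n \<le> E. l2_inner M (\<psi> n) f * \<psi> n x)"
    "orth_projection M (spectral_projector M H {..E})"
proof -
  define P where "P = (SOME P. spectral_measure_of M H P)"
  have P: "spectral_measure_of M H P"
    unfolding P_def by (rule someI[of "spectral_measure_of M H", OF spectral_measure_of_proj])
  interpret pvm M P by standard (use P in \<open>simp add: spectral_measure_of_def\<close>)
  have eq: "spectral_projector M H {..E} = P {..E}"
    by (simp add: spectral_projector_def P_def)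
  show "AE x in M. spectral_projector M H {..E} f x = (\<Sum>n | En n \<le> E. l2_inner M (\<psi> n) f * \<psi> n x)"
    unfolding eq by (rule spectral_projector_expansion[OF P assms])
  show "orth_projection M (spectral_projector M H {..E})"
    unfolding eq by (rule orth) simp
qed

end

section \<open>Smooth tensor products and cutoffs\<close>

text \<open>The one-dimensional counterpart of \<open>C_k\<close>. The derivative enters as a
  witness, which the closure lemmas can supply directly.\<close>

primrec diffk :: "nat \<Rightarrow> (real \<Rightarrow> complex) \<Rightarrow> bool" where
  "diffk 0 g \<longleftrightarrow> continuous_on UNIV g"
| "diffk (Suc k) g \<longleftrightarrow> (\<exists>g'. (\<forall>t. (g has_vector_derivative g' t) (at t)) \<and> diffk k g')"

definition smooth1 :: "(real \<Rightarrow> complex) \<Rightarrow> bool" where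
  "smooth1 g \<longleftrightarrow> (\<forall>k. diffk k g)"

lemma diffk_continuous: "diffk k g \<Longrightarrow> continuous_on UNIV g"
  by (cases k) (auto intro!: continuous_at_imp_continuous_on intro: has_vector_derivative_continuous)

lemma diffk_decrease: "diffk (Suc k) g \<Longrightarrow> diffk k g"
proof (induction k arbitrary: g)
  case 0
  then show ?case using diffk_continuous[of "Suc 0" g] by simp
next
  case (Suc k)
  from Suc.prems obtain g' where "\<forall>t. (g has_vector_derivative g' t) (at t)" "diffk (Suc k) g'"
    unfolding diffk.simps(2)[of "Suc k"] by blast
  with Suc.IH show ?case unfolding diffk.simps(2)[of k] by blast
qed

lemma diffk_const: "diffk k (\<lambda>t. c)"
proof (induction k arbitrary: c)
  case (Suc k)
  then show ?case by (auto intro!: exI[of _ "\<lambda>t. 0"])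
qed simp

lemma diffk_add: "diffk k f \<Longrightarrow> diffk k g \<Longrightarrow> diffk k (\<lambda>t. f t + g t)"
proof (induction k arbitrary: f g)
  case (Suc k)
  then obtain f' g' where "\<forall>t. (f has_vector_derivative f' t) (at t)" "diffk k f'"
     "\<forall>t. (g has_vector_derivative g' t) (at t)" "diffk k g'" by auto
  then show ?case using Suc.IH by (auto intro!: exI[of _ "\<lambda>t. f' t + g' t"] has_vector_derivative_add)
qed (auto intro: continuous_intros)

lemma diffk_mult: "diffk k f \<Longrightarrow> diffk k g \<Longrightarrow> diffk k (\<lambda>t. f t * g t)"
proof (induction k arbitrary: f g)
  case (Suc k)
  then obtain f' g' where d: "\<forall>t. (f has_vector_derivative f' t) (at t)" "diffk k f'"
     "\<forall>t. (g has_vector_derivative g' t) (at t)" "diffk k g'" by auto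
  have "diffk k (\<lambda>t. f t * g' t + f' t * g t)"
    by (intro diffk_add Suc.IH d diffk_decrease[OF Suc.prems(1)] diffk_decrease[OF Suc.prems(2)])
  moreover have "\<forall>t. ((\<lambda>t. f t * g t) has_vector_derivative f t * g' t + f' t * g t) (at t)"
    using d by (auto intro: has_vector_derivative_mult)
  ultimately show ?case unfolding diffk.simps(2)
    by (intro exI[of _ "\<lambda>t. f t * g' t + f' t * g t"]) blast
qed (auto intro: continuous_intros)

lemma diffk_affine:
  assumes "diffk k f"
  shows "diffk k (\<lambda>t. f (a * t + b))"
  using assms
proof (induction k arbitrary: f)
  case 0
  then show ?case by (auto intro!: continuous_on_compose2[of UNIV f] continuous_intros)
next
  case (Suc k)
  then obtain f' where d: "\<forall>t. (f has_vector_derivative f' t) (at t)" "diffk k f'" by auto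
  have "((\<lambda>t. f (a * t + b)) has_vector_derivative of_real a * f' (a * t + b)) (at t)" for t
  proof -
    have "((\<lambda>t. a * t + b) has_vector_derivative a) (at t)"
      by (auto intro!: derivative_eq_intros simp flip: has_real_derivative_iff_has_vector_derivative)
    from vector_diff_chain_at[OF this d(1)[rule_format]] show ?thesis by (simp add: o_def scaleR_conv_of_real)
  qed
  moreover have "diffk k (\<lambda>t. of_real a * f' (a * t + b))"
    by (intro diffk_mult diffk_const Suc.IH d)
  ultimately show ?case unfolding diffk.simps(2)
    by (intro exI[of _ "\<lambda>t. of_real a * f' (a * t + b)"]) blast
qed

lemma smooth1_const: "smooth1 (\<lambda>t. c)"
  and smooth1_mult: "smooth1 f \<Longrightarrow> smooth1 g \<Longrightarrow> smooth1 (\<lambda>t. f t * g t)"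
  and smooth1_affine: "smooth1 f \<Longrightarrow> smooth1 (\<lambda>t. f (a * t + b))"
  by (auto simp: smooth1_def diffk_const diffk_mult diffk_affine)

lemma smooth1_continuous: "smooth1 g \<Longrightarrow> continuous_on A g"
  unfolding smooth1_def using diffk_continuous continuous_on_subset by blast

lemma smooth1_of_deriv:
  assumes "\<And>t. (g has_vector_derivative g' t) (at t)" "smooth1 g'"
  shows "smooth1 g"
  unfolding smooth1_def
proof
  fix k
  have "diffk (Suc k) g" unfolding diffk.simps(2) using assms unfolding smooth1_def by blast
  then show "diffk k g" by (rule diffk_decrease)
qed

lemma smooth1_deriv:
  assumes "\<And>t. (g has_vector_derivative g' t) (at t)" "smooth1 g"
  shows "smooth1 g'"
  unfolding smooth1_def
proof
  fix k
  have "diffk (Suc k) g" using assms(2) unfolding smooth1_def by blast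
  then obtain h where h: "\<forall>t. (g has_vector_derivative h t) (at t)" "diffk k h"
    unfolding diffk.simps(2) by blast
  have "h = g'"
  proof
    fix t show "h t = g' t" using h(1) assms(1)[of t] by (intro vector_derivative_unique_at[of g]) auto
  qed
  with h show "diffk k g'" by simp
qed

lemma smooth1_has_deriv:
  assumes "smooth1 g"
  obtains g' where "\<And>t. (g has_vector_derivative g' t) (at t)" "smooth1 g'"
proof -
  have "diffk (Suc 0) g" using assms unfolding smooth1_def by blast
  then obtain g' where "\<And>t. (g has_vector_derivative g' t) (at t)" unfolding diffk.simps(2) by blast
  from that[OF this smooth1_deriv[OF this assms]] show ?thesis .
qed

text \<open>Serves the modes: the multiples of a mode and of its derivative form a class closed
  under differentiation, by the eigenvalue equation.\<close>

lemma smooth1_coinduct: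
  assumes "g \<in> S" and step: "\<And>g. g \<in> S \<Longrightarrow> \<exists>g'\<in>S. \<forall>t. (g has_vector_derivative g' t) (at t)"
  shows "smooth1 g"
proof -
  have "diffk k g" if "g \<in> S" for k g
    using that
  proof (induction k arbitrary: g)
    case 0
    with step obtain g' where "\<forall>t. (g has_vector_derivative g' t) (at t)" by blast
    then show ?case by (auto intro!: continuous_at_imp_continuous_on intro: has_vector_derivative_continuous)
  next
    case (Suc k)
    from step[OF Suc.prems] obtain g' where "g' \<in> S" "\<forall>t. (g has_vector_derivative g' t) (at t)" by blast
    with Suc.IH show ?case unfolding diffk.simps(2) by blast
  qed
  with assms(1) show ?thesis by (simp add: smooth1_def)
qed

subsection \<open>A smooth step\<close>

text \<open>The derivatives of exp (-1/t) are combinations of these functions, so the whole family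
  is carried through the induction on the order of differentiability.\<close>

definition flat :: "nat \<Rightarrow> real \<Rightarrow> real" where
  "flat n t = (if t > 0 then exp (- 1 / t) / t ^ n else 0)"

lemma flat_tendsto_0: "((\<lambda>t. flat n t) \<longlongrightarrow> 0) (at_right 0)"
proof -
  have "((\<lambda>t::real. inverse t ^ n / exp (inverse t)) \<longlongrightarrow> 0) (at_right 0)"
    by (rule filterlim_compose[OF tendsto_power_div_exp_0 filterlim_inverse_at_top_right])
  moreover have "eventually (\<lambda>t::real. inverse t ^ n / exp (inverse t) = flat n t) (at_right 0)"
    by (rule eventually_at_right_less[THEN eventually_mono])
      (simp add: flat_def exp_minus power_inverse field_simps)
  ultimately show ?thesis by (rule Lim_transform_eventually)
qed

lemma flat_deriv: "(flat n has_real_derivative flat (n + 2) t - n * flat (n + 1) t) (at t)"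
proof (cases t "0 :: real" rule: linorder_cases)
  case less
  have "((\<lambda>t. 0) has_real_derivative flat (n + 2) t - n * flat (n + 1) t) (at t)"
    using less by (simp add: flat_def)
  then show ?thesis
    by (rule has_field_derivative_transform_within_open[of _ _ _ "{..<0}"]) (use less in \<open>auto simp: flat_def\<close>)
next
  case equal
  \<comment> \<open>At the origin the difference quotient from the right is again a member of the
    family, \<open>flat (Suc n)\<close>, and from the left it is 0.\<close>
  have "((\<lambda>h. (flat n (0 + h) - flat n 0) / h) \<longlongrightarrow> 0) (at 0)"
  proof (rule filterlim_split_at)
    have "eventually (\<lambda>h. 0 = (flat n (0 + h) - flat n 0) / h) (at_left 0)"
      by (auto simp: eventually_at_filter flat_def)
    then show "((\<lambda>h. (flat n (0 + h) - flat n 0) / h) \<longlongrightarrow> 0) (at_left 0)"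
      by (rule Lim_transform_eventually[OF tendsto_const])
    have "eventually (\<lambda>h. flat (Suc n) h = (flat n (0 + h) - flat n 0) / h) (at_right 0)"
      by (auto simp: eventually_at_filter flat_def)
    then show "((\<lambda>h. (flat n (0 + h) - flat n 0) / h) \<longlongrightarrow> 0) (at_right 0)"
      by (rule Lim_transform_eventually[OF flat_tendsto_0])
  qed
  then show ?thesis using equal by (simp add: DERIV_def flat_def)
next
  case greater
  have "((\<lambda>t. exp (- 1 / t) / t ^ n) has_real_derivative flat (n + 2) t - n * flat (n + 1) t) (at t)"
  proof -
    have "((\<lambda>t. exp (- 1 / t) / t ^ n) has_real_derivative
        ((exp (- 1 / t) * (1 / t^2)) * t ^ n - exp (- 1 / t) * (n * t ^ (n - 1))) / (t ^ n * t ^ n)) (at t)"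
      using greater by (auto intro!: derivative_eq_intros simp: power2_eq_square)
    also have "((exp (- 1 / t) * (1 / t^2)) * t ^ n - exp (- 1 / t) * (n * t ^ (n - 1))) / (t ^ n * t ^ n)
       = flat (n + 2) t - n * flat (n + 1) t"
      using greater by (cases n) (auto simp: flat_def field_simps power2_eq_square)
    finally show ?thesis .
  qed
  then show ?thesis
    by (rule has_field_derivative_transform_within_open[of _ _ _ "{0<..}"]) (use greater in \<open>auto simp: flat_def\<close>)
qed

lemma smooth1_flat: "smooth1 (\<lambda>t. of_real (flat n t))"
proof -
  have "diffk k (\<lambda>t. of_real (flat n t))" for k n
  proof (induction k arbitrary: n)
    case 0
    show ?case using flat_deriv by (auto intro!: continuous_intros continuous_at_imp_continuous_on DERIV_isCont)
  next
    case (Suc k)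
    have "((\<lambda>t. complex_of_real (flat n t)) has_vector_derivative of_real (flat (n + 2) t - n * flat (n + 1) t)) (at t)" for t
      using flat_deriv[of n t]
      by (intro has_vector_derivative_of_real) (simp add: has_real_derivative_iff_has_vector_derivative)
    moreover have "diffk k (\<lambda>t. of_real (flat (n + 2) t) + (- of_nat n) * of_real (flat (n + 1) t))"
      by (intro diffk_add diffk_mult diffk_const Suc.IH)
    then have "diffk k (\<lambda>t. of_real (flat (n + 2) t - n * flat (n + 1) t))" by simp
    ultimately show ?case unfolding diffk.simps(2)
      by (intro exI[of _ "\<lambda>t. of_real (flat (n + 2) t - n * flat (n + 1) t)"]) blast
  qed
  then show ?thesis by (simp add: smooth1_def)
qed

text \<open>The normalised primitive of a bump on (1, 2). Placing the rise there, away from 0, makes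
  the step vanish on a neighbourhood of the origin, so that its rescalings give compactly supported
  cutoffs.\<close>

lemma smooth_step_exists:
  "\<exists>\<sigma> \<sigma>' C. smooth1 (\<lambda>t. complex_of_real (\<sigma> t)) \<and> (\<forall>t. (\<sigma> has_real_derivative \<sigma>' t) (at t)) \<and>
     (\<forall>t\<le>1. \<sigma> t = 0) \<and> (\<forall>t\<ge>2. \<sigma> t = 1) \<and> (\<forall>t. 0 \<le> \<sigma> t \<and> \<sigma> t \<le> 1) \<and>
     (\<forall>t. \<bar>\<sigma>' t\<bar> \<le> C) \<and> (\<forall>t. t \<le> 1 \<or> 2 \<le> t \<longrightarrow> \<sigma>' t = 0)"
proof -
  \<comment> \<open>Positive exactly on (1, 2).\<close>
  define B where "B t = flat 0 (t - 1) * flat 0 (2 - t)" for t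
  have flat: "flat 0 t = 0" if "t \<le> 0" for t using that by (simp add: flat_def)
  have flat_pos: "flat 0 t > 0" if "t > 0" for t using that by (simp add: flat_def)
  have flat01: "0 \<le> flat 0 t" "flat 0 t \<le> 1" for t by (simp_all add: flat_def)
  have B0: "B t = 0" if "t \<le> 1 \<or> 2 \<le> t" for t
    using that flat[of "t - 1"] flat[of "2 - t"] unfolding B_def by auto
  have Bp: "B t > 0" if "1 < t" "t < 2" for t unfolding B_def using that by (intro mult_pos_pos flat_pos) auto
  have Bn: "B t \<ge> 0" for t unfolding B_def by (intro mult_nonneg_nonneg flat01)
  have B1: "B t \<le> 1" for t unfolding B_def by (intro mult_le_one flat01)
  have sB: "smooth1 (\<lambda>t. complex_of_real (B t))"
    using smooth1_mult[OF smooth1_affine[OF smooth1_flat[of 0], of 1 "-1"] smooth1_affine[OF smooth1_flat[of 0], of "-1" 2]]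
    by (simp add: B_def)
  have contB: "continuous_on UNIV B"
    using continuous_on_Re[OF smooth1_continuous[OF sB]] by simp
  have "\<exists>F. \<forall>x::real. - \<infinity> < ereal x \<longrightarrow> ereal x < \<infinity> \<longrightarrow> (F has_vector_derivative B x) (at x)"
    using contB by (intro einterval_antiderivative) (auto simp: continuous_on_eq_continuous_at)
  then obtain F where F: "\<And>x. (F has_real_derivative B x) (at x)"
    by (auto simp: has_real_derivative_iff_has_vector_derivative)
  have mvt: "\<exists>z. a < z \<and> z < b \<and> F b - F a = (b - a) * B z" if "a < b" for a b
    using MVT2[OF that, of F B] F by auto
  have F1: "F t = F 1" if "t \<le> 1" for t
    using mvt[of t 1] B0 that by (cases "t = 1") force+
  have F2: "F t = F 2" if "t \<ge> 2" for t
    using mvt[of 2 t] B0 that by (cases "t = 2") force+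
  have mono: "F a \<le> F b" if "a \<le> b" for a b
  proof (cases "a = b")
    case False
    with mvt[of a b] that obtain z where "F b - F a = (b - a) * B z" by auto
    moreover have "(b - a) * B z \<ge> 0" using that Bn by simp
    ultimately show ?thesis by linarith
  qed simp
  define c where "c = F 2 - F 1"
  obtain z where "1 < z" "z < 2" "F 2 - F 1 = (2 - 1) * B z" using mvt[of 1 2] by auto
  then have c: "c > 0" using Bp[of z] by (simp add: c_def)
  define \<sigma> where "\<sigma> t = (F t - F 1) / c" for t
  have d\<sigma>: "(\<sigma> has_real_derivative B t / c) (at t)" for t
    unfolding \<sigma>_def using F c by (auto intro!: derivative_eq_intros)
  have "smooth1 (\<lambda>t. complex_of_real (\<sigma> t))"
  proof (rule smooth1_of_deriv)
    show "((\<lambda>t. complex_of_real (\<sigma> t)) has_vector_derivative of_real (B t / c)) (at t)" for t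
      using d\<sigma>[of t] by (intro has_vector_derivative_of_real) (simp add: has_real_derivative_iff_has_vector_derivative)
    show "smooth1 (\<lambda>t. complex_of_real (B t / c))"
      using smooth1_mult[OF sB smooth1_const[of "1 / of_real c"]] by simp
  qed
  moreover have "0 \<le> \<sigma> t \<and> \<sigma> t \<le> 1" for t
  proof -
    have "F 1 \<le> F t" using mono[of 1 t] F1[of t] by (cases "t \<le> 1") auto
    moreover have "F t \<le> F 2" using mono[of t 2] F2[of t] by (cases "t \<le> 2") auto
    ultimately show ?thesis using c by (auto simp: \<sigma>_def c_def field_simps)
  qed
  moreover have "\<sigma> t = 0" if "t \<le> 1" for t using F1[OF that] by (simp add: \<sigma>_def)
  moreover have "\<sigma> t = 1" if "t \<ge> 2" for t using F2[OF that] c by (simp add: \<sigma>_def c_def)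
  moreover have "\<bar>B t / c\<bar> \<le> 1 / c" for t using B1[of t] Bn[of t] c by (simp add: divide_right_mono)
  moreover have "B t / c = 0" if "t \<le> 1 \<or> 2 \<le> t" for t using B0[OF that] by simp
  ultimately show ?thesis using d\<sigma>
    by (intro exI[of _ \<sigma>] exI[of _ "\<lambda>t. B t / c"] exI[of _ "1 / c"] conjI allI impI) simp_all
qed

text \<open>Cutting off a function that vanishes at both end points costs only a bounded perturbation of
  the derivative, supported near the end points: the derivative of the cutoff is of order \<open>m\<close> where
  the function is of order \<open>1 / m\<close>.\<close>

lemma cutoff:
  fixes g g' :: "real \<Rightarrow> complex"
  assumes g: "smooth1 g" and g': "\<And>t. (g has_vector_derivative g' t) (at t)" and ab: "a < b"
  obtains G G' C where
    "\<And>m::nat. smooth1 (G m)"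
    "\<And>m t. (G m has_vector_derivative G' m t) (at t)"
    "\<And>m t. t \<notin> {a + 1 / Suc m..b - 1 / Suc m} \<Longrightarrow> G m t = 0"
    "\<And>m t. norm (G m t) \<le> norm (g t)"
    "\<And>t. a < t \<Longrightarrow> t < b \<Longrightarrow> (\<lambda>m. G m t) \<longlonglongrightarrow> g t"
    "\<And>t. a < t \<Longrightarrow> t < b \<Longrightarrow> (\<lambda>m. G' m t) \<longlonglongrightarrow> g' t"
    "g a = 0 \<Longrightarrow> g b = 0 \<Longrightarrow> (\<And>m t. a < t \<Longrightarrow> t < b \<Longrightarrow> norm (G' m t) \<le> C)"
proof -
  obtain \<sigma> \<sigma>' C where sm: "smooth1 (\<lambda>t. complex_of_real (\<sigma> t))" and d: "\<And>t. (\<sigma> has_real_derivative \<sigma>' t) (at t)"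
    and \<sigma>: "\<And>t. t \<le> 1 \<Longrightarrow> \<sigma> t = 0" "\<And>t. t \<ge> 2 \<Longrightarrow> \<sigma> t = 1" "\<And>t. 0 \<le> \<sigma> t" "\<And>t. \<sigma> t \<le> 1" "\<And>t. \<bar>\<sigma>' t\<bar> \<le> C"
      "\<And>t. t \<le> 1 \<or> 2 \<le> t \<Longrightarrow> \<sigma>' t = 0"
    using smooth_step_exists by blast
  have C0: "C \<ge> 0" using \<sigma>(5)[of 0] by linarith
  define M where "M m = real (Suc m)" for m
  have Mp: "M m > 0" for m by (simp add: M_def)
  define ct where "ct m t = \<sigma> (M m * (t - a)) * \<sigma> (M m * (b - t))" for m t
  define ct' where "ct' m t = M m * \<sigma>' (M m * (t - a)) * \<sigma> (M m * (b - t)) - \<sigma> (M m * (t - a)) * (M m * \<sigma>' (M m * (b - t)))" for m t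
  have ctd: "(ct m has_real_derivative ct' m t) (at t)" for m t
  proof -
    have 1: "((\<lambda>t. \<sigma> (M m * (t - a))) has_real_derivative \<sigma>' (M m * (t - a)) * M m) (at t)"
      by (rule DERIV_chain2[OF d]) (auto intro!: derivative_eq_intros)
    have 2: "((\<lambda>t. \<sigma> (M m * (b - t))) has_real_derivative \<sigma>' (M m * (b - t)) * (- M m)) (at t)"
      by (rule DERIV_chain2[OF d]) (auto intro!: derivative_eq_intros)
    show ?thesis unfolding ct_def ct'_def
      by (rule DERIV_cong[OF DERIV_mult[OF 1 2]]) (simp add: algebra_simps)
  qed
  have ctsm: "smooth1 (\<lambda>t. complex_of_real (ct m t))" for m
    using smooth1_mult[OF smooth1_affine[OF sm, of "M m" "- M m * a"] smooth1_affine[OF sm, of "- M m" "M m * b"]]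
    by (simp add: ct_def algebra_simps)
  have ct01: "0 \<le> ct m t" "ct m t \<le> 1" for m t unfolding ct_def using \<sigma> by (auto intro!: mult_le_one)
  have ctsupp: "ct m t = 0" if "t \<notin> {a + 1 / Suc m..b - 1 / Suc m}" for m t
  proof -
    have "M m * (t - a) \<le> 1 \<or> M m * (b - t) \<le> 1"
      using that by (auto simp: M_def field_simps)
    then show ?thesis using \<sigma>(1) by (auto simp: ct_def)
  qed
  have ev: "eventually (\<lambda>m. M m * (t - a) \<ge> 2 \<and> M m * (b - t) \<ge> 2) sequentially" if t: "a < t" "t < b" for t
  proof -
    obtain N where N: "real N > 2 / (t - a) + 2 / (b - t)" using reals_Archimedean2 by blast
    have "M m * (t - a) \<ge> 2 \<and> M m * (b - t) \<ge> 2" if "m \<ge> N" for m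
    proof -
      have "M m \<ge> 2 / (t - a) + 2 / (b - t)" using N that by (simp add: M_def)
      moreover have "2 / (t - a) > 0" "2 / (b - t) > 0" using t by auto
      ultimately have "M m \<ge> 2 / (t - a)" "M m \<ge> 2 / (b - t)" by linarith+
      then show ?thesis using t by (simp add: field_simps)
    qed
    then show ?thesis by (auto simp: eventually_sequentially)
  qed
  define G where "G m t = of_real (ct m t) * g t" for m t
  define G' where "G' m t = of_real (ct m t) * g' t + of_real (ct' m t) * g t" for m t
  have g'c: "continuous_on {a..b} g'" by (intro smooth1_continuous smooth1_deriv[OF g' g])
  then have "bounded (g' ` {a..b})" by (intro compact_imp_bounded compact_continuous_image) auto
  \<comment> \<open>K bounds the derivative and hence is a Lipschitz constant; it turns vanishing at
    the ends into linear decay there.\<close>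
  then obtain K where "\<forall>y\<in>g' ` {a..b}. norm y \<le> K" unfolding bounded_iff by blast
  then have K: "\<And>t. t \<in> {a..b} \<Longrightarrow> norm (g' t) \<le> K" by blast
  have K0: "K \<ge> 0" using order_trans[OF norm_ge_zero K[of a]] ab by simp
  have lip: "norm (g x - g y) \<le> K * norm (x - y)" if "x \<in> {a..b}" "y \<in> {a..b}" for x y
  proof (rule differentiable_bound[of "{a..b}" g "\<lambda>x h. h *\<^sub>R g' x"])
    show "(g has_derivative (\<lambda>h. h *\<^sub>R g' x)) (at x within {a..b})" for x
      using has_vector_derivative_at_within[OF g'] unfolding has_vector_derivative_def .
    show "onorm (\<lambda>h. h *\<^sub>R g' x) \<le> K" if "x \<in> {a..b}" for x
      using K[OF that] by (intro onorm_le) (simp add: mult.commute[of K] mult_left_mono)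
  qed (use that in auto)
  show ?thesis
  \<comment> \<open>K comes from the derivative of g, and each end adds 2 C K: the derivative of the
    step is at most C, it lives at scaled distance at most 2, and K is the slope of g.\<close>
  proof (rule that[of G G' "K + 4 * (C * K)"])
    show "smooth1 (G m)" for m unfolding G_def by (intro smooth1_mult ctsm g)
    show "(G m has_vector_derivative G' m t) (at t)" for m t
    proof -
      have "((\<lambda>t. complex_of_real (ct m t)) has_vector_derivative of_real (ct' m t)) (at t)"
        using ctd[of m t] by (intro has_vector_derivative_of_real) (simp add: has_real_derivative_iff_has_vector_derivative)
      from has_vector_derivative_mult[OF this g'] show ?thesis unfolding G_def G'_def .
    qed
    show "G m t = 0" if "t \<notin> {a + 1 / Suc m..b - 1 / Suc m}" for m t
      using ctsupp[OF that] by (simp add: G_def)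
    show "norm (G m t) \<le> norm (g t)" for m t
      unfolding G_def norm_mult using ct01[of m t] by (simp add: mult_left_le_one_le)
    show "(\<lambda>m. G m t) \<longlonglongrightarrow> g t" if "a < t" "t < b" for t
      by (rule tendsto_eventually, use ev[OF that] in eventually_elim) (simp add: G_def ct_def \<sigma>)
    show "(\<lambda>m. G' m t) \<longlonglongrightarrow> g' t" if "a < t" "t < b" for t
      by (rule tendsto_eventually, use ev[OF that] in eventually_elim) (simp add: G'_def ct_def ct'_def \<sigma>)
    show "norm (G' m t) \<le> K + 4 * (C * K)" if 0: "g a = 0" "g b = 0" and t: "a < t" "t < b" for m t
    proof -
      have b1: "\<bar>M m * \<sigma>' (M m * (t - a))\<bar> * norm (g t) \<le> 2 * (C * K)"
      proof (cases "M m * (t - a) \<ge> 2")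
        case False
        have "norm (g t) \<le> K * (t - a)" using lip[of t a] 0 t by auto
        then have "\<bar>M m * \<sigma>' (M m * (t - a))\<bar> * norm (g t) \<le> (M m * C) * (K * (t - a))"
          using Mp[of m] \<sigma>(5) C0 by (intro mult_mono) (auto simp: abs_mult intro!: mult_left_mono)
        also have "\<dots> = (M m * (t - a)) * (C * K)" by simp
        also have "\<dots> \<le> 2 * (C * K)" using False C0 K0 by (intro mult_right_mono) auto
        finally show ?thesis .
      qed (use \<sigma>(6) C0 K0 in auto)
      have b2: "\<bar>M m * \<sigma>' (M m * (b - t))\<bar> * norm (g t) \<le> 2 * (C * K)"
      proof (cases "M m * (b - t) \<ge> 2")
        case False
        have "norm (g t) \<le> K * (b - t)" using lip[of t b] 0 t by auto
        then have "\<bar>M m * \<sigma>' (M m * (b - t))\<bar> * norm (g t) \<le> (M m * C) * (K * (b - t))"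
          using Mp[of m] \<sigma>(5) C0 by (intro mult_mono) (auto simp: abs_mult intro!: mult_left_mono)
        also have "\<dots> = (M m * (b - t)) * (C * K)" by simp
        also have "\<dots> \<le> 2 * (C * K)" using False C0 K0 by (intro mult_right_mono) auto
        finally show ?thesis .
      qed (use \<sigma>(6) C0 K0 in auto)
      have "\<bar>ct' m t\<bar> \<le> \<bar>M m * \<sigma>' (M m * (t - a))\<bar> * \<sigma> (M m * (b - t)) + \<sigma> (M m * (t - a)) * \<bar>M m * \<sigma>' (M m * (b - t))\<bar>"
        unfolding ct'_def by (rule order_trans[OF abs_triangle_ineq4]) (simp add: abs_mult \<sigma>(3) abs_of_nonneg)
      also have "\<dots> \<le> \<bar>M m * \<sigma>' (M m * (t - a))\<bar> + \<bar>M m * \<sigma>' (M m * (b - t))\<bar>"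
        by (intro add_mono mult_left_le mult_left_le_one_le \<sigma>) auto
      finally have "\<bar>ct' m t\<bar> * norm (g t) \<le> (\<bar>M m * \<sigma>' (M m * (t - a))\<bar> + \<bar>M m * \<sigma>' (M m * (b - t))\<bar>) * norm (g t)"
        by (rule mult_right_mono) simp
      also have "\<dots> \<le> 4 * (C * K)" using b1 b2 by (simp add: distrib_right)
      finally have 1: "\<bar>ct' m t\<bar> * norm (g t) \<le> 4 * (C * K)" .
      have "norm (of_real (ct m t) * g' t) \<le> norm (g' t)"
        unfolding norm_mult using ct01[of m t] by (simp add: mult_left_le_one_le)
      moreover have "norm (g' t) \<le> K" using K t by auto
      moreover have "norm (of_real (ct' m t) * g t) \<le> 4 * (C * K)" using 1 by (simp add: norm_mult)
      ultimately show ?thesis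
        using norm_triangle_ineq[of "of_real (ct m t) * g' t" "of_real (ct' m t) * g t"]
        unfolding G'_def by linarith
    qed
  qed
qed

subsection \<open>Tensor products\<close>

definition tensor :: "('n::finite \<Rightarrow> real \<Rightarrow> complex) \<Rightarrow> real^'n \<Rightarrow> complex" where
  "tensor g x = (\<Prod>i\<in>UNIV. g i (x $ i))"

lemma tensor_upd: "tensor (g(i := h)) x = h (x $ i) * (\<Prod>j\<in>UNIV - {i}. g j (x $ j))"
  unfolding tensor_def by (subst prod.remove[of _ i]) auto

lemma tensor_has_derivative:
  assumes "\<And>i t. (g i has_vector_derivative g' i t) (at t)"
  shows "(tensor g has_derivative (\<lambda>h. \<Sum>i\<in>UNIV. h $ i *\<^sub>R tensor (g(i := g' i)) x)) (at x)"
proof -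
  have 1: "((\<lambda>x. g i (x $ i)) has_derivative (\<lambda>h. h $ i *\<^sub>R g' i (x $ i))) (at x)" for i
  proof -
    have "((\<lambda>x. x $ i) has_derivative (\<lambda>h. h $ i)) (at x)"
      by (rule bounded_linear_imp_has_derivative[OF bounded_linear_vec_nth])
    from has_derivative_compose[OF this assms[of i "x $ i", unfolded has_vector_derivative_def]]
    show ?thesis .
  qed
  have "((\<lambda>x. \<Prod>i\<in>UNIV. g i (x $ i)) has_derivative
     (\<lambda>h. \<Sum>i\<in>UNIV. (h $ i *\<^sub>R g' i (x $ i)) * (\<Prod>j\<in>UNIV - {i}. g j (x $ j)))) (at x)"
    by (rule has_derivative_prod[OF 1])
  moreover have "tensor g = (\<lambda>x. \<Prod>i\<in>UNIV. g i (x $ i))" by (rule ext) (simp add: tensor_def)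
  ultimately show ?thesis by (simp add: tensor_upd)
qed

lemma tensor_partial:
  assumes "\<And>i t. (g i has_vector_derivative g' i t) (at t)"
  shows "tensor g differentiable at x" "partial i (tensor g) x = tensor (g(i := g' i)) x"
proof -
  note d = tensor_has_derivative[of g g', OF assms]
  show "tensor g differentiable at x" using d by (auto simp: differentiable_def)
  have "frechet_derivative (tensor g) (at x) = (\<lambda>h. \<Sum>i\<in>UNIV. h $ i *\<^sub>R tensor (g(i := g' i)) x)"
    using frechet_derivative_at[OF d] by simp
  then have "partial i (tensor g) x = (\<Sum>j\<in>UNIV. (if j = i then 1 else 0) *\<^sub>R tensor (g(j := g' j)) x)"
    by (simp add: partial_def axis_def)
  also have "\<dots> = tensor (g(i := g' i)) x"
    by (subst sum.remove[of _ i]) (auto intro!: sum.neutral)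
  finally show "partial i (tensor g) x = tensor (g(i := g' i)) x" .
qed

lemma continuous_on_tensor:
  assumes "\<And>i. continuous_on UNIV (g i)"
  shows "continuous_on A (tensor g)"
proof -
  have "continuous_on A (\<lambda>x. g i (x $ i))" for i
    by (rule continuous_on_compose2[OF assms continuous_on_component[OF continuous_on_id]]) simp
  then show ?thesis unfolding tensor_def by (intro continuous_on_prod)
qed

text \<open>A partial derivative of a tensor product is again a tensor product, so the induction on
  the order has to range over all factors g.\<close>

lemma smooth_tensor:
  fixes g :: "'n::finite \<Rightarrow> real \<Rightarrow> complex"
  assumes "\<And>i. smooth1 (g i)"
  shows "smooth (tensor g)"
proof -
  have "C_k k (tensor g)" if "\<And>i. smooth1 (g i)" for k and g :: "'n::finite \<Rightarrow> real \<Rightarrow> complex"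
    using that
  proof (induction k arbitrary: g)
    case 0
    then show ?case unfolding C_k.simps(1) by (intro continuous_on_tensor smooth1_continuous)
  next
    case (Suc k)
    have "\<forall>i. \<exists>g'. (\<forall>t. (g i has_vector_derivative g' t) (at t)) \<and> smooth1 g'"
      by (intro allI, rule smooth1_has_deriv[OF Suc.prems]) blast
    from choice[OF this] obtain g' where g': "\<And>i t. (g i has_vector_derivative g' i t) (at t)" "\<And>i. smooth1 (g' i)"
      by blast
    have "partial i (tensor g) = tensor (g(i := g' i))" for i
      using tensor_partial(2)[of g g', OF g'(1)] by (intro ext)
    moreover have "C_k k (tensor (g(i := g' i)))" for i
      by (rule Suc.IH) (use Suc.prems g' in auto)
    ultimately show ?case using tensor_partial(1)[of g g', OF g'(1)] by simp
  qed
  with assms show ?thesis by (simp add: smooth_def)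
qed

lemma tensor_test_function:
  assumes "\<And>i. smooth1 (g i)" "\<And>i t. t \<notin> {a $ i..b $ i} \<Longrightarrow> g i t = 0" "cbox a b \<subseteq> \<Omega>"
  shows "tensor g \<in> test_functions \<Omega>"
proof -
  have "tensor g x = 0" if "x \<notin> cbox a b" for x
  proof -
    from that obtain i where "x $ i \<notin> {a $ i..b $ i}" by (auto simp: mem_box_cart)
    then show ?thesis unfolding tensor_def using assms(2) by (intro prod_zero) auto
  qed
  then show ?thesis unfolding test_functions_def using smooth_tensor[OF assms(1)] assms(3)
    by (auto intro!: exI[of _ "cbox a b"])
qed

section \<open>Integration by parts\<close>

lemma partial_path:
  fixes F :: "real^'n::finite \<Rightarrow> complex"
  assumes "\<And>x. F differentiable at x"
  shows "((\<lambda>t. F (x + t *\<^sub>R axis i 1)) has_vector_derivative partial i F (x + t *\<^sub>R axis i 1)) (at t)"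
proof -
  have 1: "((\<lambda>t. x + t *\<^sub>R axis i (1::real)) has_derivative (\<lambda>h. h *\<^sub>R axis i 1)) (at t)"
    by (auto intro!: derivative_eq_intros)
  have 2: "(F has_derivative frechet_derivative F (at (x + t *\<^sub>R axis i 1))) (at (x + t *\<^sub>R axis i 1))"
    using assms by (simp add: frechet_derivative_works[symmetric])
  have "linear (frechet_derivative F (at (x + t *\<^sub>R axis i 1)))"
    using 2 by (simp add: has_derivative_bounded_linear bounded_linear.linear)
  then show ?thesis
    using has_derivative_compose[OF 1 2] unfolding has_vector_derivative_def partial_def by (simp add: linear_scale)
qed

lemma partial_quotient_tendsto:
  fixes F :: "real^'n::finite \<Rightarrow> complex"
  assumes "\<And>x. F differentiable at x"
  shows "(\<lambda>m. of_nat (Suc m) * (F (x + (1 / Suc m) *\<^sub>R axis i 1) - F x)) \<longlonglongrightarrow> partial i F x"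
proof -
  define \<gamma> where "\<gamma> t = F (x + t *\<^sub>R axis i 1)" for t
  define d where "d = partial i F x"
  have "(\<gamma> has_vector_derivative d) (at 0)"
    using partial_path[of F x i 0] assms unfolding \<gamma>_def d_def by simp
  then have "((\<lambda>h. norm (\<gamma> (0 + h) - \<gamma> 0 - h *\<^sub>R d) / norm h) \<longlongrightarrow> 0) (at 0)"
    unfolding has_vector_derivative_def has_derivative_at by blast
  moreover have "filterlim (\<lambda>m. 1 / real (Suc m)) (at 0) sequentially"
    unfolding filterlim_at using LIMSEQ_inverse_real_of_nat by (simp add: inverse_eq_divide)
  ultimately have "(\<lambda>m. norm (\<gamma> (0 + 1 / Suc m) - \<gamma> 0 - (1 / Suc m) *\<^sub>R d) / norm (1 / Suc m)) \<longlonglongrightarrow> 0"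
    by (rule filterlim_compose)
  moreover have "norm (\<gamma> (0 + 1 / Suc m) - \<gamma> 0 - (1 / Suc m) *\<^sub>R d) / norm (1 / Suc m)
      = norm (of_nat (Suc m) * (\<gamma> (1 / Suc m) - \<gamma> 0) - d)" for m
  proof -
    have "of_nat (Suc m) * (\<gamma> (1 / Suc m) - \<gamma> 0) - d = of_nat (Suc m) * (\<gamma> (1 / Suc m) - \<gamma> 0 - (1 / Suc m) *\<^sub>R d)"
      by (simp add: scaleR_conv_of_real right_diff_distrib del: of_nat_Suc)
    then have "norm (of_nat (Suc m) * (\<gamma> (1 / Suc m) - \<gamma> 0) - d) = real (Suc m) * norm (\<gamma> (1 / Suc m) - \<gamma> 0 - (1 / Suc m) *\<^sub>R d)"
      by (simp only: norm_mult norm_of_nat)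
    then show ?thesis by (simp add: divide_inverse mult.commute)
  qed
  ultimately have "(\<lambda>m. norm (of_nat (Suc m) * (\<gamma> (1 / Suc m) - \<gamma> 0) - d)) \<longlonglongrightarrow> 0" by simp
  then have "(\<lambda>m. of_nat (Suc m) * (\<gamma> (1 / Suc m) - \<gamma> 0)) \<longlonglongrightarrow> d"
    by (rule LIM_zero_cancel[OF tendsto_norm_zero_cancel])
  then show ?thesis unfolding \<gamma>_def d_def by simp
qed

text \<open>Supplies the dominating constant when difference quotients are integrated;
  \<open>Suc m\<close> keeps the step within (0, 1].\<close>

lemma partial_quotient_bound:
  fixes F :: "real^'n::finite \<Rightarrow> complex"
  assumes "\<And>x. F differentiable at x" and C: "\<And>t. 0 \<le> t \<Longrightarrow> t \<le> 1 \<Longrightarrow> norm (partial i F (x + t *\<^sub>R axis i 1)) \<le> C"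
  shows "norm (of_nat (Suc m) * (F (x + (1 / Suc m) *\<^sub>R axis i 1) - F x)) \<le> C"
proof -
  have "norm (F (x + (1 / Suc m) *\<^sub>R axis i 1) - F (x + 0 *\<^sub>R axis i 1)) \<le> C * norm (1 / Suc m - (0::real))"
  proof (rule differentiable_bound[of "{0..1}" _ "\<lambda>t h. h *\<^sub>R partial i F (x + t *\<^sub>R axis i 1)"])
    show "((\<lambda>t. F (x + t *\<^sub>R axis i 1)) has_derivative (\<lambda>h. h *\<^sub>R partial i F (x + t *\<^sub>R axis i 1))) (at t within {0..1})" for t
      using has_derivative_at_withinI[OF partial_path[OF assms(1), unfolded has_vector_derivative_def]] .
    show "onorm (\<lambda>h. h *\<^sub>R partial i F (x + t *\<^sub>R axis i 1)) \<le> C" if "t \<in> {0..1}" for t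
      using C[of t] that by (intro onorm_le) (simp add: mult.commute[of C] mult_left_mono)
  qed auto
  then have "real (Suc m) * norm (F (x + (1 / Suc m) *\<^sub>R axis i 1) - F x) \<le> real (Suc m) * (C / Suc m)"
    by (intro mult_left_mono) simp_all
  then show ?thesis by (simp add: norm_mult del: of_nat_Suc)
qed

lemma borel_integral_translate:
  fixes F :: "'a::euclidean_space \<Rightarrow> 'b::{banach, second_countable_topology}"
  assumes "F \<in> borel_measurable borel"
  shows "(LINT x|lborel. F (x + c)) = (LINT x|lborel. F x)"
proof -
  have "(LINT x|lborel. F x) = (LINT x|distr lborel borel ((+) c). F x)" by (simp add: lborel_distr_plus)
  also have "\<dots> = (LINT x|lborel. F (c + x))" by (rule integral_distr) (use assms in auto)
  finally show ?thesis by (simp add: add.commute)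
qed

lemma integrable_continuous_compact_support:
  fixes F :: "'a::euclidean_space \<Rightarrow> 'b::{banach, second_countable_topology}"
  assumes "continuous_on UNIV F" "compact K" "\<And>x. x \<notin> K \<Longrightarrow> F x = 0"
  shows "integrable lborel F"
proof -
  have "(\<lambda>x. indicator K x *\<^sub>R F x) = F" using assms(3) by (auto simp: indicator_def)
  then show ?thesis
    using borel_integrable_compact[OF assms(2) continuous_on_subset[OF assms(1)]] by simp
qed

lemma partial_eq_0_outside:
  fixes F :: "real^'n::finite \<Rightarrow> complex"
  assumes K: "closed K" "\<And>x. x \<notin> K \<Longrightarrow> F x = 0" and x: "x \<notin> K"
  shows "partial i F x = 0"
proof -
  have "(F has_derivative (\<lambda>h. 0)) (at x)"
    by (rule has_derivative_transform_within_open[of "\<lambda>x. 0" _ _ _ "- K"]) (use K x in auto)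
  then have "frechet_derivative F (at x) = (\<lambda>h. 0)" by (metis frechet_derivative_at)
  then show ?thesis by (simp add: partial_def)
qed

text \<open>The integral of a difference quotient vanishes by translation invariance of Lebesgue measure.\<close>

lemma integral_partial_eq_0:
  fixes F :: "real^'n::finite \<Rightarrow> complex"
  assumes diff: "\<And>x. F differentiable at x" and cont: "continuous_on UNIV (partial i F)"
    and K: "compact K" "\<And>x. x \<notin> K \<Longrightarrow> F x = 0"
  shows "integrable lborel (partial i F)" "(LINT x|lborel. partial i F x) = 0"
proof -
  have contF: "continuous_on UNIV F"
    using diff by (intro continuous_at_imp_continuous_on) (auto intro: differentiable_imp_continuous_within)
  have [measurable]: "F \<in> borel_measurable borel" "partial i F \<in> borel_measurable borel"
    using contF cont by (auto intro: borel_measurable_continuous_onI)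
  have out: "partial i F x = 0" if "x \<notin> K" for x
    by (rule partial_eq_0_outside[OF compact_imp_closed[OF K(1)] K(2) that])
  show int: "integrable lborel (partial i F)"
    by (rule integrable_continuous_compact_support[OF cont K(1) out])
  have "bounded (partial i F ` K)"
    by (intro compact_imp_bounded compact_continuous_image continuous_on_subset[OF cont] K) auto
  then obtain C where "\<forall>y\<in>partial i F ` K. norm y \<le> C" unfolding bounded_iff by blast
  then have C: "norm (partial i F x) \<le> max C 0" for x by (cases "x \<in> K") (auto simp: out le_max_iff_disj)
  obtain a where a: "K \<subseteq> cbox (- a) a" using compact_imp_bounded[OF K(1)] bounded_subset_cbox_symmetric by blast
  \<comment> \<open>Steps have length at most 1, so the box enlarged by 1 contains the supports of
    all difference quotients and carries a dominating function.\<close>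
  define b where "b = a + (\<chi> j. 1)"
  have sub: "x + t *\<^sub>R axis i 1 \<notin> K" if "x \<notin> cbox (- b) b" "0 \<le> t" "t \<le> 1" for x t
  proof
    assume "x + t *\<^sub>R axis i 1 \<in> K"
    then have "x + t *\<^sub>R axis i 1 \<in> cbox (- a) a" using a by auto
    then have *: "- a $ j \<le> x $ j + t * axis i 1 $ j \<and> x $ j + t * axis i 1 $ j \<le> a $ j" for j
      by (simp add: mem_box_cart)
    have "- b $ j \<le> x $ j \<and> x $ j \<le> b $ j" for j
      using *[of j] that(2,3) by (cases "j = i") (auto simp: b_def axis_def)
    then show False using that(1) by (simp add: mem_box_cart)
  qed
  define s where "s m x = of_nat (Suc m) * (F (x + (1 / Suc m) *\<^sub>R axis i 1) - F x)" for m x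
  have F_int: "integrable lborel F" by (rule integrable_continuous_compact_support[OF contF K])
  have "(\<lambda>m. LINT x|lborel. s m x) \<longlonglongrightarrow> (LINT x|lborel. partial i F x)"
  proof (rule integral_dominated_convergence)
    show "integrable lborel (\<lambda>x. indicator (cbox (- b) b) x * max C 0)"
      by (intro integrable_mult_left integrable_real_indicator) (use emeasure_compact_finite[OF compact_cbox] in auto)
    show "AE x in lborel. (\<lambda>m. s m x) \<longlonglongrightarrow> partial i F x"
      unfolding s_def by (intro AE_I2 partial_quotient_tendsto diff)
    show "AE x in lborel. norm (s m x) \<le> indicator (cbox (- b) b) x * max C 0" for m
    proof (rule AE_I2)
      fix x
      show "norm (s m x) \<le> indicator (cbox (- b) b) x * max C 0"
      proof (cases "x \<in> cbox (- b) b")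
        case True
        then show ?thesis using partial_quotient_bound[OF diff C, of m x] by (simp add: s_def)
      next
        case False
        then have "x + (1 / Suc m) *\<^sub>R axis i 1 \<notin> K" "x + 0 *\<^sub>R axis i 1 \<notin> K" by (intro sub; simp)+
        then show ?thesis using K(2) False by (simp add: s_def)
      qed
    qed
    show "s m \<in> borel_measurable lborel" for m unfolding s_def by measurable
  qed simp
  moreover have "(LINT x|lborel. s m x) = 0" for m
  proof -
    have "(LINT x|lborel. F (x + (1 / Suc m) *\<^sub>R axis i 1)) = (LINT x|lborel. F x)"
      by (rule borel_integral_translate) measurable
    moreover have "integrable lborel (\<lambda>x. F (x + (1 / Suc m) *\<^sub>R axis i 1))"
    proof (rule integrable_continuous_compact_support)
      show "continuous_on UNIV (\<lambda>x. F (x + (1 / Suc m) *\<^sub>R axis i 1))"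
        by (intro continuous_on_compose2[OF contF] continuous_intros) auto
      show "F (x + (1 / Suc m) *\<^sub>R axis i 1) = 0" if "x \<notin> cbox (- b) b" for x
        using sub[OF that, of "1 / Suc m"] K(2) by simp
    qed simp
    ultimately show ?thesis unfolding s_def using F_int by simp
  qed
  ultimately have "(\<lambda>m. 0) \<longlonglongrightarrow> (LINT x|lborel. partial i F x)" by simp
  then show "(LINT x|lborel. partial i F x) = 0" by (simp add: LIMSEQ_const_iff)
qed

section \<open>Operations on differentiable functions and classical derivatives as weak ones\<close>

lemma partial_mult:
  fixes F G :: "real^'n::finite \<Rightarrow> complex"
  assumes "F differentiable at x" "G differentiable at x"
  shows "(\<lambda>x. F x * G x) differentiable at x" 
    "partial i (\<lambda>x. F x * G x) x = F x * partial i G x + partial i F x * G x"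
proof -
  have d: "((\<lambda>x. F x * G x) has_derivative (\<lambda>h. F x * frechet_derivative G (at x) h + frechet_derivative F (at x) h * G x)) (at x)"
    using assms by (intro has_derivative_mult) (simp_all add: frechet_derivative_works[symmetric])
  then show "(\<lambda>x. F x * G x) differentiable at x" unfolding differentiable_def by blast
  show "partial i (\<lambda>x. F x * G x) x = F x * partial i G x + partial i F x * G x"
    unfolding partial_def frechet_derivative_at[OF d, symmetric] ..
qed

lemma partial_linear:
  fixes F G :: "real^'n::finite \<Rightarrow> complex"
  assumes "F differentiable at x" "G differentiable at x"
  shows "(\<lambda>x. F x + c * G x) differentiable at x" 
    "partial i (\<lambda>x. F x + c * G x) x = partial i F x + c * partial i G x"
proof -
  have d: "((\<lambda>x. F x + c * G x) has_derivative (\<lambda>h. frechet_derivative F (at x) h + c * frechet_derivative G (at x) h)) (at x)"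
    using assms by (intro has_derivative_add has_derivative_mult_right) (simp_all add: frechet_derivative_works[symmetric])
  then show "(\<lambda>x. F x + c * G x) differentiable at x" unfolding differentiable_def by blast
  show "partial i (\<lambda>x. F x + c * G x) x = partial i F x + c * partial i G x"
    unfolding partial_def frechet_derivative_at[OF d, symmetric] ..
qed

lemma partial_cnj:
  fixes F :: "real^'n::finite \<Rightarrow> complex"
  assumes "F differentiable at x"
  shows "(\<lambda>x. cnj (F x)) differentiable at x" "partial i (\<lambda>x. cnj (F x)) x = cnj (partial i F x)"
proof -
  have d: "((\<lambda>x. cnj (F x)) has_derivative (\<lambda>h. cnj (frechet_derivative F (at x) h))) (at x)"
    using assms by (intro has_derivative_cnj) (simp_all add: frechet_derivative_works[symmetric])
  then show "(\<lambda>x. cnj (F x)) differentiable at x" unfolding differentiable_def by blast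
  show "partial i (\<lambda>x. cnj (F x)) x = cnj (partial i F x)"
    unfolding partial_def frechet_derivative_at[OF d, symmetric] ..
qed

lemma smooth_linear:
  assumes "smooth F" "smooth G"
  shows "smooth (\<lambda>x. F x + c * G x)"
proof -
  have "C_k k F \<Longrightarrow> C_k k G \<Longrightarrow> C_k k (\<lambda>x. F x + c * G x)" for k
  proof (induction k arbitrary: F G)
    case 0
    then show ?case by (auto intro!: continuous_intros)
  next
    case (Suc k)
    then have d: "F differentiable at x" "G differentiable at x" for x by auto
    have "partial i (\<lambda>x. F x + c * G x) = (\<lambda>x. partial i F x + c * partial i G x)" for i
      by (rule ext) (rule partial_linear[OF d])
    then show ?case using Suc partial_linear(1)[OF d] by simp
  qed
  then show ?thesis using assms by (simp add: smooth_def)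
qed

lemma smooth_cnj:
  assumes "smooth F"
  shows "smooth (\<lambda>x. cnj (F x))"
proof -
  have "C_k k F \<Longrightarrow> C_k k (\<lambda>x. cnj (F x))" for k
  proof (induction k arbitrary: F)
    case 0
    then show ?case by (auto intro!: continuous_intros)
  next
    case (Suc k)
    then have d: "F differentiable at x" for x by auto
    have "partial i (\<lambda>x. cnj (F x)) = (\<lambda>x. cnj (partial i F x))" for i
      by (rule ext) (rule partial_cnj[OF d])
    then show ?case using Suc partial_cnj(1)[OF d] by simp
  qed
  then show ?thesis using assms by (simp add: smooth_def)
qed

lemma smooth_C1:
  assumes "smooth F"
  shows "F differentiable at x" "continuous_on A F" "continuous_on A (partial i F)"
proof -
  have 2: "C_k (Suc 0) F" and 1: "C_k 0 F" using assms unfolding smooth_def by blast+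
  show "F differentiable at x" using 2 by simp
  show "continuous_on A F" "continuous_on A (partial i F)"
    using 1 2 continuous_on_subset[of UNIV _ A] by auto
qed

lemma smooth_zero: "smooth (\<lambda>x :: real^'n::finite. 0)"
proof -
  have "tensor (\<lambda>(i::'n) t. 0) = (\<lambda>x. 0)" by (rule ext) (simp add: tensor_def)
  then show ?thesis using smooth_tensor[of "\<lambda>(i::'n) t. 0", OF smooth1_const] by simp
qed

lemma test_functions_linear:
  assumes "F \<in> test_functions \<Omega>" "G \<in> test_functions \<Omega>"
  shows "(\<lambda>x. F x + c * G x) \<in> test_functions \<Omega>"
proof -
  from assms obtain K K' where "compact K" "K \<subseteq> \<Omega>" "\<forall>x. x \<notin> K \<longrightarrow> F x = 0"
    "compact K'" "K' \<subseteq> \<Omega>" "\<forall>x. x \<notin> K' \<longrightarrow> G x = 0" unfolding test_functions_def by auto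
  moreover have "smooth (\<lambda>x. F x + c * G x)"
    using assms by (auto simp: test_functions_def intro: smooth_linear)
  ultimately show ?thesis unfolding test_functions_def
    by (auto intro!: exI[of _ "K \<union> K'"])
qed

lemma test_functions_cnj: "F \<in> test_functions \<Omega> \<Longrightarrow> (\<lambda>x. cnj (F x)) \<in> test_functions \<Omega>"
  unfolding test_functions_def by (auto intro: smooth_cnj)

lemma smooth_periodic_linear:
  "F \<in> smooth_periodic L \<Longrightarrow> G \<in> smooth_periodic L \<Longrightarrow> (\<lambda>x. F x + c * G x) \<in> smooth_periodic L"
  unfolding smooth_periodic_def by (auto intro: smooth_linear)

lemma smooth_periodic_cnj: "F \<in> smooth_periodic L \<Longrightarrow> (\<lambda>x. cnj (F x)) \<in> smooth_periodic L"
  unfolding smooth_periodic_def by (auto intro: smooth_cnj)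

lemma integral_lebesgue_on_lborel:
  fixes F :: "'a::euclidean_space \<Rightarrow> 'b::{banach, second_countable_topology}"
  assumes "S \<in> sets lebesgue" "F \<in> borel_measurable borel" "\<And>x. x \<notin> S \<Longrightarrow> F x = 0"
  shows "(LINT x|lebesgue_on S. F x) = (LINT x|lborel. F x)"
proof -
  have "(LINT x|lebesgue_on S. F x) = (LINT x|lebesgue. indicator S x *\<^sub>R F x)"
    by (rule integral_restrict_space) (use assms in auto)
  also have "(\<lambda>x. indicator S x *\<^sub>R F x) = F" using assms(3) by (auto simp: indicator_def)
  also have "(LINT x|lebesgue. F x) = (LINT x|lborel. F x)"
    by (rule integral_completion) (use assms in auto)
  finally show ?thesis .
qed

text \<open>F times a test function is differentiable with compact support inside \<Omega>, so its
  partial derivative integrates to zero over the whole space and the boundary of \<Omega> is never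
  seen.\<close>

lemma weak_partial_classical:
  fixes F :: "real^'n::finite \<Rightarrow> complex"
  assumes F: "\<And>x. F differentiable at x" "continuous_on UNIV (partial i F)" and \<Omega>: "\<Omega> \<in> sets lebesgue"
  shows "weak_partial \<Omega> i F (partial i F)"
  unfolding weak_partial_def
proof
  fix \<phi> :: "real^'n \<Rightarrow> complex" assume "\<phi> \<in> test_functions \<Omega>"
  then obtain K where sm: "smooth \<phi>" and K: "compact K" "K \<subseteq> \<Omega>" "\<And>x. x \<notin> K \<Longrightarrow> \<phi> x = 0"
    unfolding test_functions_def by auto
  have contF: "continuous_on UNIV F"
    using F(1) by (intro continuous_at_imp_continuous_on) (auto intro: differentiable_imp_continuous_within)
  note c = contF F(2) smooth_C1(2,3)[OF sm, of UNIV]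
  have d: "\<phi> differentiable at x" for x by (rule smooth_C1(1)[OF sm])
  have p: "partial i (\<lambda>x. F x * \<phi> x) = (\<lambda>x. F x * partial i \<phi> x + partial i F x * \<phi> x)"
    by (rule ext) (rule partial_mult(2)[OF F(1) d])
  have out: "partial i \<phi> x = 0" if "x \<notin> K" for x
    by (rule partial_eq_0_outside[OF compact_imp_closed[OF K(1)] K(3) that])
  have "(LINT x|lborel. partial i (\<lambda>x. F x * \<phi> x) x) = 0"
  proof (rule integral_partial_eq_0(2)[OF partial_mult(1)[OF F(1) d] _ K(1)])
    show "continuous_on UNIV (partial i (\<lambda>x. F x * \<phi> x))" unfolding p by (intro continuous_intros c)
  qed (simp add: K(3))
  moreover have i1: "integrable lborel (\<lambda>x. F x * partial i \<phi> x)"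
    by (rule integrable_continuous_compact_support[OF continuous_on_mult[OF c(1,4)] K(1)]) (simp add: out)
  moreover have i2: "integrable lborel (\<lambda>x. partial i F x * \<phi> x)"
    by (rule integrable_continuous_compact_support[OF continuous_on_mult[OF c(2,3)] K(1)]) (simp add: K(3))
  ultimately have "(LINT x|lborel. F x * partial i \<phi> x) + (LINT x|lborel. partial i F x * \<phi> x) = 0"
    unfolding p by simp
  moreover have "(LINT x|lebesgue_on \<Omega>. F x * partial i \<phi> x) = (LINT x|lborel. F x * partial i \<phi> x)"
    by (rule integral_lebesgue_on_lborel[OF \<Omega>]) (use i1 K(2) out in auto)
  moreover have "(LINT x|lebesgue_on \<Omega>. partial i F x * \<phi> x) = (LINT x|lborel. partial i F x * \<phi> x)"
    by (rule integral_lebesgue_on_lborel[OF \<Omega>]) (use i2 K(2,3) in auto)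
  ultimately show "(LINT x|lebesgue_on \<Omega>. F x * partial i \<phi> x) = - (LINT x|lebesgue_on \<Omega>. partial i F x * \<phi> x)"
    by (simp add: eq_neg_iff_add_eq_0)
qed

section \<open>Sobolev spaces on the cube\<close>

text \<open>The \<open>itself\<close> parameter ties the dimension type to the locale.\<close>

locale cube_domain =
  fixes L :: real and dim :: "'n::finite itself"
  assumes L_pos: "L > 0"
begin

abbreviation \<Omega> :: "(real^'n) set" where "\<Omega> \<equiv> cube L"
abbreviation M :: "(real^'n) measure" where "M \<equiv> lebesgue_on \<Omega>"

lemma cube_eq_box: "\<Omega> = box (\<chi> i. - L / 2) (\<chi> i. L / 2)"
  by (auto simp: cube_def mem_box_cart)

lemma open_cube: "open \<Omega>" and lmeasurable_cube: "\<Omega> \<in> lmeasurable" and sets_cube: "\<Omega> \<in> sets lebesgue"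
  unfolding cube_eq_box by (auto intro: fmeasurableD)

lemma cube_subset_cbox: "\<Omega> \<subseteq> cbox (\<chi> i. - L / 2) (\<chi> i. L / 2)"
  unfolding cube_eq_box by (rule box_subset_cbox)

sublocale finite_measure M
  by (rule finite_measure_lebesgue_on[OF lmeasurable_cube])

lemma L2_bounded:
  assumes "f \<in> borel_measurable M" "\<And>x. x \<in> \<Omega> \<Longrightarrow> norm (f x) \<le> C"
  shows "f \<in> L2 M"
proof (rule L2_dominated[of _ "\<lambda>x. C\<^sup>2"])
  show "(norm (f x))\<^sup>2 \<le> C\<^sup>2" if "x \<in> space M" for x
    using assms(2)[of x] that by (intro power_mono) auto
qed (use assms in auto)

lemma measurable_continuous: "continuous_on UNIV f \<Longrightarrow> f \<in> borel_measurable M"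
  by (rule continuous_imp_measurable_on_sets_lebesgue[OF continuous_on_subset[OF _ subset_UNIV] sets_cube])

lemma continuous_bounded_cube:
  fixes f :: "real^'n \<Rightarrow> complex"
  assumes "continuous_on UNIV f"
  obtains C where "\<And>x. x \<in> \<Omega> \<Longrightarrow> norm (f x) \<le> C"
proof -
  have "bounded (f ` cbox (\<chi> i. - L / 2) (\<chi> i. L / 2))"
    by (intro compact_imp_bounded compact_continuous_image compact_cbox continuous_on_subset[OF assms]) auto
  then obtain C where "\<forall>y\<in>f ` cbox (\<chi> i. - L / 2) (\<chi> i. L / 2). norm y \<le> C" unfolding bounded_iff by blast
  then show ?thesis using that cube_subset_cbox by blast
qed

lemma L2_continuous: "continuous_on UNIV f \<Longrightarrow> f \<in> L2 M"
  by (rule continuous_bounded_cube[of f]) (auto intro: L2_bounded measurable_continuous)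

lemma l2_lim_pointwise:
  assumes "\<And>n. s n \<in> borel_measurable M" "f \<in> borel_measurable M"
    and "\<And>n x. x \<in> \<Omega> \<Longrightarrow> norm (s n x) \<le> C" "\<And>x. x \<in> \<Omega> \<Longrightarrow> (\<lambda>n. s n x) \<longlonglongrightarrow> f x"
  shows "l2_lim M s f"
proof -
  have f: "norm (f x) \<le> C" if "x \<in> \<Omega>" for x
    using tendsto_norm[OF assms(4)[OF that]] by (rule tendsto_upperbound) (use assms(3) that in auto)
  have "(\<lambda>n. LINT x|M. (norm (s n x - f x))\<^sup>2) \<longlonglongrightarrow> (LINT x|M. 0)"
  proof (rule integral_dominated_convergence[where w="\<lambda>x. (2 * C)\<^sup>2"])
    show "AE x in M. (\<lambda>n. (norm (s n x - f x))\<^sup>2) \<longlonglongrightarrow> 0"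
    proof (rule AE_I2)
      fix x assume "x \<in> space M"
      then have "(\<lambda>n. s n x - f x) \<longlonglongrightarrow> 0" using assms(4) by (intro LIM_zero) auto
      from tendsto_power[OF tendsto_norm[OF this], of 2] show "(\<lambda>n. (norm (s n x - f x))\<^sup>2) \<longlonglongrightarrow> 0" by simp
    qed
    show "AE x in M. norm ((norm (s n x - f x))\<^sup>2) \<le> (2 * C)\<^sup>2" for n
    proof (rule AE_I2)
      fix x assume x: "x \<in> space M"
      have "norm (s n x - f x) \<le> 2 * C"
        using norm_triangle_ineq4[of "s n x" "f x"] assms(3)[of x n] f[of x] x by simp
      then show "norm ((norm (s n x - f x))\<^sup>2) \<le> (2 * C)\<^sup>2"
        unfolding real_norm_def abs_power2 by (rule power_mono) simp
    qed
  qed (use assms in auto)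
  then have "(\<lambda>n. sqrt (LINT x|M. (norm (s n x - f x))\<^sup>2)) \<longlonglongrightarrow> sqrt 0" by (intro tendsto_real_sqrt) simp
  then show ?thesis unfolding l2_lim_def l2_norm_def by simp
qed

subsection \<open>Vanishing integrals\<close>

lemma integrable_L2:
  assumes "f \<in> L2 M"
  shows "integrable M f"
proof -
  have "(\<lambda>x. 1) \<in> L2 M" by (rule L2_bounded[of _ 1]) auto
  from L2_integrable_mult[OF assms this] show ?thesis by simp
qed

text \<open>Lebesgue's differentiation theorem: almost everywhere the value is the limit of averages
  over small cubes, and these averages are zero.\<close>

lemma AE_zero_of_integral_boxes:
  fixes f :: "real^'n \<Rightarrow> complex"
  assumes f: "f \<in> L2 M" and 0: "\<And>a b. cbox a b \<subseteq> \<Omega> \<Longrightarrow> (LINT x|M. indicator (box a b) x * f x) = 0"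
  shows "AE x in M. f x = 0"
proof -
  define F where "F x = indicator \<Omega> x *\<^sub>R f x" for x
  have F: "integrable lebesgue F"
    using integrable_L2[OF f] unfolding F_def by (subst (asm) integrable_restrict_space) (use sets_cube in auto)
  have Fset: "set_integrable lebesgue S F" if "S \<in> sets lebesgue" for S
    unfolding set_integrable_def using integrable_mult_indicator[OF that F] .
  obtain N where N: "negligible N" and lim: "\<And>x e. x \<notin> N \<Longrightarrow> 0 < e \<Longrightarrow>
      \<exists>d>0. \<forall>h. 0 < h \<and> h < d \<longrightarrow> norm (integral (cbox x (x + h *\<^sub>R One)) F /\<^sub>R h ^ DIM(real^'n) - F x) < e"
    using integrable_ccontinuous_explicit[of F] set_lebesgue_integral_eq_integral(1)[OF Fset] 
    by (metis fmeasurableD lmeasurable_cbox)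
  have zero: "f x = 0" if x: "x \<in> \<Omega>" "x \<notin> N" for x
  proof (rule ccontr)
    assume "f x \<noteq> 0"
    obtain e where e: "e > 0" "cball x e \<subseteq> \<Omega>" using open_cube x(1) open_contains_cball by blast
    obtain d where d: "d > 0" and dd: "\<And>h. 0 < h \<Longrightarrow> h < d \<Longrightarrow>
        norm (integral (cbox x (x + h *\<^sub>R One)) F /\<^sub>R h ^ DIM(real^'n) - F x) < norm (f x)"
      using lim[OF x(2), of "norm (f x)"] \<open>f x \<noteq> 0\<close> by auto
    \<comment> \<open>Small enough both for the differentiation estimate and for the cube of side h
      at x to stay in the ball of radius e.\<close>
    define h where "h = min (d / 2) (e / (norm (One :: real^'n) + 1))"
    have n: "norm (One :: real^'n) + 1 > 0" by (simp add: add_nonneg_pos)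
    have h: "0 < h" "h < d" using d e(1) n by (auto simp: h_def)
    have "h * norm (One :: real^'n) \<le> e"
    proof -
      have "h * norm (One :: real^'n) \<le> h * (norm (One :: real^'n) + 1)" using h by simp
      also have "\<dots> \<le> e / (norm (One :: real^'n) + 1) * (norm (One :: real^'n) + 1)"
        using n by (intro mult_right_mono) (auto simp: h_def)
      also have "\<dots> = e" using n by simp
      finally show ?thesis .
    qed
    then have "cbox x (x + h *\<^sub>R One) \<subseteq> cball x e"
    proof -
      have "dist x y \<le> e" if "y \<in> cbox x (x + h *\<^sub>R One)" for y
      proof -
        have "\<bar>(y - x) \<bullet> b\<bar> \<le> \<bar>(h *\<^sub>R One) \<bullet> b\<bar>" if b: "b \<in> Basis" for b :: "real^'n"
          using \<open>y \<in> cbox x (x + h *\<^sub>R One)\<close> b h by (auto simp: mem_box inner_diff_left inner_add_left)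
        then have "norm (y - x) \<le> norm (h *\<^sub>R (One :: real^'n))" by (rule norm_le_componentwise)
        then show ?thesis using \<open>h * norm (One :: real^'n) \<le> e\<close> h by (simp add: dist_norm norm_minus_commute)
      qed
      then show ?thesis by auto
    qed
    then have sub: "cbox x (x + h *\<^sub>R One) \<subseteq> \<Omega>" using e(2) by blast
    let ?B = "box x (x + h *\<^sub>R One)"
    have "integral (cbox x (x + h *\<^sub>R One)) F = integral ?B F" by (simp add: integral_open_interval)
    also have "\<dots> = (LINT y:?B|lebesgue. F y)"
      by (rule set_lebesgue_integral_eq_integral(2)[OF Fset, symmetric]) simp
    also have "\<dots> = (LINT y|lebesgue. indicator \<Omega> y *\<^sub>R (indicator ?B y * f y))"
      unfolding set_lebesgue_integral_def F_def
      by (intro Bochner_Integration.integral_cong) (auto simp: indicator_def)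
    also have "\<dots> = (LINT y|M. indicator ?B y * f y)"
      by (rule integral_restrict_space[symmetric]) (use sets_cube in auto)
    also have "\<dots> = 0" by (rule 0[OF sub])
    finally have "norm (F x) < norm (f x)" using dd[OF h] by simp
    then show False using x by (simp add: F_def)
  qed
  have "N \<in> null_sets lebesgue" using N by (simp add: negligible_iff_null_sets)
  then have "AE x in lebesgue. x \<notin> N" by (rule AE_not_in)
  then have "AE x in lebesgue. x \<in> \<Omega> \<longrightarrow> f x = 0" by eventually_elim (use zero in auto)
  then show ?thesis by (subst AE_restrict_space_iff) (use sets_cube in auto)
qed

text \<open>The indicator function of a box is a bounded pointwise limit of test functions, namely
  of tensor products of one-dimensional cutoffs.\<close>

lemma AE_zero_of_test_functions:
  assumes g: "g \<in> L2 M" and 0: "\<And>\<phi>. \<phi> \<in> test_functions \<Omega> \<Longrightarrow> (LINT x|M. g x * \<phi> x) = 0"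
  shows "AE x in M. g x = 0"
proof (rule AE_zero_of_integral_boxes[OF g])
  fix a b :: "real^'n" assume sub: "cbox a b \<subseteq> \<Omega>"
  show "(LINT x|M. indicator (box a b) x * g x) = 0"
  proof (cases "\<forall>i. a $ i < b $ i")
    case False
    then obtain i where "\<not> a $ i < b $ i" by blast
    then have "x \<notin> box a b" for x using less_trans[of "a $ i" "x $ i" "b $ i"] unfolding mem_box_cart by blast
    then show ?thesis by simp
  next
    case True
    have "\<forall>i. \<exists>G. \<forall>m::nat. smooth1 (G m) \<and> (\<forall>t. t \<notin> {a $ i..b $ i} \<longrightarrow> G m t = 0) \<and>
        (\<forall>t. norm (G m t) \<le> 1) \<and> (\<forall>t. (\<lambda>m. G m t) \<longlonglongrightarrow> (if a $ i < t \<and> t < b $ i then 1 else 0))"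
      (is "\<forall>i. \<exists>G. ?P i G")
    proof (rule allI)
      fix i show "\<exists>G. ?P i G"
    \<comment> \<open>Cutting off the constant 1 gives smooth functions that vanish outside the edge
      and tend to 1 inside it.\<close>
    proof (rule cutoff[of "\<lambda>t. 1" "\<lambda>t. 0" "a $ i" "b $ i"])
      fix G G' C
      assume G: "\<And>m::nat. smooth1 (G m)"
        "\<And>m t. t \<notin> {a $ i + 1 / real (Suc m)..b $ i - 1 / real (Suc m)} \<Longrightarrow> G m t = 0"
        "\<And>m t. norm (G m t) \<le> norm (1::complex)"
        "\<And>t. a $ i < t \<Longrightarrow> t < b $ i \<Longrightarrow> (\<lambda>m. G m t) \<longlonglongrightarrow> 1"
      have pos: "1 / real (Suc m) > 0" for m by simp
      have 1: "G m t = 0" if "\<not> (a $ i < t \<and> t < b $ i)" for m t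
      proof (rule G(2))
        show "t \<notin> {a $ i + 1 / real (Suc m)..b $ i - 1 / real (Suc m)}"
          using that pos[of m] unfolding atLeastAtMost_iff by linarith
      qed
      have "(\<lambda>m. G m t) \<longlonglongrightarrow> (if a $ i < t \<and> t < b $ i then 1 else 0)" for t
        using 1[of t] G(4)[of t] by auto
      moreover have "t \<notin> {a $ i..b $ i} \<Longrightarrow> G m t = 0" for m t by (rule 1) auto
      ultimately show "\<exists>G. ?P i G" using G(1,3) by (intro exI[of _ G]) auto
    qed (use True in \<open>auto intro: smooth1_const\<close>)
    qed
    from choice[OF this] obtain G where "\<forall>i. ?P i (G i)" by blast
    then have G: "\<And>i m. smooth1 (G i m)" "\<And>i m t. t \<notin> {a $ i..b $ i} \<Longrightarrow> G i m t = 0"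
      "\<And>i m t. norm (G i m t) \<le> 1"
      "\<And>i t. (\<lambda>m. G i m t) \<longlonglongrightarrow> (if a $ i < t \<and> t < b $ i then 1 else 0)" by blast+
    define \<phi> where "\<phi> m = tensor (\<lambda>i. G i m)" for m
    have \<phi>: "\<phi> m \<in> test_functions \<Omega>" for m
      unfolding \<phi>_def by (rule tensor_test_function[OF G(1,2) sub])
    have lim: "(\<lambda>m. \<phi> m x) \<longlonglongrightarrow> indicator (box a b) x" for x
    proof -
      have "(\<lambda>m. \<phi> m x) \<longlonglongrightarrow> (\<Prod>i\<in>UNIV. if a $ i < x $ i \<and> x $ i < b $ i then 1 else 0)"
        unfolding \<phi>_def tensor_def by (intro tendsto_prod G)
      also have "(\<Prod>i\<in>UNIV. if a $ i < x $ i \<and> x $ i < b $ i then 1 else (0::complex)) = indicator (box a b) x"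
      proof (cases "x \<in> box a b")
        case True
        then show ?thesis by (auto simp: mem_box_cart intro!: prod.neutral)
      next
        case False
        then obtain i where "\<not> (a $ i < x $ i \<and> x $ i < b $ i)" by (auto simp: mem_box_cart)
        then have "(\<Prod>i\<in>UNIV. if a $ i < x $ i \<and> x $ i < b $ i then 1 else (0::complex)) = 0"
          by (intro prod_zero) auto
        then show ?thesis using False by simp
      qed
      finally show ?thesis .
    qed
    have \<phi>1: "norm (\<phi> m x) \<le> 1" for m x
      unfolding \<phi>_def tensor_def prod_norm[symmetric] using G(3) by (intro prod_le_1) auto
    have mg: "g \<in> borel_measurable M" using g by auto
    have [measurable]: "\<phi> m \<in> borel_measurable M" for m
      using \<phi>[of m] by (intro measurable_continuous smooth_C1(2)) (simp add: test_functions_def)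
    have "(\<lambda>m. LINT x|M. g x * \<phi> m x) \<longlonglongrightarrow> (LINT x|M. g x * indicator (box a b) x)"
    proof (rule integral_dominated_convergence[where w="\<lambda>x. norm (g x)"])
      show "(\<lambda>x. g x * indicator (box a b) x) \<in> borel_measurable M"
        by (rule borel_measurable_LIMSEQ_metric[where f="\<lambda>m x. g x * \<phi> m x"])
          (use mg in \<open>auto intro!: tendsto_intros lim\<close>)
      show "integrable M (\<lambda>x. norm (g x))" using integrable_L2[OF g] by simp
      show "AE x in M. norm (g x * \<phi> m x) \<le> norm (g x)" for m
        using \<phi>1[of m] by (auto simp: norm_mult mult_left_le)
    qed (use mg lim in \<open>auto intro!: AE_I2 tendsto_intros\<close>)
    then have "(LINT x|M. g x * indicator (box a b) x) = 0"
      using 0[OF \<phi>] by (simp add: LIMSEQ_const_iff)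
    then show ?thesis by (simp add: mult.commute)
  qed
qed

subsection \<open>Weak derivatives\<close>

lemma test_function_L2:
  assumes "\<phi> \<in> test_functions \<Omega>"
  shows "\<phi> \<in> L2 M" "partial i \<phi> \<in> L2 M"
proof -
  have "smooth \<phi>" using assms by (simp add: test_functions_def)
  then show "\<phi> \<in> L2 M" "partial i \<phi> \<in> L2 M" by (intro L2_continuous smooth_C1; assumption)+
qed

lemma weak_partial_linear:
  assumes "u \<in> L2 M" "v \<in> L2 M" "g \<in> L2 M" "h \<in> L2 M" "weak_partial \<Omega> i u g" "weak_partial \<Omega> i v h"
  shows "weak_partial \<Omega> i (\<lambda>x. u x + c * v x) (\<lambda>x. g x + c * h x)"
  unfolding weak_partial_def
proof
  fix \<phi> :: "real^'n \<Rightarrow> complex" assume \<phi>: "\<phi> \<in> test_functions \<Omega>"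
  note t = test_function_L2[OF \<phi>]
  have i: "integrable M (\<lambda>x. u x * partial i \<phi> x)" "integrable M (\<lambda>x. v x * partial i \<phi> x)"
    "integrable M (\<lambda>x. g x * \<phi> x)" "integrable M (\<lambda>x. h x * \<phi> x)"
    using assms t by (auto intro: L2_integrable_mult)
  have e: "(LINT x|M. u x * partial i \<phi> x) = - (LINT x|M. g x * \<phi> x)"
    "(LINT x|M. v x * partial i \<phi> x) = - (LINT x|M. h x * \<phi> x)"
    using assms(5,6) \<phi> by (auto simp: weak_partial_def)
  show "(LINT x|M. (u x + c * v x) * partial i \<phi> x) = - (LINT x|M. (g x + c * h x) * \<phi> x)"
    unfolding distrib_right mult.assoc using i e by simp
qed

lemma weak_partial_cnj:
  assumes "weak_partial \<Omega> i u g"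
  shows "weak_partial \<Omega> i (\<lambda>x. cnj (u x)) (\<lambda>x. cnj (g x))"
  unfolding weak_partial_def
proof
  fix \<phi> :: "real^'n \<Rightarrow> complex" assume \<phi>: "\<phi> \<in> test_functions \<Omega>"
  then have d: "\<phi> differentiable at x" for x by (intro smooth_C1(1)) (simp add: test_functions_def)
  have "(LINT x|M. u x * partial i (\<lambda>x. cnj (\<phi> x)) x) = - (LINT x|M. g x * cnj (\<phi> x))"
    using assms test_functions_cnj[OF \<phi>] unfolding weak_partial_def by blast
  from arg_cong[OF this, of cnj] 
  show "(LINT x|M. cnj (u x) * partial i \<phi> x) = - (LINT x|M. cnj (g x) * \<phi> x)"
    unfolding partial_cnj(2)[OF d] by (simp flip: Bochner_Integration.integral_cnj)
qed

text \<open>Turns the definition into an equation between continuous functionals of u and g, so that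
  it survives L^2 limits.\<close>

lemma weak_partial_iff_inner:
  "weak_partial \<Omega> i u g \<longleftrightarrow> (\<forall>\<phi>\<in>test_functions \<Omega>. l2_inner M (\<lambda>x. cnj (partial i \<phi> x)) u = - l2_inner M (\<lambda>x. cnj (\<phi> x)) g)"
  unfolding weak_partial_def l2_inner_def by (simp add: mult.commute)

lemma weak_partial_lim:
  assumes "\<And>n. s n \<in> L2 M" "\<And>n. t n \<in> L2 M" "u \<in> L2 M" "g \<in> L2 M" "\<And>n. weak_partial \<Omega> i (s n) (t n)"
    "l2_lim M s u" "l2_lim M t g"
  shows "weak_partial \<Omega> i u g"
  unfolding weak_partial_iff_inner
proof
  fix \<phi> :: "real^'n \<Rightarrow> complex" assume \<phi>: "\<phi> \<in> test_functions \<Omega>"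
  note T = L2_cnj[OF test_function_L2(1)[OF \<phi>]] L2_cnj[OF test_function_L2(2)[OF \<phi>]]
  have "(\<lambda>n. l2_inner M (\<lambda>x. cnj (partial i \<phi> x)) (s n)) \<longlonglongrightarrow> l2_inner M (\<lambda>x. cnj (partial i \<phi> x)) u"
    by (rule l2_lim_inner_right) (use assms T in auto)
  moreover have "(\<lambda>n. - l2_inner M (\<lambda>x. cnj (\<phi> x)) (t n)) \<longlonglongrightarrow> - l2_inner M (\<lambda>x. cnj (\<phi> x)) g"
    by (rule tendsto_minus, rule l2_lim_inner_right) (use assms T in auto)
  moreover have "l2_inner M (\<lambda>x. cnj (partial i \<phi> x)) (s n) = - l2_inner M (\<lambda>x. cnj (\<phi> x)) (t n)" for n
    using assms(5) \<phi> unfolding weak_partial_iff_inner by blast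
  ultimately show "l2_inner M (\<lambda>x. cnj (partial i \<phi> x)) u = - l2_inner M (\<lambda>x. cnj (\<phi> x)) g"
    by (simp add: LIMSEQ_unique)
qed

lemma weak_partial_unique:
  assumes "g \<in> L2 M" "h \<in> L2 M" "weak_partial \<Omega> i u g" "weak_partial \<Omega> i u h"
  shows "AE x in M. g x = h x"
proof -
  have "AE x in M. g x - h x = 0"
  proof (rule AE_zero_of_test_functions)
    fix \<phi> :: "real^'n \<Rightarrow> complex" assume \<phi>: "\<phi> \<in> test_functions \<Omega>"
    have "integrable M (\<lambda>x. g x * \<phi> x)" "integrable M (\<lambda>x. h x * \<phi> x)"
      using assms test_function_L2[OF \<phi>] by (auto intro: L2_integrable_mult)
    moreover have "(LINT x|M. u x * partial i \<phi> x) = - (LINT x|M. g x * \<phi> x)"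
      "(LINT x|M. u x * partial i \<phi> x) = - (LINT x|M. h x * \<phi> x)"
      using assms(3,4) \<phi> unfolding weak_partial_def by blast+
    ultimately show "(LINT x|M. (g x - h x) * \<phi> x) = 0" by (simp add: left_diff_distrib)
  qed (use assms in \<open>auto intro: L2_intros\<close>)
  then show ?thesis by simp
qed

abbreviation D :: "'n \<Rightarrow> (real^'n \<Rightarrow> complex) \<Rightarrow> real^'n \<Rightarrow> complex" where "D \<equiv> weak_deriv \<Omega>"
abbreviation H1 :: "(real^'n \<Rightarrow> complex) set" where "H1 \<equiv> sobolev 1 \<Omega>"

text \<open>\<open>weak_deriv\<close> is a choice; uniqueness of weak derivatives up to null sets
  makes any other weak derivative in L^2 interchangeable with it.\<close>

lemma weak_deriv:
  assumes "g \<in> L2 M" "weak_partial \<Omega> i u g"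
  shows "D i u \<in> L2 M" "weak_partial \<Omega> i u (D i u)" "AE x in M. D i u x = g x"
proof -
  have "\<exists>g. g \<in> L2 M \<and> weak_partial \<Omega> i u g" using assms by blast
  from someI_ex[OF this] show *: "D i u \<in> L2 M" "weak_partial \<Omega> i u (D i u)" unfolding weak_deriv_def by blast+
  show "AE x in M. D i u x = g x" by (rule weak_partial_unique[OF *(1) assms(1) *(2) assms(2)])
qed

lemma H1_iff: "u \<in> H1 \<longleftrightarrow> u \<in> L2 M \<and> (\<forall>i. \<exists>g\<in>L2 M. weak_partial \<Omega> i u g)"
  by simp

declare sobolev.simps [simp del]

lemma H1_D:
  assumes "u \<in> H1"
  shows "u \<in> L2 M" "D i u \<in> L2 M" "weak_partial \<Omega> i u (D i u)"
proof -
  from assms show "u \<in> L2 M" unfolding H1_iff by blast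
  from assms obtain g where "g \<in> L2 M" "weak_partial \<Omega> i u g" unfolding H1_iff by blast
  then show "D i u \<in> L2 M" "weak_partial \<Omega> i u (D i u)" using weak_deriv by blast+
qed

lemma H1_I:
  assumes "u \<in> L2 M" "\<And>i. g i \<in> L2 M" "\<And>i. weak_partial \<Omega> i u (g i)"
  shows "u \<in> H1" "AE x in M. D i u x = g i x"
  using assms weak_deriv(3)[OF assms(2,3)] unfolding H1_iff by blast+

lemma H1_linear:
  assumes "u \<in> H1" "v \<in> H1"
  shows "(\<lambda>x. u x + c * v x) \<in> H1" "AE x in M. D i (\<lambda>x. u x + c * v x) x = D i u x + c * D i v x"
proof -
  note * = H1_D[OF assms(1)] H1_D[OF assms(2)]
  have "(\<lambda>x. u x + c * v x) \<in> L2 M" "\<And>i. (\<lambda>x. D i u x + c * D i v x) \<in> L2 M"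
    "\<And>i. weak_partial \<Omega> i (\<lambda>x. u x + c * v x) (\<lambda>x. D i u x + c * D i v x)"
    by (intro L2_intros weak_partial_linear *)+
  note I = H1_I[where g="\<lambda>i x. D i u x + c * D i v x", OF this]
  show "(\<lambda>x. u x + c * v x) \<in> H1" by (rule I)
  show "AE x in M. D i (\<lambda>x. u x + c * v x) x = D i u x + c * D i v x" by (rule I)
qed

lemma H1_cnj:
  assumes "u \<in> H1"
  shows "(\<lambda>x. cnj (u x)) \<in> H1" "AE x in M. D i (\<lambda>x. cnj (u x)) x = cnj (D i u x)"
proof -
  have "(\<lambda>x. cnj (u x)) \<in> L2 M" "\<And>i. (\<lambda>x. cnj (D i u x)) \<in> L2 M"
    "\<And>i. weak_partial \<Omega> i (\<lambda>x. cnj (u x)) (\<lambda>x. cnj (D i u x))"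
    by (intro L2_intros weak_partial_cnj H1_D[OF assms])+
  note I = H1_I[where g="\<lambda>i x. cnj (D i u x)", OF this]
  show "(\<lambda>x. cnj (u x)) \<in> H1" by (rule I)
  show "AE x in M. D i (\<lambda>x. cnj (u x)) x = cnj (D i u x)" by (rule I)
qed

lemma H1_classical:
  assumes "\<And>x. F differentiable at x" "\<And>i. continuous_on UNIV (partial i F)"
  shows "F \<in> H1" "AE x in M. D i F x = partial i F x"
proof -
  have "continuous_on UNIV F"
    using assms(1) by (intro continuous_at_imp_continuous_on) (auto intro: differentiable_imp_continuous_within)
  note I = H1_I[where g="\<lambda>i. partial i F", OF L2_continuous[OF this] L2_continuous[OF assms(2)]
    weak_partial_classical[OF assms sets_cube]]
  show "F \<in> H1" by (rule I)
  show "AE x in M. D i F x = partial i F x" by (rule I)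
qed

lemma H1_smooth: "smooth F \<Longrightarrow> F \<in> H1" "smooth F \<Longrightarrow> AE x in M. D i F x = partial i F x"
  by (rule H1_classical; rule smooth_C1; assumption)+

lemma H1_diff:
  assumes "u \<in> H1" "v \<in> H1"
  shows "(\<lambda>x. u x - v x) \<in> H1" "AE x in M. D i (\<lambda>x. u x - v x) x = D i u x - D i v x"
  using H1_linear(1)[OF assms, where c="-1"] H1_linear(2)[OF assms, where c="-1" and i=i] by simp_all

lemma H1_lim:
  assumes "\<And>n. s n \<in> H1" "u \<in> L2 M" "\<And>i. g i \<in> L2 M" "l2_lim M s u" "\<And>i. l2_lim M (\<lambda>n. D i (s n)) (g i)"
  shows "u \<in> H1" "AE x in M. D i u x = g i x"
proof -
  have "weak_partial \<Omega> i u (g i)" for i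
    by (rule weak_partial_lim[of s "\<lambda>n. D i (s n)"]) (use assms H1_D in auto)
  note I = H1_I[where g=g, OF assms(2,3) this]
  show "u \<in> H1" by (rule I)
  show "AE x in M. D i u x = g i x" by (rule I)
qed

subsection \<open>The $W^{1,2}$ norm and closures\<close>

lemma W12_norm_sq: "(W12_norm \<Omega> u)\<^sup>2 = (l2_norm M u)\<^sup>2 + (\<Sum>i\<in>UNIV. (l2_norm M (D i u))\<^sup>2)"
  unfolding W12_norm_def by (simp add: add_nonneg_nonneg sum_nonneg)

lemma W12_norm_nonneg [simp]: "0 \<le> W12_norm \<Omega> u"
  unfolding W12_norm_def by (simp add: add_nonneg_nonneg sum_nonneg)

lemma l2_norm_sq_add_le:
  assumes "f \<in> L2 M" "g \<in> L2 M"
  shows "(l2_norm M (\<lambda>x. f x + g x))\<^sup>2 \<le> 2 * (l2_norm M f)\<^sup>2 + 2 * (l2_norm M g)\<^sup>2"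
proof -
  have "(l2_norm M (\<lambda>x. f x + g x))\<^sup>2 \<le> (l2_norm M f + l2_norm M g)\<^sup>2"
    by (intro power_mono l2_norm_triangle assms) auto
  also have "\<dots> \<le> 2 * (l2_norm M f)\<^sup>2 + 2 * (l2_norm M g)\<^sup>2"
    using sum_squares_bound[of "l2_norm M f" "l2_norm M g"] by (simp add: power2_sum)
  finally show ?thesis .
qed

lemma l2_norm_D_linear:
  assumes "u \<in> H1" "v \<in> H1"
  shows "l2_norm M (D i (\<lambda>x. u x + c * v x)) = l2_norm M (\<lambda>x. D i u x + c * D i v x)"
  using H1_linear[OF assms] H1_D assms
  by (intro l2_norm_cong_AE) (auto intro!: L2_measurable L2_intros)

lemma l2_norm_D_diff:
  assumes "u \<in> H1" "v \<in> H1"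
  shows "l2_norm M (D i (\<lambda>x. u x - v x)) = l2_norm M (\<lambda>x. D i u x - D i v x)"
  using l2_norm_D_linear[OF assms, where c="-1" and i=i] by simp

text \<open>A triangle inequality for squares with the factor 2, strong enough for limit arguments
  and stable under summation over the components.\<close>

lemma W12_norm_add:
  assumes "u \<in> H1" "v \<in> H1"
  shows "(W12_norm \<Omega> (\<lambda>x. u x + c * v x))\<^sup>2 \<le> 2 * (W12_norm \<Omega> u)\<^sup>2 + 2 * (norm c)\<^sup>2 * (W12_norm \<Omega> v)\<^sup>2"
proof -
  note H = H1_D[OF assms(1)] H1_D[OF assms(2)]
  have "(W12_norm \<Omega> (\<lambda>x. u x + c * v x))\<^sup>2 = (l2_norm M (\<lambda>x. u x + c * v x))\<^sup>2
      + (\<Sum>i\<in>UNIV. (l2_norm M (\<lambda>x. D i u x + c * D i v x))\<^sup>2)"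
    unfolding W12_norm_sq l2_norm_D_linear[OF assms] ..
  also have "\<dots> \<le> (2 * (l2_norm M u)\<^sup>2 + 2 * (norm c * l2_norm M v)\<^sup>2)
      + (\<Sum>i\<in>UNIV. 2 * (l2_norm M (D i u))\<^sup>2 + 2 * (norm c * l2_norm M (D i v))\<^sup>2)"
    unfolding l2_norm_cmult[symmetric]
    by (intro add_mono sum_mono l2_norm_sq_add_le L2_intros H)
  also have "\<dots> = 2 * (W12_norm \<Omega> u)\<^sup>2 + 2 * (norm c)\<^sup>2 * (W12_norm \<Omega> v)\<^sup>2"
    unfolding W12_norm_sq power_mult_distrib sum.distrib sum_distrib_left[symmetric] distrib_left
    by (simp add: sum_distrib_left mult.assoc)
  finally show ?thesis .
qed

lemma W12_norm_diff_commute: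
  assumes "u \<in> H1" "v \<in> H1"
  shows "W12_norm \<Omega> (\<lambda>x. u x - v x) = W12_norm \<Omega> (\<lambda>x. v x - u x)"
  unfolding W12_norm_def l2_norm_D_diff[OF assms] l2_norm_D_diff[OF assms(2,1)]
  by (subst (1 2) l2_norm_minus_commute) (rule refl)

text \<open>Convergence in W^{1,2} component by component, the form in which it is fed into inner
  products; \<open>w12_lim_iff\<close> relates it to the norm.\<close>

definition w12_lim :: "(nat \<Rightarrow> real^'n \<Rightarrow> complex) \<Rightarrow> (real^'n \<Rightarrow> complex) \<Rightarrow> bool" where
  "w12_lim s u \<longleftrightarrow> l2_lim M s u \<and> (\<forall>i. l2_lim M (\<lambda>n. D i (s n)) (D i u))"

lemma w12_lim_iff:
  assumes "\<And>n. s n \<in> H1" "u \<in> H1"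
  shows "w12_lim s u \<longleftrightarrow> (\<lambda>n. W12_norm \<Omega> (\<lambda>x. u x - s n x)) \<longlonglongrightarrow> 0"
proof -
  define a where "a n = l2_norm M (\<lambda>x. s n x - u x)" for n
  define d where "d i n = l2_norm M (\<lambda>x. D i (s n) x - D i u x)" for i n
  have sq: "(W12_norm \<Omega> (\<lambda>x. u x - s n x))\<^sup>2 = (a n)\<^sup>2 + (\<Sum>i\<in>UNIV. (d i n)\<^sup>2)" for n
    unfolding W12_norm_diff_commute[OF assms(2) assms(1)] W12_norm_sq l2_norm_D_diff[OF assms] a_def d_def ..
  have "w12_lim s u \<longleftrightarrow> a \<longlonglongrightarrow> 0 \<and> (\<forall>i. d i \<longlonglongrightarrow> 0)"
    unfolding w12_lim_def l2_lim_def a_def d_def ..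
  also have "\<dots> \<longleftrightarrow> (\<lambda>n. (W12_norm \<Omega> (\<lambda>x. u x - s n x))\<^sup>2) \<longlonglongrightarrow> 0"
  proof
    assume "a \<longlonglongrightarrow> 0 \<and> (\<forall>i. d i \<longlonglongrightarrow> 0)"
    then have "(\<lambda>n. (a n)\<^sup>2 + (\<Sum>i\<in>UNIV. (d i n)\<^sup>2)) \<longlonglongrightarrow> 0\<^sup>2 + (\<Sum>i\<in>(UNIV::'n set). 0\<^sup>2)"
      by (intro tendsto_intros) auto
    then show "(\<lambda>n. (W12_norm \<Omega> (\<lambda>x. u x - s n x))\<^sup>2) \<longlonglongrightarrow> 0" unfolding sq by simp
  next
    assume *: "(\<lambda>n. (W12_norm \<Omega> (\<lambda>x. u x - s n x))\<^sup>2) \<longlonglongrightarrow> 0"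
    have "(\<lambda>n. (a n)\<^sup>2) \<longlonglongrightarrow> 0"
      by (rule tendsto_sandwich[OF _ _ tendsto_const *]) (auto simp: sq sum_nonneg)
    moreover have "(\<lambda>n. (d i n)\<^sup>2) \<longlonglongrightarrow> 0" for i
    proof (rule tendsto_sandwich[OF _ _ tendsto_const *])
      have "(d i n)\<^sup>2 \<le> (\<Sum>i\<in>UNIV. (d i n)\<^sup>2)" for n by (rule member_le_sum) auto
      then show "\<forall>\<^sub>F n in sequentially. (d i n)\<^sup>2 \<le> (W12_norm \<Omega> (\<lambda>x. u x - s n x))\<^sup>2"
        unfolding sq by (intro always_eventually allI) (simp add: add_increasing)
    qed auto
    ultimately show "a \<longlonglongrightarrow> 0 \<and> (\<forall>i. d i \<longlonglongrightarrow> 0)" by simp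
  qed
  also have "\<dots> \<longleftrightarrow> (\<lambda>n. W12_norm \<Omega> (\<lambda>x. u x - s n x)) \<longlonglongrightarrow> 0" by simp
  finally show ?thesis .
qed

lemma W12_closure_iff:
  assumes "S \<subseteq> H1"
  shows "u \<in> W12_closure \<Omega> S \<longleftrightarrow> u \<in> H1 \<and> (\<exists>s. (\<forall>n. s n \<in> S) \<and> w12_lim s u)"
proof
  assume u: "u \<in> W12_closure \<Omega> S"
  then have "u \<in> H1" and "\<forall>n. \<exists>\<phi>\<in>S. W12_norm \<Omega> (\<lambda>x. u x - \<phi> x) < 1 / real (Suc n)"
    unfolding W12_closure_def by auto
  then obtain s where s: "\<And>n. s n \<in> S" "\<And>n. W12_norm \<Omega> (\<lambda>x. u x - s n x) < 1 / real (Suc n)" by metis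
  have "(\<lambda>n. W12_norm \<Omega> (\<lambda>x. u x - s n x)) \<longlonglongrightarrow> 0"
  proof (rule tendsto_sandwich[OF _ _ tendsto_const])
    show "\<forall>\<^sub>F n in sequentially. W12_norm \<Omega> (\<lambda>x. u x - s n x) \<le> inverse (real (Suc n))"
      using s(2) by (intro always_eventually allI) (simp add: inverse_eq_divide less_imp_le)
  qed (use LIMSEQ_inverse_real_of_nat in auto)
  then have "w12_lim s u" using w12_lim_iff[of s u] s(1) assms \<open>u \<in> H1\<close> by blast
  then show "u \<in> H1 \<and> (\<exists>s. (\<forall>n. s n \<in> S) \<and> w12_lim s u)" using s(1) \<open>u \<in> H1\<close> by blast
next
  assume "u \<in> H1 \<and> (\<exists>s. (\<forall>n. s n \<in> S) \<and> w12_lim s u)"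
  then obtain s where u: "u \<in> H1" and s: "\<And>n. s n \<in> S" and "w12_lim s u" by blast
  then have lim: "(\<lambda>n. W12_norm \<Omega> (\<lambda>x. u x - s n x)) \<longlonglongrightarrow> 0" using w12_lim_iff[of s u] assms by blast
  have "\<exists>\<phi>\<in>S. W12_norm \<Omega> (\<lambda>x. u x - \<phi> x) < e" if "e > 0" for e
    using eventually_happens[OF order_tendstoD(2)[OF lim that]] s by auto
  then show "u \<in> W12_closure \<Omega> S" using u unfolding W12_closure_def by blast
qed

lemma W12_closure_closed:
  assumes S: "S \<subseteq> H1" and s: "\<And>n. s n \<in> W12_closure \<Omega> S" and u: "u \<in> H1" and lim: "w12_lim s u"
  shows "u \<in> W12_closure \<Omega> S"
proof -
  have sH: "s n \<in> H1" for n using s unfolding W12_closure_def by blast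
  have lim': "(\<lambda>n. W12_norm \<Omega> (\<lambda>x. u x - s n x)) \<longlonglongrightarrow> 0" using w12_lim_iff[of s u] sH u lim by blast
  have "\<exists>\<phi>\<in>S. W12_norm \<Omega> (\<lambda>x. u x - \<phi> x) < e" if e: "e > 0" for e
  proof -
    obtain n where n: "W12_norm \<Omega> (\<lambda>x. u x - s n x) < e / 2"
      using eventually_happens[OF order_tendstoD(2)[OF lim', of "e / 2"]] e by auto
    obtain \<phi> where \<phi>: "\<phi> \<in> S" "W12_norm \<Omega> (\<lambda>x. s n x - \<phi> x) < e / 2"
      using s[of n] e unfolding W12_closure_def by (auto dest!: spec[of _ "e / 2"])
    have \<phi>H: "\<phi> \<in> H1" using \<phi> S by blast
    have "(W12_norm \<Omega> (\<lambda>x. (u x - s n x) + 1 * (s n x - \<phi> x)))\<^sup>2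
        \<le> 2 * (W12_norm \<Omega> (\<lambda>x. u x - s n x))\<^sup>2 + 2 * (norm (1::complex))\<^sup>2 * (W12_norm \<Omega> (\<lambda>x. s n x - \<phi> x))\<^sup>2"
      by (rule W12_norm_add) (intro H1_diff u sH \<phi>H)+
    also have "\<dots> < 2 * (e / 2)\<^sup>2 + 2 * (e / 2)\<^sup>2"
    proof -
      have "(W12_norm \<Omega> (\<lambda>x. u x - s n x))\<^sup>2 < (e / 2)\<^sup>2" "(W12_norm \<Omega> (\<lambda>x. s n x - \<phi> x))\<^sup>2 < (e / 2)\<^sup>2"
        using n \<phi>(2) by (auto intro!: power_strict_mono)
      then show ?thesis by simp
    qed
    also have "\<dots> = e\<^sup>2" by (simp add: power2_eq_square)
    finally have "W12_norm \<Omega> (\<lambda>x. u x - \<phi> x) < e" using e by (auto intro: power2_less_imp_less)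
    then show ?thesis using \<phi>(1) by blast
  qed
  then show ?thesis using u unfolding W12_closure_def by blast
qed

lemma w12_lim_linear:
  assumes "\<And>n. s n \<in> H1" "\<And>n. t n \<in> H1" "u \<in> H1" "v \<in> H1" "w12_lim s u" "w12_lim t v"
  shows "w12_lim (\<lambda>n x. s n x + c * t n x) (\<lambda>x. u x + c * v x)"
  unfolding w12_lim_def
proof (intro conjI allI)
  note lim = assms(5,6)[unfolded w12_lim_def]
  note H = H1_D[OF assms(1)] H1_D[OF assms(2)] H1_D[OF assms(3)] H1_D[OF assms(4)]
  show "l2_lim M (\<lambda>n x. s n x + c * t n x) (\<lambda>x. u x + c * v x)"
    by (intro l2_lim_add l2_lim_cmult L2_intros H) (use lim in auto)
  fix i
  have "l2_lim M (\<lambda>n x. D i (s n) x + c * D i (t n) x) (\<lambda>x. D i u x + c * D i v x)"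
    by (intro l2_lim_add l2_lim_cmult L2_intros H) (use lim in auto)
  moreover have "l2_norm M (\<lambda>x. D i (\<lambda>x. s n x + c * t n x) x - D i (\<lambda>x. u x + c * v x) x)
     = l2_norm M (\<lambda>x. D i (s n) x + c * D i (t n) x - (D i u x + c * D i v x))" for n
  proof (rule l2_norm_cong_AE)
    show "AE x in M. D i (\<lambda>x. s n x + c * t n x) x - D i (\<lambda>x. u x + c * v x) x = D i (s n) x + c * D i (t n) x - (D i u x + c * D i v x)"
      using H1_linear(2)[OF assms(1)[of n] assms(2)[of n], where c=c and i=i] H1_linear(2)[OF assms(3,4), where c=c and i=i] by eventually_elim simp
    show "(\<lambda>x. D i (\<lambda>x. s n x + c * t n x) x - D i (\<lambda>x. u x + c * v x) x) \<in> borel_measurable M"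
      by (intro L2_measurable L2_diff H1_D H1_linear assms)
    show "(\<lambda>x. D i (s n) x + c * D i (t n) x - (D i u x + c * D i v x)) \<in> borel_measurable M"
      by (intro L2_measurable L2_intros H)
  qed
  ultimately show "l2_lim M (\<lambda>n. D i (\<lambda>x. s n x + c * t n x)) (D i (\<lambda>x. u x + c * v x))"
    unfolding l2_lim_def by simp
qed

lemma w12_lim_cnj:
  assumes "\<And>n. s n \<in> H1" "u \<in> H1" "w12_lim s u"
  shows "w12_lim (\<lambda>n x. cnj (s n x)) (\<lambda>x. cnj (u x))"
  unfolding w12_lim_def
proof (intro conjI allI)
  have cnj: "l2_norm M (\<lambda>x. cnj (f x) - cnj (g x)) = l2_norm M (\<lambda>x. f x - g x)" for f g :: "real^'n \<Rightarrow> complex"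
    using l2_norm_cnj[of M "\<lambda>x. f x - g x"] by simp
  note lim = assms(3)[unfolded w12_lim_def]
  show "l2_lim M (\<lambda>n x. cnj (s n x)) (\<lambda>x. cnj (u x))" using lim unfolding l2_lim_def cnj by blast
  fix i
  have "l2_norm M (\<lambda>x. D i (\<lambda>x. cnj (s n x)) x - D i (\<lambda>x. cnj (u x)) x) = l2_norm M (\<lambda>x. cnj (D i (s n) x) - cnj (D i u x))" for n
  proof (rule l2_norm_cong_AE)
    show "AE x in M. D i (\<lambda>x. cnj (s n x)) x - D i (\<lambda>x. cnj (u x)) x = cnj (D i (s n) x) - cnj (D i u x)"
      using H1_cnj(2)[OF assms(1)[of n], where i=i] H1_cnj(2)[OF assms(2), where i=i] by eventually_elim simp
    show "(\<lambda>x. D i (\<lambda>x. cnj (s n x)) x - D i (\<lambda>x. cnj (u x)) x) \<in> borel_measurable M"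
      by (intro L2_measurable L2_diff H1_D H1_cnj assms)
    show "(\<lambda>x. cnj (D i (s n) x) - cnj (D i u x)) \<in> borel_measurable M"
      by (intro L2_measurable L2_intros H1_D assms)
  qed
  then show "l2_lim M (\<lambda>n. D i (\<lambda>x. cnj (s n x))) (D i (\<lambda>x. cnj (u x)))"
    using lim unfolding l2_lim_def cnj by simp
qed

end

section \<open>Eigenfunctions of the Laplacian\<close>

text \<open>Eigenfunctions of the second derivative on the edge. The differential equations hold for
  every integer index, while I selects an orthonormal family without repetitions.
  \<open>boundary\<close> says that the end terms of an integration by parts cancel, by vanishing or
  by periodicity.\<close>

locale trig1 =
  fixes L :: real and I :: "int set" and e e' :: "int \<Rightarrow> real \<Rightarrow> complex" and \<mu> :: "int \<Rightarrow> real"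
  assumes L_pos': "L > 0"
    and de: "\<And>k t. (e k has_vector_derivative e' k t) (at t)"
    and de': "\<And>k t. (e' k has_vector_derivative - of_real (\<mu> k) * e k t) (at t)"
    and boundary: "\<And>k l. k \<in> I \<Longrightarrow> l \<in> I \<Longrightarrow> cnj (e k (L/2)) * e' l (L/2) = cnj (e k (- (L/2))) * e' l (- (L/2))"
    and ortho: "\<And>k l. k \<in> I \<Longrightarrow> l \<in> I \<Longrightarrow>
      integral {- (L/2)..L/2} (\<lambda>t. cnj (e k t) * e l t) = (if k = l then 1 else 0)"
    and \<mu>_nonneg: "\<And>k. 0 \<le> \<mu> k"
    and finite_\<mu>: "\<And>C. finite {k \<in> I. \<mu> k \<le> C}"
    and infinite_I: "infinite I"
begin

lemma smooth_e: "smooth1 (e k)"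
  and smooth_e': "smooth1 (e' k)"
proof -
  define S where "S = {g. \<exists>c k. g = (\<lambda>t. c * e k t) \<or> g = (\<lambda>t. c * e' k t)}"
  have step: "\<exists>g'\<in>S. \<forall>t. (g has_vector_derivative g' t) (at t)" if "g \<in> S" for g
  proof -
    from that consider c k where "g = (\<lambda>t. c * e k t)" | c k where "g = (\<lambda>t. c * e' k t)"
      unfolding S_def by auto
    then show ?thesis
    proof cases
      case 1
      then have "\<forall>t. (g has_vector_derivative c * e' k t) (at t)"
        using has_vector_derivative_mult_right[OF de] by blast
      moreover have "(\<lambda>t. c * e' k t) \<in> S" unfolding S_def by blast
      ultimately show ?thesis by (intro bexI[of _ "\<lambda>t. c * e' k t"])
    next
      case 2
      then have "\<forall>t. (g has_vector_derivative c * (- of_real (\<mu> k) * e k t)) (at t)"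
        using has_vector_derivative_mult_right[OF de'] by blast
      moreover have "(\<lambda>t. c * (- of_real (\<mu> k) * e k t)) = (\<lambda>t. (c * - of_real (\<mu> k)) * e k t)"
        by (simp add: mult.assoc)
      then have "(\<lambda>t. c * (- of_real (\<mu> k) * e k t)) \<in> S" unfolding S_def by blast
      ultimately show ?thesis by (intro bexI[of _ "\<lambda>t. c * (- of_real (\<mu> k) * e k t)"])
    qed
  qed
  have "(\<lambda>t. 1 * e k t) \<in> S" "(\<lambda>t. 1 * e' k t) \<in> S" unfolding S_def by blast+
  from smooth1_coinduct[OF this(1) step] smooth1_coinduct[OF this(2) step]
  show "smooth1 (e k)" "smooth1 (e' k)" by simp_all
qed

text \<open>Integrating the derivative of cnj (e k) times e' l over the edge:
  \<open>boundary\<close> cancels the end terms, and the eigenvalue equation leaves \<mu> times the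
  orthonormality relation.\<close>

lemma integral_e'_e':
  assumes "k \<in> I" "l \<in> I"
  shows "integral {- (L/2)..L/2} (\<lambda>t. cnj (e' k t) * e' l t) = (if k = l then of_real (\<mu> k) else 0)"
proof -
  have d: "((\<lambda>t. cnj (e k t) * e' l t) has_vector_derivative
      cnj (e k t) * (- of_real (\<mu> l) * e l t) + cnj (e' k t) * e' l t) (at t)" for t
    by (intro has_vector_derivative_mult de' bounded_linear.has_vector_derivative[OF bounded_linear_cnj de])
  have "((\<lambda>t. cnj (e k t) * (- of_real (\<mu> l) * e l t) + cnj (e' k t) * e' l t) has_integral
     (cnj (e k (L/2)) * e' l (L/2) - cnj (e k (- (L/2))) * e' l (- (L/2)))) {- (L/2)..L/2}"
    by (rule fundamental_theorem_of_calculus) (use L_pos' d in \<open>auto intro: has_vector_derivative_at_within\<close>)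
  then have 1: "integral {- (L/2)..L/2} (\<lambda>t. - of_real (\<mu> l) * (cnj (e k t) * e l t) + cnj (e' k t) * e' l t) = 0"
    using boundary[OF assms] by (simp add: integral_unique mult.left_commute)
  have i1: "(\<lambda>t. - of_real (\<mu> l) * (cnj (e k t) * e l t)) integrable_on {- (L/2)..L/2}"
    by (intro integrable_continuous_real continuous_intros smooth1_continuous smooth_e)
  have i2: "(\<lambda>t. cnj (e' k t) * e' l t) integrable_on {- (L/2)..L/2}"
    by (intro integrable_continuous_real continuous_intros smooth1_continuous smooth_e')
  from 1 have "- of_real (\<mu> l) * integral {- (L/2)..L/2} (\<lambda>t. cnj (e k t) * e l t)
     + integral {- (L/2)..L/2} (\<lambda>t. cnj (e' k t) * e' l t) = 0"
    unfolding Henstock_Kurzweil_Integration.integral_add[OF i1 i2] by simp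
  then show ?thesis unfolding ortho[OF assms] by (auto simp: eq_neg_iff_add_eq_0 split: if_splits)
qed

end

subsection \<open>Product integrals\<close>

text \<open>Fubini, through the description of Lebesgue measure as an image of a product measure
  whose factors are indexed by basis vectors; \<open>ax\<close> translates these into
  coordinates.\<close>

lemma lborel_integral_tensor:
  fixes g :: "'n::finite \<Rightarrow> real \<Rightarrow> complex"
  assumes g: "\<And>i. integrable lborel (g i)"
  shows "(LINT x|lborel. tensor g x) = (\<Prod>i\<in>UNIV. LINT t|lborel. g i t)"
proof -
  interpret product_sigma_finite "\<lambda>b::real^'n. lborel :: real measure" by standard
  define ax :: "'n \<Rightarrow> real^'n" where "ax i = axis i 1" for i
  have Basis: "(Basis :: (real^'n) set) = range ax" by (auto simp: Basis_vec_def ax_def)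
  have inj: "inj ax" by (auto simp: inj_on_def ax_def axis_eq_axis)
  have [measurable]: "g i \<in> borel_measurable borel" for i using g[of i] by auto
  have [measurable]: "tensor g \<in> borel_measurable borel" unfolding tensor_def[abs_def] by measurable
  have "(LINT x|lborel. tensor g x) = (LINT f|(\<Pi>\<^sub>M b\<in>Basis. lborel). tensor g (\<Sum>b\<in>Basis. f b *\<^sub>R b))"
    by (subst lborel_eq) (rule integral_distr, measurable)
  also have "\<dots> = (LINT f|(\<Pi>\<^sub>M b\<in>Basis. lborel). (\<Prod>b\<in>Basis. g (inv ax b) (f b)))"
  proof (intro Bochner_Integration.integral_cong refl)
    fix f :: "real^'n \<Rightarrow> real"
    have "(\<Sum>b\<in>Basis. f b *\<^sub>R b) $ i = f (ax i)" for i
    proof -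
      have "(\<Sum>b\<in>Basis. f b *\<^sub>R b) $ i = (\<Sum>j\<in>UNIV. f (ax j) *\<^sub>R ax j) $ i"
        unfolding Basis using inj by (simp add: sum.reindex)
      also have "\<dots> = (\<Sum>j\<in>UNIV. f (ax j) * (if i = j then 1 else 0))"
        by (simp add: ax_def axis_def)
      also have "\<dots> = f (ax i)" by (simp add: mult_delta_right)
      finally show ?thesis .
    qed
    then show "tensor g (\<Sum>b\<in>Basis. f b *\<^sub>R b) = (\<Prod>b\<in>Basis. g (inv ax b) (f b))"
      unfolding Basis using inj by (simp add: prod.reindex tensor_def)
  qed
  also have "\<dots> = (\<Prod>b\<in>Basis. LINT t|lborel. g (inv ax b) t)"
    by (rule product_integral_prod) (use g in auto)
  also have "\<dots> = (\<Prod>i\<in>UNIV. LINT t|lborel. g i t)"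
    unfolding Basis using inj by (simp add: prod.reindex)
  finally show ?thesis .
qed

context cube_domain
begin

lemma integral_tensor:
  assumes g: "\<And>i. continuous_on UNIV (g i)"
  shows "(LINT x|M. tensor g x) = (\<Prod>i\<in>UNIV. integral {- (L/2)..L/2} (g i))"
proof -
  \<comment> \<open>The factors are extended by zero beyond the open edge, so that the integral over
    the cube becomes one over the whole space.\<close>
  define h where "h i t = indicator {- (L/2)<..<L/2} t *\<^sub>R g i t" for i t
  have c: "continuous_on {- (L/2)..L/2} (g i)" for i using continuous_on_subset[OF g] by blast
  have int: "set_integrable lborel {- (L/2)..L/2} (g i)" for i
    by (rule borel_integrable_atLeastAtMost'[OF c])
  have hset: "set_integrable lborel {- (L/2)<..<L/2} (g i)" for i
    by (rule set_integrable_subset[OF int]) auto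
  have h: "integrable lborel (h i)" for i
    using hset[of i] unfolding set_integrable_def h_def .
  have "tensor h \<in> borel_measurable borel"
  proof -
    have [measurable]: "h i \<in> borel_measurable borel" for i using h[of i] by auto
    show ?thesis unfolding tensor_def[abs_def] by measurable
  qed
  moreover have out: "tensor h x = 0" if "x \<notin> \<Omega>" for x
  proof -
    from that obtain i where "x $ i \<notin> {- (L/2)<..<L/2}" by (auto simp: cube_def)
    then show ?thesis unfolding tensor_def by (intro prod_zero bexI[of _ i]) (auto simp: h_def)
  qed
  ultimately have "(LINT x|M. tensor h x) = (LINT x|lborel. tensor h x)"
    by (intro integral_lebesgue_on_lborel sets_cube)
  moreover have "(LINT x|M. tensor h x) = (LINT x|M. tensor g x)"
    by (intro Bochner_Integration.integral_cong refl) (auto simp: tensor_def h_def cube_def)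
  moreover have "(LINT t|lborel. h i t) = integral {- (L/2)..L/2} (g i)" for i
  proof -
    have "(LINT t|lborel. h i t) = (LINT t:{- (L/2)<..<L/2}|lborel. g i t)"
      unfolding set_lebesgue_integral_def h_def ..
    also have "\<dots> = integral {- (L/2)<..<L/2} (g i)"
      by (rule set_borel_integral_eq_integral(2)[OF hset])
    also have "\<dots> = integral {- (L/2)..L/2} (g i)" by (rule integral_open_interval_real[symmetric])
    finally show ?thesis .
  qed
  ultimately show ?thesis using lborel_integral_tensor[OF h] by simp
qed

lemma inner_tensor:
  assumes "\<And>i. continuous_on UNIV (g i)" "\<And>i. continuous_on UNIV (h i)"
  shows "l2_inner M (tensor g) (tensor h) = (\<Prod>i\<in>UNIV. integral {- (L/2)..L/2} (\<lambda>t. cnj (g i t) * h i t))"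
proof -
  have "l2_inner M (tensor g) (tensor h) = (LINT x|M. tensor (\<lambda>i t. cnj (g i t) * h i t) x)"
    unfolding l2_inner_def tensor_def by (simp add: prod.distrib)
  also have "\<dots> = (\<Prod>i\<in>UNIV. integral {- (L/2)..L/2} (\<lambda>t. cnj (g i t) * h i t))"
    by (intro integral_tensor continuous_intros assms)
  finally show ?thesis .
qed

text \<open>By the Stone--Weierstrass theorem, the indicator function of a box is a bounded pointwise limit
  of polynomials in the components of any map that separates the points of the cube from the points
  of its closure.\<close>

lemma AE_zero_of_polynomials:
  fixes \<Phi> :: "real^'n \<Rightarrow> complex^'n" and f :: "real^'n \<Rightarrow> complex"
  assumes \<Phi>: "continuous_on UNIV \<Phi>"
    and inj: "\<And>x y. x \<in> \<Omega> \<Longrightarrow> y \<in> cbox (\<chi> i. - L/2) (\<chi> i. L/2) \<Longrightarrow> \<Phi> x = \<Phi> y \<Longrightarrow> x = y"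
    and f: "f \<in> L2 M" and 0: "\<And>p. real_polynomial_function p \<Longrightarrow> (LINT x|M. f x * of_real (p (\<Phi> x))) = 0"
  shows "AE x in M. f x = 0"
proof (rule AE_zero_of_integral_boxes[OF f])
  fix a b :: "real^'n" assume sub: "cbox a b \<subseteq> \<Omega>"
  define K :: "(real^'n) set" where "K = cbox (\<chi> i. - L/2) (\<chi> i. L/2)"
  define C where "C = \<Phi> ` (K - box a b)"
  have c: "continuous_on A \<Phi>" for A using continuous_on_subset[OF \<Phi>] by blast
  have compC: "compact C" unfolding C_def K_def
    by (intro compact_continuous_image c compact_diff compact_cbox open_box)
  have compK: "compact (\<Phi> ` K)" unfolding K_def by (intro compact_continuous_image c compact_cbox)
  have \<Omega>K: "\<Omega> \<subseteq> K" unfolding K_def by (rule cube_subset_cbox)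
  have boxsub: "box a b \<subseteq> \<Omega>" using sub box_subset_cbox by blast
  \<comment> \<open>C must be nonempty, since \<open>infdist\<close> to the empty set is 0 by
    convention; a corner of the closed cube supplies a point.\<close>
  have "(\<chi> i. L/2) \<in> K" "(\<chi> i. L/2) \<notin> \<Omega>" unfolding K_def using L_pos by (auto simp: mem_box_cart cube_def)
  then have neC: "C \<noteq> {}" unfolding C_def using boxsub by blast
  \<comment> \<open>Zero on C and eventually 1 at each point off C: a continuous approximation on
    the image of \<Phi>, to which Stone-Weierstrass applies.\<close>
  define G where "G m y = min 1 (real m * infdist y C)" for m :: nat and y
  have Gcont: "continuous_on A (G m)" for A m unfolding G_def by (intro continuous_intros)
  have "\<exists>p. real_polynomial_function p \<and> (\<forall>y\<in>\<Phi> ` K. \<bar>G m y - p y\<bar> < 1 / real (Suc m))" for m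
    by (rule Stone_Weierstrass_real_polynomial_function[OF compK Gcont, of "1 / real (Suc m)" m]) auto
  then obtain p where p: "\<And>m. real_polynomial_function (p m)"
    "\<And>m y. y \<in> \<Phi> ` K \<Longrightarrow> \<bar>G m y - p m y\<bar> < 1 / real (Suc m)" by metis
  have G01: "0 \<le> G m y" "G m y \<le> 1" for m y unfolding G_def by (auto simp: infdist_nonneg)
  have p2: "norm (complex_of_real (p m (\<Phi> x))) \<le> 2" if "x \<in> \<Omega>" for m x
  proof -
    have "\<bar>G m (\<Phi> x) - p m (\<Phi> x)\<bar> < 1 / real (Suc m)" using that \<Omega>K by (intro p) auto
    moreover have "1 / real (Suc m) \<le> 1" by simp
    ultimately show ?thesis using G01[of m "\<Phi> x"] unfolding norm_of_real by linarith
  qed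
  have Glim: "(\<lambda>m. G m (\<Phi> x)) \<longlonglongrightarrow> indicator (box a b) x" if x: "x \<in> \<Omega>" for x
  proof (cases "x \<in> box a b")
    case True
    \<comment> \<open>Here x is in the open cube but y may lie on the boundary. In the periodic case
      \<Phi> identifies opposite faces, so only this one-sided injectivity is available.\<close>
    have "\<Phi> x \<notin> C"
    proof
      assume "\<Phi> x \<in> C"
      then obtain y where "y \<in> K" "y \<notin> box a b" "\<Phi> x = \<Phi> y" unfolding C_def by blast
      then show False using inj[OF x] True unfolding K_def by blast
    qed
    then have pos: "infdist (\<Phi> x) C > 0"
      using infdist_pos_not_in_closed[OF compact_imp_closed[OF compC] neC] by blast
    obtain N where N: "real N > 1 / infdist (\<Phi> x) C" using reals_Archimedean2 by blast
    have "G m (\<Phi> x) = 1" if "m \<ge> N" for m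
    proof -
      have "1 / infdist (\<Phi> x) C < real m" using N that by linarith
      then show ?thesis using pos by (simp add: G_def field_simps min_def)
    qed
    then have "(\<lambda>m. G m (\<Phi> x)) \<longlonglongrightarrow> 1"
      by (intro tendsto_eventually eventually_sequentiallyI[of N]) auto
    then show ?thesis using True by simp
  next
    case False
    then have "\<Phi> x \<in> C" using x \<Omega>K unfolding C_def by blast
    then have "G m (\<Phi> x) = 0" for m by (simp add: G_def)
    then show ?thesis using False by simp
  qed
  have plim: "(\<lambda>m. p m (\<Phi> x)) \<longlonglongrightarrow> indicator (box a b) x" if x: "x \<in> \<Omega>" for x
  proof -
    have "(\<lambda>m. G m (\<Phi> x) - p m (\<Phi> x)) \<longlonglongrightarrow> 0"
    proof (rule Lim_null_comparison)
      have "norm (G m (\<Phi> x) - p m (\<Phi> x)) \<le> inverse (real (Suc m))" for m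
        unfolding real_norm_def inverse_eq_divide by (rule less_imp_le[OF p(2)]) (use x \<Omega>K in auto)
      then show "\<forall>\<^sub>F m in sequentially. norm (G m (\<Phi> x) - p m (\<Phi> x)) \<le> inverse (real (Suc m))"
        by (intro always_eventually allI)
    qed (rule LIMSEQ_inverse_real_of_nat)
    from tendsto_diff[OF Glim[OF x] this] show ?thesis by simp
  qed
  have pm: "(\<lambda>x. complex_of_real (p m (\<Phi> x))) \<in> borel_measurable M" for m
  proof (rule measurable_continuous)
    show "continuous_on UNIV (\<lambda>x. complex_of_real (p m (\<Phi> x)))"
      by (intro continuous_on_of_real continuous_on_compose2[OF _ \<Phi>, of UNIV "p m"]
          continuous_on_polymonial_function) (use p(1) real_polynomial_function_eq in auto)
  qed
  have mf: "f \<in> borel_measurable M" using f by auto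
  have box: "(\<lambda>x. indicator (box a b) x :: complex) \<in> borel_measurable M"
    by (intro borel_measurable_indicator) (auto simp: sets_restrict_space_iff sets_cube boxsub)
  have "(\<lambda>m. LINT x|M. f x * of_real (p m (\<Phi> x))) \<longlonglongrightarrow> (LINT x|M. f x * indicator (box a b) x)"
  proof (rule integral_dominated_convergence[where w="\<lambda>x. norm (f x) * 2"])
    show "integrable M (\<lambda>x. norm (f x) * 2)" using integrable_L2[OF f] by simp
    show "AE x in M. (\<lambda>m. f x * of_real (p m (\<Phi> x))) \<longlonglongrightarrow> f x * indicator (box a b) x"
    proof (rule AE_I2)
      fix x assume "x \<in> space M"
      then have "(\<lambda>m. complex_of_real (p m (\<Phi> x))) \<longlonglongrightarrow> of_real (indicator (box a b) x)"
        by (intro tendsto_of_real plim) simp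
      then show "(\<lambda>m. f x * of_real (p m (\<Phi> x))) \<longlonglongrightarrow> f x * indicator (box a b) x"
        by (intro tendsto_mult tendsto_const) (simp add: of_real_indicator)
    qed
    show "AE x in M. norm (f x * of_real (p m (\<Phi> x))) \<le> norm (f x) * 2" for m
      unfolding norm_mult by (intro AE_I2 mult_left_mono p2) auto
  qed (intro borel_measurable_times mf box pm)+
  then have "(LINT x|M. f x * indicator (box a b) x) = 0"
    using 0[OF p(1)] by (simp add: LIMSEQ_const_iff)
  then show "(LINT x|M. indicator (box a b) x * f x) = 0" by (simp add: mult.commute)
qed

end

subsection \<open>Tensor eigenfunctions\<close>

locale trig = cube_domain L dim + trig1 L I e e' \<mu>
  for L :: real and dim :: "'n::finite itself" and I e e' \<mu>
begin

text \<open>Multi-indices of the modes. \<open>E1 i\<close> and \<open>E2 j i\<close> are the first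
  and second partial derivatives of the modes, the pure second derivatives already rewritten by the
  eigenvalue equation, and \<open>lam\<close> is the eigenvalue of minus the Laplacian.\<close>

definition K :: "('n \<Rightarrow> int) set" where "K = {k. \<forall>i. k i \<in> I}"
definition E :: "('n \<Rightarrow> int) \<Rightarrow> real^'n \<Rightarrow> complex" where "E k = tensor (\<lambda>i. e (k i))"
definition E1 :: "'n \<Rightarrow> ('n \<Rightarrow> int) \<Rightarrow> real^'n \<Rightarrow> complex" where
  "E1 i k = tensor ((\<lambda>j. e (k j))(i := e' (k i)))"
definition E2 :: "'n \<Rightarrow> 'n \<Rightarrow> ('n \<Rightarrow> int) \<Rightarrow> real^'n \<Rightarrow> complex" where
  "E2 j i k = (if i = j then (\<lambda>x. - of_real (\<mu> (k i)) * E k x)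
     else tensor ((\<lambda>j. e (k j))(i := e' (k i), j := e' (k j))))"
definition lam :: "('n \<Rightarrow> int) \<Rightarrow> real" where "lam k = (\<Sum>i\<in>UNIV. \<mu> (k i))"

lemma smooth_E: "smooth (E k)" and smooth_E1: "smooth (E1 i k)"
  unfolding E_def E1_def by (intro smooth_tensor; simp add: smooth_e smooth_e')+

lemma partial_E: "partial i (E k) = E1 i k"
  unfolding E_def E1_def by (rule ext) (rule tensor_partial(2)[of "\<lambda>i. e (k i)" "\<lambda>i. e' (k i)", OF de])

lemma tensor_scale: "tensor (g(i := (\<lambda>t. c * h t))) x = c * tensor (g(i := h)) x"
  by (simp add: tensor_upd)

lemma partial_E1: "partial j (E1 i k) = E2 j i k"
proof (rule ext)
  fix x
  define d where "d l = (if l = i then (\<lambda>t. - of_real (\<mu> (k i)) * e (k i) t) else e' (k l))" for l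
  have "(((\<lambda>j. e (k j))(i := e' (k i))) l has_vector_derivative d l t) (at t)" for l t
    by (simp add: d_def de de'[simplified])
  from tensor_partial(2)[of "(\<lambda>j. e (k j))(i := e' (k i))" d, OF this]
  have "partial j (E1 i k) x = tensor (((\<lambda>j. e (k j))(i := e' (k i)))(j := d j)) x" unfolding E1_def .
  also have "\<dots> = E2 j i k x"
  proof (cases "i = j")
    case True
    have "tensor (((\<lambda>j. e (k j))(i := e' (k i)))(j := d j)) x = tensor ((\<lambda>j. e (k j))(i := (\<lambda>t. - of_real (\<mu> (k i)) * e (k i) t))) x"
      using True by (simp add: d_def)
    also have "\<dots> = - of_real (\<mu> (k i)) * tensor ((\<lambda>j. e (k j))(i := e (k i))) x"
      by (rule tensor_scale)
    also have "(\<lambda>j. e (k j))(i := e (k i)) = (\<lambda>j. e (k j))" by auto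
    finally show ?thesis unfolding E2_def E_def if_P[OF True] .
  next
    case False
    then show ?thesis by (simp add: E2_def d_def)
  qed
  finally show "partial j (E1 i k) x = E2 j i k x" .
qed

lemma cont_e: "continuous_on A (e k)" and cont_e': "continuous_on A (e' k)"
  by (auto intro: smooth1_continuous smooth_e smooth_e')

lemma E_L2: "E k \<in> L2 M" and E1_L2: "E1 i k \<in> L2 M"
  by (auto intro!: L2_continuous smooth_C1 smooth_E smooth_E1)

lemma E2_L2: "E2 j i k \<in> L2 M"
  unfolding partial_E1[symmetric] by (intro L2_continuous smooth_C1 smooth_E1)

lemma prod_delta:
  fixes c :: "'n \<Rightarrow> complex"
  shows "(\<Prod>i\<in>UNIV. if k i = l i then c i else 0) = (if k = l then \<Prod>i\<in>UNIV. c i else 0)"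
proof (cases "k = l")
  case False
  then obtain i where "k i \<noteq> l i" by auto
  then show ?thesis using False by (auto intro!: prod_zero)
qed simp

lemma inner_E:
  assumes "k \<in> K" "l \<in> K"
  shows "l2_inner M (E k) (E l) = (if k = l then 1 else 0)"
proof -
  have "l2_inner M (E k) (E l) = (\<Prod>i\<in>UNIV. if k i = l i then 1 else 0)"
    unfolding E_def using assms by (subst inner_tensor) (auto simp: cont_e ortho K_def)
  also have "\<dots> = (if k = l then 1 else 0)" by (subst prod_delta) simp
  finally show ?thesis .
qed

text \<open>J is the set of differentiated coordinates, so that one computation covers the gradient
  and the mixed second derivatives.\<close>

lemma inner_tensor_upd:
  assumes "k \<in> K" "l \<in> K"
    and "\<And>j. j \<in> J \<Longrightarrow> g j = e' (k j)" "\<And>j. j \<notin> J \<Longrightarrow> g j = e (k j)"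
    and "\<And>j. j \<in> J \<Longrightarrow> h j = e' (l j)" "\<And>j. j \<notin> J \<Longrightarrow> h j = e (l j)"
  shows "l2_inner M (tensor g) (tensor h) = (if k = l then \<Prod>j\<in>J. of_real (\<mu> (k j)) else 0)"
proof -
  have "l2_inner M (tensor g) (tensor h)
      = (\<Prod>i\<in>UNIV. if k i = l i then (if i \<in> J then of_real (\<mu> (k i)) else 1) else 0)"
  proof (subst inner_tensor)
    show "continuous_on UNIV (g i)" "continuous_on UNIV (h i)" for i
      using assms(3-6)[of i] cont_e cont_e' by (cases "i \<in> J"; simp)+
    show "(\<Prod>i\<in>UNIV. integral {- (L/2)..L/2} (\<lambda>t. cnj (g i t) * h i t))
        = (\<Prod>i\<in>UNIV. if k i = l i then (if i \<in> J then of_real (\<mu> (k i)) else 1) else 0)"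
    proof (rule prod.cong[OF refl])
      fix i
      show "integral {- (L/2)..L/2} (\<lambda>t. cnj (g i t) * h i t) = (if k i = l i then (if i \<in> J then of_real (\<mu> (k i)) else 1) else 0)"
        using assms(1,2) assms(3-6)[of i] by (cases "i \<in> J") (auto simp: K_def ortho integral_e'_e')
    qed
  qed
  also have "\<dots> = (if k = l then \<Prod>i\<in>UNIV. (if i \<in> J then of_real (\<mu> (k i)) else 1) else 0)" by (rule prod_delta)
  also have "(\<Prod>i\<in>UNIV. (if i \<in> J then of_real (\<mu> (k i)) else (1::complex))) = (\<Prod>j\<in>J. of_real (\<mu> (k j)))"
    by (subst prod.inter_restrict[symmetric]) auto
  finally show ?thesis .
qed

lemma inner_E1: "k \<in> K \<Longrightarrow> l \<in> K \<Longrightarrow> l2_inner M (E1 i k) (E1 i l) = (if k = l then of_real (\<mu> (k i)) else 0)"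
  unfolding E1_def by (subst inner_tensor_upd[where J="{i}" and k=k and l=l]) auto

lemma inner_E2: "k \<in> K \<Longrightarrow> l \<in> K \<Longrightarrow>
    l2_inner M (E2 j i k) (E2 j i l) = (if k = l then of_real (\<mu> (k i) * \<mu> (k j)) else 0)"
proof (cases "i = j")
  case True
  assume "k \<in> K" "l \<in> K"
  then show ?thesis
    unfolding E2_def if_P[OF True] l2_inner_cmult_left l2_inner_cmult_right using True by (simp add: inner_E)
next
  case False
  assume k: "k \<in> K" "l \<in> K"
  have "l2_inner M (E2 j i k) (E2 j i l) = (if k = l then \<Prod>m\<in>{i, j}. of_real (\<mu> (k m)) else 0)"
    unfolding E2_def using k False by (simp only: if_False, intro inner_tensor_upd) auto
  then show ?thesis using False by simp
qed

lemma lam_nonneg: "0 \<le> lam k"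
  unfolding lam_def by (intro sum_nonneg \<mu>_nonneg)

lemma \<mu>_le_lam: "\<mu> (k i) \<le> lam k"
  unfolding lam_def by (rule member_le_sum) (auto simp: \<mu>_nonneg)

lemma finite_lam: "finite {k \<in> K. lam k \<le> C}"
proof (rule finite_subset)
  show "{k \<in> K. lam k \<le> C} \<subseteq> (UNIV \<rightarrow>\<^sub>E {k \<in> I. \<mu> k \<le> C})"
    using \<mu>_le_lam order_trans by (fastforce simp: K_def)
  show "finite (UNIV \<rightarrow>\<^sub>E {k \<in> I. \<mu> k \<le> C} :: ('n \<Rightarrow> int) set)"
    by (intro finite_PiE finite_\<mu>) auto
qed

lemma infinite_K: "infinite K"
proof
  assume "finite K"
  \<comment> \<open>\<open>undefined\<close> stands for an arbitrary coordinate; constant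
    multi-indices already reach all of I.\<close>
  then have "finite ((\<lambda>k. k undefined) ` K)" by simp
  moreover have "I \<subseteq> (\<lambda>k. k undefined) ` K"
  proof
    fix x assume "x \<in> I"
    then have "(\<lambda>_. x) \<in> K" by (simp add: K_def)
    then show "x \<in> (\<lambda>k. k undefined) ` K" by (intro image_eqI[of _ _ "\<lambda>_. x"]) auto
  qed
  ultimately show False using infinite_I finite_subset by blast
qed

section \<open>The span of the modes and its multipliers\<close>

inductive_set Sp :: "(real^'n \<Rightarrow> complex) set" where
  Sp_zero: "(\<lambda>x. 0) \<in> Sp"
| Sp_step: "g \<in> Sp \<Longrightarrow> k \<in> K \<Longrightarrow> (\<lambda>x. g x + c * E k x) \<in> Sp"

lemma Sp_E: "k \<in> K \<Longrightarrow> (\<lambda>x. c * E k x) \<in> Sp"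
  using Sp_step[OF Sp_zero] by simp

lemma Sp_add: "h \<in> Sp \<Longrightarrow> g \<in> Sp \<Longrightarrow> (\<lambda>x. g x + h x) \<in> Sp"
proof (induction h rule: Sp.induct)
  case (Sp_step h k c)
  then show ?case using Sp.Sp_step[of "\<lambda>x. g x + h x" k c] by (simp add: add.assoc)
qed simp

lemma Sp_scale: "h \<in> Sp \<Longrightarrow> (\<lambda>x. a * h x) \<in> Sp"
proof (induction h rule: Sp.induct)
  case Sp_zero
  show ?case using Sp.Sp_zero by simp
next
  case (Sp_step h k c)
  then show ?case using Sp.Sp_step[of "\<lambda>x. a * h x" k "a * c"] by (simp add: distrib_left mult.assoc)
qed

text \<open>Functions by which multiplication preserves the span of the modes. They form an algebra,
  which is what an induction over polynomials requires.\<close>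

definition multiplier :: "(real^'n \<Rightarrow> complex) \<Rightarrow> bool" where
  "multiplier h \<longleftrightarrow> (\<forall>k\<in>K. (\<lambda>x. E k x * h x) \<in> Sp)"

lemma multiplier_Sp: "g \<in> Sp \<Longrightarrow> multiplier h \<Longrightarrow> (\<lambda>x. g x * h x) \<in> Sp"
proof (induction g rule: Sp.induct)
  case Sp_zero
  show ?case using Sp.Sp_zero by simp
next
  case (Sp_step g k c)
  have "(\<lambda>x. c * (E k x * h x)) \<in> Sp" using Sp_step by (intro Sp_scale) (auto simp: multiplier_def)
  from Sp_add[OF this Sp_step.IH[OF Sp_step.prems]] show ?case by (simp add: distrib_right mult.assoc)
qed

lemma multiplier_const: "multiplier (\<lambda>x. c)"
  unfolding multiplier_def using Sp_E by (auto simp: mult.commute)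

lemma multiplier_add: "multiplier g \<Longrightarrow> multiplier h \<Longrightarrow> multiplier (\<lambda>x. g x + h x)"
  unfolding multiplier_def using Sp_add by (auto simp: distrib_left)

lemma multiplier_mult: "multiplier g \<Longrightarrow> multiplier h \<Longrightarrow> multiplier (\<lambda>x. g x * h x)"
  using multiplier_Sp[of _ h] unfolding multiplier_def by (fastforce simp: mult.assoc)

lemma multiplier_sum: "finite J \<Longrightarrow> (\<And>j. j \<in> J \<Longrightarrow> multiplier (g j)) \<Longrightarrow> multiplier (\<lambda>x. \<Sum>j\<in>J. g j x)"
  by (induction J rule: finite_induct) (simp_all add: multiplier_const multiplier_add)

text \<open>The hypothesis is a product-to-sum formula: multiplying by a function of one coordinate
  replaces one entry of the multi-index by two others and leaves the remaining factors
  alone.\<close>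

lemma multiplier_coordinate:
  assumes "\<And>k. k \<in> I \<Longrightarrow> \<exists>a l a' l'. l \<in> I \<and> l' \<in> I \<and> (\<forall>t. e k t * h t = a * e l t + a' * e l' t)"
  shows "multiplier (\<lambda>x. h (x $ i))"
  unfolding multiplier_def
proof
  fix k assume k: "k \<in> K"
  then obtain a l a' l' where l: "l \<in> I" "l' \<in> I" and eq: "\<And>t. e (k i) t * h t = a * e l t + a' * e l' t"
    using assms[of "k i"] by (auto simp: K_def)
  have E: "E (k(i := m)) x = e m (x $ i) * (\<Prod>j\<in>UNIV - {i}. e (k j) (x $ j))" for m x
  proof -
    have "(\<lambda>j. e ((k(i := m)) j)) = (\<lambda>j. e (k j))(i := e m)" by auto
    then show ?thesis unfolding E_def by (simp only: tensor_upd)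
  qed
  have "(\<lambda>x. a * E (k(i := l)) x + a' * E (k(i := l')) x) \<in> Sp"
    using k l by (intro Sp_add Sp_E) (auto simp: K_def)
  moreover have "E k x * h (x $ i) = a * E (k(i := l)) x + a' * E (k(i := l')) x" for x
  proof -
    have "E k x * h (x $ i) = E (k(i := k i)) x * h (x $ i)" by simp
    also have "\<dots> = (e (k i) (x $ i) * h (x $ i)) * (\<Prod>j\<in>UNIV - {i}. e (k j) (x $ j))"
      unfolding E by (simp add: mult.commute mult.left_commute)
    also have "\<dots> = a * E (k(i := l)) x + a' * E (k(i := l')) x"
      unfolding eq E by (simp add: distrib_right mult.assoc)
    finally show ?thesis .
  qed
  ultimately show "(\<lambda>x. E k x * h (x $ i)) \<in> Sp" by simp
qed

text \<open>Polynomials in the map \<Phi> are multipliers, so cnj f times one fixed mode is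
  orthogonal to all of them and vanishes almost everywhere; that mode has no zero in the open cube
  and can be cancelled. It takes the place of the constant function, which is not among the
  sines.\<close>

lemma total:
  fixes \<phi> :: "real \<Rightarrow> complex"
  assumes \<phi>: "continuous_on UNIV \<phi>"
    and inj: "\<And>s t. - (L/2) < s \<Longrightarrow> s < L/2 \<Longrightarrow> t \<in> {- (L/2)..L/2} \<Longrightarrow> \<phi> s = \<phi> t \<Longrightarrow> s = t"
    and Re: "\<And>k. k \<in> I \<Longrightarrow> \<exists>a l a' l'. l \<in> I \<and> l' \<in> I \<and> (\<forall>t. e k t * of_real (Re (\<phi> t)) = a * e l t + a' * e l' t)"
    and Im: "\<And>k. k \<in> I \<Longrightarrow> \<exists>a l a' l'. l \<in> I \<and> l' \<in> I \<and> (\<forall>t. e k t * of_real (Im (\<phi> t)) = a * e l t + a' * e l' t)"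
    and k0: "k0 \<in> I" "\<And>t. - (L/2) < t \<Longrightarrow> t < L/2 \<Longrightarrow> e k0 t \<noteq> 0"
    and f: "f \<in> L2 M" and orth: "\<And>k. k \<in> K \<Longrightarrow> l2_inner M (E k) f = 0"
  shows "AE x in M. f x = 0"
proof -
  define \<Phi> :: "real^'n \<Rightarrow> complex^'n" where "\<Phi> x = (\<chi> i. \<phi> (x $ i))" for x
  define k where "k = (\<lambda>i::'n. k0)"
  have k: "k \<in> K" using k0 by (simp add: K_def k_def)
  have SpL2: "g \<in> L2 M \<and> l2_inner M f g = 0" if "g \<in> Sp" for g
    using that
  proof (induction g rule: Sp.induct)
    case (Sp_step g k c)
    have "l2_inner M f (E k) = 0" using orth[OF Sp_step(2)] l2_inner_commute[of M f "E k"] by simp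
    then show ?case using Sp_step f
      by (auto simp: l2_inner_add_right l2_inner_cmult_right intro!: L2_intros E_L2)
        (simp add: l2_inner_add_right l2_inner_cmult_right L2_intros E_L2)
  qed (simp add: L2_zero)
  have mult: "multiplier (\<lambda>x. of_real (p (\<Phi> x)))" if "real_polynomial_function p" for p
    using that
  proof (induction p rule: real_polynomial_function.induct)
    case (linear p)
    interpret p: bounded_linear p by fact
    have "p (\<Phi> x) = (\<Sum>b\<in>Basis. (\<Phi> x \<bullet> b) * p b)" for x
      by (subst euclidean_representation[of "\<Phi> x", symmetric]) (simp add: p.sum p.scaleR)
    moreover have "multiplier (\<lambda>x. of_real (\<Phi> x \<bullet> b))" if "b \<in> Basis" for b
    proof -
      \<comment> \<open>The real basis of the target consists of real and imaginary unit vectors in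
        each coordinate, so the components of \<Phi> are real and imaginary parts of \<phi>.\<close>
      from that obtain i u where "b = axis i u" "u = 1 \<or> u = \<i>" by (auto simp: Basis_vec_def Basis_complex_def)
      then have "(\<forall>x. \<Phi> x \<bullet> b = Re (\<phi> (x $ i))) \<or> (\<forall>x. \<Phi> x \<bullet> b = Im (\<phi> (x $ i)))"
        by (auto simp: inner_axis \<Phi>_def inner_complex_def)
      then show ?thesis
        using multiplier_coordinate[of "\<lambda>t. of_real (Re (\<phi> t))" i] Re
          multiplier_coordinate[of "\<lambda>t. of_real (Im (\<phi> t))" i] Im by auto
    qed
    then have "multiplier (\<lambda>x. \<Sum>b\<in>Basis. of_real (\<Phi> x \<bullet> b) * of_real (p b))"
      by (intro multiplier_sum multiplier_mult multiplier_const) auto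
    ultimately show ?case by simp
  next
    case (const c)
    show ?case by (rule multiplier_const)
  next
    case (add p q)
    then show ?case using multiplier_add by simp
  next
    case (mult p q)
    then show ?case using multiplier_mult by simp
  qed
  have "AE x in M. cnj (f x) * E k x = 0"
  proof (rule AE_zero_of_polynomials)
    show "continuous_on UNIV \<Phi>"
      unfolding \<Phi>_def by (intro continuous_on_vec_lambda continuous_on_compose2[OF \<phi>] continuous_intros) auto
    show "x = y" if x: "x \<in> \<Omega>" and y: "y \<in> cbox (\<chi> i. - L/2) (\<chi> i. L/2)" and eq: "\<Phi> x = \<Phi> y" for x y
    proof -
      have "x $ i = y $ i" for i
      proof (rule inj)
        show "\<phi> (x $ i) = \<phi> (y $ i)" using arg_cong[OF eq, of "\<lambda>v. v $ i"] by (simp add: \<Phi>_def)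
      qed (use x y in \<open>auto simp: cube_def mem_box_cart\<close>)
      then show ?thesis by (simp add: vec_eq_iff)
    qed
    obtain C where C: "\<And>x. x \<in> \<Omega> \<Longrightarrow> norm (E k x) \<le> C"
      using continuous_bounded_cube[OF smooth_C1(2)[OF smooth_E]] by blast
    have "(\<lambda>x. E k x * cnj (f x)) \<in> L2 M"
      by (rule L2_bounded_mult[of _ _ _ C]) (use C in \<open>auto intro: L2_cnj f L2_measurable E_L2\<close>)
    then show "(\<lambda>x. cnj (f x) * E k x) \<in> L2 M" by (simp add: mult.commute)
    fix p :: "complex^'n \<Rightarrow> real" assume "real_polynomial_function p"
    from mult[OF this] have "(\<lambda>x. E k x * of_real (p (\<Phi> x))) \<in> Sp" using k by (simp add: multiplier_def)
    then have "l2_inner M f (\<lambda>x. E k x * of_real (p (\<Phi> x))) = 0" using SpL2 by blast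
    then show "(LINT x|M. cnj (f x) * E k x * of_real (p (\<Phi> x))) = 0"
      unfolding l2_inner_def by (simp add: mult.assoc)
  qed
  moreover have "AE x in M. E k x \<noteq> 0"
    by (rule AE_I2) (auto simp: E_def tensor_def k_def cube_def k0)
  ultimately show ?thesis by eventually_elim auto
qed

end

section \<open>The Schroedinger form\<close>

text \<open>The form domain enters as a W^{1,2}-closed subspace. Stability under conjugation is what
  will give real eigenfunctions, and B bounds the potential at every point.\<close>

locale form_space = cube_domain L dim
  for L :: real and dim :: "'n::finite itself" +
  fixes Dm :: "(real^'n \<Rightarrow> complex) set" and V :: "real^'n \<Rightarrow> real" and B :: real
  assumes Dm_H1: "Dm \<subseteq> H1"
    and Dm_linear: "\<And>u v c. u \<in> Dm \<Longrightarrow> v \<in> Dm \<Longrightarrow> (\<lambda>x. u x + c * v x) \<in> Dm"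
    and Dm_cnj: "\<And>u. u \<in> Dm \<Longrightarrow> (\<lambda>x. cnj (u x)) \<in> Dm"
    and Dm_closed: "\<And>s u. (\<And>n. s n \<in> Dm) \<Longrightarrow> u \<in> H1 \<Longrightarrow> w12_lim s u \<Longrightarrow> u \<in> Dm"
    and V_measurable: "V \<in> borel_measurable M"
    and V_bound: "\<And>x. \<bar>V x\<bar> \<le> B"
begin

abbreviation F :: "(real^'n \<Rightarrow> complex) \<Rightarrow> (real^'n \<Rightarrow> complex) \<Rightarrow> complex" where
  "F \<equiv> schroedinger_form V \<Omega>"

definition gr :: "(real^'n \<Rightarrow> complex) \<Rightarrow> real" where
  "gr u = (\<Sum>i\<in>UNIV. (l2_norm M (D i u))\<^sup>2)"

lemma gr_nonneg: "0 \<le> gr u"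
  unfolding gr_def by (intro sum_nonneg) auto

lemma W12_norm_gr: "(W12_norm \<Omega> u)\<^sup>2 = (l2_norm M u)\<^sup>2 + gr u"
  unfolding W12_norm_sq gr_def ..

lemma mult_op_L2: "u \<in> L2 M \<Longrightarrow> mult_op V u \<in> L2 M"
  unfolding mult_op_def
  by (rule L2_bounded_mult[of _ _ _ B]) (use V_measurable V_bound in auto)

lemma DmD:
  assumes "u \<in> Dm"
  shows "u \<in> H1" "u \<in> L2 M" "D i u \<in> L2 M"
  using assms Dm_H1 H1_D by blast+

lemma inner_D_linear:
  assumes "u \<in> H1" "v \<in> H1" "g \<in> L2 M"
  shows "l2_inner M g (D i (\<lambda>x. u x + c * v x)) = l2_inner M g (D i u) + c * l2_inner M g (D i v)"
proof -
  note H = H1_D[OF assms(1)] H1_D[OF assms(2)]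
  have "l2_inner M g (D i (\<lambda>x. u x + c * v x)) = l2_inner M g (\<lambda>x. D i u x + c * D i v x)"
    using H1_linear(2)[OF assms(1,2), where c=c and i=i]
    by (intro l2_inner_cong_AE) (auto intro!: L2_measurable L2_intros H assms H1_D(2) H1_linear(1))
  then show ?thesis using H assms by (simp add: l2_inner_add_right l2_inner_cmult_right L2_intros)
qed

lemma F_linear:
  assumes "u \<in> H1" "v \<in> H1" "w \<in> H1"
  shows "F w (\<lambda>x. u x + c * v x) = F w u + c * F w v"
proof -
  note H = H1_D[OF assms(1)] H1_D[OF assms(2)] H1_D[OF assms(3)]
  have "mult_op V (\<lambda>x. u x + c * v x) = (\<lambda>x. mult_op V u x + c * mult_op V v x)"
    by (auto simp: mult_op_def algebra_simps)
  then have "l2_inner M w (mult_op V (\<lambda>x. u x + c * v x)) = l2_inner M w (mult_op V u) + c * l2_inner M w (mult_op V v)"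
    using H by (simp add: l2_inner_add_right l2_inner_cmult_right L2_intros mult_op_L2)
  then show ?thesis
    unfolding schroedinger_form_def inner_D_linear[OF assms(1,2) H1_D(2)[OF assms(3)]]
    by (simp add: sum.distrib sum_distrib_left distrib_left)
qed

lemma inner_mult_op_commute: "l2_inner M v (mult_op V u) = cnj (l2_inner M u (mult_op V v))"
  unfolding l2_inner_def mult_op_def
  by (simp add: mult.commute mult.left_commute flip: Bochner_Integration.integral_cnj)

lemma F_commute: "F v u = cnj (F u v)"
proof -
  have "(\<Sum>i\<in>UNIV. l2_inner M (D i v) (D i u)) = (\<Sum>i\<in>UNIV. cnj (l2_inner M (D i u) (D i v)))"
    by (intro sum.cong refl l2_inner_commute)
  then show ?thesis
    unfolding schroedinger_form_def complex_cnj_add cnj_sum inner_mult_op_commute[of v u] by simp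
qed

lemma F_linear_left:
  assumes "u \<in> H1" "v \<in> H1" "w \<in> H1"
  shows "F (\<lambda>x. u x + c * v x) w = F u w + cnj c * F v w"
  using F_linear[OF assms, where c=c]
  by (subst (1 2 3) F_commute) simp

lemma F_cnj:
  assumes "u \<in> H1" "v \<in> H1"
  shows "F (\<lambda>x. cnj (v x)) (\<lambda>x. cnj (u x)) = cnj (F v u)"
proof -
  note H = H1_D[OF assms(1)] H1_D[OF assms(2)]
  have "l2_inner M (D i (\<lambda>x. cnj (v x))) (D i (\<lambda>x. cnj (u x))) = cnj (l2_inner M (D i v) (D i u))" for i
  proof -
    have "l2_inner M (D i (\<lambda>x. cnj (v x))) (D i (\<lambda>x. cnj (u x))) = l2_inner M (\<lambda>x. cnj (D i v x)) (\<lambda>x. cnj (D i u x))"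
      using H1_cnj(2)[OF assms(1), where i=i] H1_cnj(2)[OF assms(2), where i=i]
      by (intro l2_inner_cong_AE) (auto intro!: L2_measurable L2_cnj H H1_D(2) H1_cnj(1) assms)
    then show ?thesis by (simp add: l2_inner_cnj)
  qed
  moreover have "l2_inner M (\<lambda>x. cnj (v x)) (mult_op V (\<lambda>x. cnj (u x))) = cnj (l2_inner M v (mult_op V u))"
    unfolding l2_inner_cnj[symmetric] by (simp add: mult_op_def)
  ultimately show ?thesis unfolding schroedinger_form_def by simp
qed

text \<open>Cauchy-Schwarz for the potential term. Being two-sided, the estimate gives both the
  lower bound of the form and the equivalence of the shifted form with the W^{1,2} norm.\<close>

lemma F_self:
  assumes "u \<in> H1"
  shows "\<bar>Re (F u u) - gr u\<bar> \<le> B * (l2_norm M u)\<^sup>2"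
proof -
  note H = H1_D[OF assms]
  have B0: "B \<ge> 0" using V_bound[of undefined] by linarith
  have "Re (F u u) = gr u + Re (l2_inner M u (mult_op V u))"
    unfolding schroedinger_form_def gr_def by (simp add: l2_inner_self Re_sum del: of_real_power)
  moreover have "norm (l2_inner M u (mult_op V u)) \<le> l2_norm M u * l2_norm M (mult_op V u)"
    by (intro l2_cauchy_schwarz H mult_op_L2)
  moreover have "l2_norm M (mult_op V u) \<le> B * l2_norm M u"
  proof -
    have "l2_norm M (mult_op V u) \<le> l2_norm M (\<lambda>x. of_real B * u x)"
    proof (intro l2_norm_le_of_norm_le mult_op_L2 L2_intros H AE_I2)
      show "norm (mult_op V u x) \<le> norm (of_real B * u x)" for x
        using V_bound[of x] B0 by (simp add: mult_op_def norm_mult mult_right_mono)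
    qed
    then show ?thesis using B0 by (simp add: l2_norm_cmult)
  qed
  then have "l2_norm M u * l2_norm M (mult_op V u) \<le> l2_norm M u * (B * l2_norm M u)"
    by (intro mult_left_mono) auto
  moreover have "l2_norm M u * (B * l2_norm M u) = B * (l2_norm M u)\<^sup>2" by (simp add: power2_eq_square)
  ultimately show ?thesis using abs_Re_le_cmod[of "l2_inner M u (mult_op V u)"] by linarith
qed

lemma F_lim:
  assumes "\<And>n. s n \<in> H1" "u \<in> H1" "v \<in> H1" "w12_lim s u"
  shows "(\<lambda>n. F v (s n)) \<longlonglongrightarrow> F v u"
  unfolding schroedinger_form_def
proof (intro tendsto_add tendsto_sum)
  note lim = assms(4)[unfolded w12_lim_def]
  show "(\<lambda>n. l2_inner M (D i v) (D i (s n))) \<longlonglongrightarrow> l2_inner M (D i v) (D i u)" for i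
    using lim by (intro l2_lim_inner_right H1_D assms) blast
  have "l2_lim M (\<lambda>n. mult_op V (s n)) (mult_op V u)"
    unfolding mult_op_def
    by (rule l2_lim_bounded_mult[of _ _ _ _ B]) (use lim assms H1_D V_measurable V_bound in auto)
  then show "(\<lambda>n. l2_inner M v (mult_op V (s n))) \<longlonglongrightarrow> l2_inner M v (mult_op V u)"
    by (intro l2_lim_inner_right mult_op_L2 H1_D assms)
qed

definition H :: "((real^'n \<Rightarrow> complex) \<times> (real^'n \<Rightarrow> complex)) set" where
  "H = {(u, f). u \<in> Dm \<and> f \<in> L2 M \<and> (\<forall>v\<in>Dm. F v u = l2_inner M v f)}"

lemma symmetric_graph_H: "symmetric_graph M H"
proof
  fix u f assume uf: "(u, f) \<in> H"
  then show "u \<in> L2 M" "f \<in> L2 M" using DmD by (auto simp: H_def)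
  fix v g assume vg: "(v, g) \<in> H"
  show "l2_inner M v f = l2_inner M g u"
    using uf vg F_commute[of v u] l2_inner_commute[of M g u] by (auto simp: H_def)
  fix c
  show "(\<lambda>x. u x + c * v x, \<lambda>x. f x + c * g x) \<in> H"
    using uf vg DmD unfolding H_def
    by (auto simp: F_linear l2_inner_add_right l2_inner_cmult_right L2_intros intro!: Dm_linear L2_intros)
qed

text \<open>Weak derivatives are closed under L^2 limits, so Cauchy gradients place the limit in the
  closed domain. Serves both the closedness of \<open>H\<close> and the completeness of
  \<open>q\<close>.\<close>

lemma gr_cauchy_limit:
  assumes s: "\<And>n. s n \<in> Dm" and u: "u \<in> L2 M" "l2_lim M s u"
    and cau: "\<And>e. e > 0 \<Longrightarrow> \<exists>N. \<forall>m\<ge>N. \<forall>n\<ge>N. gr (\<lambda>x. s m x - s n x) < e"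
  shows "u \<in> Dm" "w12_lim s u"
proof -
  have sH: "s n \<in> H1" for n using s DmD by blast
  have "\<exists>g\<in>L2 M. l2_lim M (\<lambda>n. D i (s n)) g" for i
  proof (rule L2_complete)
    show "D i (s n) \<in> L2 M" for n using s DmD by blast
    fix e :: real assume e: "e > 0"
    then obtain N where N: "\<And>m n. m \<ge> N \<Longrightarrow> n \<ge> N \<Longrightarrow> gr (\<lambda>x. s m x - s n x) < e\<^sup>2"
      using cau[of "e\<^sup>2"] by auto
    have "l2_norm M (\<lambda>x. D i (s m) x - D i (s n) x) < e" if "m \<ge> N" "n \<ge> N" for m n
    proof -
      have "(l2_norm M (D i (\<lambda>x. s m x - s n x)))\<^sup>2 \<le> gr (\<lambda>x. s m x - s n x)"
        unfolding gr_def by (rule member_le_sum) auto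
      also have "\<dots> < e\<^sup>2" by (rule N[OF that])
      finally have "l2_norm M (D i (\<lambda>x. s m x - s n x)) < e"
        by (rule power2_less_imp_less) (use e in auto)
      then show ?thesis unfolding l2_norm_D_diff[OF sH sH] .
    qed
    then show "\<exists>N. \<forall>m\<ge>N. \<forall>n\<ge>N. l2_norm M (\<lambda>x. D i (s m) x - D i (s n) x) < e" by blast
  qed
  then obtain g where g: "\<And>i. g i \<in> L2 M" "\<And>i. l2_lim M (\<lambda>n. D i (s n)) (g i)" by metis
  have uH: "u \<in> H1" by (rule H1_lim[OF sH u(1) g(1) u(2) g(2)])
  have AE: "AE x in M. D i u x = g i x" for i by (rule H1_lim(2)[OF sH u(1) g(1) u(2) g(2)])
  show "w12_lim s u"
    unfolding w12_lim_def
  proof (intro conjI allI u(2))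
    fix i
    have "l2_norm M (\<lambda>x. D i (s n) x - D i u x) = l2_norm M (\<lambda>x. D i (s n) x - g i x)" for n
    proof (rule l2_norm_cong_AE)
      show "AE x in M. D i (s n) x - D i u x = D i (s n) x - g i x" using AE[of i] by eventually_elim simp
    qed (intro L2_measurable L2_diff H1_D sH uH g)+
    then show "l2_lim M (\<lambda>n. D i (s n)) (D i u)" using g(2)[of i] unfolding l2_lim_def by simp
  qed
  then show "u \<in> Dm" by (rule Dm_closed[of s u, OF s uH])
qed

lemma gr_le_of_H:
  assumes "(u, f) \<in> H"
  shows "gr u \<le> l2_norm M u * l2_norm M f + B * (l2_norm M u)\<^sup>2"
proof -
  from assms have u: "u \<in> H1" "u \<in> L2 M" and f: "f \<in> L2 M" and eq: "F u u = l2_inner M u f"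
    using DmD by (auto simp: H_def)
  have "Re (F u u) \<le> l2_norm M u * l2_norm M f"
    using l2_cauchy_schwarz[OF u(2) f] complex_Re_le_cmod[of "F u u"] unfolding eq by linarith
  then show ?thesis using F_self[OF u(1)] by linarith
qed

text \<open>Differences of pairs in the graph are again in the graph, so \<open>gr_le_of_H\<close>
  bounds the gradient of s m - s n by L^2 distances; graph convergence thus implies W^{1,2}
  convergence, under which the form is continuous.\<close>

lemma H_closed:
  assumes st: "\<And>n. (s n, t n) \<in> H" and u: "u \<in> L2 M" and f: "f \<in> L2 M"
    and lim: "l2_lim M s u" "l2_lim M t f"
  shows "(u, f) \<in> H"
proof -
  interpret symmetric_graph M H by (rule symmetric_graph_H)
  have sD: "s n \<in> Dm" and tL: "t n \<in> L2 M" for n using st[of n] by (auto simp: H_def)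
  have sL: "s n \<in> L2 M" for n using sD DmD by blast
  define a where "a n = l2_norm M (\<lambda>x. s n x - u x)" for n
  define c where "c n = l2_norm M (\<lambda>x. t n x - f x)" for n
  have a0: "a \<longlonglongrightarrow> 0" using lim(1) unfolding l2_lim_def a_def .
  have c0: "c \<longlonglongrightarrow> 0" using lim(2) unfolding l2_lim_def c_def .
  have gr: "gr (\<lambda>x. s m x - s n x) \<le> (a m + a n) * (c m + c n) + B * (a m + a n)\<^sup>2" for m n
  proof -
    have "(\<lambda>x. s m x + (-1) * s n x, \<lambda>x. t m x + (-1) * t n x) \<in> H" by (rule H_add[OF st st])
    then have H: "(\<lambda>x. s m x - s n x, \<lambda>x. t m x - t n x) \<in> H" by simp
    have 1: "l2_norm M (\<lambda>x. s m x - s n x) \<le> a m + a n"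
      using l2_norm_triangle_diff[OF sL u sL, of m n] unfolding a_def l2_norm_minus_commute[of M u] .
    have 2: "l2_norm M (\<lambda>x. t m x - t n x) \<le> c m + c n"
      using l2_norm_triangle_diff[OF tL f tL, of m n] unfolding c_def l2_norm_minus_commute[of M f] .
    have B0: "B \<ge> 0" using V_bound[of undefined] by linarith
    have "0 \<le> a m + a n" using l2_norm_nonneg order_trans[OF l2_norm_nonneg 1] by blast
    then have "l2_norm M (\<lambda>x. s m x - s n x) * l2_norm M (\<lambda>x. t m x - t n x) \<le> (a m + a n) * (c m + c n)"
      using 1 2 by (intro mult_mono) auto
    moreover have "B * (l2_norm M (\<lambda>x. s m x - s n x))\<^sup>2 \<le> B * (a m + a n)\<^sup>2"
      using 1 B0 by (intro mult_left_mono power_mono) auto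
    ultimately show ?thesis using gr_le_of_H[OF H] by linarith
  qed
  have uD: "u \<in> Dm" and w: "w12_lim s u"
  proof -
    have cau: "\<exists>N. \<forall>m\<ge>N. \<forall>n\<ge>N. gr (\<lambda>x. s m x - s n x) < e" if e: "e > 0" for e
    proof -
      \<comment> \<open>The bound becomes 4 d^2 + 4 B d^2, which is at most (4 + 4 B) d because d
        \<le> 1, hence at most e / 2.\<close>
      define d where "d = min 1 (e / (8 + 8 * B))"
      have B0: "B \<ge> 0" using V_bound[of undefined] by linarith
      have p: "8 + 8 * B > 0" using B0 by linarith
      have "d \<le> e / (8 + 8 * B)" by (simp add: d_def)
      then have "d * (8 + 8 * B) \<le> e" unfolding pos_le_divide_eq[OF p] .
      then have d: "d > 0" "d \<le> 1" "8 * d + 8 * (B * d) \<le> e"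
        using e p by (simp_all add: d_def algebra_simps)
      obtain N1 N2 where N1: "\<And>n. n \<ge> N1 \<Longrightarrow> a n < d" and N2: "\<And>n. n \<ge> N2 \<Longrightarrow> c n < d"
        using order_tendstoD(2)[OF a0 d(1)] order_tendstoD(2)[OF c0 d(1)] unfolding eventually_sequentially by blast
      have "gr (\<lambda>x. s m x - s n x) < e" if "m \<ge> max N1 N2" "n \<ge> max N1 N2" for m n
      proof -
        have p: "0 \<le> a m" "0 \<le> a n" "0 \<le> c m" "0 \<le> c n" by (auto simp: a_def c_def)
        have s: "a m + a n \<le> 2 * d" "c m + c n \<le> 2 * d"
          using N1[of m] N1[of n] N2[of m] N2[of n] that by auto
        have "(a m + a n) * (c m + c n) \<le> (2 * d) * (2 * d)" using s p d by (intro mult_mono) auto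
        moreover have "B * (a m + a n)\<^sup>2 \<le> B * (2 * d)\<^sup>2" using s p B0 by (intro mult_left_mono power_mono) auto
        moreover have "d * d \<le> d" using d by (simp add: mult_left_le)
        moreover have "B * (d * d) \<le> B * d" using \<open>d * d \<le> d\<close> B0 by (rule mult_left_mono)
        moreover have "B * d \<ge> 0" using B0 d by simp
        moreover have "(2 * d) * (2 * d) = 4 * (d * d)" "B * (2 * d)\<^sup>2 = 4 * (B * (d * d))"
          by (simp_all add: power2_eq_square)
        ultimately show ?thesis using gr[of m n] d by linarith
      qed
      then show ?thesis by blast
    qed
    show "u \<in> Dm" by (rule gr_cauchy_limit(1)[OF sD u lim(1)]) (rule cau)
    show "w12_lim s u" by (rule gr_cauchy_limit(2)[OF sD u lim(1)]) (rule cau)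
  qed
  have "F v u = l2_inner M v f" if v: "v \<in> Dm" for v
  proof -
    have "(\<lambda>n. F v (s n)) \<longlonglongrightarrow> F v u" by (rule F_lim[OF _ _ _ w]) (use DmD sD uD v in blast)+
    moreover have "F v (s n) = l2_inner M v (t n)" for n using st[of n] v by (auto simp: H_def)
    moreover have "(\<lambda>n. l2_inner M v (t n)) \<longlonglongrightarrow> l2_inner M v f"
      by (rule l2_lim_inner_right) (use tL f DmD(2)[OF v] lim in auto)
    ultimately show ?thesis by (simp add: LIMSEQ_unique)
  qed
  then show ?thesis using uD f by (simp add: H_def)
qed

end

section \<open>Eigenbases of Schroedinger operators\<close>

text \<open>The variational part is formulated over a real vector space, and pointwise scaling makes
  the function space one.\<close>

instantiation "fun" :: (type, real_vector) real_vector
begin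

definition scaleR_fun :: "real \<Rightarrow> ('a \<Rightarrow> 'b) \<Rightarrow> 'a \<Rightarrow> 'b" where
  "scaleR_fun r f = (\<lambda>x. r *\<^sub>R f x)"

instance
  by standard (auto simp: scaleR_fun_def fun_eq_iff scaleR_add_right scaleR_add_left)

end

lemma sum_fun_eq: "(\<Sum>i\<in>J. f i) = (\<lambda>x. \<Sum>i\<in>J. f i x)"
  by (induction J rule: infinite_finite_induct) (auto simp: fun_eq_iff)

context form_space
begin

lemma gr_add_le:
  assumes "u \<in> H1" "v \<in> H1"
  shows "gr (\<lambda>x. u x - v x) \<le> 2 * gr u + 2 * gr v"
proof -
  have "(l2_norm M (D i (\<lambda>x. u x - v x)))\<^sup>2 \<le> 2 * (l2_norm M (D i u))\<^sup>2 + 2 * (l2_norm M (D i v))\<^sup>2" for i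
  proof -
    have "(l2_norm M (\<lambda>x. D i u x + (-1) * D i v x))\<^sup>2 \<le> 2 * (l2_norm M (D i u))\<^sup>2 + 2 * (l2_norm M (\<lambda>x. (-1) * D i v x))\<^sup>2"
      by (intro l2_norm_sq_add_le L2_intros H1_D assms)
    then show ?thesis unfolding l2_norm_D_diff[OF assms] l2_norm_cmult by simp
  qed
  then have "gr (\<lambda>x. u x - v x) \<le> (\<Sum>i\<in>UNIV. 2 * (l2_norm M (D i u))\<^sup>2 + 2 * (l2_norm M (D i v))\<^sup>2)"
    unfolding gr_def by (intro sum_mono)
  then show ?thesis by (simp add: gr_def sum.distrib sum_distrib_left)
qed

section \<open>The real-valued part of the form domain and the shifted form\<close>

lemma Dm_cmult: "u \<in> Dm \<Longrightarrow> (\<lambda>x. c * u x) \<in> Dm"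
  using Dm_linear[of u u "c - 1"] by (simp add: algebra_simps)

definition re :: "(real^'n \<Rightarrow> complex) \<Rightarrow> real^'n \<Rightarrow> complex" where
  "re u = (\<lambda>x. of_real (Re (u x)))"
definition im :: "(real^'n \<Rightarrow> complex) \<Rightarrow> real^'n \<Rightarrow> complex" where
  "im u = (\<lambda>x. of_real (Im (u x)))"
text \<open>A real subspace whose members remain complex functions, so that inner products and forms
  apply to them unchanged. Reality is required at every point, not just almost everywhere.\<close>

definition X :: "(real^'n \<Rightarrow> complex) set" where
  "X = {u \<in> Dm. \<forall>x. cnj (u x) = u x}"

lemma X_Dm: "u \<in> X \<Longrightarrow> u \<in> Dm" and X_cnj: "u \<in> X \<Longrightarrow> cnj (u x) = u x"
  by (auto simp: X_def)

lemma re_im: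
  assumes "u \<in> Dm"
  shows "re u \<in> X" "im u \<in> X" "u = (\<lambda>x. re u x + \<i> * im u x)"
proof -
  have "(\<lambda>x. (1/2) * (u x + 1 * cnj (u x))) \<in> Dm"
    by (intro Dm_cmult Dm_linear Dm_cnj assms)
  moreover have "(\<lambda>x. (1/2) * (u x + 1 * cnj (u x))) = re u"
    by (auto simp: re_def complex_eq_iff)
  ultimately show "re u \<in> X" by (simp add: X_def) (simp add: re_def)
  have "(\<lambda>x. (- \<i>/2) * (u x + (-1) * cnj (u x))) \<in> Dm"
    by (intro Dm_cmult Dm_linear Dm_cnj assms)
  moreover have "(\<lambda>x. (- \<i>/2) * (u x + (-1) * cnj (u x))) = im u"
    by (auto simp: im_def complex_eq_iff)
  ultimately show "im u \<in> X" by (simp add: X_def) (simp add: im_def)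
  show "u = (\<lambda>x. re u x + \<i> * im u x)" by (rule ext) (simp add: re_def im_def complex_eq_iff)
qed

lemma X_real:
  assumes "u \<in> X" "v \<in> X"
  shows "cnj (l2_inner M u v) = l2_inner M u v" "cnj (F u v) = F u v"
proof -
  have eq: "(\<lambda>x. cnj (u x)) = u" "(\<lambda>x. cnj (v x)) = v" using assms by (auto simp: X_def)
  show "cnj (l2_inner M u v) = l2_inner M u v" using l2_inner_cnj[of M u v] unfolding eq by simp
  show "cnj (F u v) = F u v" using F_cnj[of v u] assms DmD X_Dm unfolding eq by metis
qed

lemma X_real': 
  assumes "u \<in> X" "v \<in> X"
  shows "l2_inner M u v = of_real (Re (l2_inner M u v))" "F u v = of_real (Re (F u v))"
  using X_real[OF assms] by (auto simp: complex_eq_iff)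

definition b :: "(real^'n \<Rightarrow> complex) \<Rightarrow> (real^'n \<Rightarrow> complex) \<Rightarrow> real" where
  "b u v = Re (l2_inner M u v)"
text \<open>The shift by B absorbs the potential, and the additional 1 makes q dominate b and the
  full W^{1,2} norm.\<close>

definition q :: "(real^'n \<Rightarrow> complex) \<Rightarrow> (real^'n \<Rightarrow> complex) \<Rightarrow> real" where
  "q u v = Re (F u v) + (B + 1) * b u v"

lemma b_self: "b u u = (l2_norm M u)\<^sup>2"
  unfolding b_def l2_inner_self by simp

lemma q_ge: "u \<in> Dm \<Longrightarrow> gr u + b u u \<le> q u u"
  and q_le: "u \<in> Dm \<Longrightarrow> q u u \<le> (2 * B + 1) * (W12_norm \<Omega> u)\<^sup>2"
proof -
  assume u: "u \<in> Dm"
  have B0: "B \<ge> 0" using V_bound[of undefined] by linarith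
  note * = F_self[OF DmD(1)[OF u]]
  show "gr u + b u u \<le> q u u" using * unfolding q_def b_self by (simp add: algebra_simps)
  have "q u u \<le> gr u + (2 * B + 1) * (l2_norm M u)\<^sup>2" using * unfolding q_def b_self by (simp add: algebra_simps)
  also have "\<dots> \<le> (2 * B + 1) * gr u + (2 * B + 1) * (l2_norm M u)\<^sup>2"
    using mult_right_mono[of 1 "2 * B + 1" "gr u"] B0 gr_nonneg[of u] by simp
  finally show "q u u \<le> (2 * B + 1) * (W12_norm \<Omega> u)\<^sup>2" unfolding W12_norm_gr by (simp add: algebra_simps)
qed

lemma fun_vector_simps:
  fixes u v :: "real^'n \<Rightarrow> complex"
  shows "u + v = (\<lambda>x. u x + 1 * v x)" "u - v = (\<lambda>x. u x - v x)" "r *\<^sub>R u = (\<lambda>x. of_real r * u x)"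
  by (auto simp: scaleR_fun_def fun_eq_iff scaleR_conv_of_real)

lemma subspace_X:
  assumes "Dm \<noteq> {}"
  shows "subspace X"
  unfolding subspace_def
proof (intro conjI ballI allI)
  from assms obtain u where "u \<in> Dm" by blast
  then show "0 \<in> X" using Dm_cmult[of u 0] by (simp add: X_def zero_fun_def)
  fix u v and r :: real assume u: "u \<in> X"
  show "r *\<^sub>R u \<in> X" using u unfolding fun_vector_simps X_def by (auto intro: Dm_cmult)
  assume v: "v \<in> X"
  show "u + v \<in> X" using u v Dm_linear[of u v 1] unfolding fun_vector_simps X_def by auto
qed

lemma psd_form_b:
  assumes "Dm \<noteq> {}"
  shows "psd_form X b"
proof
  show "subspace X" by (rule subspace_X[OF assms])
  fix u v w :: "real^'n \<Rightarrow> complex" and r :: real assume u: "u \<in> X" and w: "w \<in> X"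
  note L = DmD(2)[OF X_Dm]
  show "b (r *\<^sub>R u) w = r * b u w" unfolding b_def fun_vector_simps l2_inner_cmult_left by simp
  show "0 \<le> b u u" unfolding b_self by simp
  assume v: "v \<in> X"
  show "b (u + v) w = b u w + b v w"
    unfolding b_def fun_vector_simps using L[OF u] L[OF v] L[OF w] by (simp add: l2_inner_add_left)
  show "b u v = b v u" unfolding b_def using l2_inner_commute[of M u v] by simp
qed

lemma psd_form_q:
  assumes "Dm \<noteq> {}"
  shows "psd_form X q"
proof -
  interpret b: psd_form X b by (rule psd_form_b[OF assms])
  show ?thesis
  proof
    fix u v w :: "real^'n \<Rightarrow> complex" and r :: real assume u: "u \<in> X" and w: "w \<in> X"
    note H = DmD(1)[OF X_Dm]
    have 0: "(\<lambda>x. 0) \<in> H1" by (rule H1_smooth(1)[OF smooth_zero])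
    have F0: "F w (\<lambda>x. 0) = 0" if "w \<in> H1" for w
      using F_linear[OF 0 0 that, where c="-1"] F_linear[OF 0 0 that, where c=1] by simp
    have "F (\<lambda>x. of_real r * u x) w = of_real r * F u w"
      using F_linear_left[OF 0 H[OF u] H[OF w], where c="of_real r"] F_commute[of "\<lambda>x. 0" w] F0[OF H[OF w]] by simp
    then show "q (r *\<^sub>R u) w = r * q u w"
      unfolding q_def b.scale_left[OF u w] unfolding fun_vector_simps by (simp add: algebra_simps)
    have "0 \<le> gr u + b u u" using gr_nonneg b.nonneg[OF u] by (simp add: add_nonneg_nonneg)
    then show "0 \<le> q u u" using q_ge[OF X_Dm[OF u]] by linarith
    assume v: "v \<in> X"
    show "q (u + v) w = q u w + q v w"
      unfolding q_def b.add_left[OF u v w] unfolding fun_vector_simps F_linear_left[OF H[OF u] H[OF v] H[OF w]]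
      by (simp add: algebra_simps)
    show "q u v = q v u" unfolding q_def b.sym[OF u v] using F_commute[of u v] by simp
  qed (rule b.sub)
qed

text \<open>A limit of real-valued functions may be represented by a function that is not real at
  every point, so the limit is replaced by its real part, which is a limit of the same
  sequence.\<close>

lemma q_complete:
  assumes s: "\<And>n. s n \<in> X" and cau: "\<And>e. e > 0 \<Longrightarrow> \<exists>N. \<forall>m\<ge>N. \<forall>n\<ge>N. q (s m - s n) (s m - s n) < e"
  shows "\<exists>u\<in>X. (\<lambda>n. q (s n - u) (s n - u)) \<longlonglongrightarrow> 0"
proof -
  have sD: "s n \<in> Dm" for n using s X_Dm by blast
  have dD: "(\<lambda>x. s m x - s n x) \<in> Dm" for m n using Dm_linear[OF sD sD, of m "-1" n] by simp
  have "\<exists>u\<in>L2 M. l2_lim M s u"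
  proof (rule L2_complete)
    show "s n \<in> L2 M" for n using sD DmD by blast
    fix e :: real assume e: "e > 0"
    then obtain N where N: "\<And>m n. m \<ge> N \<Longrightarrow> n \<ge> N \<Longrightarrow> q (\<lambda>x. s m x - s n x) (\<lambda>x. s m x - s n x) < e\<^sup>2"
      using cau[of "e\<^sup>2"] unfolding fun_vector_simps by auto
    have "l2_norm M (\<lambda>x. s m x - s n x) < e" if "m \<ge> N" "n \<ge> N" for m n
    proof (rule power2_less_imp_less)
      show "(l2_norm M (\<lambda>x. s m x - s n x))\<^sup>2 < e\<^sup>2"
        using N[OF that] q_ge[OF dD, of m n] gr_nonneg[of "\<lambda>x. s m x - s n x"] unfolding b_self by linarith
    qed (use e in simp)
    then show "\<exists>N. \<forall>m\<ge>N. \<forall>n\<ge>N. l2_norm M (\<lambda>x. s m x - s n x) < e" by blast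
  qed
  then obtain u where u: "u \<in> L2 M" "l2_lim M s u" by blast
  have cau': "\<exists>N. \<forall>m\<ge>N. \<forall>n\<ge>N. gr (\<lambda>x. s m x - s n x) < e" if "e > 0" for e
  proof -
    from cau[OF that] obtain N where N: "\<And>m n. m \<ge> N \<Longrightarrow> n \<ge> N \<Longrightarrow> q (\<lambda>x. s m x - s n x) (\<lambda>x. s m x - s n x) < e"
      unfolding fun_vector_simps by auto
    have "gr (\<lambda>x. s m x - s n x) < e" if "m \<ge> N" "n \<ge> N" for m n
      using N[OF that] q_ge[OF dD, of m n] zero_le_power2[of "l2_norm M (\<lambda>x. s m x - s n x)"] unfolding b_self by linarith
    then show ?thesis by blast
  qed
  have uD: "u \<in> Dm" by (rule gr_cauchy_limit(1)[OF sD u]) (rule cau')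
  have lim: "w12_lim s u" by (rule gr_cauchy_limit(2)[OF sD u]) (rule cau')
  have sH: "s n \<in> H1" and uH: "u \<in> H1" for n using sD uD DmD by blast+
  have scnj: "(\<lambda>x. cnj (s n x)) = s n" for n using X_cnj[OF s] by auto
  have "w12_lim (\<lambda>n x. cnj (s n x)) (\<lambda>x. cnj (u x))" by (rule w12_lim_cnj[OF sH uH lim])
  then have limc: "w12_lim s (\<lambda>x. cnj (u x))" unfolding scnj .
  have cH: "(\<lambda>x. cnj (u x)) \<in> H1" by (rule H1_cnj(1)[OF uH])
  have d: "w12_lim (\<lambda>n x. s n x + (-1) * s n x) (\<lambda>x. cnj (u x) + (-1) * u x)"
    by (rule w12_lim_linear[OF sH sH cH uH limc lim])
  \<comment> \<open>re u is u plus half of cnj u - u, and the latter is a limit of zeros, because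
    the conjugate of u is a limit of the same real sequence.\<close>
  have "w12_lim (\<lambda>n x. s n x + (1/2) * (s n x + (-1) * s n x)) (\<lambda>x. u x + (1/2) * (cnj (u x) + (-1) * u x))"
    by (rule w12_lim_linear[OF sH H1_linear(1)[OF sH sH] uH H1_linear(1)[OF cH uH] lim d])
  moreover have "(\<lambda>x. u x + (1/2) * (cnj (u x) + (-1) * u x)) = re u"
    by (rule ext) (simp add: re_def complex_eq_iff)
  ultimately have "w12_lim s (re u)" by simp
  moreover have rX: "re u \<in> X" by (rule re_im[OF uD])
  moreover have rH: "re u \<in> H1" using rX X_Dm DmD by blast
  ultimately have W: "(\<lambda>n. W12_norm \<Omega> (\<lambda>x. re u x - s n x)) \<longlonglongrightarrow> 0"
    using w12_lim_iff[of s "re u"] sH by blast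
  have dX: "(\<lambda>x. s n x - re u x) \<in> Dm" for n using Dm_linear[OF sD[of n] X_Dm[OF rX], of "-1"] by simp
  have "(\<lambda>n. q (s n - re u) (s n - re u)) \<longlonglongrightarrow> 0"
  proof (rule tendsto_sandwich[OF _ _ tendsto_const])
    show "\<forall>\<^sub>F n in sequentially. 0 \<le> q (s n - re u) (s n - re u)"
    proof (intro always_eventually allI)
      fix n
      show "0 \<le> q (s n - re u) (s n - re u)"
        using q_ge[OF dX[of n]] gr_nonneg[of "\<lambda>x. s n x - re u x"] zero_le_power2[of "l2_norm M (\<lambda>x. s n x - re u x)"]
        unfolding b_self fun_vector_simps by linarith
    qed
    show "\<forall>\<^sub>F n in sequentially. q (s n - re u) (s n - re u) \<le> (2 * B + 1) * (W12_norm \<Omega> (\<lambda>x. re u x - s n x))\<^sup>2"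
      unfolding fun_vector_simps using q_le[OF dX] W12_norm_diff_commute[OF rH sH]
      by (intro always_eventually allI) simp
    show "(\<lambda>n. (2 * B + 1) * (W12_norm \<Omega> (\<lambda>x. re u x - s n x))\<^sup>2) \<longlonglongrightarrow> 0"
    proof (rule tendsto_mult_right_zero)
      show "(\<lambda>n. (W12_norm \<Omega> (\<lambda>x. re u x - s n x))\<^sup>2) \<longlonglongrightarrow> 0"
        using tendsto_power[OF W, of 2] unfolding zero_power2 .
    qed
  qed
  then show ?thesis using rX by blast
qed

end

text \<open>\<open>form_id\<close> is Green's formula without boundary term: u vanishes on the
  boundary (Dirichlet), the normal derivative of the mode does (Neumann), or opposite faces cancel
  (periodic).\<close>

locale form_basis = trig L dim I e e' \<mu> + form_space L dim Dm V B
  for L :: real and dim :: "'n::finite itself" and I e e' \<mu> Dm V B +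
  assumes E_Dm: "\<And>k. k \<in> K \<Longrightarrow> E k \<in> Dm"
    and form_id: "\<And>u k i. u \<in> Dm \<Longrightarrow> k \<in> K \<Longrightarrow> l2_inner M (D i u) (E1 i k) = of_real (\<mu> (k i)) * l2_inner M u (E k)"
    and E_total: "\<And>f. f \<in> L2 M \<Longrightarrow> (\<And>k. k \<in> K \<Longrightarrow> l2_inner M (E k) f = 0) \<Longrightarrow> AE x in M. f x = 0"
begin

definition kn :: "nat \<Rightarrow> 'n \<Rightarrow> int" where "kn = from_nat_into K"

lemma bij_kn: "bij_betw kn UNIV K"
  unfolding kn_def by (rule bij_betw_from_nat_into) (auto simp: infinite_K)

lemma kn_K: "kn n \<in> K"
  using bij_kn by (auto simp: bij_betw_def)

lemma kn_eq_iff: "kn m = kn n \<longleftrightarrow> m = n"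
  using bij_kn by (auto simp: bij_betw_def inj_on_def)

sublocale en: orthonormal_seq M "\<lambda>n. E (kn n)"
  by standard (auto simp: E_L2 inner_E kn_K kn_eq_iff)

lemma en_basis: "l2_basis M (\<lambda>n. E (kn n))"
  unfolding l2_basis_iff
proof (rule en.orthonormal_basis_of_total)
  fix f assume f: "f \<in> L2 M" and "\<And>n. l2_inner M (E (kn n)) f = 0"
  then have "l2_inner M (E k) f = 0" if "k \<in> K" for k
    using that bij_kn unfolding bij_betw_def by (metis imageE)
  from E_total[OF f this] show "l2_norm M f = 0" using l2_norm_eq_0_iff[OF f] by blast
qed

sublocale en: l2_basis M "\<lambda>n. E (kn n)"
  by (rule en_basis)

abbreviation c :: "nat \<Rightarrow> (real^'n \<Rightarrow> complex) \<Rightarrow> complex" where "c n u \<equiv> l2_inner M (E (kn n)) u"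

lemma finite_ln: "finite {n. lam (kn n) \<le> C}"
proof -
  have "kn ` {n. lam (kn n) \<le> C} \<subseteq> {k \<in> K. lam k \<le> C}" using kn_K by auto
  then have "finite (kn ` {n. lam (kn n) \<le> C})" using finite_lam finite_subset by blast
  then show ?thesis by (rule finite_imageD) (auto simp: inj_on_def kn_eq_iff)
qed

lemma E1_norm: "(l2_norm M (E1 i (kn n)))\<^sup>2 = \<mu> (kn n i)"
  and E2_norm: "(l2_norm M (E2 j i (kn n)))\<^sup>2 = \<mu> (kn n i) * \<mu> (kn n j)"
proof -
  have "complex_of_real ((l2_norm M (E1 i (kn n)))\<^sup>2) = of_real (\<mu> (kn n i))"
    unfolding l2_inner_self[symmetric] by (simp add: inner_E1 kn_K)
  then show "(l2_norm M (E1 i (kn n)))\<^sup>2 = \<mu> (kn n i)" using of_real_eq_iff by blast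
  have "complex_of_real ((l2_norm M (E2 j i (kn n)))\<^sup>2) = of_real (\<mu> (kn n i) * \<mu> (kn n j))"
    unfolding l2_inner_self[symmetric] by (simp add: inner_E2 kn_K)
  then show "(l2_norm M (E2 j i (kn n)))\<^sup>2 = \<mu> (kn n i) * \<mu> (kn n j)" using of_real_eq_iff by blast
qed

lemma E1_orth: "m \<noteq> n \<Longrightarrow> l2_inner M (E1 i (kn m)) (E1 i (kn n)) = 0"
  and E2_orth: "m \<noteq> n \<Longrightarrow> l2_inner M (E2 j i (kn m)) (E2 j i (kn n)) = 0"
  by (simp_all add: inner_E1 inner_E2 kn_K kn_eq_iff)

text \<open>Bessel's inequality for D i u and the orthogonal system \<open>E1 i\<close>. Green's
  formula expresses the pairings by the coefficients of u, and comparing D i u with a finite sum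
  involves no division by \<mu>, which may be zero.\<close>

lemma gradient_bessel:
  assumes u: "u \<in> Dm" and J: "finite J"
  shows "(\<Sum>n\<in>J. lam (kn n) * (norm (c n u))\<^sup>2) \<le> gr u"
proof -
  have *: "(\<Sum>n\<in>J. \<mu> (kn n i) * (norm (c n u))\<^sup>2) \<le> (l2_norm M (D i u))\<^sup>2" for i
  proof -
    \<comment> \<open>The candidate for the i-th derivative of the partial sum of u; its squared
      norm equals its pairing with D i u.\<close>
    define S where "S x = (\<Sum>n\<in>J. c n u * E1 i (kn n) x)" for x
    have S: "S \<in> L2 M" unfolding S_def by (intro L2_intros E1_L2)
    note Du = DmD(3)[OF u]
    have n: "(l2_norm M S)\<^sup>2 = (\<Sum>n\<in>J. \<mu> (kn n i) * (norm (c n u))\<^sup>2)"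
      unfolding S_def by (subst l2_norm_sq_orthogonal_sum[OF E1_L2 E1_orth J]) (simp_all add: E1_norm mult.commute)
    have "l2_inner M (D i u) S = (\<Sum>n\<in>J. c n u * (of_real (\<mu> (kn n i)) * l2_inner M u (E (kn n))))"
      unfolding S_def using Du
      by (subst l2_inner_sum_right) (auto simp: l2_inner_cmult_right form_id[OF u kn_K] intro!: L2_intros E1_L2)
    also have "\<dots> = (\<Sum>n\<in>J. of_real (\<mu> (kn n i) * (norm (c n u))\<^sup>2))"
      unfolding l2_inner_commute[of M u "E _"] of_real_mult complex_norm_square
      by (intro sum.cong refl) (simp add: mult.left_commute)
    finally have "Re (l2_inner M (D i u) S) = (\<Sum>n\<in>J. \<mu> (kn n i) * (norm (c n u))\<^sup>2)"
      by (simp only: Re_sum Re_complex_of_real)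
    moreover have "0 \<le> (l2_norm M (\<lambda>x. D i u x - S x))\<^sup>2" by simp
    ultimately show ?thesis unfolding l2_norm_sq_diff[OF Du S] n by linarith
  qed
  have "(\<Sum>n\<in>J. lam (kn n) * (norm (c n u))\<^sup>2) = (\<Sum>i\<in>UNIV. \<Sum>n\<in>J. \<mu> (kn n i) * (norm (c n u))\<^sup>2)"
    unfolding lam_def sum_distrib_right by (rule sum.swap)
  also have "\<dots> \<le> gr u" unfolding gr_def by (intro sum_mono *)
  finally show ?thesis .
qed

text \<open>On modes with eigenvalue above the threshold, 1 is at most the eigenvalue divided by the
  threshold, so their share of the norm is controlled by the gradient.\<close>

lemma norm_sq_le_low_modes:
  assumes w: "w \<in> Dm" and \<Lambda>: "\<Lambda> > 0"
  shows "(l2_norm M w)\<^sup>2 \<le> (\<Sum>n | lam (kn n) \<le> \<Lambda>. (norm (c n w))\<^sup>2) + gr w / \<Lambda>"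
proof (rule LIMSEQ_le_const2)
  show "(\<lambda>N. \<Sum>n<N. (norm (c n w))\<^sup>2) \<longlonglongrightarrow> (l2_norm M w)\<^sup>2"
    using en.parseval_norm[OF DmD(2)[OF w]] unfolding sums_def .
  have "(\<Sum>n<N. (norm (c n w))\<^sup>2) \<le> (\<Sum>n | lam (kn n) \<le> \<Lambda>. (norm (c n w))\<^sup>2) + gr w / \<Lambda>" for N
  proof -
    have "(norm (c n w))\<^sup>2 \<le> (if lam (kn n) \<le> \<Lambda> then (norm (c n w))\<^sup>2 else 0) + lam (kn n) * (norm (c n w))\<^sup>2 / \<Lambda>" for n
    proof (cases "lam (kn n) \<le> \<Lambda>")
      case False
      then have "1 * (norm (c n w))\<^sup>2 \<le> (lam (kn n) / \<Lambda>) * (norm (c n w))\<^sup>2"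
        using \<Lambda> by (intro mult_right_mono) auto
      then show ?thesis using False by simp
    qed (use lam_nonneg \<Lambda> in simp)
    then have "(\<Sum>n<N. (norm (c n w))\<^sup>2) \<le> (\<Sum>n<N. (if lam (kn n) \<le> \<Lambda> then (norm (c n w))\<^sup>2 else 0) + lam (kn n) * (norm (c n w))\<^sup>2 / \<Lambda>)"
      by (rule sum_mono)
    also have "\<dots> = (\<Sum>n | n < N \<and> lam (kn n) \<le> \<Lambda>. (norm (c n w))\<^sup>2) + (\<Sum>n<N. lam (kn n) * (norm (c n w))\<^sup>2) / \<Lambda>"
      by (simp add: sum.distrib sum_divide_distrib sum.inter_filter[symmetric])
    also have "\<dots> \<le> (\<Sum>n | lam (kn n) \<le> \<Lambda>. (norm (c n w))\<^sup>2) + gr w / \<Lambda>"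
      using \<Lambda> by (intro add_mono sum_mono2 finite_ln divide_right_mono gradient_bessel w) auto
    finally show ?thesis .
  qed
  then show "\<exists>N. \<forall>n\<ge>N. (\<Sum>n<n. (norm (c n w))\<^sup>2) \<le> (\<Sum>n | lam (kn n) \<le> \<Lambda>. (norm (c n w))\<^sup>2) + gr w / \<Lambda>" by blast
qed

text \<open>Rellich's theorem by Fourier series: along a diagonal subsequence every coefficient
  converges, which settles the finitely many low modes, while the gradient bound makes the high
  modes uniformly small.\<close>

lemma compact_embedding:
  fixes s :: "nat \<Rightarrow> real^'n \<Rightarrow> complex"
  assumes s: "\<And>n. s n \<in> Dm" and C: "\<And>n. gr (s n) + (l2_norm M (s n))\<^sup>2 \<le> C"
  shows "\<exists>r. strict_mono r \<and> (\<forall>d>0. \<exists>N::nat. \<forall>m\<ge>N. \<forall>n\<ge>N. (l2_norm M (\<lambda>x. s (r m) x - s (r n) x))\<^sup>2 < d)"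
proof -
  have sL: "s n \<in> L2 M" and sH: "s n \<in> H1" for n using s DmD by blast+
  have "norm (c k (s n)) \<le> sqrt C" for k n
  proof -
    have "norm (c k (s n)) \<le> l2_norm M (E (kn k)) * l2_norm M (s n)" by (intro l2_cauchy_schwarz E_L2 sL)
    also have "\<dots> = l2_norm M (s n)" by (simp add: en.norm_e)
    also have "\<dots> \<le> sqrt C" using C[of n] gr_nonneg[of "s n"] by (intro real_le_rsqrt) linarith
    finally show ?thesis .
  qed
  \<comment> \<open>Diagonal extraction over the countably many bounded coefficient
    sequences.\<close>
  then obtain r where r: "strict_mono r" and conv: "\<And>k. \<exists>l. (\<lambda>n. c k (s (r n))) \<longlonglongrightarrow> l"
    by (rule_tac function_convergent_subsequence[of "UNIV :: nat set" "\<lambda>n k. c k (s n)" "sqrt C"]) auto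
  have C0: "0 \<le> C" using order_trans[OF _ C[of 0], of 0] gr_nonneg[of "s 0"] by (simp add: add_nonneg_nonneg)
  have "\<exists>N. \<forall>m\<ge>N. \<forall>n\<ge>N. (l2_norm M (\<lambda>x. s (r m) x - s (r n) x))\<^sup>2 < d" if d: "d > 0" for d
  proof -
    \<comment> \<open>Differences have gradient energy at most 4 C, so with this threshold the high
      modes contribute at most d / 2.\<close>
    define \<Lambda> where "\<Lambda> = 8 * (C + 1) / d"
    have \<Lambda>: "\<Lambda> > 0" using d C0 by (simp add: \<Lambda>_def)
    define J where "J = {n. lam (kn n) \<le> \<Lambda>}"
    have J: "finite J" unfolding J_def by (rule finite_ln)
    \<comment> \<open>Leaves strictly less than d / 2 for the low modes together; the summand 1 also
      covers an empty J.\<close>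
    define \<epsilon> where "\<epsilon> = sqrt (d / (2 * (card J + 1)))"
    have \<epsilon>: "\<epsilon> > 0" "card J * \<epsilon>\<^sup>2 < d / 2"
      using d by (auto simp: \<epsilon>_def field_simps)
    have "\<forall>k. \<exists>N. \<forall>m\<ge>N. \<forall>n\<ge>N. norm (c k (s (r m)) - c k (s (r n))) < \<epsilon>"
      using conv \<epsilon>(1) by (metis CauchyD LIMSEQ_imp_Cauchy)
    then obtain N where N: "\<And>k m n. m \<ge> N k \<Longrightarrow> n \<ge> N k \<Longrightarrow> norm (c k (s (r m)) - c k (s (r n))) < \<epsilon>" by metis
    define N0 where "N0 = Max (insert 0 (N ` J))"
    have N0: "N k \<le> N0" if "k \<in> J" for k unfolding N0_def using J that by auto
    have "(l2_norm M (\<lambda>x. s (r m) x - s (r n) x))\<^sup>2 < d" if mn: "m \<ge> N0" "n \<ge> N0" for m n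
    proof -
      define w where "w = (\<lambda>x. s (r m) x - s (r n) x)"
      have w: "w \<in> Dm" unfolding w_def using Dm_linear[OF s s, of "r m" "-1" "r n"] by simp
      have "c k w = c k (s (r m)) - c k (s (r n))" for k
        unfolding w_def by (rule l2_inner_diff_right[OF sL sL E_L2])
      then have "norm (c k w) < \<epsilon>" if "k \<in> J" for k using N[of k m n] N0[OF that] mn by simp
      then have "(\<Sum>k\<in>J. (norm (c k w))\<^sup>2) \<le> (\<Sum>k\<in>J. \<epsilon>\<^sup>2)" by (intro sum_mono power_mono) (auto intro: less_imp_le)
      then have 1: "(\<Sum>k\<in>J. (norm (c k w))\<^sup>2) < d / 2" using \<epsilon>(2) by simp
      have "gr (s k) \<le> C" for k using C[of k] zero_le_power2[of "l2_norm M (s k)"] by linarith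
      then have "gr w \<le> 4 * C" unfolding w_def using gr_add_le[OF sH sH, of "r m" "r n"]
        by (smt (verit))
      then have "gr w / \<Lambda> \<le> 4 * C / \<Lambda>" using \<Lambda> by (intro divide_right_mono) auto
      also have "\<dots> \<le> d / 2" using d C0 by (simp add: \<Lambda>_def field_simps)
      finally show ?thesis using norm_sq_le_low_modes[OF w \<Lambda>] 1 unfolding w_def[symmetric] J_def by linarith
    qed
    then show ?thesis by blast
  qed
  then show ?thesis using r by blast
qed

lemma Dm_nonempty: "Dm \<noteq> {}"
  using E_Dm[OF kn_K] by blast

sublocale psd_b: psd_form X b
  by (rule psd_form_b[OF Dm_nonempty])

sublocale psd_q: psd_form X q
  by (rule psd_form_q[OF Dm_nonempty])

lemma norm_sq_re_im:
  assumes "u \<in> Dm"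
  shows "(l2_norm M u)\<^sup>2 = b (re u) (re u) + b (im u) (im u)"
proof -
  note ri = re_im[OF assms]
  note L = DmD(2)[OF X_Dm[OF ri(1)]] DmD(2)[OF X_Dm[OF ri(2)]]
  have "Re (l2_inner M (re u) (\<lambda>x. \<i> * im u x)) = 0"
    unfolding l2_inner_cmult_right using X_real(1)[OF ri(1,2)] by (simp add: complex_eq_iff)
  then have "(l2_norm M (\<lambda>x. re u x + \<i> * im u x))\<^sup>2 = b (re u) (re u) + b (im u) (im u)"
    unfolding l2_norm_sq_add[OF L(1) L2_cmult[OF L(2)]] l2_norm_cmult b_self by simp
  then show ?thesis using ri(3) by simp
qed

lemma norm_sq_inner_re_im:
  assumes "v \<in> X" "u \<in> Dm"
  shows "l2_inner M v u = of_real (b v (re u)) + \<i> * of_real (b v (im u))"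
proof -
  note ri = re_im[OF assms(2)]
  note L = DmD(2)[OF X_Dm[OF ri(1)]] DmD(2)[OF X_Dm[OF ri(2)]] DmD(2)[OF X_Dm[OF assms(1)]]
  have "l2_inner M v (\<lambda>x. re u x + \<i> * im u x) = l2_inner M v (re u) + \<i> * l2_inner M v (im u)"
    using L by (simp add: l2_inner_add_right l2_inner_cmult_right L2_intros)
  then show ?thesis
    using ri(3) X_real'(1)[OF assms(1) ri(1)] X_real'(1)[OF assms(1) ri(2)] unfolding b_def by metis
qed

text \<open>A counting argument: if n orthonormal vectors exhausted X, every mode would have squared
  coefficients with respect to them summing to 1; adding this up over n + 1 modes and applying
  Bessel in the other order gives n + 1 \<le> n.\<close>

lemma infinite_dimensional:
  fixes \<psi> :: "nat \<Rightarrow> real^'n \<Rightarrow> complex"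
  assumes \<psi>: "\<And>j. j < n \<Longrightarrow> \<psi> j \<in> X"
    and on: "\<And>i j. i < n \<Longrightarrow> j < n \<Longrightarrow> b (\<psi> i) (\<psi> j) = (if i = j then 1 else 0)"
  shows "\<exists>f\<in>X. (\<forall>j<n. b (\<psi> j) f = 0) \<and> b f f > 0"
proof (rule ccontr)
  assume neg: "\<not> ?thesis"
  have exp: "b g g = (\<Sum>j<n. (b (\<psi> j) g)\<^sup>2)" if g: "g \<in> X" for g
  proof -
    define p where "p = g - (\<Sum>j<n. b (\<psi> j) g *\<^sub>R \<psi> j)"
    have S: "(\<Sum>j<n. b (\<psi> j) g *\<^sub>R \<psi> j) \<in> X" using \<psi> by (intro psd_b.X_intros) auto
    have p: "p \<in> X" unfolding p_def using g S by (rule psd_b.X_intros)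
    have orth: "b (\<psi> j) p = 0" if j: "j < n" for j
    proof -
      have "b (\<psi> j) p = b (\<psi> j) g - (\<Sum>i<n. b (\<psi> i) g * b (\<psi> j) (\<psi> i))"
        unfolding p_def psd_b.diff_right[OF g S \<psi>[OF j]]
        using \<psi> j by (subst psd_b.sum_right) (auto simp: psd_b.scale_right psd_b.X_intros)
      also have "(\<Sum>i<n. b (\<psi> i) g * b (\<psi> j) (\<psi> i)) = (\<Sum>i<n. if j = i then b (\<psi> i) g else 0)"
        using on[OF j] by (intro sum.cong) auto
      also have "\<dots> = b (\<psi> j) g" using j by simp
      finally show ?thesis by simp
    qed
    \<comment> \<open>Otherwise p would be the vector whose existence is denied.\<close>
    have "b p p = 0" using neg p orth psd_b.nonneg[OF p] by force
    moreover have "b p p = b p g - (\<Sum>j<n. b (\<psi> j) g * b p (\<psi> j))"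
      apply (subst (2) p_def)
      unfolding psd_b.diff_right[OF g S p]
      using \<psi> p by (subst psd_b.sum_right) (auto simp: psd_b.scale_right psd_b.X_intros)
    moreover have "(\<Sum>j<n. b (\<psi> j) g * b p (\<psi> j)) = 0"
      using orth psd_b.sym[OF p \<psi>] by (intro sum.neutral) auto
    moreover have "b p g = b g g - (\<Sum>j<n. (b (\<psi> j) g)\<^sup>2)"
    proof -
      have "b p g = b g g - (\<Sum>j<n. b (b (\<psi> j) g *\<^sub>R \<psi> j) g)"
        unfolding p_def psd_b.diff_left[OF g S g]
        using \<psi> g by (subst psd_b.sum_left) (auto simp: psd_b.X_intros)
      also have "(\<Sum>j<n. b (b (\<psi> j) g *\<^sub>R \<psi> j) g) = (\<Sum>j<n. (b (\<psi> j) g)\<^sup>2)"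
        using \<psi> g by (intro sum.cong) (auto simp: psd_b.scale_left power2_eq_square)
      finally show ?thesis .
    qed
    ultimately show ?thesis by simp
  qed
  \<comment> \<open>Modes are complex in the periodic case, so real and imaginary parts are expanded
    separately and recombined.\<close>
  have one: "1 = (\<Sum>j<n. (norm (c k (\<psi> j)))\<^sup>2)" for k
  proof -
    have u: "E (kn k) \<in> Dm" by (rule E_Dm[OF kn_K])
    note ri = re_im[OF u]
    have "1 = (l2_norm M (E (kn k)))\<^sup>2" by (simp add: en.norm_e)
    also have "\<dots> = (\<Sum>j<n. (b (\<psi> j) (re (E (kn k))))\<^sup>2 + (b (\<psi> j) (im (E (kn k))))\<^sup>2)"
      unfolding norm_sq_re_im[OF u] exp[OF ri(1)] exp[OF ri(2)] sum.distrib ..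
    also have "\<dots> = (\<Sum>j<n. (norm (l2_inner M (\<psi> j) (E (kn k))))\<^sup>2)"
      using norm_sq_inner_re_im[OF \<psi> u] by (intro sum.cong refl) (simp add: cmod_power2)
    also have "\<dots> = (\<Sum>j<n. (norm (c k (\<psi> j)))\<^sup>2)"
      unfolding l2_inner_commute[of M "\<psi> _" "E _"] by simp
    finally show ?thesis .
  qed
  have "real (Suc n) = (\<Sum>k<Suc n. \<Sum>j<n. (norm (c k (\<psi> j)))\<^sup>2)" unfolding one[symmetric] by simp
  also have "\<dots> = (\<Sum>j<n. \<Sum>k<Suc n. (norm (c k (\<psi> j)))\<^sup>2)" by (rule sum.swap)
  also have "\<dots> \<le> (\<Sum>j<n. (l2_norm M (\<psi> j))\<^sup>2)"
    using \<psi> X_Dm DmD(2) by (intro sum_mono en.bessel) auto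
  also have "\<dots> = (\<Sum>j<n. 1)" using on unfolding b_self[symmetric] by (intro sum.cong) auto
  finally show False by simp
qed

lemma compact_form_pair: "compact_form_pair X b q"
proof (intro compact_form_pair.intro compact_form_pair_axioms.intro psd_b.psd_form_axioms psd_q.psd_form_axioms)
  show "b u u \<le> q u u" if "u \<in> X" for u
    using q_ge[OF X_Dm[OF that]] gr_nonneg[of u] by linarith
  show "\<exists>u\<in>X. (\<lambda>n. q (s n - u) (s n - u)) \<longlonglongrightarrow> 0"
    if "\<And>n. s n \<in> X" "\<And>e. e > 0 \<Longrightarrow> \<exists>N. \<forall>m\<ge>N. \<forall>n\<ge>N. q (s m - s n) (s m - s n) < e" for s
    using that by (rule q_complete)
  show "\<exists>r. strict_mono r \<and> (\<forall>e>0. \<exists>N::nat. \<forall>m\<ge>N. \<forall>n\<ge>N. b (s (r m) - s (r n)) (s (r m) - s (r n)) < e)"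
    if s: "\<And>n::nat. s n \<in> X" and C: "\<And>n. q (s n) (s n) \<le> C" for s C
    unfolding b_self fun_vector_simps
  proof (rule compact_embedding)
    show "s n \<in> Dm" for n using s X_Dm by blast
    show "gr (s n) + (l2_norm M (s n))\<^sup>2 \<le> C" for n
      using q_ge[OF X_Dm[OF s[of n]]] C[of n] unfolding b_self by linarith
  qed
  show "\<exists>f\<in>X. (\<forall>j<n. b (\<psi> j) f = 0) \<and> b f f > 0"
    if "\<And>j. j < n \<Longrightarrow> \<psi> j \<in> X" "\<And>i j. i < n \<Longrightarrow> j < n \<Longrightarrow> b (\<psi> i) (\<psi> j) = (if i = j then 1 else 0)"
    for n :: nat and \<psi>
    using that by (rule infinite_dimensional)
qed

lemma weak_partial_sum:
  assumes "\<And>n. f n \<in> L2 M" "\<And>n. g n \<in> L2 M" "\<And>n. weak_partial \<Omega> i (f n) (g n)"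
  shows "weak_partial \<Omega> i (\<lambda>x. \<Sum>n<N. a n * f n x) (\<lambda>x. \<Sum>n<(N::nat). a n * g n x)"
proof (induction N)
  case 0
  show ?case by (simp add: weak_partial_def)
next
  case (Suc N)
  have "weak_partial \<Omega> i (\<lambda>x. (\<Sum>n<N. a n * f n x) + a N * f N x) (\<lambda>x. (\<Sum>n<N. a n * g n x) + a N * g N x)"
    by (intro weak_partial_linear Suc L2_intros assms)
  then show ?case by simp
qed

text \<open>The regularity of the operator domain is read off the coefficients: if \<open>(u, f)\<close> is in the
  graph, then \<open>lam k\<close> times the coefficient of \<open>u\<close> is the coefficient of \<open>f - V u\<close>, so the series of
  the second derivatives of \<open>u\<close> converges in $L^2$.\<close>

lemma H_sobolev2:
  assumes "(u, f) \<in> H"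
  shows "u \<in> sobolev 2 \<Omega>"
proof -
  from assms have u: "u \<in> Dm" and f: "f \<in> L2 M" and eq: "\<And>v. v \<in> Dm \<Longrightarrow> F v u = l2_inner M v f"
    by (auto simp: H_def)
  define h where "h x = f x - mult_op V u x" for x
  have uL: "u \<in> L2 M" and VuL: "mult_op V u \<in> L2 M" using DmD[OF u] mult_op_L2 by blast+
  have h: "h \<in> L2 M" unfolding h_def using f VuL by (intro L2_intros)
  \<comment> \<open>The form equation tested with a mode; Green's formula turns the gradient part
    into the eigenvalue of the mode.\<close>
  have coeff: "of_real (lam (kn n)) * c n u = c n h" for n
  proof -
    have "l2_inner M (D i (E (kn n))) (D i u) = of_real (\<mu> (kn n i)) * c n u" for i
    proof -
      have "l2_inner M (D i (E (kn n))) (D i u) = l2_inner M (E1 i (kn n)) (D i u)"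
        using H1_smooth(2)[OF smooth_E[of "kn n"], where i=i] unfolding partial_E
        by (intro l2_inner_cong_AE) (auto intro!: L2_measurable E1_L2 DmD(3) E_Dm kn_K u)
      also have "\<dots> = cnj (of_real (\<mu> (kn n i)) * l2_inner M u (E (kn n)))"
        unfolding form_id[OF u kn_K, symmetric] by (rule l2_inner_commute)
      also have "\<dots> = of_real (\<mu> (kn n i)) * c n u"
        using l2_inner_commute[of M "E (kn n)" u] by simp
      finally show ?thesis .
    qed
    then have "F (E (kn n)) u = of_real (lam (kn n)) * c n u + c n (mult_op V u)"
      unfolding schroedinger_form_def by (simp add: lam_def sum_distrib_right)
    then show ?thesis
      unfolding h_def eq[OF E_Dm[OF kn_K]] l2_inner_diff_right[OF f VuL E_L2] by (simp add: algebra_simps)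
  qed
  have sum2: "summable (\<lambda>n. (lam (kn n))\<^sup>2 * (norm (c n u))\<^sup>2)"
    using en.summable_coeffs[OF h] unfolding coeff[symmetric]
    by (simp add: norm_mult power_mult_distrib lam_nonneg)
  have sum0: "summable (\<lambda>n. (norm (c n u))\<^sup>2)" by (rule en.summable_coeffs[OF uL])
  \<comment> \<open>lam \<le> 1 + lam^2 reduces the first derivatives to the two series already
    known to converge.\<close>
  have s1: "summable (\<lambda>n. (norm (c n u))\<^sup>2 * (l2_norm M (E1 i (kn n)))\<^sup>2)" for i
  proof (rule summable_comparison_test[OF _ summable_add[OF sum0 sum2]], intro exI allI impI)
    fix n
    have "\<mu> (kn n i) \<le> lam (kn n)" by (rule \<mu>_le_lam)
    also have "lam (kn n) \<le> 1 + (lam (kn n))\<^sup>2"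
      using sum_squares_bound[of 1 "lam (kn n)"] lam_nonneg[of "kn n"] by simp
    finally have "(norm (c n u))\<^sup>2 * \<mu> (kn n i) \<le> (norm (c n u))\<^sup>2 * (1 + (lam (kn n))\<^sup>2)"
      by (rule mult_left_mono) simp
    then show "norm ((norm (c n u))\<^sup>2 * (l2_norm M (E1 i (kn n)))\<^sup>2) \<le> (norm (c n u))\<^sup>2 + (lam (kn n))\<^sup>2 * (norm (c n u))\<^sup>2"
      unfolding E1_norm using \<mu>_nonneg by (simp add: algebra_simps)
  qed
  have s2: "summable (\<lambda>n. (norm (c n u))\<^sup>2 * (l2_norm M (E2 j i (kn n)))\<^sup>2)" for i j
  proof (rule summable_comparison_test[OF _ sum2], intro exI allI impI)
    fix n
    have "\<mu> (kn n i) * \<mu> (kn n j) \<le> lam (kn n) * lam (kn n)"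
      by (intro mult_mono \<mu>_le_lam \<mu>_nonneg lam_nonneg)
    then have "(norm (c n u))\<^sup>2 * (\<mu> (kn n i) * \<mu> (kn n j)) \<le> (norm (c n u))\<^sup>2 * (lam (kn n) * lam (kn n))"
      by (rule mult_left_mono) simp
    then show "norm ((norm (c n u))\<^sup>2 * (l2_norm M (E2 j i (kn n)))\<^sup>2) \<le> (lam (kn n))\<^sup>2 * (norm (c n u))\<^sup>2"
      unfolding E2_norm using \<mu>_nonneg by (simp add: power2_eq_square mult_ac)
  qed
  have w1: "weak_partial \<Omega> i (E k) (E1 i k)" for i k
    unfolding partial_E[symmetric]
    by (rule weak_partial_classical) (intro smooth_C1 smooth_E sets_cube)+
  have w2: "weak_partial \<Omega> j (E1 i k) (E2 j i k)" for i j k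
    unfolding partial_E1[symmetric]
    by (rule weak_partial_classical) (intro smooth_C1 smooth_E1 sets_cube)+
  have "\<exists>g\<in>sobolev 1 \<Omega>. weak_partial \<Omega> i u g" for i
  proof -
    obtain g where g: "g \<in> L2 M" "l2_lim M (\<lambda>N x. \<Sum>n<N. c n u * E1 i (kn n) x) g"
      using orthogonal_series_converges[OF E1_L2 E1_orth s1[of i]] by blast
    have "weak_partial \<Omega> i u g"
      by (rule weak_partial_lim[OF _ _ uL g(1) weak_partial_sum[OF E_L2 E1_L2 w1] en.expansion[OF uL] g(2)])
        (intro L2_intros E_L2 E1_L2)+
    moreover have "\<exists>g'\<in>L2 M. weak_partial \<Omega> j g g'" for j
    proof -
      obtain g' where g': "g' \<in> L2 M" "l2_lim M (\<lambda>N x. \<Sum>n<N. c n u * E2 j i (kn n) x) g'"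
        using orthogonal_series_converges[OF E2_L2 E2_orth s2[of j i]] by blast
      have "weak_partial \<Omega> j g g'"
        by (rule weak_partial_lim[OF _ _ g(1) g'(1) weak_partial_sum[OF E1_L2 E2_L2 w2] g(2) g'(2)])
          (intro L2_intros E1_L2 E2_L2)+
      then show ?thesis using g'(1) by blast
    qed
    then have "g \<in> sobolev 1 \<Omega>" unfolding H1_iff using g(1) by blast
    ultimately show ?thesis by blast
  qed
  then show ?thesis using uL unfolding numeral_2_eq_2 One_nat_def sobolev.simps(2)[of "Suc 0"] by blast
qed

text \<open>The abstract eigenvectors expand only real-valued functions of the form domain. A
  function orthogonal to them is orthogonal to real and imaginary parts of the modes, hence to the
  modes, and so vanishes; this gives completeness in complex L^2.\<close>

theorem eigenbasis_exists:
  obtains \<psi> En where "eigenbasis_graph M H \<psi> En" "\<And>n x. cnj (\<psi> n x) = \<psi> n x"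
    "\<And>n. \<psi> n \<in> sobolev 2 \<Omega>" "\<And>C. finite {n. En n \<le> C}"
proof -
  interpret compact_form_pair X b q by (rule compact_form_pair)
  obtain \<psi> A where \<psi>: "\<And>n::nat. \<psi> n \<in> X" and on: "\<And>m n. b (\<psi> m) (\<psi> n) = (if m = n then 1 else 0)"
    and eig: "\<And>n v. v \<in> X \<Longrightarrow> q v (\<psi> n) = A n * b v (\<psi> n)" and fin: "\<And>C. finite {n. A n \<le> C}"
    and conv: "\<And>f. f \<in> X \<Longrightarrow> (\<lambda>N. b (f - (\<Sum>n<N. b (\<psi> n) f *\<^sub>R \<psi> n)) (f - (\<Sum>n<N. b (\<psi> n) f *\<^sub>R \<psi> n))) \<longlonglongrightarrow> 0"
    by (rule eigenbasis) (rule that, assumption+)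
  have \<psi>D: "\<psi> n \<in> Dm" and \<psi>L: "\<psi> n \<in> L2 M" and \<psi>H: "\<psi> n \<in> H1" for n using \<psi> X_Dm DmD by blast+
  interpret \<psi>: orthonormal_seq M \<psi>
  proof
    show "l2_inner M (\<psi> m) (\<psi> n) = (if m = n then 1 else 0)" for m n
      using X_real'(1)[OF \<psi> \<psi>, of m n] on[of m n] unfolding b_def by (simp split: if_splits)
  qed (rule \<psi>L)
  have orth_X: "l2_inner M v f = 0" if f: "f \<in> L2 M" "\<And>n. l2_inner M (\<psi> n) f = 0" and v: "v \<in> X" for f v
  proof -
    have vL: "v \<in> L2 M" using v X_Dm DmD by blast
    define S where "S N x = (\<Sum>n<N. of_real (b (\<psi> n) v) * \<psi> n x)" for N :: nat and x
    have SL: "S N \<in> L2 M" for N unfolding S_def by (intro L2_intros \<psi>L)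
    have "v - (\<Sum>n<N. b (\<psi> n) v *\<^sub>R \<psi> n) = (\<lambda>x. v x - S N x)" for N
      unfolding sum_fun_eq fun_vector_simps S_def ..
    with conv[OF v] have "(\<lambda>N. (l2_norm M (\<lambda>x. v x - S N x))\<^sup>2) \<longlonglongrightarrow> 0" unfolding b_self by simp
    then have "(\<lambda>N. l2_norm M (\<lambda>x. S N x - v x)) \<longlonglongrightarrow> 0"
      unfolding l2_norm_minus_commute[of M v] by simp
    then have "l2_lim M S v" unfolding l2_lim_def .
    then have "(\<lambda>N. l2_inner M (S N) f) \<longlonglongrightarrow> l2_inner M v f" by (rule l2_lim_inner_left[OF SL vL f(1)])
    moreover have "l2_inner M (S N) f = 0" for N
      unfolding S_def using f
      by (subst l2_inner_sum_left) (auto simp: l2_inner_cmult_left intro!: L2_intros \<psi>L)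
    ultimately show ?thesis by (simp add: LIMSEQ_const_iff)
  qed
  have orth_Dm: "l2_inner M v f = 0" if f: "f \<in> L2 M" "\<And>n. l2_inner M (\<psi> n) f = 0" and v: "v \<in> Dm" for f v
  proof -
    note ri = re_im(1,2)[OF v]
    have "l2_inner M (\<lambda>x. re v x + \<i> * im v x) f = 0"
      using f(1) DmD(2)[OF X_Dm[OF ri(1)]] DmD(2)[OF X_Dm[OF ri(2)]] orth_X[OF f ri(1)] orth_X[OF f ri(2)]
      by (simp add: l2_inner_add_left l2_inner_cmult_left L2_intros)
    then show ?thesis unfolding re_im(3)[OF v, symmetric] .
  qed
  have basis: "l2_basis M \<psi>"
    unfolding l2_basis_iff
  proof (rule \<psi>.orthonormal_basis_of_total)
    fix f assume f: "f \<in> L2 M" "\<And>n. l2_inner M (\<psi> n) f = 0"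
    have "AE x in M. f x = 0" by (rule E_total[OF f(1)]) (rule orth_Dm[OF f E_Dm])
    then show "l2_norm M f = 0" using l2_norm_eq_0_iff[OF f(1)] by blast
  qed
  \<comment> \<open>Undoes the shift in \<open>q\<close>.\<close>
  define En where "En n = A n - (B + 1)" for n
  have H: "(\<psi> n, \<lambda>x. of_real (En n) * \<psi> n x) \<in> H" for n
  proof -
    have X: "F v (\<psi> n) = of_real (En n) * l2_inner M v (\<psi> n)" if v: "v \<in> X" for v
    proof -
      have "Re (F v (\<psi> n)) = En n * b v (\<psi> n)"
        using eig[OF v, of n] unfolding q_def En_def by (simp add: algebra_simps)
      then show ?thesis using X_real'[OF v \<psi>, of n] unfolding b_def by (metis of_real_mult)
    qed
    have "F v (\<psi> n) = of_real (En n) * l2_inner M v (\<psi> n)" if v: "v \<in> Dm" for v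
    proof -
      note ri = re_im(1,2)[OF v]
      note XH = DmD(1)[OF X_Dm[OF ri(1)]] DmD(1)[OF X_Dm[OF ri(2)]]
      note XL = DmD(2)[OF X_Dm[OF ri(1)]] DmD(2)[OF X_Dm[OF ri(2)]]
      have "F (\<lambda>x. re v x + \<i> * im v x) (\<psi> n) = of_real (En n) * l2_inner M (\<lambda>x. re v x + \<i> * im v x) (\<psi> n)"
        unfolding F_linear_left[OF XH \<psi>H] X[OF ri(1)] X[OF ri(2)] l2_inner_add_left[OF XL(1) L2_cmult[OF XL(2)] \<psi>L]
          l2_inner_cmult_left by (simp add: algebra_simps)
      then show ?thesis unfolding re_im(3)[OF v, symmetric] .
    qed
    then show ?thesis unfolding H_def using \<psi>D \<psi>L by (auto simp: l2_inner_cmult_right intro!: L2_intros)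
  qed
  show ?thesis
  proof (rule that)
    interpret symmetric_graph M H by (rule symmetric_graph_H)
    interpret l2_basis M \<psi> by (rule basis)
    show "eigenbasis_graph M H \<psi> En"
      by standard (use H in simp, rule H_closed)
    show "cnj (\<psi> n x) = \<psi> n x" for n x by (rule X_cnj[OF \<psi>])
    show "\<psi> n \<in> sobolev 2 \<Omega>" for n by (rule H_sobolev2[OF H])
    show "finite {n. En n \<le> C}" for C
      using fin[of "C + (B + 1)"] by (simp add: En_def algebra_simps)
  qed
qed

end

section \<open>The three boundary conditions\<close>

context cube_domain
begin

text \<open>Each factor is cut off separately. The i-th derivatives converge as soon as the i-th
  factor vanishes at both ends, whatever the other factors do there. This serves Dirichlet modes,
  where all factors vanish, and derivatives of Neumann modes, where the i-th one does.\<close>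

lemma tensor_cutoff:
  fixes g g' :: "'n \<Rightarrow> real \<Rightarrow> complex"
  assumes g: "\<And>j. smooth1 (g j)" "\<And>j t. (g j has_vector_derivative g' j t) (at t)"
  obtains \<phi> :: "nat \<Rightarrow> real^'n \<Rightarrow> complex" where "\<And>m. \<phi> m \<in> test_functions \<Omega>" "l2_lim M \<phi> (tensor g)"
    "\<And>i. g i (L/2) = 0 \<Longrightarrow> g i (- (L/2)) = 0 \<Longrightarrow> l2_lim M (\<lambda>m. partial i (\<phi> m)) (tensor (g(i := g' i)))"
proof -
  define a b where "a = - (L/2)" and "b = L/2"
  have ab: "a < b" using L_pos by (simp add: a_def b_def)
  \<comment> \<open>The conclusion of \<open>cutoff\<close> as one predicate, so that the choice
    over all coordinates can be made at once.\<close>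
  define P where "P j G G' C \<longleftrightarrow> (\<forall>m::nat. smooth1 (G m)) \<and> (\<forall>m t. (G m has_vector_derivative G' m t) (at t)) \<and>
    (\<forall>m t. t \<notin> {a + 1 / Suc m..b - 1 / Suc m} \<longrightarrow> G m t = 0) \<and>
    (\<forall>m t. norm (G m t) \<le> norm (g j t)) \<and>
    (\<forall>t. a < t \<longrightarrow> t < b \<longrightarrow> (\<lambda>m. G m t) \<longlonglongrightarrow> g j t) \<and>
    (\<forall>t. a < t \<longrightarrow> t < b \<longrightarrow> (\<lambda>m. G' m t) \<longlonglongrightarrow> g' j t) \<and>
    (g j a = 0 \<longrightarrow> g j b = 0 \<longrightarrow> (\<forall>m t. a < t \<longrightarrow> t < b \<longrightarrow> norm (G' m t) \<le> C))"
    for j G and G' :: "nat \<Rightarrow> real \<Rightarrow> complex" and C :: real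
  have "\<forall>j. \<exists>G G' C. P j G G' C"
  proof
    fix j
    show "\<exists>G G' C. P j G G' C"
      by (rule cutoff[OF g(1)[of j] g(2)[of j] ab], intro exI, unfold P_def) (intro conjI allI impI; assumption | blast)
  qed
  from choice[OF this] obtain G where "\<forall>j. \<exists>G' C. P j (G j) G' C" ..
  from choice[OF this] obtain G' where "\<forall>j. \<exists>C. P j (G j) (G' j) C" ..
  from choice[OF this] obtain C where "\<forall>j. P j (G j) (G' j) (C j)" ..
  note GG = spec[OF this, unfolded P_def]
  note G = GG[THEN conjunct1, rule_format] GG[THEN conjunct2, THEN conjunct1, rule_format]
    GG[THEN conjunct2, THEN conjunct2, THEN conjunct1, rule_format]
    GG[THEN conjunct2, THEN conjunct2, THEN conjunct2, THEN conjunct1, rule_format]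
    GG[THEN conjunct2, THEN conjunct2, THEN conjunct2, THEN conjunct2, THEN conjunct1, rule_format]
    GG[THEN conjunct2, THEN conjunct2, THEN conjunct2, THEN conjunct2, THEN conjunct2, THEN conjunct1, rule_format]
    GG[THEN conjunct2, THEN conjunct2, THEN conjunct2, THEN conjunct2, THEN conjunct2, THEN conjunct2, rule_format]
  define \<phi> where "\<phi> m = tensor (\<lambda>j. G j m)" for m
  have cube: "a < x $ j" "x $ j < b" if "x \<in> \<Omega>" for x j
    using that by (auto simp: cube_def a_def b_def)
  have test: "\<phi> m \<in> test_functions \<Omega>" for m
    unfolding \<phi>_def
  proof (rule tensor_test_function)
    show "cbox (\<chi> j. a + 1 / Suc m) (\<chi> j. b - 1 / Suc m) \<subseteq> \<Omega>"
    proof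
      fix x :: "real^'n" assume "x \<in> cbox (\<chi> j. a + 1 / Suc m) (\<chi> j. b - 1 / Suc m)"
      then have "a + 1 / Suc m \<le> x $ j" "x $ j \<le> b - 1 / Suc m" for j by (auto simp: mem_box_cart)
      moreover have "1 / real (Suc m) > 0" by simp
      ultimately have "a < x $ j \<and> x $ j < b" for j by (smt (verit))
      then show "x \<in> \<Omega>" by (simp add: cube_def a_def b_def)
    qed
  qed (use G in auto)
  have cont: "continuous_on UNIV (\<phi> m)" "continuous_on UNIV (partial i (\<phi> m))" for m i
    using smooth_C1(2,3)[of "\<phi> m" UNIV] test[of m] by (simp_all add: test_functions_def)
  have cg: "continuous_on UNIV (g j)" "continuous_on UNIV (g' j)" for j
    using g smooth1_continuous smooth1_deriv by blast+
  have p: "partial i (\<phi> m) = tensor ((\<lambda>j. G j m)(i := G' i m))" for i m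
    unfolding \<phi>_def by (rule ext) (rule tensor_partial(2)[of "\<lambda>j. G j m" "\<lambda>j. G' j m", OF G(2)])
  have 1: "l2_lim M \<phi> (tensor g)"
  proof -
    obtain C where C: "\<And>x. x \<in> \<Omega> \<Longrightarrow> norm (tensor g x) \<le> C"
      using continuous_bounded_cube[OF continuous_on_tensor[of g]] cg by blast
    show ?thesis
    proof (rule l2_lim_pointwise[where C=C])
      fix x and m assume x: "x \<in> \<Omega>"
      have "norm (\<phi> m x) \<le> norm (tensor g x)"
        unfolding \<phi>_def tensor_def prod_norm[symmetric] by (intro prod_mono) (simp add: G)
      then show "norm (\<phi> m x) \<le> C" using C[OF x] by linarith
      show "(\<lambda>m. \<phi> m x) \<longlonglongrightarrow> tensor g x"
        unfolding \<phi>_def tensor_def by (intro tendsto_prod G cube x)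
    qed (intro measurable_continuous cont continuous_on_tensor cg)+
  qed
  have 2: "l2_lim M (\<lambda>m. partial i (\<phi> m)) (tensor (g(i := g' i)))" if i: "g i b = 0" "g i a = 0" for i
  proof -
    \<comment> \<open>Replacing the i-th factor by 1 isolates the product of the others, whose bound
      together with that of the i-th derivative dominates.\<close>
    have c1: "continuous_on UNIV ((g(i := (\<lambda>t. 1))) j)" for j using cg by (cases "j = i") auto
    obtain C' where C': "\<And>x. x \<in> \<Omega> \<Longrightarrow> norm (tensor (g(i := (\<lambda>t. 1))) x) \<le> C'"
      by (rule continuous_bounded_cube[OF continuous_on_tensor[OF c1]]) (rule that)
    show ?thesis
    proof (rule l2_lim_pointwise[where C="\<bar>C i\<bar> * C'"])
      show "tensor (g(i := g' i)) \<in> borel_measurable M"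
        using cg by (intro measurable_continuous continuous_on_tensor) (auto simp: fun_upd_def)
      fix x and m assume x: "x \<in> \<Omega>"
      have "norm (partial i (\<phi> m) x) = norm (G' i m (x $ i)) * (\<Prod>j\<in>UNIV - {i}. norm (G j m (x $ j)))"
        unfolding p tensor_upd by (simp add: norm_mult prod_norm)
      also have "\<dots> \<le> \<bar>C i\<bar> * (\<Prod>j\<in>UNIV - {i}. norm (g j (x $ j)))"
        by (intro mult_mono prod_mono order_trans[OF G(7)[OF i(2,1) cube(1,2)[OF x]] abs_ge_self] prod_nonneg)
          (simp_all add: G(4))
      also have "(\<Prod>j\<in>UNIV - {i}. norm (g j (x $ j))) = norm (tensor (g(i := (\<lambda>t. 1))) x)"
        unfolding tensor_upd by (simp add: prod_norm)
      also have "\<bar>C i\<bar> * \<dots> \<le> \<bar>C i\<bar> * C'" by (intro mult_left_mono C' x) simp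
      finally show "norm (partial i (\<phi> m) x) \<le> \<bar>C i\<bar> * C'" .
      show "(\<lambda>m. partial i (\<phi> m) x) \<longlonglongrightarrow> tensor (g(i := g' i)) x"
        unfolding p tensor_upd by (intro tendsto_mult tendsto_prod G cube x)
    qed (intro measurable_continuous cont)
  qed
  show ?thesis by (rule that[OF test 1 2]) (simp_all add: a_def b_def)
qed


lemma integral_cube_continuous:
  fixes F :: "real^'n \<Rightarrow> complex"
  assumes "continuous_on UNIV F"
  shows "(LINT x|M. F x) = integral (cbox (\<chi> i. - L / 2) (\<chi> i. L / 2)) F"
  using lebesgue_integral_eq_integral[OF integrable_L2[OF L2_continuous[OF assms]] sets_cube]
  by (simp only: cube_eq_box integral_open_interval)

text \<open>The slab that leaves the cube on one side is a period translate of the one that enters on the other.\<close>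

lemma integral_cube_translate:
  fixes F :: "real^'n \<Rightarrow> complex"
  assumes cont: "continuous_on UNIV F" and per: "\<And>x. F (x + axis i L) = F x" and h: "0 \<le> h" "h \<le> L"
  shows "(LINT x|M. F (x + axis i h)) = (LINT x|M. F x)"
proof -
  define a b :: "real^'n" where "a = (\<chi> i. - L / 2)" and "b = (\<chi> i. L / 2)"
  have shift: "integral (cbox (p + c) (q + c)) F = integral (cbox p q) (\<lambda>x. F (x + c))" for p q c
  proof -
    have "(F has_integral integral (cbox (p + c) (q + c)) F) (cbox (p + c) (q + c))"
      by (intro integrable_integral integrable_continuous continuous_on_subset[OF cont]) auto
    then have "((F \<circ> (+) c) has_integral integral (cbox (p + c) (q + c)) F) (cbox p q)"
      by (simp only: has_integral_shift_cbox_iff)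
    then show ?thesis by (simp add: o_def add.commute integral_unique)
  qed
  have int: "F integrable_on cbox p q" for p q
    by (intro integrable_continuous continuous_on_subset[OF cont]) auto
  have u: "(axis i 1 :: real^'n) \<in> Basis" by (auto simp: Basis_vec_def)
  \<comment> \<open>The cube lengthened by h is cut in two ways: at h - L/2, leaving the shifted
    cube, and at L/2, leaving the cube itself. The two remaining slabs differ by a period.\<close>
  have split: "integral (cbox a (b + axis i h)) F = integral (cbox a (b + axis i h) \<inter> {x. x \<bullet> axis i 1 \<le> c}) F
     + integral (cbox a (b + axis i h) \<inter> {x. x \<bullet> axis i 1 \<ge> c}) F" for c
    by (rule Henstock_Kurzweil_Integration.integral_split[OF int u])
  have all: "(\<forall>j. P j) \<longleftrightarrow> P i \<and> (\<forall>j. j \<noteq> i \<longrightarrow> P j)" for P :: "'n \<Rightarrow> bool" by metis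
  have sets: "cbox a (b + axis i h) \<inter> {x. x \<bullet> axis i 1 \<le> h - L/2} = cbox a (b + axis i (h - L))"
    "cbox a (b + axis i h) \<inter> {x. x \<bullet> axis i 1 \<ge> h - L/2} = cbox (a + axis i h) (b + axis i h)"
    "cbox a (b + axis i h) \<inter> {x. x \<bullet> axis i 1 \<le> L/2} = cbox a b"
    "cbox a (b + axis i h) \<inter> {x. x \<bullet> axis i 1 \<ge> L/2} = cbox (a + axis i L) (b + axis i (h - L) + axis i L)"
  proof -
    show "cbox a (b + axis i h) \<inter> {x. x \<bullet> axis i 1 \<le> h - L/2} = cbox a (b + axis i (h - L))"
      using h L_pos by (intro set_eqI, subst Int_iff, subst (1 2) mem_box_cart, subst (1 2) all) (unfold mem_Collect_eq inner_axis, auto simp: axis_def a_def b_def)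
    show "cbox a (b + axis i h) \<inter> {x. x \<bullet> axis i 1 \<ge> h - L/2} = cbox (a + axis i h) (b + axis i h)"
      using h L_pos by (intro set_eqI, subst Int_iff, subst (1 2) mem_box_cart, subst (1 2) all) (unfold mem_Collect_eq inner_axis, auto simp: axis_def a_def b_def)
    show "cbox a (b + axis i h) \<inter> {x. x \<bullet> axis i 1 \<le> L/2} = cbox a b"
      using h L_pos by (intro set_eqI, subst Int_iff, subst (1 2) mem_box_cart, subst (1 2) all) (unfold mem_Collect_eq inner_axis, auto simp: axis_def a_def b_def)
    show "cbox a (b + axis i h) \<inter> {x. x \<bullet> axis i 1 \<ge> L/2} = cbox (a + axis i L) (b + axis i (h - L) + axis i L)"
      using h L_pos by (intro set_eqI, subst Int_iff, subst (1 2) mem_box_cart, subst (1 2) all) (unfold mem_Collect_eq inner_axis, auto simp: axis_def a_def b_def)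
  qed
  have "integral (cbox (a + axis i h) (b + axis i h)) F = integral (cbox a b) F"
    using split[of "h - L/2"] split[of "L/2"] unfolding sets shift[of _ "axis i L"] per by simp
  then have "integral (cbox a b) (\<lambda>x. F (x + axis i h)) = integral (cbox a b) F" unfolding shift .
  moreover have "continuous_on UNIV (\<lambda>x. F (x + axis i h))"
    by (intro continuous_on_compose2[OF cont] continuous_intros) auto
  ultimately show ?thesis using cont by (simp add: integral_cube_continuous a_def b_def)
qed

text \<open>Difference quotients with step at most L integrate to zero over a period, by translation
  invariance, and converge boundedly to the derivative.\<close>

lemma integral_partial_periodic:
  fixes F :: "real^'n \<Rightarrow> complex"
  assumes diff: "\<And>x. F differentiable at x" and cont: "continuous_on UNIV (partial i F)"
    and per: "\<And>x. F (x + axis i L) = F x"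
  shows "(LINT x|M. partial i F x) = 0"
proof -
  have contF: "continuous_on UNIV F"
    using diff by (intro continuous_at_imp_continuous_on) (auto intro: differentiable_imp_continuous_within)
  \<comment> \<open>The closed cube enlarged by 1 in the positive directions: every segment along
    which a difference quotient is estimated stays inside.\<close>
  define K :: "(real^'n) set" where "K = cbox (\<chi> i. - L / 2) (\<chi> i. L / 2 + 1)"
  have "bounded (partial i F ` K)" unfolding K_def
    by (intro compact_imp_bounded compact_continuous_image continuous_on_subset[OF cont] compact_cbox) auto
  then obtain C where C: "\<And>y. y \<in> K \<Longrightarrow> norm (partial i F y) \<le> C" unfolding bounded_iff by auto
  have sub: "x + t *\<^sub>R axis i 1 \<in> K" if "x \<in> \<Omega>" "0 \<le> t" "t \<le> 1" for x t
    unfolding K_def mem_box_cart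
  proof
    fix j
    have "- L / 2 < x $ j" "x $ j < L / 2" using that(1) by (auto simp: cube_def)
    then show "(\<chi> i. - L / 2) $ j \<le> (x + t *\<^sub>R axis i 1) $ j \<and> (x + t *\<^sub>R axis i 1) $ j \<le> (\<chi> i. L / 2 + 1) $ j"
      using that(2,3) by (cases "j = i") (auto simp: axis_def)
  qed
  define s where "s m x = of_nat (Suc m) * (F (x + (1 / Suc m) *\<^sub>R axis i 1) - F x)" for m x
  have cF: "continuous_on UNIV (\<lambda>x. F (x + c))" for c
    by (intro continuous_on_compose2[OF contF] continuous_intros) auto
  have "(\<lambda>m. LINT x|M. s m x) \<longlonglongrightarrow> (LINT x|M. partial i F x)"
  proof (rule integral_dominated_convergence[where w="\<lambda>x. C"])
    show "AE x in M. (\<lambda>m. s m x) \<longlonglongrightarrow> partial i F x"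
      unfolding s_def by (intro AE_I2 partial_quotient_tendsto diff)
    show "AE x in M. norm (s m x) \<le> C" for m
      unfolding s_def by (intro AE_I2 partial_quotient_bound diff C sub) auto
    show "s m \<in> borel_measurable M" for m
      unfolding s_def[abs_def] by (intro measurable_continuous continuous_intros cF contF)
  qed (auto intro: measurable_continuous cont)
  moreover have "\<forall>\<^sub>F m in sequentially. (LINT x|M. s m x) = 0"
  proof -
    obtain m0 where m0: "inverse (real (Suc m0)) < L" using reals_Archimedean[OF L_pos] by blast
    have "(LINT x|M. s m x) = 0" if "m \<ge> m0" for m
    proof -
      have "1 / real (Suc m) \<le> 1 / real (Suc m0)" using that by (intro divide_left_mono) auto
      then have "1 / real (Suc m) \<le> L" using m0 by (simp add: inverse_eq_divide)
      then have "(LINT x|M. F (x + axis i (1 / Suc m))) = (LINT x|M. F x)"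
        by (intro integral_cube_translate contF per) auto
      moreover have "(1 / Suc m) *\<^sub>R axis i 1 = (axis i (1 / Suc m) :: real^'n)" by (simp add: vec_eq_iff axis_def)
      moreover have "integrable M (\<lambda>x. F (x + axis i (1 / Suc m)))" "integrable M F"
        by (intro integrable_L2 L2_continuous cF contF)+
      ultimately show ?thesis unfolding s_def by simp
    qed
    then show ?thesis unfolding eventually_sequentially by blast
  qed
  ultimately have "(\<lambda>m. 0) \<longlonglongrightarrow> (LINT x|M. partial i F x)"
    by (rule Lim_transform_eventually)
  then show ?thesis by (simp add: LIMSEQ_const_iff)
qed

end

section \<open>The form domains as closed spaces stable under conjugation\<close>

context cube_domain
begin

lemma w12_lim_smooth:
  assumes "\<And>n. smooth (s n)" "smooth u" "l2_lim M s u" "\<And>i. l2_lim M (\<lambda>n. partial i (s n)) (partial i u)"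
  shows "w12_lim s u"
  unfolding w12_lim_def l2_lim_def
proof (intro conjI allI)
  show "(\<lambda>n. l2_norm M (\<lambda>x. s n x - u x)) \<longlonglongrightarrow> 0" using assms(3) unfolding l2_lim_def .
  fix i
  have "l2_norm M (\<lambda>x. D i (s n) x - D i u x) = l2_norm M (\<lambda>x. partial i (s n) x - partial i u x)" for n
  proof (rule l2_norm_cong_AE)
    show "AE x in M. D i (s n) x - D i u x = partial i (s n) x - partial i u x"
      using H1_smooth(2)[OF assms(1)[of n], where i=i] H1_smooth(2)[OF assms(2), where i=i] by eventually_elim simp
    show "(\<lambda>x. D i (s n) x - D i u x) \<in> borel_measurable M"
      by (intro L2_measurable L2_diff H1_D H1_smooth assms)
    show "(\<lambda>x. partial i (s n) x - partial i u x) \<in> borel_measurable M"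
      by (intro L2_measurable L2_diff L2_continuous smooth_C1 assms)
  qed
  then show "(\<lambda>n. l2_norm M (\<lambda>x. D i (s n) x - D i u x)) \<longlonglongrightarrow> 0"
    using assms(4)[of i] unfolding l2_lim_def by simp
qed

lemma inner_D_smooth:
  assumes "smooth u" "f \<in> L2 M"
  shows "l2_inner M (D i u) f = l2_inner M (partial i u) f"
  using H1_smooth(2)[OF assms(1), where i=i]
  by (intro l2_inner_cong_AE) (auto intro: L2_measurable assms H1_D(2)[OF H1_smooth(1)] L2_continuous smooth_C1)

lemma form_space_H1:
  assumes "V \<in> borel_measurable M" "\<And>x. \<bar>V x\<bar> \<le> B"
  shows "form_space L H1 V B"
  by unfold_locales (use assms H1_linear(1) H1_cnj(1) in auto)

lemma form_space_closure:
  assumes S: "S \<subseteq> H1" "\<And>u v c. u \<in> S \<Longrightarrow> v \<in> S \<Longrightarrow> (\<lambda>x. u x + c * v x) \<in> S" "\<And>u. u \<in> S \<Longrightarrow> (\<lambda>x. cnj (u x)) \<in> S"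
    and V: "V \<in> borel_measurable M" "\<And>x. \<bar>V x\<bar> \<le> B"
  shows "form_space L (W12_closure \<Omega> S) V B"
proof
  show "W12_closure \<Omega> S \<subseteq> H1" by (auto simp: W12_closure_def)
next
  fix u v c assume "u \<in> W12_closure \<Omega> S" "v \<in> W12_closure \<Omega> S"
  then obtain s t where s: "u \<in> H1" "\<And>n. s n \<in> S" "w12_lim s u" and t: "v \<in> H1" "\<And>n. t n \<in> S" "w12_lim t v"
    unfolding W12_closure_iff[OF S(1)] by blast
  have H: "s n \<in> H1" "t n \<in> H1" for n using s t S(1) by blast+
  show "(\<lambda>x. u x + c * v x) \<in> W12_closure \<Omega> S"
    unfolding W12_closure_iff[OF S(1)]
    by (intro conjI exI[of _ "\<lambda>n x. s n x + c * t n x"] allI S(2) s(2) t(2) H1_linear(1) w12_lim_linear H s(1,3) t(1,3))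
next
  fix u assume "u \<in> W12_closure \<Omega> S"
  then obtain s where s: "u \<in> H1" "\<And>n. s n \<in> S" "w12_lim s u"
    unfolding W12_closure_iff[OF S(1)] by blast
  have H: "s n \<in> H1" for n using s S(1) by blast
  show "(\<lambda>x. cnj (u x)) \<in> W12_closure \<Omega> S"
    unfolding W12_closure_iff[OF S(1)]
    by (intro conjI exI[of _ "\<lambda>n x. cnj (s n x)"] allI S(3) s(2) H1_cnj(1) w12_lim_cnj H s(1,3))
next
  show "u \<in> W12_closure \<Omega> S" if "\<And>n. s n \<in> W12_closure \<Omega> S" "u \<in> H1" "w12_lim s u" for s u
    by (rule W12_closure_closed[OF S(1) that])
qed (rule V)+

lemma test_functions_H1: "test_functions \<Omega> \<subseteq> H1" and smooth_periodic_H1: "smooth_periodic L \<subseteq> H1"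
  unfolding test_functions_def smooth_periodic_def using H1_smooth(1) by auto

end

section \<open>Green's formula for the modes on the three form domains\<close>

context trig
begin

lemma E2_same: "E2 i i k = (\<lambda>x. - of_real (\<mu> (k i)) * E k x)"
  by (simp add: E2_def)

text \<open>The derivative is moved onto the mode: the weak derivative of the smooth
  \<open>E1 i k\<close> is tested with cnj u, and the pure second derivative of a mode is - \<mu>
  times the mode.\<close>

lemma form_id_test_function:
  assumes u: "u \<in> test_functions \<Omega>"
  shows "l2_inner M (D i u) (E1 i k) = of_real (\<mu> (k i)) * l2_inner M u (E k)"
proof -
  have sm: "smooth u" using u by (simp add: test_functions_def)
  have w: "weak_partial \<Omega> i (E1 i k) (partial i (E1 i k))"
    by (intro weak_partial_classical smooth_C1 smooth_E1 sets_cube)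
  have p: "partial i (\<lambda>x. cnj (u x)) = (\<lambda>x. cnj (partial i u x))"
    by (rule ext) (intro partial_cnj smooth_C1 sm)
  have "(LINT x|M. E1 i k x * cnj (partial i u x)) = - (LINT x|M. - of_real (\<mu> (k i)) * E k x * cnj (u x))"
    using bspec[OF w[unfolded weak_partial_def] test_functions_cnj[OF u]] unfolding p partial_E1 E2_same .
  then have "l2_inner M (partial i u) (E1 i k) = of_real (\<mu> (k i)) * l2_inner M u (E k)"
    unfolding l2_inner_def by (simp add: mult.commute[of _ "cnj _"] mult.assoc mult.left_commute[of "cnj _" "of_real _"])
  then show ?thesis unfolding inner_D_smooth[OF sm E1_L2] .
qed

text \<open>The product of cnj u and the differentiated mode is periodic, so the integral of its
  partial derivative over the cube vanishes.\<close>

lemma form_id_smooth_periodic: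
  assumes per: "\<And>k t. e k (t + L) = e k t" "\<And>k t. e' k (t + L) = e' k t"
    and u: "u \<in> smooth_periodic L"
  shows "l2_inner M (D i u) (E1 i k) = of_real (\<mu> (k i)) * l2_inner M u (E k)"
proof -
  have sm: "smooth u" and up: "\<And>x. u (x + axis i L) = u x" using u by (simp_all add: smooth_periodic_def)
  have p: "partial i (\<lambda>x. cnj (u x)) x = cnj (partial i u x)" for x
    by (intro partial_cnj smooth_C1 sm)
  have d: "(\<lambda>x. cnj (u x)) differentiable at x" "E1 i k differentiable at x" for x
    by (intro smooth_C1 smooth_cnj sm smooth_E1)+
  have P: "partial i (\<lambda>x. cnj (u x) * E1 i k x) = (\<lambda>x. cnj (u x) * (- of_real (\<mu> (k i)) * E k x) + cnj (partial i u x) * E1 i k x)"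
    by (rule ext) (simp only: partial_mult(2)[OF d] partial_E1 E2_same p)
  have "(LINT x|M. partial i (\<lambda>x. cnj (u x) * E1 i k x) x) = 0"
  proof (rule integral_partial_periodic)
    show "(\<lambda>x. cnj (u x) * E1 i k x) differentiable at x" for x by (rule partial_mult(1)[OF d])
    show "continuous_on UNIV (partial i (\<lambda>x. cnj (u x) * E1 i k x))"
      unfolding P by (intro continuous_intros smooth_C1 sm smooth_E1 smooth_E)
    have "E1 i k (x + axis i L) = E1 i k x" for x
      unfolding E1_def tensor_upd by (simp add: per axis_def)
    then show "cnj (u (x + axis i L)) * E1 i k (x + axis i L) = cnj (u x) * E1 i k x" for x by (simp add: up)
  qed
  moreover have "integrable M (\<lambda>x. cnj (u x) * (- of_real (\<mu> (k i)) * E k x))" "integrable M (\<lambda>x. cnj (partial i u x) * E1 i k x)"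
    by (intro integrable_L2 L2_continuous continuous_intros smooth_C1 sm smooth_E1 smooth_E)+
  ultimately have "(LINT x|M. cnj (u x) * (- of_real (\<mu> (k i)) * E k x)) + (LINT x|M. cnj (partial i u x) * E1 i k x) = 0"
    unfolding P by simp
  then have "l2_inner M (partial i u) (E1 i k) = of_real (\<mu> (k i)) * l2_inner M u (E k)"
    unfolding l2_inner_def mult.left_commute[of "cnj _" "- of_real _"] mult.assoc by (simp add: add_eq_0_iff mult.left_commute[of "cnj _"])
  then show ?thesis unfolding inner_D_smooth[OF sm E1_L2] .
qed

lemma form_id_closure:
  assumes S: "S \<subseteq> H1" and id: "\<And>u. u \<in> S \<Longrightarrow> l2_inner M (D i u) (E1 i k) = c * l2_inner M u (E k)"
    and u: "u \<in> W12_closure \<Omega> S"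
  shows "l2_inner M (D i u) (E1 i k) = c * l2_inner M u (E k)"
proof -
  obtain s where s: "u \<in> H1" "\<And>n. s n \<in> S" "w12_lim s u"
    using u unfolding W12_closure_iff[OF S] by blast
  have H: "s n \<in> H1" for n using s S by blast
  have "(\<lambda>n. l2_inner M (D i (s n)) (E1 i k)) \<longlonglongrightarrow> l2_inner M (D i u) (E1 i k)"
    by (rule l2_lim_inner_left) (use H1_D H s E1_L2 in \<open>auto simp: w12_lim_def\<close>)
  moreover have "(\<lambda>n. c * l2_inner M (s n) (E k)) \<longlonglongrightarrow> c * l2_inner M u (E k)"
    by (intro tendsto_mult_left l2_lim_inner_left) (use H1_D H s E_L2 in \<open>auto simp: w12_lim_def\<close>)
  ultimately show ?thesis unfolding id[OF s(2)] by (rule LIMSEQ_unique)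
qed

text \<open>A weak derivative may be paired only with test functions, so the differentiated mode is
  approximated by cutoffs. It vanishes on the faces perpendicular to the i-th axis, exactly the
  condition under which the i-th derivatives of the cutoffs converge.\<close>

lemma form_id_H1:
  assumes bc: "\<And>k. k \<in> I \<Longrightarrow> e' k (L/2) = 0" "\<And>k. k \<in> I \<Longrightarrow> e' k (- (L/2)) = 0"
    and u: "u \<in> H1" and k: "k \<in> K"
  shows "l2_inner M (D i u) (E1 i k) = of_real (\<mu> (k i)) * l2_inner M u (E k)"
proof -
  define g where "g = (\<lambda>j. e (k j))(i := e' (k i))"
  define d where "d l = (if l = i then (\<lambda>t. - of_real (\<mu> (k i)) * e (k i) t) else e' (k l))" for l
  have d: "(g l has_vector_derivative d l t) (at t)" for l t
    by (simp add: d_def g_def de de'[simplified])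
  have sg: "smooth1 (g l)" for l by (simp add: g_def smooth_e smooth_e')
  have ki: "k i \<in> I" using k by (simp add: K_def)
  have gE: "tensor g = E1 i k" by (simp add: g_def E1_def)
  have dE: "tensor (g(i := d i)) = E2 i i k"
    using tensor_partial(2)[of g d, OF d, where i=i] partial_E1[of i i k] unfolding gE by auto
  show ?thesis
  proof (rule tensor_cutoff[of g d, OF sg d])
    fix \<phi> :: "nat \<Rightarrow> real^'n \<Rightarrow> complex"
    assume \<phi>: "\<And>m. \<phi> m \<in> test_functions \<Omega>" "l2_lim M \<phi> (tensor g)"
      "\<And>i. g i (L/2) = 0 \<Longrightarrow> g i (- (L/2)) = 0 \<Longrightarrow> l2_lim M (\<lambda>m. partial i (\<phi> m)) (tensor (g(i := d i)))"
    have lim: "l2_lim M (\<lambda>m. partial i (\<phi> m)) (E2 i i k)"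
      unfolding dE[symmetric] by (rule \<phi>(3)) (simp_all add: g_def bc ki)
    have "weak_partial \<Omega> i (\<lambda>x. cnj (u x)) (\<lambda>x. cnj (D i u x))" by (intro weak_partial_cnj H1_D u)
    then have id: "l2_inner M u (partial i (\<phi> m)) = - l2_inner M (D i u) (\<phi> m)" for m
      using \<phi>(1) unfolding weak_partial_def l2_inner_def by blast
    have "(\<lambda>m. l2_inner M u (partial i (\<phi> m))) \<longlonglongrightarrow> l2_inner M u (E2 i i k)"
      by (intro l2_lim_inner_right lim test_function_L2 \<phi> E2_L2 H1_D u)
    moreover have "(\<lambda>m. - l2_inner M (D i u) (\<phi> m)) \<longlonglongrightarrow> - l2_inner M (D i u) (E1 i k)"
      using \<phi>(2) unfolding gE by (intro tendsto_minus l2_lim_inner_right test_function_L2 \<phi> E1_L2 H1_D u)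
    ultimately have "l2_inner M u (E2 i i k) = - l2_inner M (D i u) (E1 i k)"
      unfolding id by (rule LIMSEQ_unique)
    then show ?thesis unfolding E2_same l2_inner_cmult_right by simp
  qed
qed

text \<open>All factors of the mode vanish at the ends, so the cutoffs converge together with all
  their derivatives.\<close>

lemma E_W12_closure:
  assumes bc: "\<And>k. k \<in> I \<Longrightarrow> e k (L/2) = 0" "\<And>k. k \<in> I \<Longrightarrow> e k (- (L/2)) = 0" and k: "k \<in> K"
  shows "E k \<in> W12_closure \<Omega> (test_functions \<Omega>)"
proof -
  have ki: "k i \<in> I" for i using k by (simp add: K_def)
  show ?thesis
  proof (rule tensor_cutoff[of "\<lambda>j. e (k j)" "\<lambda>j. e' (k j)", OF smooth_e de, folded E_def E1_def])
    fix \<phi> :: "nat \<Rightarrow> real^'n \<Rightarrow> complex"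
    assume \<phi>: "\<And>m. \<phi> m \<in> test_functions \<Omega>" "l2_lim M \<phi> (E k)"
      "\<And>i. e (k i) (L/2) = 0 \<Longrightarrow> e (k i) (- (L/2)) = 0 \<Longrightarrow> l2_lim M (\<lambda>m. partial i (\<phi> m)) (E1 i k)"
    have "w12_lim \<phi> (E k)"
    proof (rule w12_lim_smooth)
      show "smooth (\<phi> n)" for n using \<phi>(1)[of n] by (simp add: test_functions_def)
      show "l2_lim M (\<lambda>n. partial i (\<phi> n)) (partial i (E k))" for i
        unfolding partial_E using bc ki by (intro \<phi>) auto
    qed (rule smooth_E \<phi>)+
    then show ?thesis
      unfolding W12_closure_iff[OF test_functions_H1] using \<phi>(1) H1_smooth(1)[OF smooth_E] by blast
  qed
qed

lemma E_smooth_periodic: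
  assumes per: "\<And>k t. e k (t + L) = e k t"
  shows "E k \<in> smooth_periodic L"
proof -
  have "E k (x + axis i L) = E k x" for x i
    unfolding E_def tensor_def by (intro prod.cong refl) (simp add: per axis_def)
  then show ?thesis by (simp add: smooth_periodic_def smooth_E)
qed

lemma smooth_periodic_W12_closure:
  assumes "u \<in> smooth_periodic L"
  shows "u \<in> W12_closure \<Omega> (smooth_periodic L)"
proof -
  have "w12_lim (\<lambda>n. u) u" by (simp add: w12_lim_def l2_lim_def l2_norm_def)
  then show ?thesis unfolding W12_closure_iff[OF smooth_periodic_H1]
    using assms smooth_periodic_H1 by (intro conjI exI[of _ "\<lambda>n. u"]) auto
qed

end

subsection \<open>The one-dimensional eigenfunctions\<close>

text \<open>\<open>angle L\<close> maps the edge \<open>(- L / 2, L / 2)\<close> affinely onto \<open>(0, \<pi>)\<close>.\<close>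

definition angle :: "real \<Rightarrow> real \<Rightarrow> real" where "angle L t = pi * (t / L + 1 / 2)"

lemma angle_deriv: "(angle L has_real_derivative pi / L) (at t)"
  unfolding angle_def[abs_def] divide_inverse by (auto intro!: derivative_eq_intros)

lemma angle_ends: "L > 0 \<Longrightarrow> angle L (L/2) = pi" "L > 0 \<Longrightarrow> angle L (- (L/2)) = 0"
  by (simp_all add: angle_def)

lemma angle_range:
  assumes "L > 0"
  shows "- (L/2) \<le> t \<Longrightarrow> 0 \<le> angle L t" "t \<le> L/2 \<Longrightarrow> angle L t \<le> pi"
    "- (L/2) < t \<Longrightarrow> 0 < angle L t" "t < L/2 \<Longrightarrow> angle L t < pi"
proof -
  have "angle L t = pi / L * (t + L/2)" using assms by (simp add: angle_def field_simps)
  then show "- (L/2) \<le> t \<Longrightarrow> 0 \<le> angle L t" "- (L/2) < t \<Longrightarrow> 0 < angle L t" using assms by simp_all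
  show "t \<le> L/2 \<Longrightarrow> angle L t \<le> pi" "t < L/2 \<Longrightarrow> angle L t < pi"
    using assms by (simp_all add: angle_def field_simps)
qed

lemma angle_inj: "L > 0 \<Longrightarrow> angle L s = angle L t \<Longrightarrow> s = t"
  by (simp add: angle_def)

lemma cos_angle_deriv: "((\<lambda>t. cos (c * angle L t)) has_real_derivative - (c * pi / L) * sin (c * angle L t)) (at t)"
  by (auto intro!: derivative_eq_intros angle_deriv)

lemma sin_angle_deriv: "((\<lambda>t. sin (c * angle L t)) has_real_derivative (c * pi / L) * cos (c * angle L t)) (at t)"
  by (auto intro!: derivative_eq_intros angle_deriv)

lemma has_integral_cos_angle:
  assumes L: "L > 0"
  shows "((\<lambda>t. cos (of_int m * angle L t)) has_integral (if m = 0 then L else 0)) {- (L/2)..L/2}"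
proof (cases "m = 0")
  case True
  then show ?thesis using has_integral_const_real[of "1::real" "- (L/2)" "L/2"] L by simp
next
  case False
  define c where "c = of_int m * pi / L"
  have c: "c \<noteq> 0" using False L by (simp add: c_def)
  have "((\<lambda>t. sin (of_int m * angle L t) / c) has_real_derivative cos (of_int m * angle L t)) (at t)" for t
    using DERIV_cdivide[OF sin_angle_deriv[of "of_int m" L t], of c] c unfolding c_def by simp
  then have "((\<lambda>t. cos (of_int m * angle L t)) has_integral
     (sin (of_int m * angle L (L/2)) / c - sin (of_int m * angle L (- (L/2))) / c)) {- (L/2)..L/2}"
    using L by (intro fundamental_theorem_of_calculus)
      (auto simp: has_real_derivative_iff_has_vector_derivative intro: has_vector_derivative_at_within)
  then show ?thesis using False L by (simp add: angle_ends sin_npi_int mult.commute)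
qed

lemma integral_of_real_cos_angle:
  assumes L: "L > 0" and f: "\<And>t. f t = complex_of_real (a * cos (of_int m * angle L t) + b * cos (of_int n * angle L t))"
  shows "integral {- (L/2)..L/2} f = of_real (a * (if m = 0 then L else 0) + b * (if n = 0 then L else 0))"
proof -
  have "((\<lambda>t. a * cos (of_int m * angle L t) + b * cos (of_int n * angle L t)) has_integral
      a * (if m = 0 then L else 0) + b * (if n = 0 then L else 0)) {- (L/2)..L/2}"
    by (intro has_integral_add has_integral_mult_right has_integral_cos_angle L)
  from has_integral_linear[OF this bounded_linear_of_real[where 'a=complex]]
  have "(f has_integral of_real (a * (if m = 0 then L else 0) + b * (if n = 0 then L else 0))) {- (L/2)..L/2}"
    unfolding o_def f[symmetric] .
  then show ?thesis by (rule integral_unique)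
qed

lemma finite_int_square_le:
  fixes c C :: real
  assumes "c > 0"
  shows "finite {k :: int. (of_int k * c)\<^sup>2 \<le> C}"
proof (rule finite_subset)
  show "{k :: int. (of_int k * c)\<^sup>2 \<le> C} \<subseteq> {- \<lceil>C / c\<^sup>2\<rceil>..\<lceil>C / c\<^sup>2\<rceil>}"
  proof safe
    fix k :: int assume "(of_int k * c)\<^sup>2 \<le> C"
    then have "(of_int k)\<^sup>2 \<le> C / c\<^sup>2" using assms by (simp add: power_mult_distrib field_simps)
    then have "of_int (k\<^sup>2) \<le> C / c\<^sup>2" by simp
    then have "k\<^sup>2 \<le> \<lceil>C / c\<^sup>2\<rceil>" by linarith
    moreover have "\<bar>k\<bar> \<le> k\<^sup>2"
      using mult_left_mono[of 1 "\<bar>k\<bar>" "\<bar>k\<bar>"] by (cases "k = 0") (auto simp: power2_eq_square abs_mult_self_eq)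
    ultimately show "k \<in> {- \<lceil>C / c\<^sup>2\<rceil>..\<lceil>C / c\<^sup>2\<rceil>}" by auto
  qed
qed auto

text \<open>Squared frequencies of the sines and cosines: integer multiples of pi / L, half of the
  periodic ones.\<close>

definition half_freq_sq :: "real \<Rightarrow> int \<Rightarrow> real" where "half_freq_sq L k = (of_int k * (pi / L))\<^sup>2"

lemma finite_half_freq_sq:
  assumes "L > 0"
  shows "finite {k \<in> I. half_freq_sq L k \<le> C}"
proof -
  have "finite {k :: int. (of_int k * (pi / L))\<^sup>2 \<le> C}" by (rule finite_int_square_le) (use assms in simp)
  then show ?thesis unfolding half_freq_sq_def by (rule finite_subset[rotated]) auto
qed

definition dir_e :: "real \<Rightarrow> int \<Rightarrow> real \<Rightarrow> complex" where
  "dir_e L k t = of_real (sqrt (2 / L) * sin (of_int k * angle L t))"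
definition dir_e' :: "real \<Rightarrow> int \<Rightarrow> real \<Rightarrow> complex" where
  "dir_e' L k t = of_real (sqrt (2 / L) * (of_int k * pi / L) * cos (of_int k * angle L t))"

lemma dir_e_ends: "L > 0 \<Longrightarrow> dir_e L k (L/2) = 0" "L > 0 \<Longrightarrow> dir_e L k (- (L/2)) = 0"
  by (simp_all add: dir_e_def angle_ends sin_npi_int mult.commute)

lemma trig1_dirichlet:
  assumes L: "L > 0"
  shows "trig1 L {1..} (dir_e L) (dir_e' L) (half_freq_sq L)"
proof
  show "(dir_e L k has_vector_derivative dir_e' L k t) (at t)" for k t
    unfolding dir_e_def[abs_def] dir_e'_def mult.assoc
    by (intro has_vector_derivative_of_real DERIV_cmult sin_angle_deriv)
  show "(dir_e' L k has_vector_derivative - of_real (half_freq_sq L k) * dir_e L k t) (at t)" for k t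
  proof -
    have "(dir_e' L k has_vector_derivative of_real (sqrt (2 / L) * (of_int k * pi / L) * (- (of_int k * pi / L) * sin (of_int k * angle L t)))) (at t)"
      unfolding dir_e'_def[abs_def]
      by (intro has_vector_derivative_of_real DERIV_cmult cos_angle_deriv)
    then show ?thesis by (simp add: dir_e_def half_freq_sq_def power2_eq_square mult_ac)
  qed
  show "integral {- (L/2)..L/2} (\<lambda>t. cnj (dir_e L k t) * dir_e L l t) = (if k = l then 1 else 0)"
    if "k \<in> {1..}" "l \<in> {1..}" for k l
  proof -
    have "cnj (dir_e L k t) * dir_e L l t
        = of_real (1 / L * cos (of_int (k - l) * angle L t) + - (1 / L) * cos (of_int (k + l) * angle L t))" for t
    proof -
      have "cnj (dir_e L k t) * dir_e L l t
         = of_real ((sqrt (2 / L))\<^sup>2 * (sin (of_int k * angle L t) * sin (of_int l * angle L t)))"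
        unfolding dir_e_def complex_cnj_complex_of_real of_real_mult[symmetric] power2_eq_square by (simp only: mult_ac)
      also have "\<dots> = of_real (2 / L * ((cos (of_int (k - l) * angle L t) - cos (of_int (k + l) * angle L t)) / 2))"
        using L by (subst sin_times_sin) (simp add: algebra_simps)
      finally show ?thesis by (simp add: algebra_simps diff_divide_distrib)
    qed
    from integral_of_real_cos_angle[OF L this] show ?thesis using that L by auto
  qed
  show "infinite {1::int..}" by (rule infinite_Ici)
  show "finite {k \<in> {1..}. half_freq_sq L k \<le> C}" for C by (rule finite_half_freq_sq[OF L])
qed (use L in \<open>auto simp: dir_e_ends half_freq_sq_def\<close>)

text \<open>Normalisation in L^2 of the edge; the constant mode differs because its mean square is
  not halved by oscillation.\<close>

definition neu_c :: "real \<Rightarrow> int \<Rightarrow> real" where "neu_c L k = (if k = 0 then sqrt (1 / L) else sqrt (2 / L))"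
definition neu_e :: "real \<Rightarrow> int \<Rightarrow> real \<Rightarrow> complex" where
  "neu_e L k t = of_real (neu_c L k * cos (of_int k * angle L t))"
definition neu_e' :: "real \<Rightarrow> int \<Rightarrow> real \<Rightarrow> complex" where
  "neu_e' L k t = of_real (neu_c L k * - (of_int k * pi / L) * sin (of_int k * angle L t))"

lemma neu_c_pos: "L > 0 \<Longrightarrow> neu_c L k > 0"
  by (simp add: neu_c_def)

lemma neu_e'_ends: "L > 0 \<Longrightarrow> neu_e' L k (L/2) = 0" "L > 0 \<Longrightarrow> neu_e' L k (- (L/2)) = 0"
  by (simp_all add: neu_e'_def angle_ends sin_npi_int mult.commute)

lemma trig1_neumann:
  assumes L: "L > 0"
  shows "trig1 L {0..} (neu_e L) (neu_e' L) (half_freq_sq L)"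
proof
  show "(neu_e L k has_vector_derivative neu_e' L k t) (at t)" for k t
    unfolding neu_e_def[abs_def] neu_e'_def mult.assoc
    by (intro has_vector_derivative_of_real DERIV_cmult cos_angle_deriv)
  show "(neu_e' L k has_vector_derivative - of_real (half_freq_sq L k) * neu_e L k t) (at t)" for k t
  proof -
    have "(neu_e' L k has_vector_derivative of_real (neu_c L k * - (of_int k * pi / L) * ((of_int k * pi / L) * cos (of_int k * angle L t)))) (at t)"
      unfolding neu_e'_def[abs_def]
      by (intro has_vector_derivative_of_real DERIV_cmult sin_angle_deriv)
    then show ?thesis by (simp add: neu_e_def half_freq_sq_def power2_eq_square mult_ac)
  qed
  show "integral {- (L/2)..L/2} (\<lambda>t. cnj (neu_e L k t) * neu_e L l t) = (if k = l then 1 else 0)"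
    if "k \<in> {0..}" "l \<in> {0..}" for k l
  proof -
    define c where "c = neu_c L k * neu_c L l / 2"
    have "cnj (neu_e L k t) * neu_e L l t
        = of_real (c * cos (of_int (k - l) * angle L t) + c * cos (of_int (k + l) * angle L t))" for t
    proof -
      have "cnj (neu_e L k t) * neu_e L l t
         = of_real (neu_c L k * neu_c L l * (cos (of_int k * angle L t) * cos (of_int l * angle L t)))"
        by (simp add: neu_e_def)
      also have "\<dots> = of_real (neu_c L k * neu_c L l * ((cos (of_int (k - l) * angle L t) + cos (of_int (k + l) * angle L t)) / 2))"
        by (subst cos_times_cos) (simp add: algebra_simps)
      finally show ?thesis by (simp add: algebra_simps add_divide_distrib c_def)
    qed
    from integral_of_real_cos_angle[OF L this]
    have "integral {- (L/2)..L/2} (\<lambda>t. cnj (neu_e L k t) * neu_e L l t)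
      = of_real (c * (if k - l = 0 then L else 0) + c * (if k + l = 0 then L else 0))" .
    \<comment> \<open>For nonnegative indices k + l = 0 means k = l = 0; then both cosine terms
      contribute, which the smaller normalisation of the constant mode compensates.\<close>
    moreover have "c * (if k - l = 0 then L else 0) + c * (if k + l = 0 then L else 0) = (if k = l then 1 else 0)"
      using that L by (auto simp: c_def neu_c_def)
    ultimately show ?thesis by (simp only: of_real_eq_iff) simp
  qed
  show "infinite {0::int..}" by (rule infinite_Ici)
  show "finite {k \<in> {0..}. half_freq_sq L k \<le> C}" for C by (rule finite_half_freq_sq[OF L])
qed (use L in \<open>auto simp: neu_e'_ends half_freq_sq_def\<close>)

definition per_e :: "real \<Rightarrow> int \<Rightarrow> real \<Rightarrow> complex" where
  "per_e L k t = of_real (sqrt (1 / L)) * cis (of_int k * (2 * pi / L) * t)"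
definition per_e' :: "real \<Rightarrow> int \<Rightarrow> real \<Rightarrow> complex" where
  "per_e' L k t = \<i> * of_real (of_int k * (2 * pi / L)) * per_e L k t"

lemma cis_linear_deriv: "((\<lambda>t. cis (c * t)) has_vector_derivative \<i> * of_real c * cis (c * t)) (at t)"
proof -
  have "((\<lambda>t. cis (c * t)) has_derivative (\<lambda>h. (c * h) *\<^sub>R (\<i> * cis (c * t)))) (at t)"
    by (rule has_derivative_cis) (auto intro!: derivative_eq_intros)
  then show ?thesis unfolding has_vector_derivative_def by (simp add: scaleR_conv_of_real mult_ac)
qed

lemma cis_add_multiple: "cis (x + of_int n * (2 * pi)) = cis x"
  by (simp add: cis_mult[symmetric] mult.commute[of "of_int n"] cis_multiple_2pi)

lemma per_e_periodic:
  assumes "L > 0"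
  shows "per_e L k (t + L) = per_e L k t" "per_e' L k (t + L) = per_e' L k t"
proof -
  have "of_int k * (2 * pi / L) * (t + L) = of_int k * (2 * pi / L) * t + of_int k * (2 * pi)"
    using assms by (simp add: field_simps)
  then show "per_e L k (t + L) = per_e L k t" unfolding per_e_def by (simp only: cis_add_multiple)
  then show "per_e' L k (t + L) = per_e' L k t" unfolding per_e'_def by simp
qed

lemma has_integral_cis:
  assumes L: "L > 0"
  shows "((\<lambda>t. cis (of_int m * (2 * pi / L) * t)) has_integral (if m = 0 then of_real L else 0)) {- (L/2)..L/2}"
proof (cases "m = 0")
  case True
  then show ?thesis using has_integral_const_real[of "1::complex" "- (L/2)" "L/2"] L by (simp add: scaleR_conv_of_real)
next
  case False
  define c where "c = of_int m * (2 * pi / L)"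
  have c: "c \<noteq> 0" using False L by (simp add: c_def)
  have "((\<lambda>t. inverse (\<i> * of_real c) * cis (c * t)) has_vector_derivative cis (c * t)) (at t)" for t
  proof -
    have "inverse (\<i> * of_real c) * (\<i> * of_real c * cis (c * t)) = cis (c * t)"
      using c by (simp add: field_simps)
    then show ?thesis
      using has_vector_derivative_mult_right[OF cis_linear_deriv[of c t], of "inverse (\<i> * of_real c)"] by metis
  qed
  then have "((\<lambda>t. cis (c * t)) has_integral
     (inverse (\<i> * of_real c) * cis (c * (L/2)) - inverse (\<i> * of_real c) * cis (c * (- (L/2))))) {- (L/2)..L/2}"
    using L by (intro fundamental_theorem_of_calculus) (auto intro: has_vector_derivative_at_within)
  moreover have "c * (L/2) = c * (- (L/2)) + of_int m * (2 * pi)" using L by (simp add: c_def field_simps)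
  then have "cis (c * (L/2)) = cis (c * (- (L/2)))" by (simp only: cis_add_multiple)
  ultimately show ?thesis using False by (simp add: c_def)
qed

lemma trig1_periodic:
  assumes L: "L > 0"
  shows "trig1 L UNIV (per_e L) (per_e' L) (\<lambda>k. (of_int k * (2 * pi / L))\<^sup>2)"
proof
  show d: "(per_e L k has_vector_derivative per_e' L k t) (at t)" for k t
    using has_vector_derivative_mult_right[OF cis_linear_deriv[of "of_int k * (2 * pi / L)" t], of "of_real (sqrt (1 / L))"]
    unfolding per_e_def[abs_def] per_e'_def by (simp add: mult_ac)
  show "(per_e' L k has_vector_derivative - of_real ((of_int k * (2 * pi / L))\<^sup>2) * per_e L k t) (at t)" for k t
    using has_vector_derivative_mult_right[OF d[of k t], of "\<i> * of_real (of_int k * (2 * pi / L))"]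
    unfolding per_e'_def[abs_def] by (simp add: power2_eq_square mult_ac)
  show "integral {- (L/2)..L/2} (\<lambda>t. cnj (per_e L k t) * per_e L l t) = (if k = l then 1 else 0)" for k l
  proof -
    have "cnj (per_e L k t) * per_e L l t = of_real (1 / L) * cis (of_int (l - k) * (2 * pi / L) * t)" for t
    proof -
      have "cnj (per_e L k t) * per_e L l t = of_real ((sqrt (1 / L))\<^sup>2) * (cis (- (of_int k * (2 * pi / L) * t)) * cis (of_int l * (2 * pi / L) * t))"
        unfolding per_e_def complex_cnj_mult complex_cnj_complex_of_real cis_cnj power2_eq_square of_real_mult by (simp only: mult_ac)
      also have "\<dots> = of_real (1 / L) * cis (of_int (l - k) * (2 * pi / L) * t)"
        using L unfolding cis_mult by (simp add: algebra_simps diff_divide_distrib)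
      finally show ?thesis .
    qed
    moreover have "integral {- (L/2)..L/2} (\<lambda>t. of_real (1 / L) * cis (of_int (l - k) * (2 * pi / L) * t))
        = of_real (1 / L) * (if l - k = 0 then of_real L else 0)"
      by (intro integral_unique has_integral_mult_right has_integral_cis L)
    ultimately show ?thesis using L by simp
  qed
  have ends: "per_e L k (L/2) = per_e L k (- (L/2))" "per_e' L k (L/2) = per_e' L k (- (L/2))" for k
    using per_e_periodic[OF L, of k "- (L/2)"] by simp_all
  show "cnj (per_e L k (L/2)) * per_e' L l (L/2) = cnj (per_e L k (- (L/2))) * per_e' L l (- (L/2))" for k l
    unfolding ends ..
  show "finite {k \<in> UNIV. (of_int k * (2 * pi / L))\<^sup>2 \<le> C}" for C
    using finite_int_square_le[of "2 * pi / L" C] L by simp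
qed (use L in auto)

section \<open>Completeness of the sine, cosine and exponential systems\<close>

lemma total_dirichlet:
  fixes f :: "real^'n::finite \<Rightarrow> complex"
  assumes "trig L {1..} (dir_e L) (dir_e' L) (half_freq_sq L)"
    and "f \<in> L2 (lebesgue_on (cube L))" "\<And>k. k \<in> trig.K {1..} \<Longrightarrow> l2_inner (lebesgue_on (cube L)) (trig.E (dir_e L) k) f = 0"
  shows "AE x in lebesgue_on (cube L). f x = 0"
proof -
  interpret trig L "TYPE('n)" "{1..}" "dir_e L" "dir_e' L" "half_freq_sq L" by (rule assms)
  show ?thesis
  \<comment> \<open>The cosine of the angle is injective on the closed edge and multiplication by it
    averages neighbouring sines; the first sine has no zero in the open edge.\<close>
  proof (rule total[where \<phi>="\<lambda>t. of_real (cos (angle L t))" and ?k0.0=1])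
    show "continuous_on UNIV (\<lambda>t. complex_of_real (cos (angle L t)))"
      unfolding angle_def[abs_def] divide_inverse by (intro continuous_intros)
    show "s = t" if "- (L/2) < s" "s < L/2" "t \<in> {- (L/2)..L/2}" "complex_of_real (cos (angle L s)) = of_real (cos (angle L t))" for s t
      by (rule angle_inj[OF L_pos cos_inj_pi]) (use that in \<open>auto simp: angle_range[OF L_pos]\<close>)
    show "\<exists>a l a' l'. l \<in> {1..} \<and> l' \<in> {1..} \<and>
        (\<forall>t. dir_e L k t * of_real (Re (of_real (cos (angle L t)))) = a * dir_e L l t + a' * dir_e L l' t)"
      if "k \<in> {1..}" for k
    proof -
      have id: "dir_e L k t * of_real (Re (of_real (cos (angle L t)))) = 1/2 * dir_e L (k + 1) t + 1/2 * dir_e L (k - 1) t" for t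
      proof -
        have t: "sin (of_int k * angle L t) * cos (angle L t) = (sin (of_int (k + 1) * angle L t) + sin (of_int (k - 1) * angle L t)) / 2"
          by (subst sin_times_cos) (simp add: algebra_simps)
        have "sqrt (2/L) * sin (of_int k * angle L t) * cos (angle L t) =
           1/2 * (sqrt (2/L) * sin (of_int (k + 1) * angle L t)) + 1/2 * (sqrt (2/L) * sin (of_int (k - 1) * angle L t))"
          unfolding mult.assoc t by (simp add: algebra_simps add_divide_distrib)
        from arg_cong[OF this, of complex_of_real] show ?thesis
          unfolding dir_e_def of_real_mult of_real_add by simp
      qed
      show ?thesis
      \<comment> \<open>The lower neighbour of index 1 is 0, outside the index set; its sine
        vanishes, so the coefficient 0 with an arbitrary admissible index replaces it.\<close>
      proof (cases "k = 1")
        case True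
        have "dir_e L (k - 1) t = 0" for t by (simp add: dir_e_def True)
        then show ?thesis using that unfolding id by (intro exI[of _ "1/2"] exI[of _ "k + 1"] exI[of _ 0] exI[of _ k]) auto
      next
        case False
        then show ?thesis using that unfolding id by (intro exI[of _ "1/2"] exI[of _ "k + 1"] exI[of _ "1/2"] exI[of _ "k - 1"]) auto
      qed
    qed
    show "\<exists>a l a' l'. l \<in> {1..} \<and> l' \<in> {1..} \<and>
        (\<forall>t. dir_e L k t * of_real (Im (of_real (cos (angle L t)))) = a * dir_e L l t + a' * dir_e L l' t)"
      if "k \<in> {1..}" for k
      using that by (intro exI[of _ 0] exI[of _ k]) simp
    show "dir_e L 1 t \<noteq> 0" if "- (L/2) < t" "t < L/2" for t
      using sin_gt_zero[OF angle_range(3)[OF L_pos that(1)] angle_range(4)[OF L_pos that(2)]] L_pos by (simp add: dir_e_def)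
  qed (use assms in auto)
qed

lemma total_neumann:
  fixes f :: "real^'n::finite \<Rightarrow> complex"
  assumes "trig L {0..} (neu_e L) (neu_e' L) (half_freq_sq L)"
    and "f \<in> L2 (lebesgue_on (cube L))" "\<And>k. k \<in> trig.K {0..} \<Longrightarrow> l2_inner (lebesgue_on (cube L)) (trig.E (neu_e L) k) f = 0"
  shows "AE x in lebesgue_on (cube L). f x = 0"
proof -
  interpret trig L "TYPE('n)" "{0..}" "neu_e L" "neu_e' L" "half_freq_sq L" by (rule assms)
  show ?thesis
  proof (rule total[where \<phi>="\<lambda>t. of_real (cos (angle L t))" and ?k0.0=0])
    show "continuous_on UNIV (\<lambda>t. complex_of_real (cos (angle L t)))"
      unfolding angle_def[abs_def] divide_inverse by (intro continuous_intros)
    show "s = t" if "- (L/2) < s" "s < L/2" "t \<in> {- (L/2)..L/2}" "complex_of_real (cos (angle L s)) = of_real (cos (angle L t))" for s t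
      by (rule angle_inj[OF L_pos cos_inj_pi]) (use that in \<open>auto simp: angle_range[OF L_pos]\<close>)
    show "\<exists>a l a' l'. l \<in> {0..} \<and> l' \<in> {0..} \<and>
        (\<forall>t. neu_e L k t * of_real (Re (of_real (cos (angle L t)))) = a * neu_e L l t + a' * neu_e L l' t)"
      if "k \<in> {0..}" for k
    proof -
      \<comment> \<open>Half the ratio of normalisations, which is not constant because index 0 is
        normalised differently.\<close>
      define c where "c l = neu_c L k / (2 * neu_c L l)" for l
      have c: "c l * neu_c L l = neu_c L k / 2" for l using neu_c_pos[OF L_pos, of l] by (simp add: c_def)
      \<comment> \<open>The lower neighbour of index 0 is -1; evenness of the cosine reflects it to
        1.\<close>
      have abs: "cos (of_int \<bar>k - 1\<bar> * angle L t) = cos (of_int (k - 1) * angle L t)" for t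
        using cos_minus[of "of_int (k - 1) * angle L t"] by (auto simp: abs_if algebra_simps)
      have "neu_e L k t * of_real (Re (of_real (cos (angle L t))))
          = of_real (c (k + 1)) * neu_e L (k + 1) t + of_real (c \<bar>k - 1\<bar>) * neu_e L \<bar>k - 1\<bar> t" for t
      proof -
        have t: "cos (of_int k * angle L t) * cos (angle L t) = (cos (of_int (k - 1) * angle L t) + cos (of_int (k + 1) * angle L t)) / 2"
          by (subst cos_times_cos) (simp add: algebra_simps)
        have "neu_c L k * cos (of_int k * angle L t) * cos (angle L t) =
            c (k + 1) * neu_c L (k + 1) * cos (of_int (k + 1) * angle L t) + c \<bar>k - 1\<bar> * neu_c L \<bar>k - 1\<bar> * cos (of_int \<bar>k - 1\<bar> * angle L t)"
          unfolding c abs mult.assoc t by (simp add: algebra_simps add_divide_distrib)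
        from arg_cong[OF this, of complex_of_real] show ?thesis
          unfolding neu_e_def of_real_mult of_real_add by (simp add: mult.assoc)
      qed
      then show ?thesis using that
        by (intro exI[of _ "of_real (c (k + 1))"] exI[of _ "k + 1"] exI[of _ "of_real (c \<bar>k - 1\<bar>)"] exI[of _ "\<bar>k - 1\<bar>"]) auto
    qed
    show "\<exists>a l a' l'. l \<in> {0..} \<and> l' \<in> {0..} \<and>
        (\<forall>t. neu_e L k t * of_real (Im (of_real (cos (angle L t)))) = a * neu_e L l t + a' * neu_e L l' t)"
      if "k \<in> {0..}" for k
      using that by (intro exI[of _ 0] exI[of _ k]) simp
    show "neu_e L 0 t \<noteq> 0" if "- (L/2) < t" "t < L/2" for t
      using L_pos by (simp add: neu_e_def neu_c_def)
  qed (use assms in auto)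
qed

lemma total_periodic:
  fixes f :: "real^'n::finite \<Rightarrow> complex"
  assumes "trig L UNIV (per_e L) (per_e' L) (\<lambda>k. (of_int k * (2 * pi / L))\<^sup>2)"
    and "f \<in> L2 (lebesgue_on (cube L))" "\<And>k. k \<in> trig.K UNIV \<Longrightarrow> l2_inner (lebesgue_on (cube L)) (trig.E (per_e L) k) f = 0"
  shows "AE x in lebesgue_on (cube L). f x = 0"
proof -
  interpret trig L "TYPE('n)" UNIV "per_e L" "per_e' L" "\<lambda>k. (of_int k * (2 * pi / L))\<^sup>2" by (rule assms)
  define \<tau> where "\<tau> t = 2 * pi / L * t" for t
  have shift: "per_e L k t * cis (of_int n * \<tau> t) = per_e L (k + n) t" for k n t
    by (simp add: per_e_def \<tau>_def cis_mult mult.assoc algebra_simps add_divide_distrib)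
  have shift': "per_e L (k + 1) t = per_e L k t * cis (\<tau> t)" "per_e L (k - 1) t = per_e L k t * cis (- \<tau> t)" for k t
    using shift[of k t 1] shift[of k t "-1"] by simp_all
  show ?thesis
  proof (rule total[where \<phi>="\<lambda>t. cis (\<tau> t)" and ?k0.0=0])
    show "continuous_on UNIV (\<lambda>t. cis (\<tau> t))"
      unfolding \<tau>_def cis_conv_exp by (intro continuous_intros)
    show "s = t" if st: "- (L/2) < s" "s < L/2" "t \<in> {- (L/2)..L/2}" and eq: "cis (\<tau> s) = cis (\<tau> t)" for s t
    proof -
      have "sin (\<tau> s) = sin (\<tau> t) \<and> cos (\<tau> s) = cos (\<tau> t)" using eq by (simp add: complex_eq_iff)
      then obtain n :: int where n: "\<tau> s = \<tau> t + 2 * pi * of_int n" unfolding sin_cos_eq_iff by blast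
      then have "2 * pi * (s / L) = 2 * pi * (t / L + of_int n)" by (simp add: \<tau>_def algebra_simps)
      then have n': "s / L = t / L + of_int n" by (subst (asm) mult_left_cancel) simp_all
      \<comment> \<open>\<open>cis\<close> identifies the two ends of the edge, but s is an interior
        point, so s and t cannot differ by a full period.\<close>
      have "\<bar>s - t\<bar> < L" using st by auto
      then have "\<bar>(s - t) / L\<bar> < 1" using L_pos by simp
      then have "\<bar>of_int n :: real\<bar> < 1" using n' by (simp add: diff_divide_distrib)
      then have "n = 0" by linarith
      with n' show ?thesis using L_pos by simp
    qed
    show "\<exists>a l a' l'. l \<in> UNIV \<and> l' \<in> UNIV \<and>
        (\<forall>t. per_e L k t * of_real (Re (cis (\<tau> t))) = a * per_e L l t + a' * per_e L l' t)" for k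
    proof -
      have "per_e L k t * of_real (Re (cis (\<tau> t))) = 1/2 * per_e L (k + 1) t + 1/2 * per_e L (k - 1) t" for t
        unfolding shift' by (simp add: complex_eq_iff distrib_left[symmetric] add_divide_distrib[symmetric])
      then show ?thesis by blast
    qed
    show "\<exists>a l a' l'. l \<in> UNIV \<and> l' \<in> UNIV \<and>
        (\<forall>t. per_e L k t * of_real (Im (cis (\<tau> t))) = a * per_e L l t + a' * per_e L l' t)" for k
    proof -
      have "per_e L k t * of_real (Im (cis (\<tau> t))) = (- \<i>/2) * per_e L (k + 1) t + (\<i>/2) * per_e L (k - 1) t" for t
        unfolding shift' by (simp add: complex_eq_iff) (simp add: field_simps)
      then show ?thesis by blast
    qed
    show "per_e L 0 t \<noteq> 0" if "- (L/2) < t" "t < L/2" for t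
      using L_pos by (simp add: per_e_def)
  qed (use assms in auto)
qed

section \<open>The spectral projector\<close>

lemma eigenbasis_of_form_basis:
  fixes V :: "real^'n::finite \<Rightarrow> real"
  assumes "form_basis L I e e' \<mu> (form_domain bc L) V B"
  shows "\<exists>\<psi> En. eigenbasis_graph (lebesgue_on (cube L)) (schroedinger_op bc V L) \<psi> En \<and>
    (\<forall>n x. cnj (\<psi> n x) = \<psi> n x) \<and> (\<forall>n. \<psi> n \<in> sobolev 2 (cube L)) \<and> (\<forall>C. finite {n. En n \<le> C})"
proof -
  interpret form_basis L "TYPE('n)" I e e' \<mu> "form_domain bc L" V B by (rule assms)
  have "H = schroedinger_op bc V L" unfolding H_def schroedinger_op_def ..
  then show ?thesis using eigenbasis_exists by metis
qed

text \<open>Each boundary condition is matched with the system of modes that satisfies it: sines,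
  cosines or exponentials. The potential enters only through its bound.\<close>

theorem schroedinger_eigenbasis:
  fixes V :: "real^'n::finite \<Rightarrow> real"
  assumes L: "L > 0" and V: "V \<in> borel_measurable lebesgue" "\<And>x. \<bar>V x\<bar> \<le> B"
  shows "\<exists>\<psi> En. eigenbasis_graph (lebesgue_on (cube L)) (schroedinger_op bc V L) \<psi> En \<and>
    (\<forall>n x. cnj (\<psi> n x) = \<psi> n x) \<and> (\<forall>n. \<psi> n \<in> sobolev 2 (cube L)) \<and> (\<forall>C. finite {n. En n \<le> C})"
proof -
  interpret cube_domain L "TYPE('n)" using L by unfold_locales
  have VM: "V \<in> borel_measurable M" using V(1) by (rule measurable_restrict_space1)
  show ?thesis
  proof (cases bc)
    case Dirichlet
    have T: "trig L {1..} (dir_e L) (dir_e' L) (half_freq_sq L)"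
      by (intro trig.intro cube_domain_axioms trig1_dirichlet L)
    interpret T: trig L "TYPE('n)" "{1..}" "dir_e L" "dir_e' L" "half_freq_sq L" by (rule T)
    have FS: "form_space L (form_domain Dirichlet L) V B" unfolding form_domain.simps
      by (intro form_space_closure test_functions_H1 test_functions_linear test_functions_cnj VM V)
    have "form_basis L {1..} (dir_e L) (dir_e' L) (half_freq_sq L) (form_domain Dirichlet L) V B"
    proof (rule form_basis.intro[OF T FS form_basis_axioms.intro])
      show "T.E k \<in> form_domain Dirichlet L" if "k \<in> T.K" for k
        using that unfolding form_domain.simps by (intro T.E_W12_closure dir_e_ends L)
      show "l2_inner M (D i u) (T.E1 i k) = of_real (half_freq_sq L (k i)) * l2_inner M u (T.E k)"
        if "u \<in> form_domain Dirichlet L" for u k i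
        using that unfolding form_domain.simps
        by (rule T.form_id_closure[OF test_functions_H1 T.form_id_test_function, rotated])
    qed (rule total_dirichlet[OF T])
    then show ?thesis unfolding Dirichlet by (rule eigenbasis_of_form_basis)
  next
    case Neumann
    have T: "trig L {0..} (neu_e L) (neu_e' L) (half_freq_sq L)"
      by (intro trig.intro cube_domain_axioms trig1_neumann L)
    interpret T: trig L "TYPE('n)" "{0..}" "neu_e L" "neu_e' L" "half_freq_sq L" by (rule T)
    have FS: "form_space L (form_domain Neumann L) V B" unfolding form_domain.simps
      by (intro form_space_H1 VM V)
    have "form_basis L {0..} (neu_e L) (neu_e' L) (half_freq_sq L) (form_domain Neumann L) V B"
    proof (rule form_basis.intro[OF T FS form_basis_axioms.intro])
      show "T.E k \<in> form_domain Neumann L" for k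
        unfolding form_domain.simps by (intro H1_smooth T.smooth_E)
      show "l2_inner M (D i u) (T.E1 i k) = of_real (half_freq_sq L (k i)) * l2_inner M u (T.E k)"
        if "u \<in> form_domain Neumann L" "k \<in> T.K" for u k i
        using that unfolding form_domain.simps by (intro T.form_id_H1 neu_e'_ends L)
    qed (rule total_neumann[OF T])
    then show ?thesis unfolding Neumann by (rule eigenbasis_of_form_basis)
  next
    case Periodic
    define \<mu> where "\<mu> k = (of_int k * (2 * pi / L))\<^sup>2" for k
    have T: "trig L UNIV (per_e L) (per_e' L) \<mu>"
      unfolding \<mu>_def[abs_def] by (intro trig.intro cube_domain_axioms trig1_periodic L)
    interpret T: trig L "TYPE('n)" UNIV "per_e L" "per_e' L" \<mu> by (rule T)
    have FS: "form_space L (form_domain Periodic L) V B" unfolding form_domain.simps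
      by (intro form_space_closure smooth_periodic_H1 smooth_periodic_linear smooth_periodic_cnj VM V)
    have "form_basis L UNIV (per_e L) (per_e' L) \<mu> (form_domain Periodic L) V B"
    proof (rule form_basis.intro[OF T FS form_basis_axioms.intro])
      show "T.E k \<in> form_domain Periodic L" for k
        unfolding form_domain.simps by (intro T.smooth_periodic_W12_closure T.E_smooth_periodic per_e_periodic L)
      show "l2_inner M (D i u) (T.E1 i k) = of_real (\<mu> (k i)) * l2_inner M u (T.E k)"
        if "u \<in> form_domain Periodic L" for u k i
        using that unfolding form_domain.simps
        by (rule T.form_id_closure[OF smooth_periodic_H1 T.form_id_smooth_periodic[OF per_e_periodic[OF L]], rotated])
    qed (rule total_periodic[OF T[unfolded \<mu>_def[abs_def]]])
    then show ?thesis unfolding Periodic by (rule eigenbasis_of_form_basis)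
  qed
qed

section \<open>The observation set and the form inequality\<close>

lemma sets_obs_set:
  assumes "L > 0"
  shows "obs_set L \<delta> (z :: int^'n::finite \<Rightarrow> real^'n) \<in> sets lebesgue"
proof -
  interpret cube_domain L "TYPE('n)" using assms by unfold_locales
  have "open (obs_set L \<delta> z)" unfolding obs_set_def by (rule open_Int[OF open_cube open_UN]) simp
  then show ?thesis by (intro sets_completionI_sets) simp
qed

lemma integral_obs_set:
  fixes g :: "real^'n::finite \<Rightarrow> real"
  assumes "L > 0"
  shows "(LINT x|lebesgue_on (cube L). indicator (obs_set L \<delta> z) x * g x) = (LINT x|lebesgue_on (obs_set L \<delta> z). g x)"
proof -
  interpret cube_domain L "TYPE('n)" using assms by unfold_locales
  note obs = sets_obs_set[OF assms, of \<delta> z]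
  have "(LINT x|lebesgue_on (cube L). indicator (obs_set L \<delta> z) x * g x)
      = (LINT x|lebesgue. indicator (cube L) x *\<^sub>R (indicator (obs_set L \<delta> z) x * g x))"
    by (rule integral_restrict_space) (use sets_cube in auto)
  also have "(\<lambda>x. indicator (cube L) x *\<^sub>R (indicator (obs_set L \<delta> z) x * g x)) = (\<lambda>x. indicator (obs_set L \<delta> z) x *\<^sub>R g x)"
    by (auto simp: obs_set_def indicator_def)
  also have "(LINT x|lebesgue. indicator (obs_set L \<delta> z) x *\<^sub>R g x) = (LINT x|lebesgue_on (obs_set L \<delta> z). g x)"
    by (rule integral_restrict_space[symmetric]) (use obs in auto)
  finally show ?thesis .
qed

theorem projector_ucp_of_scale_free_ucp:
  assumes ucp: "scale_free_ucp TYPE('n::finite) K\<^sub>0"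
  shows "projector_ucp TYPE('n) K\<^sub>0"
  unfolding projector_ucp_def Let_def
proof (intro allI impI)
  fix \<delta> E :: real and V :: "real^'n \<Rightarrow> real" and L :: nat and z :: "int^'n \<Rightarrow> real^'n" and bc
  assume A: "0 < \<delta> \<and> \<delta> < 1/2 \<and> bounded_potential V \<and> 1 \<le> real L \<and> equidistributed \<delta> z"
  then have L: "real L > 0" by simp
  interpret cube_domain "real L" "TYPE('n)" using L by unfold_locales
  have "bounded (range V)" using A by (simp add: bounded_potential_def)
  then obtain B where "\<forall>y\<in>range V. norm y \<le> B" unfolding bounded_iff ..
  then have B: "\<bar>V x\<bar> \<le> B" for x by simp
  have V: "V \<in> borel_measurable lebesgue" using A by (simp add: bounded_potential_def)
  from schroedinger_eigenbasis[where bc=bc, OF L V B]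
  obtain \<psi> where "\<exists>En. eigenbasis_graph M (schroedinger_op bc V L) \<psi> En \<and>
    (\<forall>n x. cnj (\<psi> n x) = \<psi> n x) \<and> (\<forall>n. \<psi> n \<in> sobolev 2 \<Omega>) \<and> (\<forall>C. finite {n. En n \<le> C})" ..
  then obtain En where *: "eigenbasis_graph M (schroedinger_op bc V L) \<psi> En \<and>
    (\<forall>n x. cnj (\<psi> n x) = \<psi> n x) \<and> (\<forall>n. \<psi> n \<in> sobolev 2 \<Omega>) \<and> (\<forall>C. finite {n. En n \<le> C})" ..
  note eg = *[THEN conjunct1] and real = *[THEN conjunct2, THEN conjunct1, rule_format]
    and sob = *[THEN conjunct2, THEN conjunct2, THEN conjunct1, rule_format]
    and fin = *[THEN conjunct2, THEN conjunct2, THEN conjunct2, rule_format]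
  interpret eigenbasis_graph M "schroedinger_op bc V L" \<psi> En by (rule eg)
  define Q where "Q = spectral_projector M (schroedinger_op bc V L) {..E}"
  define W :: "(real^'n \<Rightarrow> complex) \<Rightarrow> real^'n \<Rightarrow> complex" where "W = mult_op (indicator (obs_set L \<delta> z))"
  define c where "c = ucp_factor K\<^sub>0 \<delta> V E"
  note obs = sets_obs_set[OF L, of \<delta> z]
  have ind: "(\<lambda>x. indicator (obs_set L \<delta> z) x :: real) \<in> borel_measurable M"
    by (intro measurable_restrict_space1 borel_measurable_indicator obs)
  show "form_ge M (\<lambda>f. Q (W (Q f))) (\<lambda>f x. of_real c * Q f x)"
    unfolding form_ge_def
  proof
    fix f assume f: "f \<in> L2 M"
    define S where "S x = (\<Sum>n | En n \<le> E. l2_inner M (\<psi> n) f * \<psi> n x)" for x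
    \<comment> \<open>The projector is known only up to null sets; from here on the honest finite
      sum S, to which the unique continuation principle applies, replaces it under
      integrals.\<close>
    have QS: "AE x in M. Q f x = S x" unfolding Q_def S_def by (rule spectral_projector_eq(1)[OF fin f])
    have Q: "Q g \<in> L2 M" "l2_inner M (Q g) h = l2_inner M g (Q h)" "AE x in M. Q (Q g) x = Q g x"
      if "g \<in> L2 M" "h \<in> L2 M" for g h
      using spectral_projector_eq(2)[OF fin f, of E] that unfolding orth_projection_def Q_def by blast+
    have Qf: "Q f \<in> L2 M" by (rule Q(1)[OF f f])
    have WQ: "W (Q f) \<in> L2 M"
      unfolding W_def mult_op_def by (rule L2_bounded_mult[of _ _ _ 1]) (use ind Qf in \<open>auto simp: indicator_def\<close>)
    have SM: "S \<in> borel_measurable M"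
      unfolding S_def[abs_def] by (intro L2_measurable L2_sum L2_cmult e_L2)
    have norms: "AE x in M. (norm (Q f x))\<^sup>2 = (norm (S x))\<^sup>2" using QS by eventually_elim simp
    have "l2_inner M f (Q f) = l2_inner M f (Q (Q f))"
      using Q(3)[OF f f] by (intro l2_inner_cong_AE L2_measurable Q(1)[OF _ f] f Qf) auto
    also have "\<dots> = l2_inner M (Q f) (Q f)" by (rule Q(2)[OF f Qf, symmetric])
    also have "\<dots> = of_real (LINT x|M. (norm (Q f x))\<^sup>2)" unfolding l2_inner_self l2_norm_sq ..
    also have "(LINT x|M. (norm (Q f x))\<^sup>2) = (LINT x|M. (norm (S x))\<^sup>2)"
      using norms L2_measurable[OF Qf] SM by (intro integral_cong_AE) auto
    finally have right: "Re (l2_inner M f (\<lambda>x. of_real c * Q f x)) = c * (LINT x|M. (norm (S x))\<^sup>2)"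
      by (simp add: l2_inner_cmult_right)
    have "l2_inner M f (Q (W (Q f))) = l2_inner M (Q f) (W (Q f))" by (rule Q(2)[OF f WQ, symmetric])
    also have "\<dots> = (LINT x|M. of_real (indicator (obs_set L \<delta> z) x * (norm (Q f x))\<^sup>2))"
      unfolding l2_inner_def W_def mult_op_def
      by (intro Bochner_Integration.integral_cong refl) (simp add: complex_norm_square mult_ac del: of_real_power)
    also have "\<dots> = of_real (LINT x|M. indicator (obs_set L \<delta> z) x * (norm (Q f x))\<^sup>2)" by (rule integral_complex_of_real)
    also have "(LINT x|M. indicator (obs_set L \<delta> z) x * (norm (Q f x))\<^sup>2)
        = (LINT x|M. indicator (obs_set L \<delta> z) x * (norm (S x))\<^sup>2)"
    proof (rule integral_cong_AE)
      show "AE x in M. indicator (obs_set L \<delta> z) x * (norm (Q f x))\<^sup>2 = indicator (obs_set L \<delta> z) x * (norm (S x))\<^sup>2"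
        using norms by eventually_elim simp
    qed (use ind L2_measurable[OF Qf] SM in auto)
    also have "\<dots> = (LINT x|lebesgue_on (obs_set L \<delta> z). (norm (S x))\<^sup>2)" by (rule integral_obs_set[OF L])
    finally have left: "Re (l2_inner M f (Q (W (Q f)))) = (LINT x|lebesgue_on (obs_set L \<delta> z). (norm (S x))\<^sup>2)"
      by simp
    \<comment> \<open>The principle quantifies over real-valued functions; invariance under
      conjugation lets the complex eigenfunctions be passed to it through their real parts.\<close>
    have Re: "complex_of_real (Re (\<psi> n x)) = \<psi> n x" for n x
      using real[of n x] Reals_cnj_iff of_real_Re by blast
    have "orthonormal_basis_L2 M \<psi>" using l2_basis_axioms l2_basis_iff by blast
    then have "c * (LINT x|M. (norm (S x))\<^sup>2) \<le> (LINT x|lebesgue_on (obs_set L \<delta> z). (norm (S x))\<^sup>2)"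
      using ucp[unfolded scale_free_ucp_def, rule_format, of \<delta> V L z "\<lambda>n x. Re (\<psi> n x)" En bc E "\<lambda>n. l2_inner M (\<psi> n) f"]
        A sob H_eig unfolding S_def c_def of_real_mult Re by blast
    then show "Re (l2_inner M f (\<lambda>x. of_real c * Q f x)) \<le> Re (l2_inner M f (Q (W (Q f))))"
      unfolding left right .
  qed
qed

theorem mainTheorem2:
  assumes "\<exists>K\<^sub>0. scale_free_ucp TYPE('n::finite) K\<^sub>0"
  shows "(\<exists>K\<^sub>0. projector_ucp TYPE('n) K\<^sub>0) \<and>
         (\<forall>K\<^sub>0. scale_free_ucp TYPE('n) K\<^sub>0 \<longrightarrow> projector_ucp TYPE('n) K\<^sub>0)"
  using assms projector_ucp_of_scale_free_ucp by blast

end
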